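(* Let $\mu$ be a probability distribution on $\mathbb{R}$ of the form $\mu=p\mu_{\mathrm d}+(1-p)\mu_{\mathrm{ac}}$ with $0<p\le1$, a discrete probability distribution $\mu_{\mathrm d}$ and an absolutely continuous probability distribution $\mu_{\mathrm{ac}}$. The following statements are equivalent. (i) $\mu$ is quasi-infinitely divisible. (ii) $\inf_{z\in\mathbb{R}}|\widehat\mu(z)|>0$. (iii) $\widehat\mu(z)\ne0$ for all $z\in\mathbb{R}$ and $\inf_{z\in\mathbb{R}}|\widehat{\mu}_{\mathrm d}(z)|>0$. If these statements are satisfied, then $\mu$ has Gaussian variance $0$, finite drift $\gamma\in\mathbb{R}$ and quasi-Lévy measure $\nu$ given by $$\nu(dx)=\sum_{y\in C}c_y\,\delta_y(dx)+\left(h(x)+\frac{m e^{-|x|}}{|x|}\operatorname{sgn}(x)\right)dx$$ with an at most countable set $C\subset\mathbb{R}$, an absolutely summable sequence $(c_y)_{y\in C}\subset\mathbb{R}$, $m\in\mathbb{Z}$ and $h\in L^1(\mathbb{R};\mathbb{R})$.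
   Context: For a probability distribution $\mu$ on $\mathbb{R}$, $\widehat\mu(z)=\int_{\mathbb{R}}e^{\mathrm{i}zx}\mu(dx)$ is its characteristic function. A discrete distribution is one concentrated on an at most countable set; absolutely continuous means with respect to Lebesgue measure. $\delta_y$ is the Dirac measure at $y$. $\operatorname{sgn}(x)=x/|x|$ for $x\neq0$, $\operatorname{sgn}(0)=0$. A distribution $\mu$ is infinitely divisible if for every $n\in\mathbb{N}$ it is the $n$-fold convolution of some probability distribution with itself. $\mu$ is quasi-infinitely divisible if there exist infinitely divisible distributions $\mu_1,\mu_2$ with $\widehat\mu(z)=\widehat{\mu_1}(z)/\widehat{\mu_2}(z)$ for all $z\in\mathbb{R}$. A Lévy measure is a measure $\nu$ on $\mathbb{R}$ with $\nu(\{0\})=0$ and $\int(x^2\wedge1)\nu(dx)<\infty$; a quasi-Lévy type measure is a (formal) difference $\nu=\nu_1-\nu_2$ of two Lévy measures, well-defined as a finite signed measure on $\mathbb{R}\setminus(-r,r)$ for each $r>0$, and with $\int f\,d\nu=\int f\,d\nu_1-\int f\,d\nu_2$ for measurable $f$ with $|f(x)|\le C(1\wedge x^2)$. Equivalently to the definition of quasi-infinite divisibility as the existence of infinitely divisible distributions $\mu_1,\mu_2$ with $\widehat\mu(z)=\widehat{\mu_1}(z)/\widehat{\mu_2}(z)$ for all $z\in\mathbb{R}$, $\mu$ is quasi-infinitely divisible iff $$\widehat\mu(z)=\exp\left(\mathrm{i}\gamma z-\frac{az^2}{2}+\int_{\mathbb{R}}(e^{\mathrm{i}zx}-1-\mathrm{i}zx\mathbf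 1_{(-1,1)}(x))\,\nu(dx)\right),\quad z\in\mathbb{R},$$ for some $a,\gamma\in\mathbb{R}$ and a quasi-Lévy type measure $\nu$; the triplet $(a,\gamma,\nu)$ is then unique, $a$ is called the Gaussian variance and $\nu$ the quasi-Lévy measure of $\mu$. $\mu$ is said to have finite drift $\gamma_0\in\mathbb{R}$ if $\widehat\mu(z)=\exp(\mathrm{i}\gamma_0z-\frac{az^2}{2}+\int_{\mathbb{R}}(e^{\mathrm{i}zx}-1)\nu(dx))$ for all $z\in\mathbb{R}$ (then $\gamma=\gamma_0+\int_{(-1,1)}x\,\nu(dx)$). *)

theory Defs
  imports "HOL-Probability.Probability"
begin

text \<open>Probability distributions on the real line are the measures satisfying the library predicate
  \<^term>\<open>real_distribution\<close> (probability measures on the Borel sets), and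
  \<^term>\<open>char M\<close> is the characteristic function.\<close>

definition discrete_distribution :: "real measure \<Rightarrow> bool" where
  "discrete_distribution M \<longleftrightarrow>
     real_distribution M \<and> (\<exists>C. countable C \<and> measure M C = 1)"

definition ac_distribution :: "real measure \<Rightarrow> bool" where
  "ac_distribution M \<longleftrightarrow> real_distribution M \<and> absolutely_continuous lborel M"

primrec conv_power :: "real measure \<Rightarrow> nat \<Rightarrow> real measure" where
  "conv_power M 0 = return borel 0"
| "conv_power M (Suc n) = convolution M (conv_power M n)"

definition infinitely_divisible :: "real measure \<Rightarrow> bool" where
  "infinitely_divisible M \<longleftrightarrow>
     real_distribution M \<and>
     (\<forall>n\<ge>1. \<exists>R. real_distribution R \<and> M = conv_power R n)"

text \<open>The characteristic function of an infinitely divisible distribution has no zeros, so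
  the quotient below is never a division by zero.\<close>

definition quasi_infinitely_divisible :: "real measure \<Rightarrow> bool" where
  "quasi_infinitely_divisible M \<longleftrightarrow>
     real_distribution M \<and>
     (\<exists>M1 M2. infinitely_divisible M1 \<and> infinitely_divisible M2 \<and>
        (\<forall>z. char M z = char M1 z / char M2 z))"

definition levy_measure :: "real measure \<Rightarrow> bool" where
  "levy_measure N \<longleftrightarrow>
     sets N = sets borel \<and> emeasure N {0} = 0 \<and>
     (\<integral>\<^sup>+x. ennreal (min (x\<^sup>2) 1) \<partial>N) < \<infinity>"

definition away_from_0 :: "real set \<Rightarrow> bool" where
  "away_from_0 B \<longleftrightarrow> B \<in> sets borel \<and> (\<exists>r>0. B \<inter> {-r<..<r} = {})"

text \<open>The difference of two Levy measures need not be a signed measure, since both can be infinite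
  near the origin. It is encoded by its values on the Borel sets bounded away from the
  origin, where both measures are finite; its values on other sets are irrelevant.\<close>

definition levy_difference ::
    "(real set \<Rightarrow> real) \<Rightarrow> real measure \<Rightarrow> real measure \<Rightarrow> bool" where
  "levy_difference \<nu> N1 N2 \<longleftrightarrow>
     levy_measure N1 \<and> levy_measure N2 \<and>
     (\<forall>B. away_from_0 B \<longrightarrow> \<nu> B = measure N1 B - measure N2 B)"

definition quasi_levy_type :: "(real set \<Rightarrow> real) \<Rightarrow> bool" where
  "quasi_levy_type \<nu> \<longleftrightarrow> (\<exists>N1 N2. levy_difference \<nu> N1 N2)"

text \<open>The value of the integral does not depend on the decomposition: if \<open>N1 - N2\<close> and \<open>N1' - N2'\<close>
  both represent \<open>\<nu>\<close>, then \<open>N1 + N2' = N1' + N2\<close>. Requiring integrability for some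
  decomposition is the same as requiring it for the total variation of \<open>\<nu>\<close>, because the
  Jordan decomposition is the smallest one. A function bounded by a multiple of
  \<open>min 1 (x^2)\<close> is integrable for every decomposition.\<close>

definition has_quasi_levy_integral ::
    "(real \<Rightarrow> complex) \<Rightarrow> complex \<Rightarrow> (real set \<Rightarrow> real) \<Rightarrow> bool" where
  "has_quasi_levy_integral f I \<nu> \<longleftrightarrow>
     (\<exists>N1 N2. levy_difference \<nu> N1 N2 \<and> integrable N1 f \<and> integrable N2 f \<and>
        I = (\<integral>x. f x \<partial>N1) - (\<integral>x. f x \<partial>N2))"

definition characteristic_triplet ::
    "real measure \<Rightarrow> real \<Rightarrow> real \<Rightarrow> (real set \<Rightarrow> real) \<Rightarrow> bool" where
  "characteristic_triplet M a \<gamma> \<nu> \<longleftrightarrow>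
     quasi_levy_type \<nu> \<and>
     (\<forall>z::real. \<exists>I.
        has_quasi_levy_integral
          (\<lambda>x. iexp (z * x) - 1 - \<i> * of_real (z * x * indicator {-1<..<1} x)) I \<nu> \<and>
        char M z = exp (\<i> * of_real (\<gamma> * z) - of_real (a * z\<^sup>2 / 2) + I))"

text \<open>Here \<open>a\<close> and \<open>\<nu>\<close> are the Gaussian variance and the quasi-Levy measure of \<open>M\<close>.\<close>

definition finite_drift ::
    "real measure \<Rightarrow> real \<Rightarrow> real \<Rightarrow> (real set \<Rightarrow> real) \<Rightarrow> bool" where
  "finite_drift M a \<gamma>\<^sub>0 \<nu> \<longleftrightarrow>
     (\<exists>\<gamma>. characteristic_triplet M a \<gamma> \<nu>) \<and>
     (\<forall>z::real. \<exists>I.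
        has_quasi_levy_integral (\<lambda>x. iexp (z * x) - 1) I \<nu> \<and>
        char M z = exp (\<i> * of_real (\<gamma>\<^sub>0 * z) - of_real (a * z\<^sup>2 / 2) + I))"

end

theory Submission
  imports Defs "HOL-Library.Poly_Mapping"
begin

text \<open>The transforms of complex measures with a discrete and an absolutely continuous part form an
  algebra under pointwise multiplication, in which the norm of a power is governed by the supremum
  norm. Hence a function in the algebra bounded away from \<open>0\<close> can be replaced, up to a factor
  \<open>exp w\<close> with \<open>w\<close> in the algebra, by a product \<open>P (1 + \<phi>)\<close> of a trigonometric polynomial
  and a perturbation of \<open>1\<close> by the transform of a smooth compactly supported density. The polynomial
  equals \<open>c e^{i \<gamma> z + w z}\<close>: its logarithmic derivative lies in the algebra, and its frequencies
  generate a finitely generated, hence discrete in coordinates, group. The second factor tends to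
  \<open>1\<close> at both ends, so it has a winding number \<open>m\<close>, which is split off as
  \<open>((1 + i z) / (1 - i z))^m = e^{2 i m arctan z}\<close>; this is the source of the term
  \<open>m e^{-\<bar>x\<bar>} sgn x / \<bar>x\<bar>\<close> of the quasi-Levy measure and a quotient of gamma transforms.

  Conversely, the second differences of the logarithm of the modulus of an infinitely divisible
  characteristic function are bounded by its value at the step. For a quotient, a bounded step from
  any point leads to an almost period of the discrete part, where the modulus is not small, so the
  modulus was not small at the starting point either.\<close>

text \<open>The binder of \<open>Sum_any\<close> would make every \<open>\<Sum>n. f n\<close> ambiguous.\<close>

no_syntax "_Sum_any" :: "pttrn \<Rightarrow> 'a \<Rightarrow> 'a::comm_monoid_add"    (\<open>(\<open>indent=2 notation=\<open>binder \<Sum>\<close>\<close>\<Sum>_. _)\<close> [0, 10] 10)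

subsection \<open>Transforms of complex measures\<close>

text \<open>The norm of a power exceeds the power of the supremum norm only by a polynomial factor,
  for two counting reasons. The n-th power of a trigonometric polynomial with k frequencies has at
  most (n + 1)^k frequencies, and each coefficient is a mean value, hence bounded by the supremum.
  When a compactly supported density is added to the polynomial, the density part of the n-th power
  lives on an interval of length O(n) and is bounded pointwise by the L1 norm of its transform. This
  replaces Gelfand theory: inverses and logarithms come from power series. The obstacle is the
  logarithm of a trigonometric polynomial. Its logarithmic derivative has summable coefficients, but
  a primitive divides the coefficient at y by y, and frequencies may accumulate at 0. Additive
  coordinates \<phi> give further derivations; since derivations commute, division by y becomes
  division by \<phi> y, and at every nonzero y some coordinate exceeds a fixed constant. For
  densities the division is by x, and the value at x = 0 produces the arctangent. Real weights come
  only at the end, from F (-z) = cnj (F z).\<close>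

text \<open>A complex measure is encoded as the image under \<open>\<pi>\<close> of the density
  \<open>w\<close> relative to \<open>N\<close>. Atoms may repeat, since \<open>\<pi>\<close> need
  not be injective; this makes products and series of discrete measures a matter of
  re-indexing.\<close>

definition ft :: "'a measure \<Rightarrow> ('a \<Rightarrow> real) \<Rightarrow> ('a \<Rightarrow> complex) \<Rightarrow> real \<Rightarrow> complex" where
  "ft N \<pi> w z = (LINT x|N. w x * iexp (z * \<pi> x))"

lemma norm_iexp_minus_one_le: "cmod (iexp t - 1) \<le> \<bar>t\<bar>"
  using iexp_approx1[of t 0] by simp

lemma integrable_times_iexp [simp]:
  assumes "integrable N w" "\<pi> \<in> borel_measurable N"
  shows "integrable N (\<lambda>x. w x * iexp (z * \<pi> x))"
proof (rule Bochner_Integration.integrable_bound[OF assms(1)])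
  note [measurable] = assms(2) borel_measurable_integrable[OF assms(1)]
  show "(\<lambda>x. w x * iexp (z * \<pi> x)) \<in> borel_measurable N" by measurable
qed (simp add: norm_mult)

lemma norm_ft_le:
  assumes "integrable N w" "\<pi> \<in> borel_measurable N"
  shows "cmod (ft N \<pi> w z) \<le> (LINT x|N. cmod (w x))"
  unfolding ft_def
  using integral_norm_bound[of N "\<lambda>x. w x * iexp (z * \<pi> x)"] by (simp add: norm_mult)

lemma isCont_ft:
  assumes "integrable N w" "\<pi> \<in> borel_measurable N"
  shows "isCont (ft N \<pi> w) z"
  unfolding continuous_at_sequentially comp_def ft_def
proof (intro allI impI)
  fix Z :: "nat \<Rightarrow> real" assume Z: "Z \<longlonglongrightarrow> z"
  note [measurable] = assms(2) borel_measurable_integrable[OF assms(1)]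
  show "(\<lambda>n. LINT x|N. w x * iexp (Z n * \<pi> x)) \<longlonglongrightarrow> (LINT x|N. w x * iexp (z * \<pi> x))"
  proof (rule integral_dominated_convergence[where w="\<lambda>x. cmod (w x)"])
    show "AE x in N. (\<lambda>n. w x * iexp (Z n * \<pi> x)) \<longlonglongrightarrow> w x * iexp (z * \<pi> x)"
      by (intro AE_I2 tendsto_intros Z)
  qed (use assms in \<open>auto simp: norm_mult\<close>)
qed

text \<open>Difference quotients of integrals are treated by dominated convergence along sequences,
  which calls for the derivative as a limit of quotients.\<close>

lemma has_vector_derivative_complex_iff:
  fixes f :: "real \<Rightarrow> complex"
  shows "(f has_vector_derivative D) (at z) \<longleftrightarrow> ((\<lambda>t. (f t - f z) / of_real (t - z)) \<longlongrightarrow> D) (at z)"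
proof -
  have eq: "norm ((f t - f z) - (t - z) *\<^sub>R D) / norm (t - z) = norm ((f t - f z) / of_real (t - z) - D)"
    if "t \<noteq> z" for t
  proof -
    have "(f t - f z) / of_real (t - z) - D = ((f t - f z) - (t - z) *\<^sub>R D) / of_real (t - z)"
      using that by (simp add: diff_divide_distrib scaleR_conv_of_real del: of_real_diff)
    then show ?thesis by (simp add: norm_divide del: of_real_diff)
  qed
  have "(f has_vector_derivative D) (at z) \<longleftrightarrow>
        ((\<lambda>t. norm ((f t - f z) - (t - z) *\<^sub>R D) / norm (t - z)) \<longlongrightarrow> 0) (at z)"
    by (simp add: has_vector_derivative_def has_derivative_iff_norm bounded_linear_scaleR_left)
  also have "\<dots> \<longleftrightarrow> ((\<lambda>t. norm ((f t - f z) / of_real (t - z) - D)) \<longlongrightarrow> 0) (at z)"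
    by (intro filterlim_cong refl) (auto simp: eventually_at_filter simp del: of_real_diff real_norm_def intro!: always_eventually eq)
  also have "\<dots> \<longleftrightarrow> ((\<lambda>t. (f t - f z) / of_real (t - z)) \<longlongrightarrow> D) (at z)"
    by (simp add: tendsto_norm_zero_iff LIM_zero_iff)
  finally show ?thesis .
qed

text \<open>Differentiation under the integral sign. Subtracting 1 from the exponential leaves an
  integrand of size |z| |\<open>\<pi> x\<close>| |\<open>w x\<close>|, so \<open>w\<close> may have
  a singularity where \<open>\<pi>\<close> vanishes, as the weight exp(-|x|) sgn x / |x|
  does.\<close>

lemma has_vector_derivative_ft:
  fixes w :: "'a \<Rightarrow> complex"
  assumes [measurable]: "w \<in> borel_measurable N" "\<pi> \<in> borel_measurable N"
    and int: "integrable N (\<lambda>x. of_real (\<pi> x) * w x)"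
  shows "((\<lambda>z. LINT x|N. w x * (iexp (z * \<pi> x) - 1)) has_vector_derivative
           \<i> * ft N \<pi> (\<lambda>x. of_real (\<pi> x) * w x) z) (at z)"
proof -
  have int1: "integrable N (\<lambda>x. w x * (iexp (t * \<pi> x) - 1))" for t
  proof (rule Bochner_Integration.integrable_bound[OF integrable_mult_right[OF int, of "of_real t"]])
    show "AE x in N. norm (w x * (iexp (t * \<pi> x) - 1)) \<le> norm (complex_of_real t * (of_real (\<pi> x) * w x))"
    proof (intro AE_I2)
      fix x
      have "cmod (w x) * cmod (iexp (t * \<pi> x) - 1) \<le> cmod (w x) * \<bar>t * \<pi> x\<bar>"
        by (intro mult_left_mono norm_iexp_minus_one_le norm_ge_zero)
      then show "norm (w x * (iexp (t * \<pi> x) - 1)) \<le> norm (complex_of_real t * (of_real (\<pi> x) * w x))"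
        by (simp add: norm_mult abs_mult mult_ac)
    qed
  qed measurable
  show ?thesis
    unfolding has_vector_derivative_complex_iff ft_def
  proof -
    let ?D = "\<i> * (LINT x|N. of_real (\<pi> x) * w x * iexp (z * \<pi> x))"
    let ?q = "\<lambda>t x. (w x * (iexp (t * \<pi> x) - iexp (z * \<pi> x))) / of_real (t - z) - \<i> * (of_real (\<pi> x) * w x * iexp (z * \<pi> x))"
    have lim: "((\<lambda>t. LINT x|N. ?q t x) \<longlongrightarrow> 0) (at z)"
      unfolding tendsto_at_iff_sequentially comp_def
    proof (intro allI impI)
      fix Z :: "nat \<Rightarrow> real" assume Zne: "\<forall>i. Z i \<in> UNIV - {z}" and Z: "Z \<longlonglongrightarrow> z"
      have "(\<lambda>n. LINT x|N. ?q (Z n) x) \<longlonglongrightarrow> (LINT x|N. 0)"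
      \<comment> \<open>The difference quotient and its limit are each bounded by
        |\<open>\<pi> x\<close>| |\<open>w x\<close>|, whence the factor 2.\<close>
      proof (rule integral_dominated_convergence[where w="\<lambda>x. 2 * cmod (of_real (\<pi> x) * w x)"])
        show "AE x in N. (\<lambda>n. ?q (Z n) x) \<longlonglongrightarrow> 0"
        proof (intro AE_I2)
          fix x
          have "((\<lambda>t. iexp (t * \<pi> x)) has_vector_derivative (\<i> * of_real (\<pi> x) * iexp (z * \<pi> x))) (at z)"
            by (auto intro!: derivative_eq_intros has_vector_derivative_real_field simp: algebra_simps)
          then have "((\<lambda>t. (iexp (t * \<pi> x) - iexp (z * \<pi> x)) / of_real (t - z)) \<longlongrightarrow> \<i> * of_real (\<pi> x) * iexp (z * \<pi> x)) (at z)"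
            unfolding has_vector_derivative_complex_iff .
          then have "(\<lambda>n. (iexp (Z n * \<pi> x) - iexp (z * \<pi> x)) / of_real (Z n - z)) \<longlonglongrightarrow> \<i> * of_real (\<pi> x) * iexp (z * \<pi> x)"
            unfolding tendsto_at_iff_sequentially comp_def using Zne Z by blast
          then have "(\<lambda>n. w x * ((iexp (Z n * \<pi> x) - iexp (z * \<pi> x)) / of_real (Z n - z)) - \<i> * (of_real (\<pi> x) * w x * iexp (z * \<pi> x)))
             \<longlonglongrightarrow> w x * (\<i> * of_real (\<pi> x) * iexp (z * \<pi> x)) - \<i> * (of_real (\<pi> x) * w x * iexp (z * \<pi> x))"
            by (intro tendsto_intros)
          then show "(\<lambda>n. ?q (Z n) x) \<longlonglongrightarrow> 0"
            by (simp add: mult_ac)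
        qed
        show "AE x in N. norm (?q (Z n) x) \<le> 2 * cmod (of_real (\<pi> x) * w x)" for n
        proof (intro AE_I2)
          fix x
          have ne: "Z n - z \<noteq> 0" using Zne by auto
          have "iexp (Z n * \<pi> x) - iexp (z * \<pi> x) = iexp (z * \<pi> x) * (iexp ((Z n - z) * \<pi> x) - 1)"
            by (simp add: exp_add[symmetric] algebra_simps)
          then have "cmod (iexp (Z n * \<pi> x) - iexp (z * \<pi> x)) \<le> \<bar>(Z n - z) * \<pi> x\<bar>"
            using norm_iexp_minus_one_le[of "(Z n - z) * \<pi> x"] by (simp add: norm_mult)
          then have "cmod (w x) * cmod (iexp (Z n * \<pi> x) - iexp (z * \<pi> x)) \<le> cmod (w x) * \<bar>(Z n - z) * \<pi> x\<bar>"
            by (intro mult_left_mono) auto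
          then have "norm ((w x * (iexp (Z n * \<pi> x) - iexp (z * \<pi> x))) / of_real (Z n - z)) \<le> cmod (of_real (\<pi> x) * w x)"
            using ne by (simp only: norm_mult norm_divide norm_of_real abs_mult) (simp add: divide_le_eq mult_ac)
          moreover have "norm (\<i> * (of_real (\<pi> x) * w x * iexp (z * \<pi> x))) = cmod (of_real (\<pi> x) * w x)"
            by (simp add: norm_mult)
          ultimately show "norm (?q (Z n) x) \<le> 2 * cmod (of_real (\<pi> x) * w x)"
            using norm_triangle_ineq4[of "(w x * (iexp (Z n * \<pi> x) - iexp (z * \<pi> x))) / of_real (Z n - z)" "\<i> * (of_real (\<pi> x) * w x * iexp (z * \<pi> x))"]
            by linarith
        qed
      qed (use int in auto)
      then show "(\<lambda>n. LINT x|N. ?q (Z n) x) \<longlonglongrightarrow> 0" by simp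
    qed
    have eq: "(LINT x|N. ?q t x) = ((LINT x|N. w x * (iexp (t * \<pi> x) - 1)) - (LINT x|N. w x * (iexp (z * \<pi> x) - 1))) / of_real (t - z) - ?D"
      for t
    proof -
      have "(LINT x|N. ?q t x) = (LINT x|N. (w x * (iexp (t * \<pi> x) - 1) - w x * (iexp (z * \<pi> x) - 1)) / of_real (t - z) - \<i> * (of_real (\<pi> x) * w x * iexp (z * \<pi> x)))"
        by (intro Bochner_Integration.integral_cong) (auto simp: algebra_simps)
      also have "\<dots> = ((LINT x|N. w x * (iexp (t * \<pi> x) - 1)) - (LINT x|N. w x * (iexp (z * \<pi> x) - 1))) / of_real (t - z) - ?D"
        using int1[of t] int1[of z] integrable_times_iexp[OF int assms(2), of z]
        by (subst Bochner_Integration.integral_diff) (auto simp: integral_diff)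
      finally show ?thesis .
    qed
    show "((\<lambda>t. ((LINT x|N. w x * (iexp (t * \<pi> x) - 1)) - (LINT x|N. w x * (iexp (z * \<pi> x) - 1))) / of_real (t - z)) \<longlongrightarrow> ?D) (at z)"
      using lim unfolding eq by (rule LIM_zero_cancel)
  qed
qed

section \<open>Convolutions and products\<close>

lemma integrable_lborel_translate:
  fixes h :: "real \<Rightarrow> 'b::{banach, second_countable_topology}"
  assumes "integrable lborel h"
  shows "integrable lborel (\<lambda>x. h (x - t))"
  using lborel_integrable_real_affine[OF assms, of 1 "-t"] by simp

lemma integral_lborel_translate:
  fixes h :: "real \<Rightarrow> 'b::{banach, second_countable_topology}"
  shows "(LINT x|lborel. h (x - t)) = (LINT x|lborel. h x)"
  using lborel_integral_real_affine[of 1 h "-t"] by simp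

text \<open>Convolving a complex measure with an integrable function gives an integrable function,
  by Fubini on \<open>N\<close> times Lebesgue measure. Keeping \<open>N\<close> general treats
  discrete and absolutely continuous factors at once.\<close>

lemma ft_convolution:
  fixes N :: "'a measure" and h :: "real \<Rightarrow> complex"
  assumes N: "sigma_finite_measure N" and w: "integrable N w" and [measurable]: "\<pi> \<in> borel_measurable N"
    and h: "integrable lborel h"
  defines "k \<equiv> \<lambda>x. LINT v|N. w v * h (x - \<pi> v)"
  shows "integrable lborel k"
    and "(LINT x|lborel. cmod (k x)) \<le> (LINT v|N. cmod (w v)) * (LINT x|lborel. cmod (h x))"
    and "ft lborel (\<lambda>x. x) k z = ft N \<pi> w z * ft lborel (\<lambda>x. x) h z"
proof -
  interpret N: sigma_finite_measure N by fact
  interpret P: pair_sigma_finite N lborel ..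
  note [measurable] = borel_measurable_integrable[OF w]
  have [measurable]: "h \<in> borel_measurable borel" using borel_measurable_integrable[OF h] by simp
  have tr: "(LINT x|lborel. cmod (w v * h (x - \<pi> v))) = cmod (w v) * (LINT x|lborel. cmod (h x))" for v
    using integral_lborel_translate[of "\<lambda>x. cmod (h x)" "\<pi> v"] by (simp add: norm_mult)
  have int: "integrable (N \<Otimes>\<^sub>M lborel) (\<lambda>(v, x). w v * h (x - \<pi> v))"
  proof (rule P.Fubini_integrable)
    show "(\<lambda>(v, x). w v * h (x - \<pi> v)) \<in> borel_measurable (N \<Otimes>\<^sub>M lborel)" by measurable
    show "integrable N (\<lambda>v. LINT x|lborel. norm (case (v, x) of (v, x) \<Rightarrow> w v * h (x - \<pi> v)))"
      using w by (simp add: tr)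
    show "AE v in N. integrable lborel (\<lambda>x. case (v, x) of (v, x) \<Rightarrow> w v * h (x - \<pi> v))"
      by (intro AE_I2) (simp add: integrable_lborel_translate h)
  qed
  show k: "integrable lborel k"
    unfolding k_def using P.integrable_snd[OF int] by simp
  have intn: "integrable (N \<Otimes>\<^sub>M lborel) (\<lambda>(v, x). cmod (w v * h (x - \<pi> v)))"
    using integrable_norm[OF int] by (simp add: case_prod_beta')
  have "(LINT x|lborel. cmod (k x)) \<le> (LINT x|lborel. LINT v|N. cmod (w v * h (x - \<pi> v)))"
    unfolding k_def
  proof (rule integral_mono)
    show "integrable lborel (\<lambda>x. cmod (LINT v|N. w v * h (x - \<pi> v)))"
      using integrable_norm[OF k] by (simp add: k_def)
    show "integrable lborel (\<lambda>x. LINT v|N. cmod (w v * h (x - \<pi> v)))"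
      using P.integrable_snd[OF intn] by simp
  qed (rule integral_norm_bound)
  also have "\<dots> = (LINT v|N. LINT x|lborel. cmod (w v * h (x - \<pi> v)))"
    using P.Fubini_integral[OF intn] by simp
  also have "\<dots> = (LINT v|N. cmod (w v)) * (LINT x|lborel. cmod (h x))"
    by (simp only: tr) simp
  finally show "(LINT x|lborel. cmod (k x)) \<le> (LINT v|N. cmod (w v)) * (LINT x|lborel. cmod (h x))" .
  have intz: "integrable (N \<Otimes>\<^sub>M lborel) (\<lambda>(v, x). w v * h (x - \<pi> v) * iexp (z * x))"
    using integrable_times_iexp[OF int, of snd z] by (simp add: case_prod_beta')
  have "ft lborel (\<lambda>x. x) k z = (LINT x|lborel. LINT v|N. w v * h (x - \<pi> v) * iexp (z * x))"
    unfolding ft_def k_def by simp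
  also have "\<dots> = (LINT v|N. LINT x|lborel. w v * h (x - \<pi> v) * iexp (z * x))"
    using P.Fubini_integral[OF intz] by simp
  also have "\<dots> = (LINT v|N. w v * iexp (z * \<pi> v) * ft lborel (\<lambda>x. x) h z)"
  proof (intro Bochner_Integration.integral_cong refl)
    fix v
    have "w v * h (x - \<pi> v) * iexp (z * x) = w v * iexp (z * \<pi> v) * (h (x - \<pi> v) * iexp (z * (x - \<pi> v)))" for x
      by (simp add: exp_diff algebra_simps)
    then have "(LINT x|lborel. w v * h (x - \<pi> v) * iexp (z * x)) =
        w v * iexp (z * \<pi> v) * (LINT x|lborel. h (x - \<pi> v) * iexp (z * (x - \<pi> v)))"
      by (simp only: integral_mult_right_zero)
    then show "(LINT x|lborel. w v * h (x - \<pi> v) * iexp (z * x)) = w v * iexp (z * \<pi> v) * ft lborel (\<lambda>x. x) h z"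
      using integral_lborel_translate[of "\<lambda>x. h x * iexp (z * x)" "\<pi> v"] by (simp only: ft_def)
  qed
  also have "\<dots> = ft N \<pi> w z * ft lborel (\<lambda>x. x) h z"
    unfolding ft_def[of N] by (simp only: integral_mult_left_zero)
  finally show "ft lborel (\<lambda>x. x) k z = ft N \<pi> w z * ft lborel (\<lambda>x. x) h z" .
qed

text \<open>Convolution as the image of a product measure under addition. With counting measures it
  multiplies discrete transforms, with probability measures it gives the characteristic function of
  a convolution.\<close>

lemma ft_pair:
  fixes N1 :: "'a measure" and N2 :: "'b measure"
  assumes N: "sigma_finite_measure N1" "sigma_finite_measure N2"
    and w: "integrable N1 w1" "integrable N2 w2"
    and [measurable]: "\<pi>1 \<in> borel_measurable N1" "\<pi>2 \<in> borel_measurable N2"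
  shows "integrable (N1 \<Otimes>\<^sub>M N2) (\<lambda>(x, y). w1 x * w2 y)"
    and "(LINT p|(N1 \<Otimes>\<^sub>M N2). cmod (case p of (x, y) \<Rightarrow> w1 x * w2 y)) = (LINT x|N1. cmod (w1 x)) * (LINT y|N2. cmod (w2 y))"
    and "ft (N1 \<Otimes>\<^sub>M N2) (\<lambda>(x, y). \<pi>1 x + \<pi>2 y) (\<lambda>(x, y). w1 x * w2 y) z = ft N1 \<pi>1 w1 z * ft N2 \<pi>2 w2 z"
proof -
  interpret N1: sigma_finite_measure N1 by fact
  interpret N2: sigma_finite_measure N2 by fact
  interpret P: pair_sigma_finite N1 N2 ..
  note [measurable] = w[THEN borel_measurable_integrable]
  show int: "integrable (N1 \<Otimes>\<^sub>M N2) (\<lambda>(x, y). w1 x * w2 y)"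
    by (rule P.Fubini_integrable) (use w in \<open>auto simp: norm_mult\<close>)
  have "integrable (N1 \<Otimes>\<^sub>M N2) (\<lambda>(x, y). cmod (w1 x * w2 y))"
    using integrable_norm[OF int] by (simp add: case_prod_beta')
  from P.integral_fst[OF this]
  show "(LINT p|(N1 \<Otimes>\<^sub>M N2). cmod (case p of (x, y) \<Rightarrow> w1 x * w2 y)) = (LINT x|N1. cmod (w1 x)) * (LINT y|N2. cmod (w2 y))"
    by (simp add: norm_mult case_prod_beta')
  have "integrable (N1 \<Otimes>\<^sub>M N2) (\<lambda>(x, y). w1 x * w2 y * iexp (z * (\<pi>1 x + \<pi>2 y)))"
    using integrable_times_iexp[OF int, of "\<lambda>(x, y). \<pi>1 x + \<pi>2 y" z] by (simp add: case_prod_beta')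
  from P.integral_fst[OF this]
  have "(LINT p|(N1 \<Otimes>\<^sub>M N2). (case p of (x, y) \<Rightarrow> w1 x * w2 y * iexp (z * (\<pi>1 x + \<pi>2 y)))) =
     (LINT x|N1. LINT y|N2. (w1 x * iexp (z * \<pi>1 x)) * (w2 y * iexp (z * \<pi>2 y)))"
    by (simp add: distrib_left exp_add mult_ac)
  also have "\<dots> = ft N1 \<pi>1 w1 z * ft N2 \<pi>2 w2 z"
    unfolding ft_def by (simp only: integral_mult_right_zero integral_mult_left_zero)
  finally show "ft (N1 \<Otimes>\<^sub>M N2) (\<lambda>(x, y). \<pi>1 x + \<pi>2 y) (\<lambda>(x, y). w1 x * w2 y) z = ft N1 \<pi>1 w1 z * ft N2 \<pi>2 w2 z"
    by (simp add: ft_def case_prod_beta')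
qed

text \<open>\<open>dtr\<close>, \<open>ltr\<close> and \<open>wtr\<close>: transforms of discrete measures, of Lebesgue densities, and of
  sums of both. The first argument bounds the total variation.\<close>

definition dtr :: "real \<Rightarrow> (real \<Rightarrow> complex) \<Rightarrow> bool" where
  "dtr B u \<longleftrightarrow> (\<exists>(a::nat \<Rightarrow> complex) y. integrable (count_space UNIV) a \<and>
     (LINT n|count_space UNIV. cmod (a n)) \<le> B \<and> u = ft (count_space UNIV) y a)"

definition ltr :: "real \<Rightarrow> (real \<Rightarrow> complex) \<Rightarrow> bool" where
  "ltr B u \<longleftrightarrow> (\<exists>h. integrable lborel h \<and> (LINT x|lborel. cmod (h x)) \<le> B \<and> u = ft lborel (\<lambda>x. x) h)"

definition wtr :: "real \<Rightarrow> (real \<Rightarrow> complex) \<Rightarrow> bool" where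
  "wtr B u \<longleftrightarrow> (\<exists>A C v w. dtr A v \<and> ltr C w \<and> A + C \<le> B \<and> u = (\<lambda>z. v z + w z))"

section \<open>Closure properties of the algebra\<close>

lemma dtr_mono: "dtr A u \<Longrightarrow> A \<le> B \<Longrightarrow> dtr B u" unfolding dtr_def by (blast intro: order_trans)
lemma ltr_mono: "ltr A u \<Longrightarrow> A \<le> B \<Longrightarrow> ltr B u" unfolding ltr_def by (blast intro: order_trans)
lemma wtr_mono: "wtr A u \<Longrightarrow> A \<le> B \<Longrightarrow> wtr B u" unfolding wtr_def by (blast intro: order_trans)

lemma dtr_nonneg: "dtr A u \<Longrightarrow> 0 \<le> A"
  unfolding dtr_def by (elim exE conjE) (rule order_trans, rule Bochner_Integration.integral_nonneg, simp_all)

lemma ltr_nonneg: "ltr A u \<Longrightarrow> 0 \<le> A"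
  unfolding ltr_def by (elim exE conjE) (rule order_trans, rule Bochner_Integration.integral_nonneg, simp_all)

lemma wtr_nonneg: "wtr A u \<Longrightarrow> 0 \<le> A"
  unfolding wtr_def by (elim exE conjE) (drule dtr_nonneg, drule ltr_nonneg, linarith)

text \<open>\<open>dtr\<close> fixes the index type \<open>nat\<close>. A sum over a countable set
  is moved there by an enumeration and padded with zeros off its range.\<close>

lemma dtr_countable:
  assumes S: "countable S" and a: "integrable (count_space S) a"
  shows "dtr (LINT s|count_space S. cmod (a s)) (ft (count_space S) y a)"
proof -
  define g where "g = to_nat_on S"
  define R where "R = g ` S"
  have bij: "bij_betw g S R" unfolding g_def R_def by (simp add: S inj_on_imp_bij_betw inj_on_to_nat_on)
  define i where "i = the_inv_into S g"
  have bi: "bij_betw i R S" unfolding i_def by (rule bij_betw_the_inv_into[OF bij])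
  define a' where "a' = (\<lambda>n. indicator R n *\<^sub>R a (i n))"
  have res: "integral\<^sup>L (count_space UNIV) (\<lambda>n. indicator R n *\<^sub>R f (i n)) = integral\<^sup>L (count_space S) f"
    for f :: "_ \<Rightarrow> 'x::{banach,second_countable_topology}"
    using integral_bij_count_space[OF bi, of f] integral_restrict_space[of R "count_space UNIV" "\<lambda>n. f (i n)"]
    by (simp add: restrict_count_space)
  have resi: "integrable (count_space UNIV) (\<lambda>n. indicator R n *\<^sub>R f (i n)) \<longleftrightarrow> integrable (count_space S) f"
    for f :: "_ \<Rightarrow> 'x::{banach,second_countable_topology}"
    using integrable_bij_count_space[OF bi, of f] integrable_restrict_space[of R "count_space UNIV" "\<lambda>n. f (i n)"]
    by (simp add: restrict_count_space)
  have "integrable (count_space UNIV) a'" using a unfolding a'_def resi .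
  moreover have "(LINT n|count_space UNIV. cmod (a' n)) = (LINT s|count_space S. cmod (a s))"
    using res[of "\<lambda>s. cmod (a s)"] by (simp add: a'_def)
  moreover have "ft (count_space S) y a = ft (count_space UNIV) (\<lambda>n. y (i n)) a'"
  proof
    fix z
    show "ft (count_space S) y a z = ft (count_space UNIV) (\<lambda>n. y (i n)) a' z"
      using res[of "\<lambda>s. a s * iexp (z * y s)"] by (simp add: a'_def ft_def)
  qed
  ultimately show ?thesis unfolding dtr_def by force
qed

lemma dtr_monom: "dtr (cmod c) (\<lambda>z. c * iexp (z * t))"
proof -
  have "dtr (LINT s|count_space {()}. cmod c) (ft (count_space {()}) (\<lambda>_. t) (\<lambda>_. c))"
    by (rule dtr_countable) (auto simp: integrable_count_space)
  moreover have "ft (count_space {()}) (\<lambda>_. t) (\<lambda>_. c) = (\<lambda>z. c * iexp (z * t))"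
    by (auto simp: ft_def fun_eq_iff lebesgue_integral_count_space_finite)
  ultimately show ?thesis by (simp add: lebesgue_integral_count_space_finite)
qed

lemma dtr_const: "dtr (cmod c) (\<lambda>_. c)"
  using dtr_monom[of c 0] by simp

lemma dtr_mult:
  assumes "dtr A u" "dtr B v"
  shows "dtr (A * B) (\<lambda>z. u z * v z)"
proof -
  obtain a :: "nat \<Rightarrow> complex" and y where a: "integrable (count_space UNIV) a" "(LINT n|count_space UNIV. cmod (a n)) \<le> A" "u = ft (count_space UNIV) y a"
    using assms(1) unfolding dtr_def by blast
  obtain b :: "nat \<Rightarrow> complex" and x where b: "integrable (count_space UNIV) b" "(LINT n|count_space UNIV. cmod (b n)) \<le> B" "v = ft (count_space UNIV) x b"
    using assms(2) unfolding dtr_def by blast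
  have sf: "sigma_finite_measure (count_space (UNIV::nat set))"
    by (simp add: sigma_finite_measure_count_space_countable)
  have pm: "count_space (UNIV::nat set) \<Otimes>\<^sub>M count_space (UNIV::nat set) = count_space UNIV"
    using pair_measure_countable[of "UNIV::nat set" "UNIV::nat set"] by simp
  note p = ft_pair[OF sf sf a(1) b(1), of y x, unfolded pm]
  have d: "dtr (LINT s|count_space UNIV. cmod (case s of (i, j) \<Rightarrow> a i * b j)) (ft (count_space UNIV) (\<lambda>(i, j). y i + x j) (\<lambda>(i, j). a i * b j))"
    by (rule dtr_countable) (auto intro: p(1))
  have e: "ft (count_space UNIV) (\<lambda>(i, j). y i + x j) (\<lambda>(i, j). a i * b j) = (\<lambda>z. u z * v z)"
    unfolding a(3) b(3) by (rule ext) (simp add: p(3))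
  have le: "(LINT s|count_space UNIV. cmod (case s of (i, j) \<Rightarrow> a i * b j)) \<le> A * B"
  proof -
    have "(LINT s|count_space UNIV. cmod (case s of (i, j) \<Rightarrow> a i * b j)) =
        (LINT n|count_space UNIV. cmod (a n)) * (LINT n|count_space UNIV. cmod (b n))"
      by (rule p(2)) simp_all
    also have "\<dots> \<le> A * B"
      using dtr_nonneg[OF assms(1)] by (intro mult_mono a(2) b(2)) auto
    finally show ?thesis .
  qed
  show ?thesis using dtr_mono[OF d le] unfolding e .
qed

text \<open>Completeness of the discrete measures: the coefficients of all terms form one family
  indexed by pairs, whose total variation is at most the sum of the bounds.\<close>

lemma dtr_suminf:
  assumes "\<And>n. dtr (B n) (u n)" and B: "summable B"
  shows "dtr (\<Sum>n. B n) (\<lambda>z. \<Sum>n. u n z)"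
proof -
  obtain a y where a: "\<And>n. integrable (count_space (UNIV::nat set)) (a n)" "\<And>n. (LINT k|count_space UNIV. cmod (a n k)) \<le> B n"
     "\<And>n. u n = ft (count_space UNIV) (y n) (a n)"
    using assms(1) unfolding dtr_def by metis
  have sf: "sigma_finite_measure (count_space (UNIV::nat set))"
    by (simp add: sigma_finite_measure_count_space_countable)
  interpret P: pair_sigma_finite "count_space (UNIV::nat set)" "count_space (UNIV::nat set)"
    using sf by (simp add: pair_sigma_finite_def)
  have pm: "count_space (UNIV::nat set) \<Otimes>\<^sub>M count_space (UNIV::nat set) = count_space UNIV"
    using pair_measure_countable[of "UNIV::nat set" "UNIV::nat set"] by simp
  let ?a = "\<lambda>(n, k). a n k"
  have nn: "0 \<le> (LINT k|count_space UNIV. cmod (a n k))" for n by simp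
  have s: "summable (\<lambda>n. LINT k|count_space UNIV. cmod (a n k))"
    using nn a(2) by (intro summable_comparison_test'[OF B, of 0]) (simp del: Bochner_Integration.integral_nonneg)
  have int: "integrable (count_space UNIV) ?a"
    using P.Fubini_integrable[of ?a] a(1) s unfolding pm by (simp add: integrable_count_space_nat_iff)
  have d: "dtr (LINT s|count_space UNIV. cmod (?a s)) (ft (count_space UNIV) (\<lambda>(n, k). y n k) ?a)"
    by (rule dtr_countable) (auto intro: int)
  have le: "(LINT s|count_space UNIV. cmod (?a s)) \<le> (\<Sum>n. B n)"
  proof -
    have i2: "integrable (count_space UNIV) (\<lambda>(n, k). cmod (a n k))"
      using integrable_norm[OF int] by (simp add: case_prod_beta')
    have "(LINT s|count_space UNIV. cmod (?a s)) = (LINT n|count_space UNIV. LINT k|count_space UNIV. cmod (a n k))"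
      using P.integral_fst[of "\<lambda>n k. cmod (a n k)"] i2 unfolding pm by (simp add: case_prod_beta')
    also have "\<dots> = (\<Sum>n. LINT k|count_space UNIV. cmod (a n k))"
      using s by (intro integral_count_space_nat) (simp add: integrable_count_space_nat_iff)
    also have "\<dots> \<le> (\<Sum>n. B n)" by (intro suminf_le a s B)
    finally show ?thesis .
  qed
  have e: "ft (count_space UNIV) (\<lambda>(n, k). y n k) ?a = (\<lambda>z. \<Sum>n. u n z)"
  proof
    fix z
    have i3: "integrable (count_space UNIV) (\<lambda>(n, k). a n k * iexp (z * y n k))"
      using integrable_times_iexp[OF int, of "\<lambda>(n,k). y n k" z] by (simp add: case_prod_beta')
    have "ft (count_space UNIV) (\<lambda>(n, k). y n k) ?a z = (LINT n|count_space UNIV. LINT k|count_space UNIV. a n k * iexp (z * y n k))"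
      using P.integral_fst[of "\<lambda>n k. a n k * iexp (z * y n k)"] i3 unfolding pm by (simp add: ft_def case_prod_beta')
    also have "\<dots> = (\<Sum>n. LINT k|count_space UNIV. a n k * iexp (z * y n k))"
      using P.integrable_fst[of "\<lambda>n k. a n k * iexp (z * y n k)"] i3 unfolding pm
      by (intro integral_count_space_nat) simp
    finally show "ft (count_space UNIV) (\<lambda>(n, k). y n k) ?a z = (\<Sum>n. u n z)" by (simp add: a(3) ft_def)
  qed
  show ?thesis using dtr_mono[OF d le] unfolding e .
qed

text \<open>Completeness of L1: the series of densities converges absolutely almost everywhere
  because the integrals of the moduli are summable.\<close>

lemma ltr_suminf:
  assumes "\<And>n. ltr (B n) (u n)" and B: "summable B"
  shows "ltr (\<Sum>n. B n) (\<lambda>z. \<Sum>n. u n z)"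
proof -
  obtain h where h: "\<And>n. integrable lborel (h n)" "\<And>n. (LINT x|lborel. cmod (h n x)) \<le> B n"
     "\<And>n. u n = ft lborel (\<lambda>x. x) (h n)"
    using assms(1) unfolding ltr_def by metis
  have nn: "0 \<le> (LINT x|lborel. cmod (h n x))" for n by simp
  have s: "summable (\<lambda>n. LINT x|lborel. cmod (h n x))"
    using nn h(2) by (intro summable_comparison_test'[OF B, of 0]) (simp del: Bochner_Integration.integral_nonneg)
  note [measurable] = h(1)[THEN borel_measurable_integrable]
  have "(\<integral>\<^sup>+x. (\<Sum>n. ennreal (cmod (h n x))) \<partial>lborel) = (\<Sum>n. ennreal (LINT x|lborel. cmod (h n x)))"
    using h(1) by (subst nn_integral_suminf) (auto simp: nn_integral_eq_integral)
  also have "\<dots> = ennreal (\<Sum>n. LINT x|lborel. cmod (h n x))" using s by (intro suminf_ennreal2) auto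
  finally have "(\<integral>\<^sup>+x. (\<Sum>n. ennreal (cmod (h n x))) \<partial>lborel) \<noteq> \<infinity>" by simp
  then have "AE x in lborel. (\<Sum>n. ennreal (cmod (h n x))) \<noteq> \<infinity>"
    by (intro nn_integral_PInf_AE) auto
  then have sae: "AE x in lborel. summable (\<lambda>n. cmod (h n x))"
    by eventually_elim (auto intro: summable_suminf_not_top)
  let ?h = "\<lambda>x. \<Sum>n. h n x"
  have int: "integrable lborel ?h" by (rule integrable_suminf[OF h(1) sae s])
  have "(LINT x|lborel. cmod (?h x)) \<le> (LINT x|lborel. (\<Sum>n. cmod (h n x)))"
  proof (rule integral_mono_AE)
    show "integrable lborel (\<lambda>x. \<Sum>n. cmod (h n x))"
      by (rule integrable_suminf) (use h(1) sae s in auto)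
    show "AE x in lborel. cmod (?h x) \<le> (\<Sum>n. cmod (h n x))"
      using sae by eventually_elim (rule summable_norm)
  qed (use int in auto)
  also have "\<dots> = (\<Sum>n. LINT x|lborel. cmod (h n x))"
    by (rule integral_suminf) (use h(1) sae s in auto)
  also have "\<dots> \<le> (\<Sum>n. B n)" by (intro suminf_le h s B)
  finally have bd: "(LINT x|lborel. cmod (?h x)) \<le> (\<Sum>n. B n)" .
  have "ft lborel (\<lambda>x. x) ?h z = (\<Sum>n. u n z)" for z
  proof -
    have "ft lborel (\<lambda>x. x) ?h z = (LINT x|lborel. (\<Sum>n. h n x * iexp (z * x)))"
      unfolding ft_def
    proof (rule integral_cong_AE)
      show "AE x in lborel. ?h x * iexp (z * x) = (\<Sum>n. h n x * iexp (z * x))"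
        using sae by eventually_elim (simp add: suminf_mult2 summable_norm_cancel)
    qed measurable
    also have "\<dots> = (\<Sum>n. LINT x|lborel. h n x * iexp (z * x))"
    proof (rule integral_suminf)
      show "integrable lborel (\<lambda>x. h n x * iexp (z * x))" for n
        by (intro integrable_times_iexp h(1)) simp
    qed (use sae s in \<open>simp_all add: norm_mult\<close>)
    finally show ?thesis by (simp add: h(3) ft_def)
  qed
  then have eq: "(\<lambda>z. \<Sum>n. u n z) = ft lborel (\<lambda>x. x) ?h" by auto
  show ?thesis unfolding ltr_def eq
  proof (rule exI[of _ ?h], intro conjI)
    show "integrable lborel ?h" by (fact int)
    show "(LINT x|lborel. cmod (?h x)) \<le> (\<Sum>n. B n)" by (fact bd)
  qed (rule refl)
qed

text \<open>Two functions padded with zeros form a summable sequence, so addition is a special case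
  of \<open>dtr_suminf\<close>.\<close>

lemma dtr_add:
  assumes "dtr A u" "dtr B v"
  shows "dtr (A + B) (\<lambda>z. u z + v z)"
proof -
  let ?f = "\<lambda>n. if n = 0 then u else if n = Suc 0 then v else (\<lambda>_. 0)"
  let ?B = "\<lambda>n. if n = 0 then A else if n = Suc 0 then B else 0"
  have *: "(\<lambda>n. if n = 0 then x else if n = Suc 0 then y else 0) sums (x + y)" for x y :: "'b::real_normed_vector"
    using sums_finite[of "{0, Suc 0}" "\<lambda>n. if n = 0 then x else if n = Suc 0 then y else 0"] by simp
  have "dtr (\<Sum>n. ?B n) (\<lambda>z. \<Sum>n. ?f n z)"
    using assms dtr_const[of 0] by (intro dtr_suminf) (auto intro: sums_summable[OF *])
  moreover have "(\<lambda>z. \<Sum>n. ?f n z) = (\<lambda>z. u z + v z)"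
  proof
    fix z
    have "(\<lambda>n. ?f n z) = (\<lambda>n. if n = 0 then u z else if n = Suc 0 then v z else 0)" by auto
    then show "(\<Sum>n. ?f n z) = u z + v z" using sums_unique[OF *[of "u z" "v z"]] by simp
  qed
  moreover have "(\<Sum>n. ?B n) = A + B" using sums_unique[OF *[of A B]] by simp
  ultimately show ?thesis by simp
qed

lemma ltr_zero: "ltr 0 (\<lambda>_. 0)"
  unfolding ltr_def by (rule exI[of _ "\<lambda>_. 0"]) (auto simp: ft_def)

lemma ltr_add:
  assumes "ltr A u" "ltr B v"
  shows "ltr (A + B) (\<lambda>z. u z + v z)"
proof -
  let ?f = "\<lambda>n. if n = 0 then u else if n = Suc 0 then v else (\<lambda>_. 0)"
  let ?B = "\<lambda>n. if n = 0 then A else if n = Suc 0 then B else 0"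
  have *: "(\<lambda>n. if n = 0 then x else if n = Suc 0 then y else 0) sums (x + y)" for x y :: "'b::real_normed_vector"
    using sums_finite[of "{0, Suc 0}" "\<lambda>n. if n = 0 then x else if n = Suc 0 then y else 0"] by simp
  have "ltr (\<Sum>n. ?B n) (\<lambda>z. \<Sum>n. ?f n z)"
    using assms ltr_zero by (intro ltr_suminf) (auto intro: sums_summable[OF *])
  moreover have "(\<lambda>z. \<Sum>n. ?f n z) = (\<lambda>z. u z + v z)"
  proof
    fix z
    have "(\<lambda>n. ?f n z) = (\<lambda>n. if n = 0 then u z else if n = Suc 0 then v z else 0)" by auto
    then show "(\<Sum>n. ?f n z) = u z + v z" using sums_unique[OF *[of "u z" "v z"]] by simp
  qed
  moreover have "(\<Sum>n. ?B n) = A + B" using sums_unique[OF *[of A B]] by simp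
  ultimately show ?thesis by simp
qed

text \<open>Absolutely continuous measures form an ideal: the second factor may be any finite
  complex measure.\<close>

lemma ltr_mult_ft:
  assumes "ltr A u" and N: "sigma_finite_measure N" and w: "integrable N w" "(LINT x|N. cmod (w x)) \<le> B" "\<pi> \<in> borel_measurable N"
  shows "ltr (A * B) (\<lambda>z. u z * ft N \<pi> w z)"
proof -
  obtain h where h: "integrable lborel h" "(LINT x|lborel. cmod (h x)) \<le> A" "u = ft lborel (\<lambda>x. x) h"
    using assms(1) unfolding ltr_def by blast
  note c = ft_convolution[OF N w(1) w(3) h(1)]
  let ?k = "\<lambda>x. LINT v|N. w v * h (x - \<pi> v)"
  have B: "0 \<le> B" using order_trans[OF Bochner_Integration.integral_nonneg w(2)] by simp
  show ?thesis unfolding ltr_def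
  proof (rule exI[of _ ?k], intro conjI)
    have "(LINT x|lborel. cmod (?k x)) \<le> B * A"
      using B by (intro order_trans[OF c(2)] mult_mono w h) simp_all
    then show "(LINT x|lborel. cmod (?k x)) \<le> A * B" by (simp add: mult.commute)
    show "(\<lambda>z. u z * ft N \<pi> w z) = ft lborel (\<lambda>x. x) ?k"
      by (rule ext) (simp only: c(3) h(3) mult.commute)
  qed (rule c(1))
qed

lemma ltr_mult_dtr:
  assumes "ltr A u" "dtr B v"
  shows "ltr (A * B) (\<lambda>z. u z * v z)"
proof -
  obtain b :: "nat \<Rightarrow> complex" and x where b: "integrable (count_space UNIV) b" "(LINT n|count_space UNIV. cmod (b n)) \<le> B" "v = ft (count_space UNIV) x b"
    using assms(2) unfolding dtr_def by blast
  show ?thesis unfolding b(3)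
    by (rule ltr_mult_ft[OF assms(1) _ b(1,2)]) (simp_all add: sigma_finite_measure_count_space_countable)
qed

lemma ltr_mult_ltr:
  assumes "ltr A u" "ltr B v"
  shows "ltr (A * B) (\<lambda>z. u z * v z)"
proof -
  obtain b where b: "integrable lborel b" "(LINT n|lborel. cmod (b n)) \<le> B" "v = ft lborel (\<lambda>x. x) b"
    using assms(2) unfolding ltr_def by blast
  show ?thesis unfolding b(3)
    by (rule ltr_mult_ft[OF assms(1) lborel.sigma_finite_measure_axioms b(1,2)]) simp_all
qed

lemma cnj_ft: "cnj (ft N \<pi> w z) = ft N (\<lambda>x. - \<pi> x) (\<lambda>x. cnj (w x)) z"
proof -
  have *: "cnj (w x * iexp (z * \<pi> x)) = cnj (w x) * iexp (z * (- \<pi> x))" for x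
    by (simp add: exp_cnj)
  show ?thesis unfolding ft_def Bochner_Integration.integral_cnj[symmetric] * ..
qed

lemma dtr_cnj:
  assumes "dtr A u" shows "dtr A (\<lambda>z. cnj (u z))"
proof -
  obtain b :: "nat \<Rightarrow> complex" and x where b: "integrable (count_space UNIV) b" "(LINT n|count_space UNIV. cmod (b n)) \<le> A" "u = ft (count_space UNIV) x b"
    using assms unfolding dtr_def by blast
  have "(\<lambda>z. cnj (u z)) = ft (count_space UNIV) (\<lambda>n. - x n) (\<lambda>n. cnj (b n))"
    unfolding b(3) by (simp add: cnj_ft)
  with b(1,2) show ?thesis unfolding dtr_def
    by (intro exI[of _ "\<lambda>n. cnj (b n)"] exI[of _ "\<lambda>n. - x n"]) simp
qed

lemma ltr_cnj:
  assumes "ltr A u" shows "ltr A (\<lambda>z. cnj (u z))"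
proof -
  obtain b where b: "integrable lborel b" "(LINT n|lborel. cmod (b n)) \<le> A" "u = ft lborel (\<lambda>x. x) b"
    using assms unfolding ltr_def by blast
  have "cnj (u z) = ft lborel (\<lambda>x. x) (\<lambda>n. cnj (b (- n))) z" for z
  proof -
    have "cnj (u z) = (LINT x|lborel. cnj (b x) * iexp (z * (- x)))"
      unfolding b(3) cnj_ft by (simp only: ft_def)
    also have "\<dots> = ft lborel (\<lambda>x. x) (\<lambda>n. cnj (b (- n))) z"
      unfolding ft_def using lborel_integral_real_affine[of "-1" "\<lambda>x. cnj (b x) * iexp (z * (- x))" 0] by simp
    finally show ?thesis .
  qed
  then have e: "(\<lambda>z. cnj (u z)) = ft lborel (\<lambda>x. x) (\<lambda>n. cnj (b (- n)))" by auto
  have "integrable lborel (\<lambda>n. b (- n))" using lborel_integrable_real_affine[OF b(1), of "-1" 0] by simp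
  moreover have "(LINT n|lborel. cmod (b (- n))) \<le> A"
    using b(2) lborel_integral_real_affine[of "-1" "\<lambda>x. cmod (b x)" 0] by simp
  ultimately show ?thesis unfolding ltr_def e
    by (intro exI[of _ "\<lambda>n. cnj (b (- n))"]) simp
qed

lemma wtr_dtr: "dtr A u \<Longrightarrow> wtr A u"
  unfolding wtr_def using ltr_zero by (intro exI[of _ A] exI[of _ 0] exI[of _ u] exI[of _ "\<lambda>_. 0"]) simp

lemma wtr_ltr: "ltr A u \<Longrightarrow> wtr A u"
  unfolding wtr_def using dtr_const[of 0] by (intro exI[of _ 0] exI[of _ A] exI[of _ "\<lambda>_. 0"] exI[of _ u]) simp

lemma wtr_sum2: "dtr A u \<Longrightarrow> ltr B v \<Longrightarrow> wtr (A + B) (\<lambda>z. u z + v z)"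
  unfolding wtr_def by blast

lemma wtrE:
  assumes "wtr B u"
  obtains A C v w where "dtr A v" "ltr C w" "A + C \<le> B" "u = (\<lambda>z. v z + w z)"
  using assms unfolding wtr_def by blast

lemma wtr_add:
  assumes "wtr A u" "wtr B v"
  shows "wtr (A + B) (\<lambda>z. u z + v z)"
proof -
  obtain A1 A2 u1 u2 where u: "dtr A1 u1" "ltr A2 u2" "A1 + A2 \<le> A" "u = (\<lambda>z. u1 z + u2 z)"
    using assms(1) by (rule wtrE)
  obtain B1 B2 v1 v2 where v: "dtr B1 v1" "ltr B2 v2" "B1 + B2 \<le> B" "v = (\<lambda>z. v1 z + v2 z)"
    using assms(2) by (rule wtrE)
  have "wtr ((A1 + B1) + (A2 + B2)) (\<lambda>z. (u1 z + v1 z) + (u2 z + v2 z))"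
    by (intro wtr_sum2 dtr_add ltr_add u v)
  then have "wtr ((A1 + B1) + (A2 + B2)) (\<lambda>z. u z + v z)"
    by (simp add: u v add_ac)
  then show ?thesis by (rule wtr_mono) (use u v in linarith)
qed

text \<open>Three of the four products contain a density and fall into the ideal of absolutely
  continuous transforms; only \<open>u1 z * v1 z\<close> stays discrete. The bounds multiply because
  (A1 + A2)(B1 + B2) expands in the same way.\<close>

lemma wtr_mult:
  assumes "wtr A u" "wtr B v"
  shows "wtr (A * B) (\<lambda>z. u z * v z)"
proof -
  obtain A1 A2 u1 u2 where u: "dtr A1 u1" "ltr A2 u2" "A1 + A2 \<le> A" "u = (\<lambda>z. u1 z + u2 z)"
    using assms(1) by (rule wtrE)
  obtain B1 B2 v1 v2 where v: "dtr B1 v1" "ltr B2 v2" "B1 + B2 \<le> B" "v = (\<lambda>z. v1 z + v2 z)"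
    using assms(2) by (rule wtrE)
  have "wtr ((A1 * B1) + ((A2 * B1 + B2 * A1) + A2 * B2)) (\<lambda>z. (u1 z * v1 z) + ((u2 z * v1 z + v2 z * u1 z) + u2 z * v2 z))"
    by (intro wtr_sum2 dtr_mult ltr_add ltr_mult_dtr ltr_mult_ltr u v)
  then have "wtr ((A1 + A2) * (B1 + B2)) (\<lambda>z. u z * v z)"
    by (simp add: u v algebra_simps)
  moreover have "(A1 + A2) * (B1 + B2) \<le> A * B"
    using u v wtr_nonneg[OF assms(1)] dtr_nonneg[OF v(1)] ltr_nonneg[OF v(2)] by (intro mult_mono) auto
  ultimately show ?thesis by (rule wtr_mono)
qed

lemma ltr_mult_wtr:
  assumes "ltr A u" "wtr B v"
  shows "ltr (A * B) (\<lambda>z. u z * v z)"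
proof -
  obtain B1 B2 v1 v2 where v: "dtr B1 v1" "ltr B2 v2" "B1 + B2 \<le> B" "v = (\<lambda>z. v1 z + v2 z)"
    using assms(2) by (rule wtrE)
  have "ltr (A * B1 + A * B2) (\<lambda>z. u z * v1 z + u z * v2 z)"
    by (intro ltr_add ltr_mult_dtr ltr_mult_ltr assms v)
  then have "ltr (A * (B1 + B2)) (\<lambda>z. u z * v z)"
    by (simp add: v algebra_simps)
  then show ?thesis
    by (rule ltr_mono) (intro mult_left_mono v ltr_nonneg[OF assms(1)])
qed

lemma wtr_cnj:
  assumes "wtr A u" shows "wtr A (\<lambda>z. cnj (u z))"
proof -
  obtain A1 A2 u1 u2 where u: "dtr A1 u1" "ltr A2 u2" "A1 + A2 \<le> A" "u = (\<lambda>z. u1 z + u2 z)"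
    using assms(1) by (rule wtrE)
  have "wtr (A1 + A2) (\<lambda>z. cnj (u1 z) + cnj (u2 z))"
    by (intro wtr_sum2 dtr_cnj ltr_cnj u)
  then show ?thesis using u(3) by (simp add: u(4) wtr_mono)
qed

lemma norm_dtr_le: "dtr A u \<Longrightarrow> cmod (u z) \<le> A"
  unfolding dtr_def by (elim exE conjE) (simp, rule order_trans[OF norm_ft_le], simp_all)

lemma norm_ltr_le: "ltr A u \<Longrightarrow> cmod (u z) \<le> A"
  unfolding ltr_def by (elim exE conjE) (simp, rule order_trans[OF norm_ft_le], simp_all)

lemma norm_wtr_le: "wtr A u \<Longrightarrow> cmod (u z) \<le> A"
  by (erule wtrE) (simp, rule order_trans[OF norm_triangle_ineq], drule norm_dtr_le[of _ _ z], drule norm_ltr_le[of _ _ z], linarith)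

lemma isCont_dtr: "dtr A u \<Longrightarrow> isCont u z"
  unfolding dtr_def by (auto intro!: isCont_ft)

lemma isCont_ltr: "ltr A u \<Longrightarrow> isCont u z"
  unfolding ltr_def by (auto intro!: isCont_ft)

lemma isCont_wtr: "wtr A u \<Longrightarrow> isCont u z"
  by (erule wtrE) (simp, intro continuous_intros, erule isCont_dtr, erule isCont_ltr)

lemma wtr_const: "wtr (cmod c) (\<lambda>_. c)"
  by (intro wtr_dtr dtr_const)

lemma wtr_cmult: "wtr A u \<Longrightarrow> wtr (cmod c * A) (\<lambda>z. c * u z)"
  by (intro wtr_mult wtr_const)

lemma wtr_power: "wtr A u \<Longrightarrow> wtr (A ^ n) (\<lambda>z. u z ^ n)"
proof (induction n)
  case 0 show ?case using wtr_const[of 1] by simp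
next
  case (Suc n) then show ?case by (auto intro: wtr_mult)
qed

lemma wtr_sum:
  assumes "finite S" "\<And>s. s \<in> S \<Longrightarrow> wtr (A s) (u s)"
  shows "wtr (\<Sum>s\<in>S. A s) (\<lambda>z. \<Sum>s\<in>S. u s z)"
  using assms
proof (induction S rule: finite_induct)
  case empty show ?case using wtr_const[of 0] by simp
next
  case (insert x F) then show ?case by (auto intro: wtr_add)
qed

lemma dtr_sum:
  assumes "finite S" "\<And>s. s \<in> S \<Longrightarrow> dtr (A s) (u s)"
  shows "dtr (\<Sum>s\<in>S. A s) (\<lambda>z. \<Sum>s\<in>S. u s z)"
  using assms
proof (induction S rule: finite_induct)
  case empty show ?case using dtr_const[of 0] by simp
next
  case (insert x F) then show ?case by (auto intro: dtr_add)
qed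

text \<open>The two components are summed separately. Each bound lies below \<open>B n\<close>
  because the bound of the other component is nonnegative.\<close>

lemma wtr_suminf:
  assumes u: "\<And>n. wtr (B n) (u n)" and B: "summable B"
  shows "wtr (\<Sum>n. B n) (\<lambda>z. \<Sum>n. u n z)"
proof -
  have "\<forall>n. \<exists>A C v w. dtr A v \<and> ltr C w \<and> A + C \<le> B n \<and> u n = (\<lambda>z. v z + w z)"
    using u unfolding wtr_def by blast
  then obtain A C v w where "\<forall>n. dtr (A n) (v n) \<and> ltr (C n) (w n) \<and> A n + C n \<le> B n \<and> u n = (\<lambda>z. v n z + w n z)"
    unfolding choice_iff by blast
  then have d: "\<And>n. dtr (A n) (v n)" and l: "\<And>n. ltr (C n) (w n)"
      and le: "\<And>n. A n + C n \<le> B n" and eq: "\<And>n. u n = (\<lambda>z. v n z + w n z)"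
    by auto
  have nA: "0 \<le> A n" and nC: "0 \<le> C n" for n using dtr_nonneg[OF d] ltr_nonneg[OF l] by auto
  have leA: "A n \<le> B n" and leC: "C n \<le> B n" for n using nA[of n] nC[of n] le[of n] by linarith+
  have sA: "summable A" by (rule summable_comparison_test'[OF B, of 0]) (use leA nA in simp)
  have sC: "summable C" by (rule summable_comparison_test'[OF B, of 0]) (use leC nC in simp)
  have "wtr ((\<Sum>n. A n) + (\<Sum>n. C n)) (\<lambda>z. (\<Sum>n. v n z) + (\<Sum>n. w n z))"
    by (intro wtr_sum2 dtr_suminf ltr_suminf d l sA sC)
  moreover have "(\<Sum>n. v n z) + (\<Sum>n. w n z) = (\<Sum>n. u n z)" for z
  proof -
    have "summable (\<lambda>n. v n z)"
      by (rule summable_comparison_test'[OF sA, of 0]) (use norm_dtr_le[OF d] in auto)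
    moreover have "summable (\<lambda>n. w n z)"
      by (rule summable_comparison_test'[OF sC, of 0]) (use norm_ltr_le[OF l] in auto)
    ultimately show ?thesis by (simp add: suminf_add eq)
  qed
  moreover have "(\<Sum>n. A n) + (\<Sum>n. C n) \<le> (\<Sum>n. B n)"
    using suminf_add[OF sA sC] suminf_le[of "\<lambda>n. A n + C n" B] le summable_add[OF sA sC] B by simp
  ultimately show ?thesis by (simp add: wtr_mono)
qed


section \<open>Trigonometric polynomials\<close>

abbreviation "keys \<equiv> Poly_Mapping.keys"
abbreviation "lookup \<equiv> Poly_Mapping.lookup"

text \<open>A frequency \<open>y\<close> with coefficient \<open>c\<close> stands for the summand \<open>c e^{i y z}\<close>, so that the
  convolution product of \<open>poly_mapping\<close> is the pointwise product.\<close>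

type_synonym trigpoly = "real \<Rightarrow>\<^sub>0 complex"

definition tpev :: "trigpoly \<Rightarrow> real \<Rightarrow> complex" where
  "tpev p z = (\<Sum>y\<in>keys p. lookup p y * iexp (z * y))"

definition tpn :: "trigpoly \<Rightarrow> real" where
  "tpn p = (\<Sum>y\<in>keys p. cmod (lookup p y))"

lemma tpev_superset:
  assumes "finite S" "keys p \<subseteq> S"
  shows "tpev p z = (\<Sum>y\<in>S. lookup p y * iexp (z * y))"
  unfolding tpev_def using assms by (intro sum.mono_neutral_left) (auto simp: in_keys_iff)

lemma tpn_superset:
  assumes "finite S" "keys p \<subseteq> S"
  shows "tpn p = (\<Sum>y\<in>S. cmod (lookup p y))"
  unfolding tpn_def using assms by (intro sum.mono_neutral_left) (auto simp: in_keys_iff)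

lemma tpev_zero [simp]: "tpev 0 z = 0" by (simp add: tpev_def)

lemma tpev_single [simp]: "tpev (Poly_Mapping.single y c) z = c * iexp (z * y)"
  by (subst tpev_superset[of "{y}"]) auto

lemma tpev_one [simp]: "tpev 1 z = 1"
  using tpev_single[of 0 1 z] by simp

lemma tpev_add [simp]: "tpev (p + q) z = tpev p z + tpev q z"
  using keys_add[of p q]
  by (simp add: tpev_superset[of "keys p \<union> keys q"] lookup_add algebra_simps sum.distrib)

lemma tpev_uminus [simp]: "tpev (- p) z = - tpev p z"
  by (simp add: tpev_def sum_negf)

lemma tpev_diff [simp]: "tpev (p - q) z = tpev p z - tpev q z"
  using tpev_add[of p "- q" z] by simp

lemma tpev_sum [simp]: "tpev (\<Sum>s\<in>S. f s) z = (\<Sum>s\<in>S. tpev (f s) z)"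
  by (induction S rule: infinite_finite_induct) auto

lemma poly_mapping_eq_sum_single: "p = (\<Sum>y\<in>keys p. Poly_Mapping.single y (lookup p y))"
  by (rule poly_mapping_eqI) (auto simp: lookup_sum lookup_single when_def in_keys_iff)

lemma tpev_mult [simp]: "tpev (p * q) z = tpev p z * tpev q z"
proof -
  have "p * q = (\<Sum>x\<in>keys p. \<Sum>y\<in>keys q. Poly_Mapping.single (x + y) (lookup p x * lookup q y))"
    by (subst poly_mapping_eq_sum_single[of p], subst poly_mapping_eq_sum_single[of q])
       (simp add: sum_product mult_single)
  then show ?thesis
    by (simp add: tpev_def[of p] tpev_def[of q] sum_product distrib_left exp_add mult_ac)
qed

lemma tpev_power [simp]: "tpev (p ^ n) z = tpev p z ^ n"
  by (induction n) auto

lemma tpn_nonneg: "0 \<le> tpn p" unfolding tpn_def by (auto intro: sum_nonneg)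

lemma dtr_tpev: "dtr (tpn p) (tpev p)"
  unfolding tpn_def tpev_def[abs_def] by (intro dtr_sum dtr_monom) simp

lemma has_vector_derivative_iexp_divide:
  assumes "s \<noteq> 0"
  shows "((\<lambda>z. c * iexp (z * s) / (\<i> * of_real s)) has_vector_derivative c * iexp (z * s)) (at z within A)"
  using assms by (auto intro!: derivative_eq_intros has_vector_derivative_real_field simp: mult_ac)

text \<open>The coefficient at \<open>y\<close> is the mean value of p(z) exp(-i z y): over [0, T]
  the other frequencies contribute a bounded amount, which disappears after division by T.\<close>

lemma norm_lookup_le:
  assumes M: "\<And>z. cmod (tpev p z) \<le> M"
  shows "cmod (lookup p y) \<le> M"
proof -
  define S where "S = keys p \<union> {y}"
  have S: "finite S" "keys p \<subseteq> S" "y \<in> S" by (auto simp: S_def)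
  \<comment> \<open>The integral of exp(i z (x - y)) over [0, T] has modulus at most 2 / |x - y|,
    uniformly in T.\<close>
  define R where "R = (\<Sum>x\<in>S - {y}. cmod (lookup p x) * 2 / \<bar>x - y\<bar>)"
  have R0: "0 \<le> R" unfolding R_def by (intro sum_nonneg) auto
  have key: "cmod (lookup p y) * T \<le> M * T + R" if T: "T > 0" for T
  proof -
    have cont: "continuous_on {0..T} (\<lambda>z. tpev p z * iexp (- (z * y)))"
      unfolding tpev_def by (intro continuous_intros)
    have i1: "((\<lambda>z. lookup p x * iexp (z * (x - y))) has_integral
       (if x = y then of_real T * lookup p y else lookup p x * (iexp (T * (x - y)) - 1) / (\<i> * of_real (x - y)))) {0..T}" for x
    proof (cases "x = y")
      case True
      then show ?thesis using has_integral_const_real[of "lookup p y" 0 T] T by (simp add: scaleR_conv_of_real)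
    next
      case False
      have "((\<lambda>z. lookup p x * iexp (z * (x - y))) has_integral
          (lookup p x * iexp (T * (x - y)) / (\<i> * of_real (x - y)) - lookup p x * iexp (0 * (x - y)) / (\<i> * of_real (x - y)))) {0..T}"
      proof (rule fundamental_theorem_of_calculus)
        fix z
        show "((\<lambda>z. lookup p x * iexp (z * (x - y)) / (\<i> * of_real (x - y))) has_vector_derivative lookup p x * iexp (z * (x - y))) (at z within {0..T})"
          using False by (intro has_vector_derivative_iexp_divide) simp
      qed (use T in simp)
      then show ?thesis using False by (simp add: diff_divide_distrib right_diff_distrib)
    qed
    have "((\<lambda>z. \<Sum>x\<in>S. lookup p x * iexp (z * (x - y))) has_integral
       (\<Sum>x\<in>S. if x = y then of_real T * lookup p y else lookup p x * (iexp (T * (x - y)) - 1) / (\<i> * of_real (x - y)))) {0..T}"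
      by (intro has_integral_sum S i1)
    also have "(\<lambda>z. \<Sum>x\<in>S. lookup p x * iexp (z * (x - y))) = (\<lambda>z. tpev p z * iexp (- (z * y)))"
    proof
      fix z
      have "lookup p x * iexp (z * (x - y)) = lookup p x * iexp (z * x) * iexp (- (z * y))" for x
        by (simp add: algebra_simps flip: exp_add)
      then show "(\<Sum>x\<in>S. lookup p x * iexp (z * (x - y))) = tpev p z * iexp (- (z * y))"
        using S by (simp only: tpev_superset[of S] sum_distrib_right)
    qed
    also have "(\<Sum>x\<in>S. if x = y then of_real T * lookup p y else lookup p x * (iexp (T * (x - y)) - 1) / (\<i> * of_real (x - y)))
       = of_real T * lookup p y + (\<Sum>x\<in>S - {y}. lookup p x * (iexp (T * (x - y)) - 1) / (\<i> * of_real (x - y)))" (is "_ = _ + ?E")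
      using S by (simp add: sum.remove[of S y])
    finally have I: "((\<lambda>z. tpev p z * iexp (- (z * y))) has_integral (of_real T * lookup p y + ?E)) {0..T}" .
    have "cmod (of_real T * lookup p y + ?E) \<le> M * Henstock_Kurzweil_Integration.content (cbox 0 T)"
    proof (rule has_integral_bound)
      show "0 \<le> M" using M[of 0] norm_ge_zero[of "tpev p 0"] by linarith
      show "((\<lambda>z. tpev p z * iexp (- (z * y))) has_integral (of_real T * lookup p y + ?E)) (cbox 0 T)"
        using I by simp
    qed (simp add: norm_mult M)
    then have b: "cmod (of_real T * lookup p y + ?E) \<le> M * T" using T by simp
    have "cmod ?E \<le> R"
      unfolding R_def
    proof (intro sum_norm_le)
      fix x assume x: "x \<in> S - {y}"
      have "cmod (iexp (T * (x - y)) - 1) \<le> 2"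
        using norm_triangle_ineq4[of "iexp (T * (x - y))" 1] by simp
      then have "cmod (lookup p x) * cmod (iexp (T * (x - y)) - 1) / \<bar>x - y\<bar> \<le> cmod (lookup p x) * 2 / \<bar>x - y\<bar>"
        by (intro divide_right_mono mult_left_mono) auto
      then show "cmod (lookup p x * (iexp (T * (x - y)) - 1) / (\<i> * of_real (x - y))) \<le> cmod (lookup p x) * 2 / \<bar>x - y\<bar>"
        by (simp only: norm_mult norm_divide norm_of_real norm_ii mult_1)
    qed
    then have "cmod (of_real T * lookup p y) \<le> M * T + R"
      using b norm_triangle_ineq4[of "of_real T * lookup p y + ?E" ?E] by simp
    then show ?thesis using T by (simp add: norm_mult mult.commute)
  qed
  show ?thesis
  proof (rule ccontr)
    assume "\<not> cmod (lookup p y) \<le> M"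
    then have d: "cmod (lookup p y) - M > 0" by simp
    \<comment> \<open>With this T the excess T (|c| - M) equals R + 1, more than the R that
      \<open>key\<close> allows.\<close>
    define T where "T = (R + 1) / (cmod (lookup p y) - M)"
    have "T > 0" using d R0 unfolding T_def by simp
    from key[OF this] have "T * (cmod (lookup p y) - M) \<le> R" by (simp add: algebra_simps)
    then show False using d unfolding T_def by simp
  qed
qed

text \<open>A frequency of the power is a sum of n frequencies of p, hence determined by
  multiplicities between 0 and n. The count is polynomial in n for arbitrary real frequencies, also
  rationally independent ones.\<close>

lemma card_keys_power:
  "card (keys (p ^ n :: trigpoly)) \<le> (n + 1) ^ card (keys p)"
proof -
  let ?F = "\<lambda>f::real \<Rightarrow> nat. \<Sum>y\<in>keys p. of_nat (f y) * y"
  have sub: "keys (p ^ n) \<subseteq> ?F ` (keys p \<rightarrow>\<^sub>E {0..n})"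
  proof (induction n)
    case 0
    have "(0::real) \<in> ?F ` (keys p \<rightarrow>\<^sub>E {0..0})"
      by (intro image_eqI[of _ _ "\<lambda>y\<in>keys p. 0"]) auto
    then show ?case by simp
  next
    case (Suc n)
    show ?case
    proof
      fix x assume "x \<in> keys (p ^ Suc n)"
      then obtain a b where ab: "a \<in> keys p" "b \<in> keys (p ^ n)" "x = a + b"
        using keys_mult[of p "p ^ n"] by auto
      then obtain f where f: "f \<in> keys p \<rightarrow>\<^sub>E {0..n}" "b = ?F f" using Suc by blast
      have "x = ?F (f(a := Suc (f a)))"
        unfolding ab(3) f(2) using ab(1) by (simp add: sum.remove[of "keys p" a] algebra_simps)
      moreover have "f(a := Suc (f a)) \<in> keys p \<rightarrow>\<^sub>E {0..Suc n}"
        using f(1) ab(1) by (fastforce simp: PiE_iff extensional_def)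
      ultimately show "x \<in> ?F ` (keys p \<rightarrow>\<^sub>E {0..Suc n})"
        by (rule image_eqI)
    qed
  qed
  have "card (keys (p ^ n)) \<le> card (keys p \<rightarrow>\<^sub>E {0..n})"
    by (rule surj_card_le[OF _ sub]) (auto intro: finite_PiE)
  also have "\<dots> = (n + 1) ^ card (keys p)" by (simp add: card_PiE)
  finally show ?thesis .
qed

text \<open>The number of coefficients times a bound for each: total variation of powers is
  controlled by the supremum norm up to a polynomial factor.\<close>

lemma tpn_power_le:
  assumes M: "\<And>z. cmod (tpev p z) \<le> M"
  shows "tpn (p ^ n) \<le> real (n + 1) ^ card (keys p) * M ^ n"
proof -
  have M0: "0 \<le> M" using M[of 0] norm_ge_zero[of "tpev p 0"] by linarith
  have "cmod (tpev (p ^ n) z) \<le> M ^ n" for z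
    by (simp add: norm_power power_mono M)
  then have "tpn (p ^ n) \<le> real (card (keys (p ^ n))) * M ^ n"
    unfolding tpn_def by (intro sum_bounded_above norm_lookup_le)
  also have "\<dots> \<le> real (n + 1) ^ card (keys p) * M ^ n"
    using card_keys_power[of p n] M0 of_nat_mono[OF card_keys_power[of p n], where 'a=real]
    by (intro mult_right_mono) auto
  finally show ?thesis .
qed

lemma tpn_single [simp]: "tpn (Poly_Mapping.single y c) = cmod c"
  by (subst tpn_superset[of "{y}"]) auto

lemma tpn_add: "tpn (p + q) \<le> tpn p + tpn q"
proof -
  have "tpn (p + q) = (\<Sum>y\<in>keys p \<union> keys q. cmod (lookup p y + lookup q y))"
    using keys_add[of p q] by (subst tpn_superset[of "keys p \<union> keys q"]) (auto simp: lookup_add)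
  also have "\<dots> \<le> (\<Sum>y\<in>keys p \<union> keys q. cmod (lookup p y)) + (\<Sum>y\<in>keys p \<union> keys q. cmod (lookup q y))"
    unfolding sum.distrib[symmetric] by (intro sum_mono norm_triangle_ineq)
  also have "\<dots> = tpn p + tpn q" by (simp add: tpn_superset[of "keys p \<union> keys q"])
  finally show ?thesis .
qed

lemma tpn_sum: "tpn (\<Sum>s\<in>S. f s) \<le> (\<Sum>s\<in>S. tpn (f s))"
proof (induction S rule: infinite_finite_induct)
  case (insert x F)
  then show ?case using tpn_add[of "f x" "\<Sum>s\<in>F. f s"] by simp
qed (simp_all add: tpn_def)

lemma tpn_mult: "tpn (p * q) \<le> tpn p * tpn q"
proof -
  have "p * q = (\<Sum>x\<in>keys p. \<Sum>y\<in>keys q. Poly_Mapping.single (x + y) (lookup p x * lookup q y))"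
    by (subst poly_mapping_eq_sum_single[of p], subst poly_mapping_eq_sum_single[of q])
       (simp add: sum_product mult_single)
  also have "tpn \<dots> \<le> (\<Sum>x\<in>keys p. \<Sum>y\<in>keys q. tpn (Poly_Mapping.single (x + y) (lookup p x * lookup q y)))"
    by (intro order_trans[OF tpn_sum] sum_mono order_refl)
  also have "\<dots> = tpn p * tpn q"
    by (simp add: tpn_def[of p] tpn_def[of q] sum_product norm_mult)
  finally show ?thesis .
qed

lemma norm_tpev_le: "cmod (tpev p z) \<le> tpn p"
  by (rule norm_dtr_le[OF dtr_tpev])

section \<open>Almost periodicity of discrete transforms\<close>

lemma dtr_approx:
  assumes "dtr B u" "0 < e"
  shows "\<exists>p. dtr e (\<lambda>z. u z - tpev p z)"
proof -
  obtain a :: "nat \<Rightarrow> complex" and y where a: "integrable (count_space UNIV) a" "u = ft (count_space UNIV) y a"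
    using assms(1) unfolding dtr_def by blast
  have s: "summable (\<lambda>n. cmod (a n))" using a(1) by (simp add: integrable_count_space_nat_iff)
  obtain N where N: "cmod (\<Sum>n. cmod (a (n + N))) < e"
    using suminf_exist_split[OF assms(2) s] by auto
  have su: "summable (\<lambda>n. a n * iexp (z * y n))" for z
    by (rule summable_comparison_test'[OF s, of 0]) (simp add: norm_mult)
  have u: "u z = (\<Sum>n. a n * iexp (z * y n))" for z
    unfolding a(2) ft_def by (intro integral_count_space_nat integrable_times_iexp a(1)) simp
  define p where "p = (\<Sum>n<N. Poly_Mapping.single (y n) (a n))"
  have "dtr (\<Sum>n. cmod (a (n + N))) (\<lambda>z. \<Sum>n. a (n + N) * iexp (z * y (n + N)))"
    by (intro dtr_suminf dtr_monom summable_ignore_initial_segment s)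
  moreover have "(\<lambda>z. \<Sum>n. a (n + N) * iexp (z * y (n + N))) = (\<lambda>z. u z - tpev p z)"
    using suminf_split_initial_segment[OF su, of _ N] by (auto simp: fun_eq_iff u p_def)
  ultimately show ?thesis using N by (intro exI[of _ p]) (auto intro: dtr_mono)
qed

text \<open>Bohr's relatively dense almost periods, by the pigeonhole principle. The pattern
  \<open>c \<tau>\<close> records the position of exp(i \<tau> y) up to \<eta> at the finitely many
  frequencies of an approximating polynomial. Only finitely many patterns occur, and two points with
  the same pattern differ by an almost period.\<close>

lemma dtr_almost_periodic:
  assumes u: "dtr B u" and e: "0 < e"
  obtains L where "0 \<le> L" "\<And>\<tau>. \<exists>h\<in>{0..L}. \<forall>z. cmod (u (z + \<tau> + h) - u z) \<le> e"
proof -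
  obtain p where p: "dtr (e / 3) (\<lambda>z. u z - tpev p z)"
    using dtr_approx[OF u, of "e / 3"] e by auto
  \<comment> \<open>Chosen so that an error 2 \<eta> in every exponential changes
    \<open>tpev p\<close> by at most e / 3.\<close>
  define \<eta> where "\<eta> = e / (6 * (tpn p + 1))"
  have \<eta>: "\<eta> > 0" using e tpn_nonneg[of p] by (simp add: \<eta>_def)
  define N where "N = \<lceil>1 / \<eta>\<rceil> + 1"
  define c where "c = (\<lambda>\<tau>::real. \<lambda>y\<in>keys p. (\<lfloor>cos (\<tau> * y) / \<eta>\<rfloor>, \<lfloor>sin (\<tau> * y) / \<eta>\<rfloor>))"
  have fl: "\<lfloor>x / \<eta>\<rfloor> \<in> {-N..N}" if "\<bar>x\<bar> \<le> 1" for x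
  proof -
    have "\<bar>x / \<eta>\<bar> \<le> 1 / \<eta>" using that \<eta> by (simp add: divide_le_cancel)
    then show ?thesis unfolding N_def by (simp; linarith)
  qed
  have "range c \<subseteq> keys p \<rightarrow>\<^sub>E ({-N..N} \<times> {-N..N})"
    unfolding c_def using fl by auto
  then have "finite (range c)" by (rule finite_subset) (auto intro!: finite_PiE)
  \<comment> \<open>A finite set of points that represents every pattern.\<close>
  then obtain T where T: "finite T" "range c = c ` T"
    using finite_subset_image[of "range c" c UNIV] by auto
  then have T0: "T \<noteq> {}" by auto
  have close: "cmod (u (z + s - t) - u z) \<le> e" if "c s = c t" for s t z
  proof -
    have d: "cmod (iexp (s * y) - iexp (t * y)) \<le> 2 * \<eta>" if y: "y \<in> keys p" for y
    proof -
      have a: "\<bar>a - b\<bar> \<le> \<eta>" if "\<lfloor>a / \<eta>\<rfloor> = \<lfloor>b / \<eta>\<rfloor>" for a b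
      proof -
        have "\<bar>a / \<eta> - b / \<eta>\<bar> \<le> 1" using that by linarith
        then have "\<bar>(a - b) / \<eta>\<bar> \<le> 1" by (simp add: diff_divide_distrib)
        then show ?thesis using \<eta> by (simp add: abs_divide)
      qed
      have "c s y = c t y" using \<open>c s = c t\<close> by simp
      then have "\<bar>cos (s * y) - cos (t * y)\<bar> \<le> \<eta>" "\<bar>sin (s * y) - sin (t * y)\<bar> \<le> \<eta>"
        using y by (auto simp: c_def intro: a)
      then have "\<bar>Re (iexp (s * y) - iexp (t * y))\<bar> \<le> \<eta>" "\<bar>Im (iexp (s * y) - iexp (t * y))\<bar> \<le> \<eta>"
        by (simp_all add: exp_Euler cos_of_real sin_of_real flip: of_real_mult)
      then show ?thesis using cmod_le[of "iexp (s * y) - iexp (t * y)"] by linarith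
    qed
    have "tpev p (z + s - t) - tpev p z = (\<Sum>y\<in>keys p. lookup p y * iexp ((z - t) * y) * (iexp (s * y) - iexp (t * y)))"
      unfolding tpev_def sum_subtractf[symmetric]
      by (intro sum.cong refl) (simp add: algebra_simps flip: exp_add)
    also have "cmod \<dots> \<le> (\<Sum>y\<in>keys p. cmod (lookup p y) * (2 * \<eta>))"
    proof (intro sum_norm_le)
      fix y assume y: "y \<in> keys p"
      have "cmod (lookup p y * iexp ((z - t) * y)) = cmod (lookup p y)" by (simp add: norm_mult)
      then show "cmod (lookup p y * iexp ((z - t) * y) * (iexp (s * y) - iexp (t * y))) \<le> cmod (lookup p y) * (2 * \<eta>)"
        by (subst norm_mult) (metis mult_left_mono d[OF y] norm_ge_zero)
    qed
    also have "\<dots> = tpn p * (2 * \<eta>)" by (simp add: tpn_def sum_distrib_right)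
    also have "\<dots> \<le> e / 3"
      using e tpn_nonneg[of p] unfolding \<eta>_def by (simp add: field_simps)
    finally have 1: "cmod (tpev p (z + s - t) - tpev p z) \<le> e / 3" .
    have "u (z + s - t) - u z = (tpev p (z + s - t) - tpev p z) + (u (z + s - t) - tpev p (z + s - t)) - (u z - tpev p z)"
      by simp
    also have "cmod \<dots> \<le> e / 3 + e / 3 + e / 3"
      by (intro order_trans[OF norm_triangle_ineq4] add_mono order_trans[OF norm_triangle_ineq] 1
           norm_dtr_le[OF p])
    finally show ?thesis by simp
  qed
  show ?thesis
  proof
    show "0 \<le> Max T - Min T" using T(1) T0 by (simp add: Max_ge_iff)
    fix \<tau>
    \<comment> \<open>Shifting by \<open>Max T\<close> beforehand makes the correction
      \<open>Max T - t\<close> nonnegative.\<close>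
    have "c (\<tau> + Max T) \<in> c ` T" using T(2) by auto
    then obtain t where t: "t \<in> T" "c (\<tau> + Max T) = c t" by auto
    have "Max T - t \<in> {0..Max T - Min T}" using T(1) t(1) by auto
    moreover have "cmod (u (z + \<tau> + (Max T - t)) - u z) \<le> e" for z
      using close[OF t(2), of z] by (simp add: algebra_simps)
    ultimately show "\<exists>h\<in>{0..Max T - Min T}. \<forall>z. cmod (u (z + \<tau> + h) - u z) \<le> e" by blast
  qed
qed

lemma dtr_recurrence:
  assumes "dtr B u" "0 < e"
  obtains \<tau> where "R \<le> \<tau>" "\<And>z. cmod (u (z + \<tau>) - u z) \<le> e"
proof -
  obtain L where "\<And>\<tau>. \<exists>h\<in>{0..L}. \<forall>z. cmod (u (z + \<tau> + h) - u z) \<le> e"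
    using dtr_almost_periodic[OF assms] by metis
  from this[of R] obtain h where "0 \<le> h" "\<And>z. cmod (u (z + (R + h)) - u z) \<le> e"
    by (auto simp: add.assoc)
  then show ?thesis by (intro that[of "R + h"]) auto
qed

text \<open>At z plus a large almost period the vanishing summand is negligible while
  \<open>u\<close> has nearly its value at z. So a bound for the sum passes to the discrete part at
  every point.\<close>

lemma dtr_add_vanishing_le:
  assumes u: "dtr B u" and v: "(v \<longlongrightarrow> (0::complex)) at_top" and M: "\<And>z. cmod (u z + v z) \<le> M"
  shows "cmod (u z) \<le> M"
proof (rule field_le_epsilon)
  fix e :: real assume e: "0 < e"
  have "\<forall>\<^sub>F x in at_top. cmod (v x) < e / 2"
    using tendstoD[OF v, of "e / 2"] e by simp
  then obtain R where R: "\<And>x. R \<le> x \<Longrightarrow> cmod (v x) < e / 2" unfolding eventually_at_top_linorder by blast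
  obtain \<tau> where \<tau>: "R - z \<le> \<tau>" "\<And>z. cmod (u (z + \<tau>) - u z) \<le> e / 2"
    using dtr_recurrence[OF u, of "e / 2"] e by (metis half_gt_zero)
  have vR: "cmod (v (z + \<tau>)) \<le> e / 2"
    using \<tau>(1) by (intro less_imp_le[OF R]) linarith
  have "u z = (u (z + \<tau>) + v (z + \<tau>)) - v (z + \<tau>) - (u (z + \<tau>) - u z)" by simp
  also have "cmod \<dots> \<le> M + e / 2 + e / 2"
    using vR by (intro order_trans[OF norm_triangle_ineq4] add_mono order_trans[OF norm_triangle_ineq4] M \<tau>(2)) simp
  finally show "cmod (u z) \<le> M + e" by simp
qed

text \<open>The same shift for lower bounds. It yields the bound on the discrete part in statement
  (iii), and it keeps an approximating trigonometric polynomial away from 0.\<close>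

lemma dtr_add_vanishing_ge:
  assumes u: "dtr B u" and v: "(v \<longlongrightarrow> (0::complex)) at_top" and M: "\<And>z. M \<le> cmod (u z + v z)"
  shows "M \<le> cmod (u z)"
proof (rule field_le_epsilon)
  fix e :: real assume e: "0 < e"
  have "\<forall>\<^sub>F x in at_top. cmod (v x) < e / 2"
    using tendstoD[OF v, of "e / 2"] e by simp
  then obtain R where R: "\<And>x. R \<le> x \<Longrightarrow> cmod (v x) < e / 2" unfolding eventually_at_top_linorder by blast
  obtain \<tau> where \<tau>: "R - z \<le> \<tau>" "\<And>z. cmod (u (z + \<tau>) - u z) \<le> e / 2"
    using dtr_recurrence[OF u, of "e / 2"] e by (metis half_gt_zero)
  have vR: "cmod (v (z + \<tau>)) \<le> e / 2"
    using \<tau>(1) by (intro less_imp_le[OF R]) linarith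
  have "M \<le> cmod (u (z + \<tau>) + v (z + \<tau>))" by (rule M)
  also have "u (z + \<tau>) + v (z + \<tau>) = u z + v (z + \<tau>) + (u (z + \<tau>) - u z)" by simp
  also have "cmod \<dots> \<le> cmod (u z) + e / 2 + e / 2"
    using vR by (intro order_trans[OF norm_triangle_ineq] add_mono \<tau>(2)) simp
  finally show "M \<le> cmod (u z) + e" by simp
qed

section \<open>Approximation in L1 by Lipschitz densities of compact support\<close>

abbreviation lft :: "(real \<Rightarrow> complex) \<Rightarrow> real \<Rightarrow> complex" where
  "lft h \<equiv> ft lborel (\<lambda>x. x) h"

text \<open>The conditions are those of the growth estimate for powers: compact support makes
  supports grow linearly, the Lipschitz condition gives a pointwise inversion bound, and the decay
  makes the transform integrable.\<close>

definition nice :: "(real \<Rightarrow> complex) \<Rightarrow> bool" where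
  "nice h \<longleftrightarrow> integrable lborel h \<and> (\<exists>L. \<forall>x y. cmod (h x - h y) \<le> L * \<bar>x - y\<bar>) \<and>
     (\<exists>T. \<forall>x. T < \<bar>x\<bar> \<longrightarrow> h x = 0) \<and> (\<exists>C. \<forall>z. cmod (lft h z) \<le> C / (1 + z\<^sup>2))"

definition approximable :: "(real \<Rightarrow> complex) \<Rightarrow> bool" where
  "approximable f \<longleftrightarrow> (\<forall>e>0. \<exists>h. nice h \<and> (LINT x|lborel. cmod (f x - h x)) < e)"

lemma lft_add:
  assumes "integrable lborel f" "integrable lborel g"
  shows "lft (\<lambda>x. f x + g x) z = lft f z + lft g z"
  unfolding ft_def distrib_right using assms by (intro Bochner_Integration.integral_add integrable_times_iexp) auto

lemma lft_cmult: "lft (\<lambda>x. c * f x) z = c * lft f z"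
  unfolding ft_def by (simp add: mult.assoc)

lemma nice_integrable: "nice h \<Longrightarrow> integrable lborel h" by (simp add: nice_def)

lemma nice_cmult:
  assumes "nice f"
  shows "nice (\<lambda>x. c * f x)"
proof -
  obtain L T C where f: "\<And>x y. cmod (f x - f y) \<le> L * \<bar>x - y\<bar>" "\<And>x. T < \<bar>x\<bar> \<Longrightarrow> f x = 0" "\<And>z. cmod (lft f z) \<le> C / (1 + z\<^sup>2)"
    and i: "integrable lborel f"
    using assms unfolding nice_def by blast
  have "cmod (c * f x - c * f y) \<le> (cmod c * L) * \<bar>x - y\<bar>" for x y
    using mult_left_mono[OF f(1)[of x y], of "cmod c"] by (simp add: norm_mult mult.assoc flip: right_diff_distrib)
  moreover have "cmod (lft (\<lambda>x. c * f x) z) \<le> (cmod c * C) / (1 + z\<^sup>2)" for z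
    using mult_left_mono[OF f(3)[of z], of "cmod c"] by (simp add: norm_mult lft_cmult)
  ultimately show ?thesis unfolding nice_def using i f(2) by (metis integrable_mult_right mult_zero_right)
qed

lemma nice_add:
  assumes "nice f" "nice g"
  shows "nice (\<lambda>x. f x + g x)"
proof -
  obtain L T C where f: "\<And>x y. cmod (f x - f y) \<le> L * \<bar>x - y\<bar>" "\<And>x. T < \<bar>x\<bar> \<Longrightarrow> f x = 0" "\<And>z. cmod (lft f z) \<le> C / (1 + z\<^sup>2)"
    and fi: "integrable lborel f"
    using assms(1) unfolding nice_def by blast
  obtain L' T' C' where g: "\<And>x y. cmod (g x - g y) \<le> L' * \<bar>x - y\<bar>" "\<And>x. T' < \<bar>x\<bar> \<Longrightarrow> g x = 0" "\<And>z. cmod (lft g z) \<le> C' / (1 + z\<^sup>2)"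
    and gi: "integrable lborel g"
    using assms(2) unfolding nice_def by blast
  have 1: "cmod ((f x + g x) - (f y + g y)) \<le> (L + L') * \<bar>x - y\<bar>" for x y
    using norm_triangle_ineq[of "f x - f y" "g x - g y"] f(1)[of x y] g(1)[of x y] by (simp add: algebra_simps)
  have 2: "cmod (lft (\<lambda>x. f x + g x) z) \<le> (C + C') / (1 + z\<^sup>2)" for z
    unfolding lft_add[OF fi gi] add_divide_distrib
    by (intro order_trans[OF norm_triangle_ineq] add_mono f g)
  have 3: "f x + g x = 0" if "max T T' < \<bar>x\<bar>" for x using that f(2) g(2) by simp
  show ?thesis unfolding nice_def
    by (intro conjI exI[of _ "L + L'"] exI[of _ "max T T'"] exI[of _ "C + C'"] allI impI 1 2 3
          Bochner_Integration.integrable_add fi gi)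
qed

lemma nice_zero: "nice (\<lambda>_. 0)"
  unfolding nice_def
  by (intro conjI exI[of _ 0]) (auto simp: ft_def)

lemma approximable_closure:
  assumes fi: "integrable lborel f"
    and ap: "\<And>e. 0 < e \<Longrightarrow> \<exists>g. integrable lborel g \<and> approximable g \<and> (LINT x|lborel. cmod (f x - g x)) < e"
  shows "approximable f"
  unfolding approximable_def
proof (intro allI impI)
  fix e :: real assume e: "0 < e"
  obtain g where g: "integrable lborel g" "approximable g" "(LINT x|lborel. cmod (f x - g x)) < e / 2"
    using ap[of "e / 2"] e by auto
  obtain h where h: "nice h" "(LINT x|lborel. cmod (g x - h x)) < e / 2"
    using g(2) e unfolding approximable_def by (meson half_gt_zero)
  note hi = nice_integrable[OF h(1)]
  have "(LINT x|lborel. cmod (f x - h x)) \<le> (LINT x|lborel. cmod (f x - g x) + cmod (g x - h x))"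
    using fi g hi by (intro integral_mono) (auto intro: norm_triangle_le_diff norm_diff_triangle_le)
  also have "\<dots> = (LINT x|lborel. cmod (f x - g x)) + (LINT x|lborel. cmod (g x - h x))"
    using fi g hi by (intro Bochner_Integration.integral_add) auto
  also have "\<dots> < e" using g h by simp
  finally show "\<exists>h. nice h \<and> (LINT x|lborel. cmod (f x - h x)) < e" using h(1) by blast
qed

lemma approximable_add:
  assumes "integrable lborel f" "integrable lborel g" "approximable f" "approximable g"
  shows "approximable (\<lambda>x. f x + g x)"
  unfolding approximable_def
proof (intro allI impI)
  fix e :: real assume e: "0 < e"
  obtain h where h: "nice h" "(LINT x|lborel. cmod (f x - h x)) < e / 2"
    using assms(3) e unfolding approximable_def by (meson half_gt_zero)
  obtain k where k: "nice k" "(LINT x|lborel. cmod (g x - k x)) < e / 2"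
    using assms(4) e unfolding approximable_def by (meson half_gt_zero)
  note hi = nice_integrable[OF h(1)] nice_integrable[OF k(1)]
  have "(LINT x|lborel. cmod ((f x + g x) - (h x + k x))) \<le> (LINT x|lborel. cmod (f x - h x) + cmod (g x - k x))"
    using assms hi by (intro integral_mono) (auto intro: norm_diff_triangle_ineq)
  also have "\<dots> = (LINT x|lborel. cmod (f x - h x)) + (LINT x|lborel. cmod (g x - k x))"
    using assms hi by (intro Bochner_Integration.integral_add) auto
  also have "\<dots> < e" using h k by simp
  finally show "\<exists>h. nice h \<and> (LINT x|lborel. cmod (f x + g x - h x)) < e"
    using nice_add[OF h(1) k(1)] by blast
qed

lemma approximable_cmult:
  assumes "approximable f"
  shows "approximable (\<lambda>x. c * f x)"
  unfolding approximable_def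
proof (intro allI impI)
  fix e :: real assume e: "0 < e"
  have pos: "0 < cmod c + 1" by (simp add: add_nonneg_pos)
  then have "0 < e / (cmod c + 1)" using e by simp
  then obtain h where h: "nice h" "(LINT x|lborel. cmod (f x - h x)) < e / (cmod c + 1)"
    using assms unfolding approximable_def by blast
  have "(LINT x|lborel. cmod (c * f x - c * h x)) = cmod c * (LINT x|lborel. cmod (f x - h x))"
    by (simp add: norm_mult flip: right_diff_distrib)
  also have "\<dots> \<le> (cmod c + 1) * (LINT x|lborel. cmod (f x - h x))"
    by (intro mult_right_mono) auto
  also have "\<dots> < e" using h(2) pos by (simp only: pos_less_divide_eq mult.commute)
  finally show "\<exists>h. nice h \<and> (LINT x|lborel. cmod (c * f x - h x)) < e"
    using nice_cmult[OF h(1)] by blast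
qed

lemma integrable_indicator_Icc: "integrable lborel (\<lambda>x. of_real (indicator {a..b::real} x) :: complex)"
  by (simp add: emeasure_lborel_Icc_eq)

lemma norm_lft_indicator_le:
  fixes a b :: real
  assumes "a \<le> b"
  shows "cmod (lft (\<lambda>x. of_real (indicator {a..b} x)) z) \<le> b - a"
    and "cmod (lft (\<lambda>x. of_real (indicator {a..b} x)) z) * \<bar>z\<bar> \<le> 2"
proof -
  show "cmod (lft (\<lambda>x. of_real (indicator {a..b} x)) z) \<le> b - a"
    using norm_ft_le[OF integrable_indicator_Icc[of a b], of "\<lambda>x. x" z] assms by simp
  show "cmod (lft (\<lambda>x. of_real (indicator {a..b} x)) z) * \<bar>z\<bar> \<le> 2"
  proof (cases "z = 0")
    case False
    have "lft (\<lambda>x. of_real (indicator {a..b} x)) z = (LINT x:{a..b}|lborel. iexp (z * x))"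
      unfolding ft_def set_lebesgue_integral_def
      by (intro Bochner_Integration.integral_cong) (auto split: split_indicator)
    also have "\<dots> = integral {a..b} (\<lambda>x. iexp (x * z))"
      by (subst set_borel_integral_eq_integral(2)) (auto intro!: borel_integrable_atLeastAtMost' continuous_intros simp: mult.commute)
    also have "\<dots> = 1 * iexp (b * z) / (\<i> * of_real z) - 1 * iexp (a * z) / (\<i> * of_real z)"
      using has_vector_derivative_iexp_divide[OF False, of 1] assms
      by (intro integral_unique fundamental_theorem_of_calculus) auto
    also have "cmod \<dots> * \<bar>z\<bar> = cmod (iexp (b * z) - iexp (a * z))"
      using False by (simp add: norm_divide norm_mult flip: diff_divide_distrib)
    also have "\<dots> \<le> 2" using norm_triangle_ineq4[of "iexp (b * z)" "iexp (a * z)"] by simp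
    finally show ?thesis .
  qed simp
qed

text \<open>The approximant is the indicator of [a, b] convolved with the uniform density on [0, s],
  a trapezoid. Its transform is a product of two factors of size O(min(1, 1 / |z|)), whence the
  decay 1 / (1 + z^2).\<close>

lemma approximable_indicator_Icc:
  fixes a b :: real
  assumes "a \<le> b"
  shows "approximable (\<lambda>x. of_real (indicator {a..b} x))"
  unfolding approximable_def
proof (intro allI impI)
  fix e :: real assume e: "0 < e"
  \<comment> \<open>The approximant differs from the indicator only on [a, a + s] and [b, b + s], by
    at most 1, so the error is at most 2 s < e.\<close>
  define s where "s = e / 3"
  have s: "0 < s" using e by (simp add: s_def)
  \<comment> \<open>The length of the part of [x - b, x - a] inside [0, s], divided by s; the
    maximum with 0 covers an empty intersection.\<close>
  define r where "r = (\<lambda>x. max 0 (min s (x - a) - max 0 (x - b)) / s)"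
  have r0: "r x = 0" if "x < a \<or> b + s < x" for x
  proof -
    have "min s (x - a) - max 0 (x - b) \<le> 0" using that s by linarith
    then show ?thesis unfolding r_def by (simp only: max_absorb1 div_0)
  qed
  let ?w = "\<lambda>x. of_real (indicator {0..s} x / s) :: complex"
  let ?h = "\<lambda>x. of_real (indicator {a..b} x) :: complex"
  have wi: "integrable lborel ?w"
    by (simp add: emeasure_lborel_Icc_eq)
  have k: "(LINT v|lborel. ?w v * ?h (x - v)) = of_real (r x)" for x
  proof -
    have "(LINT v|lborel. ?w v * ?h (x - v)) = (LINT v|lborel. of_real (indicator {max 0 (x - b)..min s (x - a)} v / s))"
      by (intro Bochner_Integration.integral_cong) (auto split: split_indicator)
    also have "\<dots> = of_real (LINT v|lborel. indicator {max 0 (x - b)..min s (x - a)} v / s)"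
      by (rule integral_complex_of_real)
    also have "(LINT v|lborel. indicator {max 0 (x - b)..min s (x - a)} v / s) = r x"
      unfolding r_def by (auto simp: measure_def emeasure_lborel_Icc_eq max_def)
    finally show ?thesis .
  qed
  note conv = ft_convolution[OF lborel.sigma_finite_measure_axioms wi _ integrable_indicator_Icc[of a b], of "\<lambda>x. x", simplified k, simplified]
  have "nice (\<lambda>x. of_real (r x))"
    unfolding nice_def
  proof (intro conjI)
    show "integrable lborel (\<lambda>x. complex_of_real (r x))" by (rule conv(1))
    have "cmod (of_real (r x) - of_real (r y)) \<le> (2 / s) * \<bar>x - y\<bar>" for x y
    proof -
      have *: "\<bar>max 0 (min s (x - a) - max 0 (x - b)) - max 0 (min s (y - a) - max 0 (y - b))\<bar> \<le> 2 * \<bar>x - y\<bar>"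
        by (auto simp: max_def min_def abs_if)
      have "\<bar>r x - r y\<bar> = \<bar>max 0 (min s (x - a) - max 0 (x - b)) - max 0 (min s (y - a) - max 0 (y - b))\<bar> / s"
        unfolding r_def diff_divide_distrib[symmetric] abs_divide using s by (simp only: abs_of_pos)
      also have "\<dots> \<le> (2 * \<bar>x - y\<bar>) / s" using s * by (intro divide_right_mono) auto
      finally have "\<bar>r x - r y\<bar> \<le> (2 / s) * \<bar>x - y\<bar>" by simp
      then show ?thesis by (simp only: of_real_diff[symmetric] norm_of_real)
    qed
    then show "\<exists>L. \<forall>x y. cmod (of_real (r x) - of_real (r y)) \<le> L * \<bar>x - y\<bar>" by (intro exI allI)
    show "\<exists>T. \<forall>x. T < \<bar>x\<bar> \<longrightarrow> complex_of_real (r x) = 0"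
    proof (intro exI allI impI)
      fix x assume "\<bar>a\<bar> + \<bar>b\<bar> + s < \<bar>x\<bar>"
      then have "x < a \<or> b + s < x" using s by arith
      then show "complex_of_real (r x) = 0" by (simp add: r0)
    qed
    show "\<exists>C. \<forall>z. cmod (lft (\<lambda>x. of_real (r x)) z) \<le> C / (1 + z\<^sup>2)"
    proof (intro exI allI)
      fix z
      let ?A = "cmod (lft (\<lambda>x. of_real (indicator {0..s} x)) z)"
      let ?B = "cmod (lft ?h z)"
      have "lft ?w z = inverse (of_real s) * lft (\<lambda>x. of_real (indicator {0..s} x)) z"
        unfolding lft_cmult[symmetric] by (intro arg_cong2[of _ _ _ _ "\<lambda>f z. lft f z"]) (auto simp: divide_inverse mult.commute)
      then have eq: "cmod (lft (\<lambda>x. of_real (r x)) z) = ?A * ?B / s"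
        using s by (simp add: conv(3) norm_mult divide_inverse norm_inverse mult_ac)
      note A = norm_lft_indicator_le[of 0 s z] and B = norm_lft_indicator_le[OF assms, of z]
      have "(?A * \<bar>z\<bar>) * (?B * \<bar>z\<bar>) \<le> 2 * 2" using A B s by (intro mult_mono) auto
      moreover have "?A * ?B \<le> s * (b - a)" using A B s by (intro mult_mono) auto
      ultimately have "?A * ?B * (1 + z\<^sup>2) \<le> 4 + s * (b - a)"
        by (simp add: algebra_simps power2_eq_square abs_mult_self_eq flip: abs_mult)
      then have "?A * ?B \<le> (4 + s * (b - a)) / (1 + z\<^sup>2)"
        by (simp add: pos_le_divide_eq add_pos_nonneg)
      then have "?A * ?B / s \<le> (4 + s * (b - a)) / (1 + z\<^sup>2) / s"
        using s by (intro divide_right_mono) simp_all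
      then show "cmod (lft (\<lambda>x. of_real (r x)) z) \<le> ((4 + s * (b - a)) / s) / (1 + z\<^sup>2)"
        unfolding eq by (simp only: divide_divide_eq_left mult.commute)
    qed
  qed
  moreover have "(LINT x|lborel. cmod (?h x - of_real (r x))) < e"
  proof -
    have "\<bar>indicator {a..b} x - r x\<bar> \<le> indicator {a..a + s} x + indicator {b..b + s} x" for x
    proof -
      have "0 \<le> r x" "r x \<le> 1" using s by (auto simp: r_def max_def min_def)
      moreover have "r x = 1" if "a + s < x" "x < b" using that s by (auto simp: r_def)
      moreover note r0[of x]
      ultimately show ?thesis using s assms by (auto split: split_indicator)
    qed
    then have "cmod (?h x - of_real (r x)) \<le> indicator {a..a + s} x + indicator {b..b + s} x" for x
      by (simp only: of_real_diff[symmetric] norm_of_real)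
    then have "(LINT x|lborel. cmod (?h x - of_real (r x))) \<le> (LINT x|lborel. indicator {a..a + s} x + indicator {b..b + s} x)"
      using conv(1) integrable_indicator_Icc[of a b] by (intro integral_mono) (auto simp: emeasure_lborel_Icc_eq)
    also have "\<dots> = s + s"
      using s by (subst Bochner_Integration.integral_add) (auto simp: emeasure_lborel_Icc_eq)
    also have "\<dots> < e" using e by (simp add: s_def)
    finally show ?thesis .
  qed
  ultimately show "\<exists>h. nice h \<and> (LINT x|lborel. cmod (?h x - h x)) < e" by blast
qed

lemma integral_norm_le_indicator_limit:
  fixes A :: "nat \<Rightarrow> real set"
  assumes "integrable lborel (indicator B :: real \<Rightarrow> real)" "\<And>n. A n \<in> sets borel" "\<And>n. A n \<subseteq> B" "incseq A" "C = (\<Union>n. A n)" "0 < e"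
  shows "\<exists>n. (LINT x|lborel. cmod (of_real (indicator C x) - of_real (indicator (A n) x))) < e"
proof -
  have C: "C \<in> sets borel" using assms(2,5) by auto
  have "(\<lambda>n. LINT x|lborel. cmod (of_real (indicator C x) - of_real (indicator (A n) x))) \<longlonglongrightarrow> (LINT x|lborel. cmod (of_real (indicator C x :: real) - of_real (indicator C x)))"
  proof (rule integral_dominated_convergence[where w="indicator B"])
    show "AE x in lborel. (\<lambda>n. cmod (of_real (indicator C x) - of_real (indicator (A n) x))) \<longlonglongrightarrow> cmod (of_real (indicator C x :: real) - of_real (indicator C x))"
      unfolding assms(5) by (intro AE_I2 tendsto_intros LIMSEQ_indicator_incseq assms)
    show "AE x in lborel. norm (cmod (of_real (indicator C x) - of_real (indicator (A n) x))) \<le> indicator B x" for n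
      using assms(3,5) by (intro AE_I2) (auto split: split_indicator)
  qed (use assms(1,2) C in measurable)
  then have "\<forall>\<^sub>F n in sequentially. (LINT x|lborel. cmod (of_real (indicator C x) - of_real (indicator (A n) x))) < e"
    using assms(6) by (intro order_tendstoD) auto
  then show ?thesis by (rule eventually_happens'[OF sequentially_bot])
qed

lemma integrable_indicator_subset_Icc:
  fixes A :: "real set"
  assumes "A \<in> sets borel" "A \<subseteq> {a..b}"
  shows "integrable lborel (\<lambda>x. indicator A x :: real)" "integrable lborel (\<lambda>x. of_real (indicator A x) :: complex)"
proof -
  show "integrable lborel (\<lambda>x. indicator A x :: real)"
    by (rule Bochner_Integration.integrable_bound[of _ "\<lambda>x. indicator {a..b} x :: real"])
       (use assms in \<open>auto simp: emeasure_lborel_Icc_eq intro!: AE_I2 split: split_indicator\<close>)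
  then show "integrable lborel (\<lambda>x. of_real (indicator A x) :: complex)"
    by (simp only: complex_of_real_integrable_eq)
qed

text \<open>Intersecting with a bounded interval keeps all indicators integrable, so the complement
  step can subtract from the indicator of that interval.\<close>

lemma approximable_bounded_set:
  assumes "A \<in> sets borel"
  shows "approximable (\<lambda>x. of_real (indicator (A \<inter> {-a..a::real}) x))"
  using assms
proof (induction rule: borel_set_induct)
  case empty
  then show ?case using nice_zero by (auto simp: approximable_def)
next
  case (interval c d)
  show ?case
  proof (cases "max c (- a) \<le> min d a")
    case True
    then show ?thesis using approximable_indicator_Icc[OF True] by simp
  next
    case False
    then have "{c..d} \<inter> {-a..a} = {}" by auto
    then show ?thesis using nice_zero by (auto simp: approximable_def)
  qed
next
  case (compl A)
  note i = integrable_indicator_subset_Icc(2)[of "A \<inter> {-a..a}" "-a" a]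
  have "approximable (\<lambda>x. of_real (indicator (UNIV \<inter> {-a..a}) x))"
  proof (cases "-a \<le> a")
    case True
    then show ?thesis using approximable_indicator_Icc[OF True] by simp
  next
    case False
    then show ?thesis using nice_zero by (auto simp: approximable_def)
  qed
  then have "approximable (\<lambda>x. of_real (indicator {-a..a} x) + (-1) * of_real (indicator (A \<inter> {-a..a}) x))"
    using compl i by (intro approximable_add approximable_cmult integrable_indicator_Icc integrable_mult_right) auto
  also have "(\<lambda>x. of_real (indicator {-a..a} x) + (-1) * of_real (indicator (A \<inter> {-a..a}) x)) =
      (\<lambda>x. complex_of_real (indicator (- A \<inter> {-a..a}) x))"
    by (auto simp: fun_eq_iff split: split_indicator)
  finally show ?case .
next
  case (union f)
  let ?A = "\<lambda>n. (\<Union>i<n. f i) \<inter> {-a..a}"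
  let ?C = "(\<Union>i. f i) \<inter> {-a..a}"
  have meas: "?A n \<in> sets borel" "?C \<in> sets borel" for n using union by auto
  note ia = integrable_indicator_subset_Icc(2)[OF meas(1) Int_lower2]
  have ap: "approximable (\<lambda>x. of_real (indicator (?A n) x))" for n
  proof (induction n)
    case 0
    then show ?case using nice_zero by (auto simp: approximable_def)
  next
    case (Suc n)
    have i2: "integrable lborel (\<lambda>x. of_real (indicator (f n \<inter> {-a..a}) x) :: complex)"
      using union by (intro integrable_indicator_subset_Icc(2)) auto
    have "f n \<inter> (\<Union>i<n. f i) = {}"
      using union(1) unfolding disjoint_family_on_def by (auto; metis disjoint_iff less_irrefl)
    then have "(\<lambda>x. complex_of_real (indicator (?A (Suc n)) x)) =
       (\<lambda>x. of_real (indicator (?A n) x) + of_real (indicator (f n \<inter> {-a..a}) x))"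
      by (auto simp: fun_eq_iff less_Suc_eq split: split_indicator)
    then show ?case
      using approximable_add[OF ia i2 Suc union(3)] by simp
  qed
  show ?case
  proof (rule approximable_closure)
    show "integrable lborel (\<lambda>x. of_real (indicator ?C x) :: complex)"
      by (rule integrable_indicator_subset_Icc(2)[OF meas(2) Int_lower2])
    fix e :: real assume "0 < e"
    have "\<exists>n. (LINT x|lborel. cmod (of_real (indicator ?C x) - of_real (indicator (?A n) x))) < e"
    proof (rule integral_norm_le_indicator_limit[where B="{-a..a}"])
      show "integrable lborel (indicator {-a..a} :: real \<Rightarrow> real)"
        using integrable_indicator_subset_Icc(1)[of "{-a..a}" "-a" a] by simp
      show "incseq ?A" by (rule incseq_SucI) (auto simp: lessThan_Suc)
    qed (use meas \<open>0 < e\<close> in auto)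
    then show "\<exists>g. integrable lborel g \<and> approximable g \<and> (LINT x|lborel. cmod (of_real (indicator ?C x) - g x)) < e"
      using ap ia by blast
  qed
qed

text \<open>Density of the nice functions in L1: sets of finite measure are exhausted by bounded
  sets, and L1 limits of approximable functions are approximable.\<close>

lemma approximable_integrable:
  fixes f :: "real \<Rightarrow> complex"
  assumes "integrable lborel f"
  shows "approximable f"
  using assms
proof (induction rule: integrable_induct)
  case (base A c)
  have Ai: "integrable lborel (indicator A :: real \<Rightarrow> real)"
    using base by simp
  have "approximable (\<lambda>x. of_real (indicator A x))"
  proof (rule approximable_closure)
    show "integrable lborel (\<lambda>x. of_real (indicator A x) :: complex)"
      using Ai by (simp only: complex_of_real_integrable_eq)
    fix e :: real assume "0 < e"
    let ?A = "\<lambda>n. A \<inter> {- real n..real n}"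
    have "\<exists>n. (LINT x|lborel. cmod (of_real (indicator A x) - of_real (indicator (?A n) x))) < e"
    proof (rule integral_norm_le_indicator_limit[where B=A])
      show "incseq ?A" by (auto simp: incseq_def)
      show "A = (\<Union>n. ?A n)"
      proof (intro equalityI subsetI)
        fix x assume "x \<in> A"
        obtain n where "\<bar>x\<bar> \<le> real n" using real_arch_simple by blast
        then show "x \<in> (\<Union>n. ?A n)" using \<open>x \<in> A\<close> by (intro UN_I[of n]) auto
      qed auto
    qed (use Ai base \<open>0 < e\<close> in auto)
    then show "\<exists>g. integrable lborel g \<and> approximable g \<and> (LINT x|lborel. cmod (of_real (indicator A x) - g x)) < e"
      using approximable_bounded_set[of A] integrable_indicator_subset_Icc(2)[of "?A _"] base
      by (metis Int_lower2 atLeastAtMost_borel sets.Int sets_lborel)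
  qed
  from approximable_cmult[OF this, of c] show ?case
    by (simp add: scaleR_conv_of_real mult.commute)
next
  case (add f g)
  then show ?case by (intro approximable_add)
next
  case (lim f s)
  show ?case
  proof (rule approximable_closure)
    fix e :: real assume "0 < e"
    note [measurable] = lim(1)[THEN borel_measurable_integrable] lim(4)[THEN borel_measurable_integrable]
    have "(\<lambda>i. LINT x|lborel. cmod (f x - s i x)) \<longlonglongrightarrow> (LINT x|lborel. cmod (f x - f x))"
    proof (rule integral_dominated_convergence[where w="\<lambda>x. 3 * cmod (f x)"])
      show "AE x in lborel. (\<lambda>i. cmod (f x - s i x)) \<longlonglongrightarrow> cmod (f x - f x)"
        using lim(2) by (intro AE_I2 tendsto_intros) auto
      show "AE x in lborel. norm (cmod (f x - s i x)) \<le> 3 * cmod (f x)" for i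
      proof (intro AE_I2)
        fix x :: real
        show "norm (cmod (f x - s i x)) \<le> 3 * cmod (f x)"
          using lim(3)[of x i] norm_triangle_ineq4[of "f x" "s i x"] by simp
      qed
    qed (use lim(4) in auto)
    then have "\<forall>\<^sub>F i in sequentially. (LINT x|lborel. cmod (f x - s i x)) < e"
      using \<open>0 < e\<close> by (intro order_tendstoD) auto
    then obtain i where "(LINT x|lborel. cmod (f x - s i x)) < e"
      using eventually_happens'[OF sequentially_bot] by blast
    then show "\<exists>g. integrable lborel g \<and> approximable g \<and> (LINT x|lborel. cmod (f x - g x)) < e"
      using lim(1,5) by blast
  qed (rule lim(4))
qed

lemma ltr_lft: "integrable lborel h \<Longrightarrow> ltr (LINT x|lborel. cmod (h x)) (lft h)"
  unfolding ltr_def by blast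

lemma lft_diff:
  assumes "integrable lborel f" "integrable lborel g"
  shows "lft (\<lambda>x. f x - g x) z = lft f z - lft g z"
  using lft_add[OF assms(1) integrable_mult_right[OF assms(2), of "-1"]] lft_cmult[of "-1" g] by simp

lemma ltr_approx:
  assumes "ltr B u" "0 < e"
  obtains h where "nice h" "ltr e (\<lambda>z. u z - lft h z)"
proof -
  obtain f where f: "integrable lborel f" "u = lft f" using assms(1) unfolding ltr_def by blast
  obtain h where h: "nice h" "(LINT x|lborel. cmod (f x - h x)) < e"
    using approximable_integrable[OF f(1)] assms(2) unfolding approximable_def by blast
  have "ltr (LINT x|lborel. cmod (f x - h x)) (lft (\<lambda>x. f x - h x))"
    using f(1) nice_integrable[OF h(1)] by (intro ltr_lft) auto
  moreover have "lft (\<lambda>x. f x - h x) = (\<lambda>z. u z - lft h z)"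
    using lft_diff[OF f(1) nice_integrable[OF h(1)]] by (auto simp: f(2))
  ultimately show ?thesis using h by (intro that[of h]) (auto intro: ltr_mono)
qed

lemma tendsto_inverse_one_plus_square:
  "((\<lambda>z::real. C / (1 + z\<^sup>2)) \<longlongrightarrow> 0) at_top" "((\<lambda>z::real. C / (1 + z\<^sup>2)) \<longlongrightarrow> 0) at_bot"
  by (intro real_tendsto_divide_at_top[OF tendsto_const] filterlim_tendsto_add_at_top[OF tendsto_const]
        filterlim_pow_at_top filterlim_ident; simp)
     (intro real_tendsto_divide_at_top[OF tendsto_const] filterlim_tendsto_add_at_top[OF tendsto_const]
        filterlim_pow_at_bot_even filterlim_ident; simp)

text \<open>The Riemann-Lebesgue lemma: the decay is explicit for a nice density, and the transform
  of the remainder is uniformly small by its L1 norm.\<close>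

lemma ltr_tendsto_0:
  assumes u: "ltr B u" and F: "F = at_top \<or> F = at_bot"
  shows "(u \<longlongrightarrow> 0) F"
proof (rule tendstoI)
  fix e :: real assume e: "0 < e"
  obtain h where h: "nice h" "ltr (e / 2) (\<lambda>z. u z - lft h z)"
    using ltr_approx[OF u, of "e / 2"] e by auto
  obtain C where C: "\<And>z. cmod (lft h z) \<le> C / (1 + z\<^sup>2)"
    using h(1) unfolding nice_def by blast
  have "\<forall>\<^sub>F z in F. C / (1 + z\<^sup>2) < e / 2"
  proof (rule order_tendstoD(2))
    show "((\<lambda>z. C / (1 + z\<^sup>2)) \<longlongrightarrow> 0) F" using F tendsto_inverse_one_plus_square[of C] by blast
  qed (use e in simp)
  then show "\<forall>\<^sub>F z in F. dist (u z) 0 < e"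
  proof eventually_elim
    case (elim z)
    have "cmod (u z) \<le> cmod (u z - lft h z) + cmod (lft h z)"
      using norm_triangle_ineq[of "u z - lft h z" "lft h z"] by simp
    moreover have "cmod (lft h z) < e / 2" using elim C[of z] by linarith
    moreover note norm_ltr_le[OF h(2), of z]
    ultimately have "cmod (u z) < e" by linarith
    then show ?case by simp
  qed
qed

subsection \<open>The spectral radius\<close>

lemma norm_lebesgue_integral_le:
  fixes f :: "'a \<Rightarrow> 'b::{banach, second_countable_topology}"
  assumes "integrable M f" "\<And>x. norm (f x) \<le> g x" "integrable M g"
  shows "norm (LINT x|M. f x) \<le> (LINT x|M. g x)"
  by (rule order_trans[OF integral_norm_bound integral_mono]) (use assms in auto)

definition lipbd :: "(real \<Rightarrow> complex) \<Rightarrow> bool" where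
  "lipbd h \<longleftrightarrow> (\<exists>L. \<forall>x y. cmod (h x - h y) \<le> L * \<bar>x - y\<bar>) \<and> (\<exists>M. \<forall>x. cmod (h x) \<le> M)"

lemma lipbdE:
  assumes "lipbd h"
  obtains L M where "0 \<le> L" "\<And>x y. cmod (h x - h y) \<le> L * \<bar>x - y\<bar>" "0 \<le> M" "\<And>x. cmod (h x) \<le> M"
proof -
  obtain L M where L: "\<And>x y. cmod (h x - h y) \<le> L * \<bar>x - y\<bar>" and M: "\<And>x. cmod (h x) \<le> M"
    using assms unfolding lipbd_def by blast
  have "0 \<le> L" using order_trans[OF norm_ge_zero L[of 1 0]] by simp
  moreover have "0 \<le> M" using M[of 0] norm_ge_zero[of "h 0"] by linarith
  ultimately show ?thesis using that L M by blast
qed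

lemma lipbd_if_vanishing:
  assumes L: "\<And>x y. cmod (h x - h y) \<le> L * \<bar>x - y\<bar>" and T: "\<And>x. T < \<bar>x\<bar> \<Longrightarrow> h x = 0"
  shows "lipbd h"
proof -
  have L0: "0 \<le> L" using order_trans[OF norm_ge_zero L[of 1 0]] by simp
  have "cmod (h x) \<le> L * (2 * \<bar>T\<bar> + 1)" for x
  proof (cases "T < \<bar>x\<bar>")
    case False
    have "cmod (h x) = cmod (h x - h (\<bar>T\<bar> + 1))" using T[of "\<bar>T\<bar> + 1"] by simp
    also have "\<dots> \<le> L * \<bar>x - (\<bar>T\<bar> + 1)\<bar>" by (rule L)
    also have "\<dots> \<le> L * (2 * \<bar>T\<bar> + 1)" using False L0 by (intro mult_left_mono) auto
    finally show ?thesis .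
  qed (use T L0 in simp)
  then show ?thesis unfolding lipbd_def using L by blast
qed

lemma lipbd_measurable: "lipbd h \<Longrightarrow> h \<in> borel_measurable borel"
proof (intro borel_measurable_continuous_onI)
  assume "lipbd h"
  then obtain L M where L: "0 \<le> L" "\<And>x y. cmod (h x - h y) \<le> L * \<bar>x - y\<bar>" and "0 \<le> M" "\<And>x. cmod (h x) \<le> M" by (rule lipbdE) blast
  then have "L-lipschitz_on UNIV h" by (auto simp: lipschitz_on_def dist_norm)
  then show "continuous_on UNIV h" by (rule lipschitz_on_continuous_on)
qed

text \<open>Boundedness makes the integrand integrable for every x, so the convolution is a genuine
  function at each point, with Lipschitz constant and bound multiplied by the total
  variation.\<close>

lemma lipbd_convolution:
  assumes h: "lipbd h" and w: "integrable N w" and [measurable]: "\<pi> \<in> borel_measurable N"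
  shows "lipbd (\<lambda>x. LINT v|N. w v * h (x - \<pi> v))"
proof -
  obtain L M where L: "0 \<le> L" "\<And>x y. cmod (h x - h y) \<le> L * \<bar>x - y\<bar>" and M: "0 \<le> M" "\<And>x. cmod (h x) \<le> M"
    using h by (rule lipbdE) blast
  note [measurable] = lipbd_measurable[OF h] borel_measurable_integrable[OF w]
  have int: "integrable N (\<lambda>v. w v * h (x - \<pi> v))" for x
  proof (rule Bochner_Integration.integrable_bound[OF integrable_mult_left[OF w, of "of_real M"]])
    show "AE v in N. norm (w v * h (x - \<pi> v)) \<le> norm (w v * of_real M)"
      using M by (intro AE_I2) (auto simp: norm_mult intro!: mult_left_mono)
  qed measurable
  show ?thesis unfolding lipbd_def
  proof (intro conjI exI allI)
    fix x y
    have "(LINT v|N. w v * h (x - \<pi> v)) - (LINT v|N. w v * h (y - \<pi> v)) = (LINT v|N. w v * (h (x - \<pi> v) - h (y - \<pi> v)))"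
      using int by (simp add: right_diff_distrib)
    also have "cmod \<dots> \<le> (LINT v|N. cmod (w v) * (L * \<bar>x - y\<bar>))"
    proof (rule norm_lebesgue_integral_le)
      show "integrable N (\<lambda>v. w v * (h (x - \<pi> v) - h (y - \<pi> v)))" using int by (simp add: right_diff_distrib)
      show "cmod (w v * (h (x - \<pi> v) - h (y - \<pi> v))) \<le> cmod (w v) * (L * \<bar>x - y\<bar>)" for v
        unfolding norm_mult using L(2)[of "x - \<pi> v" "y - \<pi> v"] by (intro mult_left_mono) auto
    qed (use w in simp)
    finally show "cmod ((LINT v|N. w v * h (x - \<pi> v)) - (LINT v|N. w v * h (y - \<pi> v))) \<le> (LINT v|N. cmod (w v)) * L * \<bar>x - y\<bar>"
      by (simp add: mult.assoc)
  next
    fix x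
    have "cmod (LINT v|N. w v * h (x - \<pi> v)) \<le> (LINT v|N. cmod (w v) * M)"
      by (rule norm_lebesgue_integral_le) (use int w M in \<open>auto simp: norm_mult intro!: mult_left_mono\<close>)
    then show "cmod (LINT v|N. w v * h (x - \<pi> v)) \<le> (LINT v|N. cmod (w v)) * M" by simp
  qed
qed

section \<open>A pointwise bound by Fourier inversion\<close>

text \<open>Self-duality of the Gaussian, in the form in which Fubini's theorem moves a Gaussian
  average of a density to its transform.\<close>

lemma std_normal_density_eq_ft:
  "of_real (std_normal_density v) = (LINT t|lborel. of_real (std_normal_density t) * iexp (t * v)) / of_real (sqrt (2 * pi))"
proof -
  have "char std_normal_distribution v = (LINT t|lborel. of_real (std_normal_density t) * iexp (t * v))"
    unfolding char_def
    by (subst integral_density) (auto simp: scaleR_conv_of_real mult.commute intro!: Bochner_Integration.integral_cong)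
  then show ?thesis
    unfolding char_std_normal_distribution by (simp add: std_normal_density_def field_simps)
qed

text \<open>The mollification of \<open>r\<close> by a Gaussian of width \<open>s\<close> is an integral of the transform of \<open>r\<close>
  against a Gaussian of width \<open>1 / s\<close>.\<close>

lemma norm_le_integral_norm_lft:
  assumes ri: "integrable lborel r" and lb: "lipbd r" and fi: "integrable lborel (lft r)"
  shows "cmod (r x) \<le> (LINT z|lborel. cmod (lft r z)) / (2 * pi)"
proof -
  obtain L M where L: "0 \<le> L" "\<And>x y. cmod (r x - r y) \<le> L * \<bar>x - y\<bar>" and M: "0 \<le> M" "\<And>x. cmod (r x) \<le> M"
    using lb by (rule lipbdE) blast
  note [measurable] = lipbd_measurable[OF lb]
  let ?n = std_normal_density
  define K where "K = (LINT v|lborel. ?n v * \<bar>v\<bar>)"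
  have ni: "integrable lborel ?n" by simp
  have nvi: "integrable lborel (\<lambda>v. ?n v * \<bar>v\<bar>)"
    using integrable_std_normal_moment_abs[of 1] by simp
  have nci: "integrable lborel (\<lambda>v. of_real (?n v) :: complex)"
    using ni by (simp only: complex_of_real_integrable_eq)
  \<comment> \<open>The error \<open>L * s * K\<close> comes from |r x - r (x - s v)| <= L s |v|;
    \<open>K\<close> is the first absolute moment of the Gaussian.\<close>
  have key: "cmod (r x) \<le> (LINT z|lborel. cmod (lft r z)) / (2 * pi) + L * s * K" if s: "0 < s" for s
  proof -
    define I where "I = (LINT v|lborel. r (x - s * v) * of_real (?n v))"
    have int1: "integrable lborel (\<lambda>v. r (x - s * v) * of_real (?n v))"
      by (rule Bochner_Integration.integrable_bound[OF integrable_mult_right[OF nci, of "of_real M"]])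
         (use M in \<open>auto simp: norm_mult intro!: AE_I2 mult_right_mono\<close>)
    have "r x - I = (LINT v|lborel. (r x - r (x - s * v)) * of_real (?n v))"
    proof -
      have "(LINT v|lborel. r x * of_real (?n v)) = r x"
        by (simp add: integral_complex_of_real)
      then have "r x - I = (LINT v|lborel. r x * of_real (?n v)) - I" by simp
      also have "\<dots> = (LINT v|lborel. r x * of_real (?n v) - r (x - s * v) * of_real (?n v))"
        unfolding I_def by (rule Bochner_Integration.integral_diff[symmetric]) (use nci int1 in auto)
      finally show ?thesis by (simp add: left_diff_distrib)
    qed
    also have "cmod \<dots> \<le> (LINT v|lborel. L * s * (?n v * \<bar>v\<bar>))"
    proof (rule norm_lebesgue_integral_le)
      show "integrable lborel (\<lambda>v. (r x - r (x - s * v)) * of_real (?n v))"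
        unfolding left_diff_distrib using nci int1 by auto
      show "cmod ((r x - r (x - s * v)) * of_real (?n v)) \<le> L * s * (?n v * \<bar>v\<bar>)" for v
      proof -
        have "cmod (r x - r (x - s * v)) * ?n v \<le> (L * \<bar>x - (x - s * v)\<bar>) * ?n v"
          by (intro mult_right_mono L) simp
        then show ?thesis using s by (simp add: norm_mult abs_mult mult_ac)
      qed
    qed (use nvi in simp)
    finally have 1: "cmod (r x - I) \<le> L * s * K" by (simp add: K_def)
    have rsi: "integrable lborel (\<lambda>v. r (x - s * v))"
      using lborel_integrable_real_affine[OF ri, of "- s" x] s by simp
    have int2: "integrable (lborel \<Otimes>\<^sub>M lborel) (\<lambda>(v, t). r (x - s * v) * (of_real (?n t) * iexp (t * v)))"
    proof (rule lborel_pair.Fubini_integrable)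
      show "integrable lborel (\<lambda>v. LINT t|lborel. norm (case (v, t) of (v, t) \<Rightarrow> r (x - s * v) * (of_real (?n t) * iexp (t * v))))"
        using rsi by (simp add: norm_mult)
      show "AE v in lborel. integrable lborel (\<lambda>t. case (v, t) of (v, t) \<Rightarrow> r (x - s * v) * (of_real (?n t) * iexp (t * v)))"
      proof (intro AE_I2)
        fix v :: real
        have "integrable lborel (\<lambda>t. of_real (?n t) * iexp (v * t))"
          by (rule integrable_times_iexp[OF nci]) simp
        then show "integrable lborel (\<lambda>t. case (v, t) of (v, t) \<Rightarrow> r (x - s * v) * (of_real (?n t) * iexp (t * v)))"
          by (simp add: mult.commute[of v])
      qed
    qed measurable
    have inner: "(LINT v|lborel. r (x - s * v) * iexp (t * v)) = of_real (1 / s) * iexp (t * x / s) * lft r (- t / s)" for t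
    proof -
      have "lft r (- t / s) = \<bar>- s\<bar> *\<^sub>R (LINT v|lborel. r (x + - s * v) * iexp ((- t / s) * (x + - s * v)))"
        unfolding ft_def using s by (intro lborel_integral_real_affine) simp
      also have "(\<lambda>v. r (x + - s * v) * iexp ((- t / s) * (x + - s * v))) = (\<lambda>v. iexp (- (t * x / s)) * (r (x - s * v) * iexp (t * v)))"
      proof
        fix v
        have "(- t / s) * (x + - s * v) = - (t * x / s) + t * v" using s by (simp add: field_simps)
        then have "iexp ((- t / s) * (x + - s * v)) = iexp (- (t * x / s)) * iexp (t * v)"
          by (simp only: of_real_add distrib_left exp_add)
        then show "r (x + - s * v) * iexp ((- t / s) * (x + - s * v)) = iexp (- (t * x / s)) * (r (x - s * v) * iexp (t * v))"
          by (simp only: mult.left_commute[of "r _"] mult.assoc) (simp add: mult.left_commute)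
      qed
      finally have "lft r (- t / s) = of_real s * iexp (- (t * x / s)) * (LINT v|lborel. r (x - s * v) * iexp (t * v))"
        using s by (simp only: integral_mult_right_zero scaleR_conv_of_real abs_minus_cancel abs_of_pos mult.assoc)
      then have "of_real (1 / s) * iexp (t * x / s) * lft r (- t / s) =
          (of_real (1 / s) * of_real s) * (iexp (t * x / s) * iexp (- (t * x / s))) * (LINT v|lborel. r (x - s * v) * iexp (t * v))"
        by (simp only: mult_ac)
      then show ?thesis using s by (simp flip: exp_add)
    qed
    have "I = (LINT v|lborel. LINT t|lborel. r (x - s * v) * (of_real (?n t) * iexp (t * v))) / of_real (sqrt (2 * pi))"
      unfolding I_def by (subst std_normal_density_eq_ft) (simp add: integral_divide_zero)
    also have "(LINT v|lborel. LINT t|lborel. r (x - s * v) * (of_real (?n t) * iexp (t * v))) =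
        (LINT t|lborel. LINT v|lborel. r (x - s * v) * (of_real (?n t) * iexp (t * v)))"
      using lborel_pair.Fubini_integral[OF int2] by simp
    also have "\<dots> = (LINT t|lborel. of_real (?n t) * (of_real (1 / s) * iexp (t * x / s) * lft r (- t / s)))"
    proof (intro Bochner_Integration.integral_cong refl)
      fix t
      have "(LINT v|lborel. r (x - s * v) * (of_real (?n t) * iexp (t * v))) = of_real (?n t) * (LINT v|lborel. r (x - s * v) * iexp (t * v))"
        by (simp add: mult.left_commute)
      then show "(LINT v|lborel. r (x - s * v) * (of_real (?n t) * iexp (t * v))) = of_real (?n t) * (of_real (1 / s) * iexp (t * x / s) * lft r (- t / s))"
        by (simp only: inner)
    qed
    finally have I: "cmod I = cmod (LINT t|lborel. of_real (?n t) * (of_real (1 / s) * iexp (t * x / s) * lft r (- t / s))) / sqrt (2 * pi)"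
      by (simp only: norm_divide norm_of_real) simp
    have fsi: "integrable lborel (\<lambda>t. lft r (- t / s))"
      using lborel_integrable_real_affine[OF fi, of "- 1 / s" 0] s by simp
    \<comment> \<open>The Gaussian weight is bounded by its maximum 1 / sqrt (2 pi). Together with
      the same factor from self-duality this gives the constant 1 / (2 pi).\<close>
    have nb: "?n t \<le> 1 / sqrt (2 * pi)" for t
      unfolding std_normal_density_def by (simp add: divide_right_mono)
    have "cmod (LINT t|lborel. of_real (?n t) * (of_real (1 / s) * iexp (t * x / s) * lft r (- t / s))) \<le>
        (LINT t|lborel. 1 / sqrt (2 * pi) * (1 / s * cmod (lft r (- t / s))))"
    proof (rule order_trans[OF integral_norm_bound integral_mono])
      show "integrable lborel (\<lambda>t. 1 / sqrt (2 * pi) * (1 / s * cmod (lft r (- t / s))))" using fsi by simp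
      have "cmod (of_real (?n t) * (of_real (1 / s) * iexp (t * x / s) * lft r (- t / s))) \<le> 1 / sqrt (2 * pi) * (1 / s * cmod (lft r (- t / s)))" for t
      proof -
        have "cmod (of_real (?n t) * (of_real (1 / s) * iexp (t * x / s) * lft r (- t / s))) = ?n t * (1 / s * cmod (lft r (- t / s)))"
          using s by (simp only: norm_mult norm_of_real norm_exp_i_times abs_of_nonneg normal_density_nonneg) simp
        then show ?thesis using s by (simp only:) (intro mult_right_mono nb, simp)
      qed
      then show "cmod (of_real (?n t) * (of_real (1 / s) * iexp (t * x / s) * lft r (- t / s))) \<le> 1 / sqrt (2 * pi) * (1 / s * cmod (lft r (- t / s)))" for t .
      show "integrable lborel (\<lambda>t. cmod (of_real (?n t) * (of_real (1 / s) * iexp (t * x / s) * lft r (- t / s))))"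
      proof (rule Bochner_Integration.integrable_bound[OF integrable_norm[OF integrable_mult_right[OF fsi, of "of_real (1 / sqrt (2 * pi) / s)"]]])
        have [measurable]: "(\<lambda>t. lft r (- t / s)) \<in> borel_measurable borel" using borel_measurable_integrable[OF fsi] by simp
        show "(\<lambda>t. cmod (of_real (?n t) * (of_real (1 / s) * iexp (t * x / s) * lft r (- t / s)))) \<in> borel_measurable lborel" by measurable
        show "AE t in lborel. norm (cmod (of_real (?n t) * (of_real (1 / s) * iexp (t * x / s) * lft r (- t / s)))) \<le> norm (cmod (of_real (1 / sqrt (2 * pi) / s) * lft r (- t / s)))"
        proof (intro AE_I2)
          fix t :: real
          have "cmod (of_real (?n t) * (of_real (1 / s) * iexp (t * x / s) * lft r (- t / s))) \<le> 1 / sqrt (2 * pi) * (1 / s * cmod (lft r (- t / s)))" by fact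
          then show "norm (cmod (of_real (?n t) * (of_real (1 / s) * iexp (t * x / s) * lft r (- t / s)))) \<le> norm (cmod (of_real (1 / sqrt (2 * pi) / s) * lft r (- t / s)))"
            using s by (simp add: norm_mult norm_divide)
        qed
      qed
    qed
    also have "\<dots> = 1 / sqrt (2 * pi) * (LINT z|lborel. cmod (lft r z))"
      using lborel_integral_real_affine[of "- 1 / s" "\<lambda>z. cmod (lft r z)" 0] s by simp
    finally have "cmod I \<le> 1 / sqrt (2 * pi) * (LINT z|lborel. cmod (lft r z)) / sqrt (2 * pi)"
      unfolding I by (intro divide_right_mono) auto
    also have "\<dots> = (LINT z|lborel. cmod (lft r z)) / (2 * pi)" by simp
    finally show ?thesis using 1 norm_triangle_ineq[of "r x - I" I] by simp
  qed
  show ?thesis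
  proof (rule field_le_epsilon)
    fix e :: real assume e: "0 < e"
    have K0: "0 \<le> K" unfolding K_def by simp
    \<comment> \<open>The added 1 keeps the width e / (L K + 1) defined when L K = 0.\<close>
    have pos: "0 < L * K + 1" using L(1) K0 by (simp add: add_nonneg_pos)
    have "e * (L * K / (L * K + 1)) \<le> e * 1"
      using e pos by (intro mult_left_mono) (auto simp: pos_divide_le_eq)
    then have "L * (e / (L * K + 1)) * K \<le> e" by (simp add: mult_ac)
    then show "cmod (r x) \<le> (LINT z|lborel. cmod (lft r z)) / (2 * pi) + e"
      using key[of "e / (L * K + 1)"] e pos by simp
  qed
qed


section \<open>Growth of powers\<close>

text \<open>\<open>T\<close> is a radius of the support. It is tracked because it adds under
  multiplication, hence grows only linearly along powers.\<close>

definition cltr :: "real \<Rightarrow> (real \<Rightarrow> complex) \<Rightarrow> bool" where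
  "cltr T u \<longleftrightarrow> (\<exists>r. integrable lborel r \<and> lipbd r \<and> (\<forall>x. T < \<bar>x\<bar> \<longrightarrow> r x = 0) \<and> u = lft r)"

lemma lipbd_add:
  assumes "lipbd f" "lipbd g"
  shows "lipbd (\<lambda>x. f x + g x)"
proof -
  obtain L M where L: "0 \<le> L" "\<And>x y. cmod (f x - f y) \<le> L * \<bar>x - y\<bar>" and M: "0 \<le> M" "\<And>x. cmod (f x) \<le> M"
    using assms(1) by (rule lipbdE) blast
  obtain L' M' where L': "0 \<le> L'" "\<And>x y. cmod (g x - g y) \<le> L' * \<bar>x - y\<bar>" and M': "0 \<le> M'" "\<And>x. cmod (g x) \<le> M'"
    using assms(2) by (rule lipbdE) blast
  show ?thesis unfolding lipbd_def
  proof (intro conjI exI allI)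
    fix x y
    show "cmod (f x + g x - (f y + g y)) \<le> (L + L') * \<bar>x - y\<bar>"
      using norm_triangle_ineq[of "f x - f y" "g x - g y"] L(2)[of x y] L'(2)[of x y] by (simp add: algebra_simps)
    show "cmod (f x + g x) \<le> M + M'"
      by (intro order_trans[OF norm_triangle_ineq] add_mono M M')
  qed
qed

lemma cltr_zero: "cltr T (\<lambda>_. 0)"
  unfolding cltr_def
proof (intro exI conjI)
  show "lipbd (\<lambda>_. 0)" unfolding lipbd_def by (intro conjI exI[of _ 0]) auto
qed (auto simp: ft_def fun_eq_iff)

lemma cltr_add:
  assumes "cltr T u" "cltr S v"
  shows "cltr (max T S) (\<lambda>z. u z + v z)"
proof -
  obtain r where r: "integrable lborel r" "lipbd r" "\<And>x. T < \<bar>x\<bar> \<Longrightarrow> r x = 0" "u = lft r"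
    using assms(1) unfolding cltr_def by blast
  obtain s where s: "integrable lborel s" "lipbd s" "\<And>x. S < \<bar>x\<bar> \<Longrightarrow> s x = 0" "v = lft s"
    using assms(2) unfolding cltr_def by blast
  show ?thesis unfolding cltr_def
  proof (intro exI conjI)
    show "(\<lambda>z. u z + v z) = lft (\<lambda>x. r x + s x)" by (simp add: fun_eq_iff lft_add r s)
  qed (use r s lipbd_add in auto)
qed

lemma cltr_mult_ft:
  assumes u: "cltr T u" and N: "sigma_finite_measure N" and w: "integrable N w" "\<pi> \<in> borel_measurable N"
    and S: "\<And>v. v \<in> space N \<Longrightarrow> w v \<noteq> 0 \<Longrightarrow> \<bar>\<pi> v\<bar> \<le> S"
  shows "cltr (T + S) (\<lambda>z. u z * ft N \<pi> w z)"
proof -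
  obtain r where r: "integrable lborel r" "lipbd r" "\<And>x. T < \<bar>x\<bar> \<Longrightarrow> r x = 0" "u = lft r"
    using u unfolding cltr_def by blast
  note c = ft_convolution[OF N w r(1)]
  let ?k = "\<lambda>x. LINT v|N. w v * r (x - \<pi> v)"
  show ?thesis unfolding cltr_def
  proof (intro exI conjI allI impI)
    show "integrable lborel ?k" by (rule c(1))
    show "lipbd ?k" by (rule lipbd_convolution[OF r(2) w])
    show "(\<lambda>z. u z * ft N \<pi> w z) = lft ?k" by (rule ext) (simp only: c(3) r(4) mult.commute)
    fix x assume x: "T + S < \<bar>x\<bar>"
    have "w v * r (x - \<pi> v) = 0" if "v \<in> space N" for v
    proof (cases "w v = 0")
      case False
      then have "T < \<bar>x - \<pi> v\<bar>" using S[OF that] x by linarith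
      then show ?thesis by (simp add: r(3))
    qed simp
    then have "?k x = (LINT v|N. 0)" by (intro Bochner_Integration.integral_cong) auto
    then show "?k x = 0" by simp
  qed
qed

text \<open>Inversion bounds the density by A / (2 pi), and its support has length 2 T.\<close>

lemma cltr_imp_ltr:
  assumes "cltr T u" and T: "0 \<le> T" and ui: "integrable lborel u" and A: "(LINT z|lborel. cmod (u z)) \<le> A"
  shows "ltr (T * A / pi) u"
proof -
  obtain r where r: "integrable lborel r" "lipbd r" "\<And>x. T < \<bar>x\<bar> \<Longrightarrow> r x = 0" "u = lft r"
    using assms(1) unfolding cltr_def by blast
  have b: "cmod (r x) \<le> A / (2 * pi)" for x
    using A[unfolded r(4)]
    by (intro order_trans[OF norm_le_integral_norm_lft[OF r(1,2) ui[unfolded r(4)]]] divide_right_mono) auto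
  have "(LINT x|lborel. cmod (r x)) \<le> (LINT x|lborel. indicator {-T..T} x * (A / (2 * pi)))"
  proof (rule integral_mono)
    show "cmod (r x) \<le> indicator {-T..T} x * (A / (2 * pi))" for x
      using b[of x] r(3)[of x] by (auto split: split_indicator)
  qed (use r(1) in \<open>auto simp: emeasure_lborel_Icc_eq\<close>)
  also have "\<dots> = T * A / pi" using T by simp
  finally show ?thesis using ltr_lft[OF r(1)] unfolding r(4) by (rule ltr_mono[rotated])
qed

lemma nice_lipbd: "nice h \<Longrightarrow> lipbd h"
  unfolding nice_def using lipbd_if_vanishing by blast

lemma integrable_inverse_one_plus_square: "integrable lborel (\<lambda>z::real. C / (1 + z\<^sup>2))"
  using integrable_mult_right[OF integrable_inverse_1_plus_square[unfolded set_integrable_def], of C]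
  by (simp add: divide_inverse)

lemma nice_integrable_lft:
  assumes "nice h" shows "integrable lborel (lft h)"
proof -
  obtain C where C: "\<And>z. cmod (lft h z) \<le> C / (1 + z\<^sup>2)"
    using assms unfolding nice_def by blast
  have "continuous_on UNIV (lft h)"
    using isCont_ft[OF nice_integrable[OF assms], of "\<lambda>x. x"] by (simp add: continuous_at_imp_continuous_on)
  then have [measurable]: "lft h \<in> borel_measurable borel" by (rule borel_measurable_continuous_onI)
  have C0: "0 \<le> C" using order_trans[OF norm_ge_zero C[of 0]] by simp
  show ?thesis
    by (rule Bochner_Integration.integrable_bound[OF integrable_inverse_one_plus_square[of C]])
       (use C C0 in \<open>auto intro!: AE_I2\<close>)
qed

lemma norm_power_diff_le:
  fixes x y :: complex
  assumes "cmod x \<le> r" "cmod y \<le> r"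
  shows "cmod (x ^ n - y ^ n) \<le> real n * cmod (x - y) * r ^ (n - 1)"
proof (induction n)
  case (Suc n)
  have r0: "0 \<le> r" using assms(1) norm_ge_zero[of x] by linarith
  have "x ^ Suc n - y ^ Suc n = x * (x ^ n - y ^ n) + (x - y) * y ^ n" by (simp add: algebra_simps)
  also have "cmod \<dots> \<le> r * (real n * cmod (x - y) * r ^ (n - 1)) + cmod (x - y) * r ^ n"
    using Suc assms r0
    by (intro order_trans[OF norm_triangle_ineq] add_mono) (auto simp: norm_mult norm_power intro!: mult_mono power_mono)
  also have "\<dots> = real (Suc n) * cmod (x - y) * r ^ (Suc n - 1)"
    by (cases n) (auto simp: algebra_simps)
  finally show ?case .
qed simp

text \<open>In each induction step one factor n + 1 is absorbed by half of the decay,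
  \<open>sqrt q ^ n\<close>.\<close>

lemma poly_times_power_bounded:
  fixes q :: real
  assumes "0 < q" "q < 1"
  shows "\<exists>C. \<forall>n. real (n + 1) ^ K * q ^ n \<le> C"
  using assms
proof (induction K arbitrary: q)
  case 0
  then show ?case by (intro exI[of _ 1]) (auto intro: power_le_one)
next
  case (Suc K)
  define s where "s = sqrt q"
  have s: "0 < s" "s < 1" "q = s * s" using Suc.prems by (auto simp: s_def)
  obtain C where C: "\<And>n. real (n + 1) ^ K * s ^ n \<le> C" using Suc.IH[OF s(1,2)] by blast
  have "(\<lambda>n. real n * s ^ n + s ^ n) \<longlonglongrightarrow> 0 + 0"
    using s by (intro tendsto_add powser_times_n_limit_0 LIMSEQ_realpow_zero) auto
  then have "Bseq (\<lambda>n. real (n + 1) * s ^ n)"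
    by (intro convergent_imp_Bseq convergentI) (simp add: algebra_simps)
  then obtain D where D: "0 < D" "\<And>n. norm (real (n + 1) * s ^ n) \<le> D" unfolding Bseq_def by blast
  have "real (n + 1) ^ Suc K * q ^ n \<le> C * D" for n
  proof -
    have "real (n + 1) ^ Suc K * q ^ n = (real (n + 1) ^ K * s ^ n) * (real (n + 1) * s ^ n)"
      by (simp add: s(3) power_mult_distrib mult_ac)
    also have "\<dots> \<le> C * D"
      using C[of n] D(2)[of n] s by (intro mult_mono) (auto intro: order_trans[OF _ C[of 0]])
    finally show ?thesis .
  qed
  then show ?case by blast
qed

lemma tpev_eq_ft: "tpev p = ft (count_space (keys p)) (\<lambda>y. y) (lookup p)"
  by (auto simp: fun_eq_iff ft_def tpev_def lebesgue_integral_count_space_finite)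

lemma cltr_mult_tpev:
  assumes u: "cltr T u" and S: "\<And>y. y \<in> keys p \<Longrightarrow> \<bar>y\<bar> \<le> S"
  shows "cltr (T + S) (\<lambda>z. u z * tpev p z)"
  unfolding tpev_eq_ft
  by (rule cltr_mult_ft[OF u])
     (use S in \<open>auto simp: sigma_finite_measure_count_space_countable integrable_count_space countable_finite\<close>)

lemma keys_power_bound:
  fixes p :: trigpoly
  assumes "\<And>y. y \<in> keys p \<Longrightarrow> \<bar>y\<bar> \<le> S" "y \<in> keys (p ^ n)"
  shows "\<bar>y\<bar> \<le> real n * S"
  using assms(2)
proof (induction n arbitrary: y)
  case (Suc n)
  then obtain a b where "a \<in> keys p" "b \<in> keys (p ^ n)" "y = a + b"
    using keys_mult[of p "p ^ n"] by auto
  then show ?case using assms(1)[of a] Suc.IH[of b] by (simp add: algebra_simps)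
qed simp

text \<open>Subtracting \<open>tpev p z ^ n\<close> leaves the transform of a density supported in
  [-n T, n T], and this transform has L1 norm at most \<open>n * A * \<rho> ^ (n - 1)\<close>. The
  density thus has total variation of order n^2 \<rho>^n, while the trigonometric part costs a power
  of n + 1 times \<rho>^n.\<close>

lemma wtr_power_bound_nice:
  assumes h: "nice h" and M: "\<And>z. cmod (tpev p z + lft h z) \<le> \<rho>" and \<rho>: "0 < \<rho>" "\<rho> < \<sigma>"
  shows "\<exists>C\<ge>0. \<forall>n. wtr (C * \<sigma> ^ n) (\<lambda>z. (tpev p z + lft h z) ^ n)"
proof -
  let ?v = "\<lambda>z. tpev p z + lft h z"
  note hi = nice_integrable[OF h] and hfi = nice_integrable_lft[OF h]
  \<comment> \<open>Along large almost periods the density part is negligible, so the bound for the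
    sum holds for the polynomial alone.\<close>
  have P: "cmod (tpev p z) \<le> \<rho>" for z
    by (rule dtr_add_vanishing_le[OF dtr_tpev ltr_tendsto_0[OF ltr_lft[OF hi]] M]) simp
  obtain T0 where T0: "\<And>x. T0 < \<bar>x\<bar> \<Longrightarrow> h x = 0" using h unfolding nice_def by blast
  \<comment> \<open>One radius for the support of \<open>h\<close> and for all frequencies, so that
    each further factor enlarges the support by at most T.\<close>
  define T where "T = max \<bar>T0\<bar> (\<Sum>y\<in>keys p. \<bar>y\<bar>)"
  have T: "0 \<le> T" "\<And>x. T < \<bar>x\<bar> \<Longrightarrow> h x = 0" "\<And>y. y \<in> keys p \<Longrightarrow> \<bar>y\<bar> \<le> T"
    using T0 by (auto simp: T_def intro!: max.coboundedI2 member_le_sum)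
  have ch: "cltr T (lft h)" unfolding cltr_def using hi nice_lipbd[OF h] T(2) by blast
  \<comment> \<open>The induction splits (p + h)^(n + 1) - p^(n + 1) into ((p + h)^n - p^n) p, ((p +
    h)^n - p^n) h and h p^n; each term contains a compactly supported density.\<close>
  have cl: "cltr (real n * T) (\<lambda>z. ?v z ^ n - tpev p z ^ n)" for n
  proof (induction n)
    case 0
    then show ?case using cltr_zero by simp
  next
    case (Suc n)
    have "cltr (real n * T + T) (\<lambda>z. (?v z ^ n - tpev p z ^ n) * tpev p z)"
      by (rule cltr_mult_tpev[OF Suc T(3)])
    moreover have "cltr (real n * T + T) (\<lambda>z. (?v z ^ n - tpev p z ^ n) * lft h z)"
      by (rule cltr_mult_ft[OF Suc lborel.sigma_finite_measure_axioms hi]) (use T(2) in force)+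
    moreover have "cltr (T + real n * T) (\<lambda>z. lft h z * tpev (p ^ n) z)"
      by (rule cltr_mult_tpev[OF ch keys_power_bound[OF T(3)]])
    ultimately have "cltr (max (max (real n * T + T) (real n * T + T)) (T + real n * T)) (\<lambda>z. ((?v z ^ n - tpev p z ^ n) * tpev p z + (?v z ^ n - tpev p z ^ n) * lft h z) + lft h z * tpev (p ^ n) z)"
      by (intro cltr_add)
    then show ?case by (simp add: algebra_simps)
  qed
  define A where "A = (LINT z|lborel. cmod (lft h z))"
  have A0: "0 \<le> A" by (simp add: A_def)
  have lt: "ltr (real n * T * (real n * A * \<rho> ^ (n - 1)) / pi) (\<lambda>z. ?v z ^ n - tpev p z ^ n)" for n
  proof (rule cltr_imp_ltr[OF cl])
    have bd: "cmod (?v z ^ n - tpev p z ^ n) \<le> real n * \<rho> ^ (n - 1) * cmod (lft h z)" for z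
      using norm_power_diff_le[OF M[of z] P[of z], of n] by (simp add: mult_ac)
    have "continuous_on UNIV (lft h)"
      using isCont_ft[OF hi, of "\<lambda>x. x"] by (simp add: continuous_at_imp_continuous_on)
    moreover have "continuous_on UNIV (tpev p)"
      using isCont_dtr[OF dtr_tpev] by (simp add: continuous_at_imp_continuous_on)
    ultimately have [measurable]: "lft h \<in> borel_measurable borel" "tpev p \<in> borel_measurable borel"
      by (auto intro: borel_measurable_continuous_onI)
    show "integrable lborel (\<lambda>z. ?v z ^ n - tpev p z ^ n)"
      by (rule Bochner_Integration.integrable_bound[OF integrable_mult_right[OF integrable_norm[OF hfi], of "real n * \<rho> ^ (n - 1)"]])
         (use bd \<rho> in \<open>auto intro!: AE_I2\<close>)
    then have "(LINT z|lborel. cmod (?v z ^ n - tpev p z ^ n)) \<le> (LINT z|lborel. real n * \<rho> ^ (n - 1) * cmod (lft h z))"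
      using hfi bd by (intro integral_mono) auto
    then show "(LINT z|lborel. cmod (?v z ^ n - tpev p z ^ n)) \<le> real n * A * \<rho> ^ (n - 1)"
      by (simp add: A_def mult_ac)
  qed (use T in simp)
  \<comment> \<open>The summand 2 absorbs the factor n^2 of the density part.\<close>
  define K where "K = card (keys p) + 2"
  define D where "D = 1 + T * A / (pi * \<rho>)"
  have D0: "0 \<le> T * A / (pi * \<rho>)" using T A0 \<rho> by simp
  \<comment> \<open>The gap between \<rho> and \<sigma> absorbs the polynomial factor.\<close>
  obtain C where C: "\<And>n. real (n + 1) ^ K * (\<rho> / \<sigma>) ^ n \<le> C"
    using poly_times_power_bounded[of "\<rho> / \<sigma>" K] \<rho> by auto
  have C1: "1 \<le> C" using C[of 0] by simp
  have "wtr (C * D * \<sigma> ^ n) (\<lambda>z. ?v z ^ n)" for n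
  proof -
    have "tpev (p ^ n) = (\<lambda>z. tpev p z ^ n)" by (simp add: fun_eq_iff)
    then have "dtr (tpn (p ^ n)) (\<lambda>z. tpev p z ^ n)" using dtr_tpev[of "p ^ n"] by simp
    from wtr_sum2[OF this lt[of n]]
    have "wtr (tpn (p ^ n) + real n * T * (real n * A * \<rho> ^ (n - 1)) / pi) (\<lambda>z. ?v z ^ n)"
      by simp
    moreover have "tpn (p ^ n) + real n * T * (real n * A * \<rho> ^ (n - 1)) / pi \<le> C * D * \<sigma> ^ n"
    proof -
      have 1: "tpn (p ^ n) \<le> real (n + 1) ^ K * \<rho> ^ n"
        using \<rho> by (intro order_trans[OF tpn_power_le[of p \<rho> n, OF P]] mult_right_mono power_increasing) (auto simp: K_def)
      have 2: "real n * T * (real n * A * \<rho> ^ (n - 1)) / pi \<le> real (n + 1) ^ K * \<rho> ^ n * (T * A / (pi * \<rho>))"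
      proof (cases n)
        case (Suc m)
        have "real n * real n \<le> real (n + 1) ^ 2" unfolding power2_eq_square by (intro mult_mono) auto
        also have "\<dots> \<le> real (n + 1) ^ K" by (rule power_increasing) (auto simp: K_def)
        finally have "real n * real n * (\<rho> ^ n * (T * A / (pi * \<rho>))) \<le> real (n + 1) ^ K * (\<rho> ^ n * (T * A / (pi * \<rho>)))"
          using \<rho> by (intro mult_right_mono mult_nonneg_nonneg D0) auto
        then show ?thesis using \<rho> by (simp add: Suc field_simps)
      qed (use D0 in auto)
      have "tpn (p ^ n) + real n * T * (real n * A * \<rho> ^ (n - 1)) / pi \<le> real (n + 1) ^ K * \<rho> ^ n * D"
        using 1 2 by (simp add: D_def distrib_left)
      also have "\<dots> = real (n + 1) ^ K * (\<rho> / \<sigma>) ^ n * (D * \<sigma> ^ n)"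
        using \<rho> by (simp add: power_divide)
      also have "\<dots> \<le> C * (D * \<sigma> ^ n)" using C[of n] D0 \<rho> by (intro mult_right_mono) (auto simp: D_def)
      finally show ?thesis by (simp add: mult.assoc)
    qed
    ultimately show ?thesis by (rule wtr_mono)
  qed
  then show ?thesis using C1 D0 by (intro exI[of _ "C * D"]) (auto simp: D_def)
qed

text \<open>The spectral radius of an element of the algebra is its supremum norm.\<close>

theorem wtr_power_bound:
  assumes u: "wtr B u" and \<rho>: "\<And>z. cmod (u z) \<le> \<rho>" and \<sigma>: "\<rho> < \<sigma>"
  shows "\<exists>C\<ge>0. \<forall>n. wtr (C * \<sigma> ^ n) (\<lambda>z. u z ^ n)"
proof -
  obtain A C v w where vw: "dtr A v" "ltr C w" "u = (\<lambda>z. v z + w z)"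
    using u by (rule wtrE) blast
  \<comment> \<open>Approximation costs e in the supremum, the power bound for the approximant
    another e, and the remainder of norm e enters through the binomial formula: \<rho> + 3 e <
    \<sigma>.\<close>
  define e where "e = (\<sigma> - \<rho>) / 4"
  have e: "0 < e" using \<sigma> by (simp add: e_def)
  have \<rho>0: "0 \<le> \<rho>" using \<rho>[of 0] norm_ge_zero[of "u 0"] by linarith
  obtain p where p: "dtr (e / 2) (\<lambda>z. v z - tpev p z)" using dtr_approx[OF vw(1), of "e / 2"] e by auto
  obtain h where h: "nice h" "ltr (e / 2) (\<lambda>z. w z - lft h z)" using ltr_approx[OF vw(2), of "e / 2"] e by auto
  let ?v = "\<lambda>z. tpev p z + lft h z"
  let ?d = "\<lambda>z. (v z - tpev p z) + (w z - lft h z)"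
  have d: "wtr e ?d" using wtr_sum2[OF p h(2)] by simp
  have ud: "u z = ?v z + ?d z" for z by (simp add: vw(3))
  have vb: "cmod (?v z) \<le> \<rho> + e" for z
    using norm_triangle_ineq4[of "u z" "?d z"] \<rho>[of z] norm_wtr_le[OF d, of z] by (simp add: ud)
  obtain C where C: "0 \<le> C" "\<And>n. wtr (C * (\<rho> + 2 * e) ^ n) (\<lambda>z. ?v z ^ n)"
    using wtr_power_bound_nice[OF h(1) vb, of "\<rho> + 2 * e"] e \<rho>0 by auto
  have "wtr (C * \<sigma> ^ n) (\<lambda>z. u z ^ n)" for n
  proof -
    have "wtr (\<Sum>k\<le>n. cmod (of_nat (n choose k)) * (C * (\<rho> + 2 * e) ^ k * e ^ (n - k))) (\<lambda>z. \<Sum>k\<le>n. of_nat (n choose k) * (?v z ^ k * ?d z ^ (n - k)))"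
      by (intro wtr_sum wtr_cmult wtr_mult C wtr_power d) simp
    moreover have "(\<Sum>k\<le>n. of_nat (n choose k) * (?v z ^ k * ?d z ^ (n - k))) = u z ^ n" for z
      unfolding ud binomial_ring by (simp add: mult.assoc)
    moreover have "(\<Sum>k\<le>n. cmod (of_nat (n choose k)) * (C * (\<rho> + 2 * e) ^ k * e ^ (n - k))) = C * ((\<rho> + 2 * e) + e) ^ n"
      by (subst binomial_ring[of "\<rho> + 2 * e" e]) (simp add: sum_distrib_left mult_ac)
    moreover have "C * ((\<rho> + 2 * e) + e) ^ n \<le> C * \<sigma> ^ n"
      using C(1) e \<rho>0 by (intro mult_left_mono power_mono) (auto simp: e_def field_simps)
    ultimately show ?thesis by (simp add: wtr_mono)
  qed
  then show ?thesis using C(1) by blast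
qed

section \<open>Power series in the algebra: logarithms near 1 and inverses\<close>

text \<open>The logarithmic series in u - 1 converges in total variation although the total
  variation of u - 1 may exceed 1: its powers decay like \<sigma>^n by the spectral radius
  bound.\<close>

theorem wtr_Ln:
  assumes u: "wtr B u" and \<rho>: "\<And>z. cmod (u z - 1) \<le> \<rho>" "\<rho> < 1"
  obtains A w where "wtr A w" "\<And>z. u z = exp (w z)"
proof -
  define \<sigma> where "\<sigma> = (\<rho> + 1) / 2"
  have \<rho>0: "0 \<le> \<rho>" using \<rho>(1)[of 0] norm_ge_zero[of "u 0 - 1"] by linarith
  have \<sigma>: "\<rho> < \<sigma>" "\<sigma> < 1" "0 < \<sigma>" using \<rho>(2) \<rho>0 by (auto simp: \<sigma>_def)
  have "wtr (B + cmod (-1)) (\<lambda>z. u z + (-1))" by (intro wtr_add u wtr_const)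
  then obtain C where C: "0 \<le> C" "\<And>n. wtr (C * \<sigma> ^ n) (\<lambda>z. (u z - 1) ^ n)"
    using wtr_power_bound[of "B + 1" "\<lambda>z. u z - 1" \<rho> \<sigma>] \<rho> \<sigma> by auto
  \<comment> \<open>The coefficient at n = 0 is a division by zero, hence 0, as the logarithmic
    series requires.\<close>
  let ?c = "\<lambda>n. (-1) ^ Suc n / of_nat n :: complex"
  have "wtr (\<Sum>n. C * \<sigma> ^ n) (\<lambda>z. \<Sum>n. ?c n * (u z - 1) ^ n)"
  proof (rule wtr_suminf)
    fix n
    have "cmod (?c n) \<le> 1" by (cases n) (auto simp: norm_divide norm_power divide_le_eq_1 simp del: of_nat_Suc)
    then have "cmod (?c n) * (C * \<sigma> ^ n) \<le> 1 * (C * \<sigma> ^ n)"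
      using C(1) \<sigma> by (intro mult_right_mono) auto
    then show "wtr (C * \<sigma> ^ n) (\<lambda>z. ?c n * (u z - 1) ^ n)"
      using wtr_cmult[OF C(2)[of n], of "?c n"] by (auto intro: wtr_mono)
    show "summable (\<lambda>n. C * \<sigma> ^ n)" using \<sigma> by (intro summable_mult summable_geometric) auto
  qed
  moreover have "u z = exp (\<Sum>n. ?c n * (u z - 1) ^ n)" for z
  proof -
    have lt: "cmod (u z - 1) < 1" using \<rho>(1)[of z] \<rho>(2) by linarith
    have "(\<lambda>n. ?c n * (u z - 1) ^ n) sums ln (1 + (u z - 1))"
      using Ln_series[OF lt] by simp
    moreover have "u z \<noteq> 0" using lt by auto
    ultimately show ?thesis by (simp add: sums_iff exp_Ln)
  qed
  ultimately show ?thesis by (rule that)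
qed

text \<open>The algebra is closed under conjugation, so it contains |u|^2. As |u|^2 lies between
  \<delta>^2 and M, the function 1 - |u|^2 / M has supremum below 1, and its geometric series
  inverts |u|^2; the factor cnj u then gives 1 / u.\<close>

theorem wtr_inverse:
  assumes u: "wtr B u" and \<delta>: "0 < \<delta>" "\<And>z. \<delta> \<le> cmod (u z)"
  obtains A where "wtr A (\<lambda>z. inverse (u z))"
proof -
  have B: "\<delta> \<le> B" using \<delta>(2)[of 0] norm_wtr_le[OF u, of 0] by linarith
  \<comment> \<open>The total variation bound B also bounds |u|, so |u|^2 / M never exceeds
    1.\<close>
  define M where "M = B\<^sup>2"
  have M: "0 < M" using B \<delta> by (simp add: M_def)
  let ?v = "\<lambda>z. 1 + of_real (- 1 / M) * (u z * cnj (u z))"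
  have v: "wtr (cmod 1 + cmod (of_real (- 1 / M)) * (B * B)) ?v"
    by (intro wtr_add wtr_const wtr_cmult wtr_mult wtr_cnj u)
  have veq: "?v z = of_real (1 - (cmod (u z))\<^sup>2 / M)" for z
    by (simp add: complex_norm_square[symmetric])
  define \<rho> where "\<rho> = 1 - \<delta>\<^sup>2 / M"
  have \<rho>0: "0 \<le> \<rho>" using B \<delta>(1) M by (simp add: \<rho>_def M_def power_mono)
  have \<rho>: "cmod (?v z) \<le> \<rho>" for z
  proof -
    have "\<delta>\<^sup>2 \<le> (cmod (u z))\<^sup>2" "(cmod (u z))\<^sup>2 \<le> M"
      using \<delta> norm_wtr_le[OF u, of z] by (auto simp: M_def intro: power_mono)
    then have "0 \<le> 1 - (cmod (u z))\<^sup>2 / M" "1 - (cmod (u z))\<^sup>2 / M \<le> \<rho>"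
      using M by (auto simp: \<rho>_def divide_right_mono)
    then show ?thesis unfolding veq norm_of_real by simp
  qed
  define \<sigma> where "\<sigma> = (\<rho> + 1) / 2"
  have \<rho>1: "\<rho> < 1" using \<delta> M by (simp add: \<rho>_def)
  have \<sigma>: "\<rho> < \<sigma>" "\<sigma> < 1" "0 < \<sigma>" using \<rho>0 \<rho>1 by (auto simp: \<sigma>_def)
  obtain C where C: "0 \<le> C" "\<And>n. wtr (C * \<sigma> ^ n) (\<lambda>z. ?v z ^ n)"
    using wtr_power_bound[OF v \<rho> \<sigma>(1)] by auto
  have "wtr (\<Sum>n. C * \<sigma> ^ n) (\<lambda>z. \<Sum>n. ?v z ^ n)"
    using \<sigma> by (intro wtr_suminf C summable_mult summable_geometric) auto
  then have "wtr (cmod (of_real (1 / M)) * B * (\<Sum>n. C * \<sigma> ^ n)) (\<lambda>z. of_real (1 / M) * cnj (u z) * (\<Sum>n. ?v z ^ n))"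
    by (intro wtr_mult wtr_const wtr_cnj u)
  moreover have "of_real (1 / M) * cnj (u z) * (\<Sum>n. ?v z ^ n) = inverse (u z)" for z
  proof -
    have "cmod (?v z) < 1" using \<rho>[of z] \<rho>1 by linarith
    then have "(\<Sum>n. ?v z ^ n) = 1 / (1 - ?v z)" by (intro suminf_geometric)
    moreover have "u z \<noteq> 0" using \<delta>(1) \<delta>(2)[of z] by auto
    ultimately show ?thesis using M by (simp add: field_simps)
  qed
  ultimately show ?thesis by (intro that) simp
qed

text \<open>The quotient u / v lies within \<eta> / \<delta> < 1 of the constant 1, so the
  logarithmic series applies to it.\<close>

lemma wtr_exp_quotient:
  assumes u: "wtr B u" and v: "wtr A v" and \<delta>: "0 < \<delta>" "\<And>z. \<delta> \<le> cmod (v z)"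
    and close: "\<And>z. cmod (u z - v z) \<le> \<eta>" "\<eta> < \<delta>"
  obtains C w where "wtr C w" "\<And>z. u z = v z * exp (w z)"
proof -
  obtain D where D: "wtr D (\<lambda>z. inverse (v z))" using wtr_inverse[OF v \<delta>] by blast
  have "cmod (u z * inverse (v z) - 1) \<le> \<eta> / \<delta>" for z
  proof -
    have vz: "v z \<noteq> 0" using \<delta>(1) \<delta>(2)[of z] by auto
    have "cmod (u z * inverse (v z) - 1) = cmod (u z - v z) / cmod (v z)"
      using vz by (simp add: field_simps flip: norm_divide)
    also have "\<dots> \<le> \<eta> / \<delta>"
      using close(1)[of z] \<delta> by (intro frac_le order_trans[OF norm_ge_zero close(1)]) auto
    finally show ?thesis .
  qed
  then obtain C w where w: "wtr C w" "\<And>z. u z * inverse (v z) = exp (w z)"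
    using wtr_Ln[OF wtr_mult[OF u D], of "\<eta> / \<delta>"] close(2) \<delta>(1) by (metis less_divide_eq_1_pos divide_less_eq_1_pos)
  have "u z = v z * exp (w z)" for z
  proof -
    have "v z \<noteq> 0" using \<delta>(1) \<delta>(2)[of z] by auto
    then show ?thesis using w(2)[of z, symmetric] by simp
  qed
  then show ?thesis using w(1) that by blast
qed

section \<open>The logarithm of a trigonometric polynomial\<close>

lemma integrable_count_space_finite_support:
  fixes f :: "'a \<Rightarrow> 'b::{banach,second_countable_topology}"
  assumes "finite A" "\<And>x. x \<notin> A \<Longrightarrow> f x = 0"
  shows "integrable (count_space S) f"
proof -
  have "integrable (count_space S) (\<lambda>x. indicator (S \<inter> A) x *\<^sub>R f x)"
    using integrable_restrict_space[of "S \<inter> A" "count_space S" f] integrable_count_space[of "S \<inter> A" f] assms(1)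
    by (simp add: restrict_count_space_subset)
  also have "?this \<longleftrightarrow> integrable (count_space S) f"
    by (intro Bochner_Integration.integrable_cong) (auto simp: indicator_def assms(2))
  finally show ?thesis .
qed

lemma integral_count_space_finite_support:
  fixes f :: "'a \<Rightarrow> 'b::{banach,second_countable_topology}"
  assumes "finite A" "A \<subseteq> S" "\<And>x. x \<notin> A \<Longrightarrow> f x = 0"
  shows "integral\<^sup>L (count_space S) f = (\<Sum>x\<in>A. f x)"
proof -
  have "integral\<^sup>L (count_space S) f = (\<Sum>x | x \<in> S \<and> f x \<noteq> 0. f x)"
    using assms by (intro lebesgue_integral_count_space_finite_support) (auto intro: finite_subset)
  also have "\<dots> = (\<Sum>x\<in>A. f x)"
    using assms by (intro sum.mono_neutral_left) auto
  finally show ?thesis .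
qed

text \<open>Coefficients are collected frequency by frequency, so that \<alpha> y belongs to a
  definite frequency y and can be divided by y afterwards.\<close>

lemma trigpoly_series:
  fixes f :: "nat \<Rightarrow> trigpoly"
  assumes s: "summable (\<lambda>n. tpn (f n))" and S: "countable S" "\<And>n. keys (f n) \<subseteq> S"
  defines "\<alpha> \<equiv> \<lambda>y. suminf (\<lambda>n. lookup (f n) y)"
  shows "summable (\<lambda>n. lookup (f n) y)" "integrable (count_space S) \<alpha>"
    "ft (count_space S) (\<lambda>y. y) \<alpha> z = suminf (\<lambda>n. tpev (f n) z)"
proof -
  have lk: "cmod (lookup (f n) y) \<le> tpn (f n)" for n y
    by (rule norm_lookup_le) (rule norm_tpev_le)
  show sl: "summable (\<lambda>n. lookup (f n) y)" for y
    by (rule summable_comparison_test'[OF s, of 0]) (use lk in auto)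
  have slc: "integrable (count_space UNIV) (\<lambda>n. lookup (f n) y)" for y
    unfolding integrable_count_space_nat_iff
    by (rule summable_comparison_test'[OF s, of 0]) (use lk in auto)
  interpret P: pair_sigma_finite "count_space (UNIV::nat set)" "count_space S"
    using S(1) by (auto simp: pair_sigma_finite_def intro!: sigma_finite_measure_count_space_countable)
  have pm: "count_space (UNIV::nat set) \<Otimes>\<^sub>M count_space S = count_space (UNIV \<times> S)"
    by (rule pair_measure_countable) (use S in auto)
  have i1: "integrable (count_space S) (lookup (f n))" for n
    by (rule integrable_count_space_finite_support[of "keys (f n)"]) (auto simp: in_keys_iff)
  have n1: "(LINT y|count_space S. cmod (lookup (f n) y)) = tpn (f n)" for n
    unfolding tpn_def by (rule integral_count_space_finite_support) (use S in \<open>auto simp: in_keys_iff\<close>)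
  have int: "integrable (count_space (UNIV \<times> S)) (\<lambda>(n, y). lookup (f n) y)"
    using P.Fubini_integrable[of "\<lambda>(n, y). lookup (f n) y"] i1 s
    unfolding pm by (simp add: n1 integrable_count_space_nat_iff tpn_nonneg)
  have a: "(LINT n|count_space UNIV. lookup (f n) y) = \<alpha> y" for y
    unfolding \<alpha>_def by (rule integral_count_space_nat[OF slc])
  show "integrable (count_space S) \<alpha>"
    using P.integrable_snd[of "\<lambda>n y. lookup (f n) y"] int unfolding pm by (simp add: a)
  have intz: "integrable (count_space (UNIV \<times> S)) (\<lambda>(n, y). lookup (f n) y * iexp (z * y))"
    using integrable_times_iexp[OF int, of snd z] by (simp add: case_prod_beta')
  have "(LINT y|count_space S. LINT n|count_space UNIV. lookup (f n) y * iexp (z * y)) =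
      (LINT n|count_space UNIV. LINT y|count_space S. lookup (f n) y * iexp (z * y))"
    using P.Fubini_integral[of "\<lambda>n y. lookup (f n) y * iexp (z * y)"] intz unfolding pm by simp
  also have "\<dots> = (LINT n|count_space UNIV. tpev (f n) z)"
  proof (intro Bochner_Integration.integral_cong refl)
    fix n
    show "(LINT y|count_space S. lookup (f n) y * iexp (z * y)) = tpev (f n) z"
      unfolding tpev_def by (rule integral_count_space_finite_support) (use S in \<open>auto simp: in_keys_iff\<close>)
  qed
  also have "(LINT n|count_space UNIV. tpev (f n) z) = suminf (\<lambda>n. tpev (f n) z)"
  proof (rule integral_count_space_nat, unfold integrable_count_space_nat_iff)
    show "summable (\<lambda>n. cmod (tpev (f n) z))"
      by (rule summable_comparison_test'[OF s, of 0]) (use norm_tpev_le in auto)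
  qed
  finally show "ft (count_space S) (\<lambda>y. y) \<alpha> z = suminf (\<lambda>n. tpev (f n) z)"
    unfolding ft_def by (simp add: a)
qed

text \<open>Every additive \<open>\<phi>\<close> makes \<open>tpd \<phi>\<close> a derivation; the derivative in \<open>z\<close> is \<open>\<i> * tpd id\<close>.\<close>

definition tpd :: "(real \<Rightarrow> real) \<Rightarrow> trigpoly \<Rightarrow> trigpoly" where
  "tpd \<phi> p = Poly_Mapping.mapp (\<lambda>y c. of_real (\<phi> y) * c) p"

lemma lookup_tpd [simp]: "lookup (tpd \<phi> p) y = of_real (\<phi> y) * lookup p y"
  unfolding tpd_def lookup_mapp by (auto simp: when_def in_keys_iff)

lemma keys_tpd: "keys (tpd \<phi> p) \<subseteq> keys p"
  by (auto simp: in_keys_iff)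

lemma tpd_add [simp]: "tpd \<phi> (p + q) = tpd \<phi> p + tpd \<phi> q"
  by (rule poly_mapping_eqI) (simp add: lookup_add distrib_left)

lemma tpd_zero [simp]: "tpd \<phi> 0 = 0"
  by (rule poly_mapping_eqI) simp

lemma tpd_sum: "tpd \<phi> (\<Sum>s\<in>S. f s) = (\<Sum>s\<in>S. tpd \<phi> (f s))"
  by (induction S rule: infinite_finite_induct) auto

lemma tpd_single: "tpd \<phi> (Poly_Mapping.single y c) = Poly_Mapping.single y (of_real (\<phi> y) * c)"
  by (rule poly_mapping_eqI) (auto simp: lookup_single when_def)

text \<open>Additivity of \<phi> is the Leibniz rule on single exponentials.\<close>

lemma tpd_mult:
  assumes \<phi>: "\<And>x y. \<phi> (x + y) = \<phi> x + \<phi> y"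
  shows "tpd \<phi> (p * q) = tpd \<phi> p * q + p * tpd \<phi> q"
proof -
  have ex: "p * q = (\<Sum>x\<in>keys p. \<Sum>y\<in>keys q. Poly_Mapping.single (x + y) (lookup p x * lookup q y))" for p q :: trigpoly
    by (subst poly_mapping_eq_sum_single[of p], subst poly_mapping_eq_sum_single[of q])
       (simp add: sum_product mult_single)
  have pd: "tpd \<phi> p = (\<Sum>x\<in>keys p. Poly_Mapping.single x (of_real (\<phi> x) * lookup p x))" for p
    by (subst poly_mapping_eq_sum_single[of p]) (simp add: tpd_sum tpd_single)
  have "tpd \<phi> p * q + p * tpd \<phi> q =
     (\<Sum>x\<in>keys p. Poly_Mapping.single x (of_real (\<phi> x) * lookup p x)) * (\<Sum>y\<in>keys q. Poly_Mapping.single y (lookup q y))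
   + (\<Sum>x\<in>keys p. Poly_Mapping.single x (lookup p x)) * (\<Sum>y\<in>keys q. Poly_Mapping.single y (of_real (\<phi> y) * lookup q y))"
    by (simp only: pd poly_mapping_eq_sum_single[symmetric])
  also have "\<dots> = tpd \<phi> (p * q)"
    unfolding ex[of p q] tpd_sum tpd_single \<phi>
    by (simp only: sum_product mult_single sum.distrib[symmetric] single_add[symmetric])
       (intro sum.cong refl arg_cong[of _ _ "Poly_Mapping.single _"], simp add: algebra_simps)
  finally show ?thesis by simp
qed

lemma tpd_commute: "tpd \<phi> (tpd \<psi> p) = tpd \<psi> (tpd \<phi> p)"
  by (rule poly_mapping_eqI) simp

lemma tpd_one [simp]: "\<phi> 0 = 0 \<Longrightarrow> tpd \<phi> 1 = 0"
  using tpd_single[of \<phi> 0 1] by simp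

lemma tpd_uminus [simp]: "tpd \<phi> (- p) = - tpd \<phi> p"
  by (rule poly_mapping_eqI) simp

lemma tpd_diff [simp]: "tpd \<phi> (p - q) = tpd \<phi> p - tpd \<phi> q"
  using tpd_add[of \<phi> p "- q"] by simp

lemma tpd_power:
  assumes "\<And>x y. \<phi> (x + y) = \<phi> x + \<phi> y"
  shows "tpd \<phi> (p ^ Suc n) = of_nat (Suc n) * p ^ n * tpd \<phi> p"
proof (induction n)
  case 0
  show ?case by simp
next
  case (Suc n)
  have "tpd \<phi> (p ^ Suc (Suc n)) = tpd \<phi> p * p ^ Suc n + p * tpd \<phi> (p ^ Suc n)"
    using tpd_mult[of \<phi> p "p ^ Suc n"] assms by simp
  also have "\<dots> = of_nat (Suc (Suc n)) * p ^ Suc n * tpd \<phi> p"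
    unfolding Suc by (simp add: algebra_simps)
  finally show ?case .
qed

lemma tpev_of_nat [simp]: "tpev (of_nat n) z = of_nat n"
  by (induction n) auto

definition tpcnj :: "trigpoly \<Rightarrow> trigpoly" where
  "tpcnj p = (\<Sum>y\<in>keys p. Poly_Mapping.single (- y) (cnj (lookup p y)))"

lemma tpev_tpcnj [simp]: "tpev (tpcnj p) z = cnj (tpev p z)"
  unfolding tpcnj_def by (simp add: tpev_def[of p] exp_cnj)

lemma keys_tpcnj: "keys (tpcnj p) \<subseteq> uminus ` keys p"
proof -
  have "keys (\<Sum>y\<in>A. Poly_Mapping.single (- y) (cnj (lookup p y))) \<subseteq> uminus ` A" if "finite A" for A
    using that
  proof (induction A rule: finite_induct)
    case (insert x F)
    let ?s = "Poly_Mapping.single (- x) (cnj (lookup p x))" and ?r = "\<Sum>y\<in>F. Poly_Mapping.single (- y) (cnj (lookup p y))"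
    have "keys (?s + ?r) \<subseteq> keys ?s \<union> keys ?r" by (rule keys_add)
    also have "\<dots> \<subseteq> uminus ` insert x F"
    proof (rule Un_least)
      show "keys ?s \<subseteq> uminus ` insert x F" by (simp split: if_splits)
      show "keys ?r \<subseteq> uminus ` insert x F" by (rule subset_trans[OF insert.IH]) blast
    qed
    finally show ?case using insert.hyps by simp
  qed simp
  then show ?thesis unfolding tpcnj_def by simp
qed

lemma has_vector_derivative_tpev:
  "(tpev p has_vector_derivative \<i> * tpev (tpd (\<lambda>y. y) p) z) (at z)"
proof -
  have 1: "((\<lambda>z. c * iexp (z * y)) has_vector_derivative \<i> * (of_real y * c * iexp (z * y))) (at z)" for c y
    by (auto intro!: derivative_eq_intros has_vector_derivative_real_field simp: mult_ac)
  have *: "((\<lambda>z. \<Sum>y\<in>keys p. lookup p y * iexp (z * y)) has_vector_derivative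
     (\<Sum>y\<in>keys p. \<i> * (of_real y * lookup p y * iexp (z * y)))) (at z)"
    by (intro has_vector_derivative_sum 1)
  have e: "tpev (tpd (\<lambda>y. y) p) z = (\<Sum>y\<in>keys p. of_real y * lookup p y * iexp (z * y))"
    by (subst tpev_superset[OF _ keys_tpd]) (auto simp: mult_ac)
  have f: "tpev p = (\<lambda>z. \<Sum>y\<in>keys p. lookup p y * iexp (z * y))"
    by (rule ext) (rule tpev_def)
  show ?thesis unfolding e unfolding f sum_distrib_left by (rule *)
qed

lemma vector_space_rat_real: "vector_space (\<lambda>(q::rat) (x::real). of_rat q * x)"
proof
  fix a b :: rat and x y :: real
  show "of_rat a * (x + y) = of_rat a * x + of_rat a * y" by (rule distrib_left)
  show "of_rat (a + b) * x = of_rat a * x + of_rat b * x" by (simp add: of_rat_add distrib_right)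
  show "of_rat a * (of_rat b * x) = of_rat (a * b) * x" by (simp add: of_rat_mult)
  show "of_rat 1 * x = x" by simp
qed

text \<open>On a finitely generated group of real numbers the coordinates with respect to a basis of the
  reals over the rationals take values in a discrete group.\<close>

lemma finitely_generated_coordinates:
  fixes S :: "real set"
  assumes S: "finite S"
  obtains \<Phi> :: "(real \<Rightarrow> real) set" and \<kappa> where "finite \<Phi>" "0 < \<kappa>"
    "\<And>\<phi> x y. \<phi> \<in> \<Phi> \<Longrightarrow> \<phi> (x + y) = \<phi> x + \<phi> y"
    "\<And>k :: real \<Rightarrow> int. (\<Sum>s\<in>S. of_int (k s) * s) \<noteq> 0 \<Longrightarrow> \<exists>\<phi>\<in>\<Phi>. \<kappa> \<le> \<bar>\<phi> (\<Sum>s\<in>S. of_int (k s) * s)\<bar>"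
proof -
  interpret rat_real: vector_space "\<lambda>(q::rat) (x::real). of_rat q * x"
    by (rule vector_space_rat_real)
  obtain B where B: "rat_real.independent B" "UNIV \<subseteq> rat_real.span B"
    by (rule rat_real.maximal_independent_subset[of UNIV])
  then have sp: "x \<in> rat_real.span B" for x by auto
  let ?r = "rat_real.representation B"
  \<comment> \<open>Only finitely many basis elements occur in the generators.\<close>
  let ?B = "\<Union>s\<in>S. {b. ?r s b \<noteq> 0}"
  have fB: "finite ?B" using S by (auto intro: rat_real.finite_representation)
  define den where "den = (\<lambda>q::rat. snd (quotient_of q))"
  have den: "0 < den q" "\<exists>k::int. of_int (den q) * q = of_int k" for q
  proof -
    obtain a b where ab: "quotient_of q = (a, b)" by force
    have "q = of_int a / of_int b" "0 < b"
      using quotient_of_div[OF ab] quotient_of_denom_pos[OF ab] by auto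
    then show "0 < den q" "\<exists>k::int. of_int (den q) * q = of_int k"
      using ab by (auto simp: den_def)
  qed
  \<comment> \<open>A common denominator of all coordinates of the generators. D times a coordinate
    of a group element is an integer, so a nonzero coordinate has modulus at least 1 / D.\<close>
  define D where "D = (\<Prod>s\<in>S. \<Prod>b\<in>?B. den (?r s b))"
  have D: "0 < D" unfolding D_def by (intro prod_pos ballI den)
  have Dint: "\<exists>k::int. of_int D * ?r s b = of_int k" if "s \<in> S" for s b
  proof (cases "?r s b = 0")
    case False
    then have b: "b \<in> ?B" using that by auto
    obtain k :: int where k: "of_int (den (?r s b)) * ?r s b = of_int k" using den(2) by blast
    have "den (?r s b) dvd (\<Prod>b\<in>?B. den (?r s b))" using fB b by (intro dvd_prodI)
    also have "\<dots> dvd D" unfolding D_def using S that by (intro dvd_prodI)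
    finally obtain m where "D = den (?r s b) * m" by (elim dvdE)
    then have "of_int D * ?r s b = of_int (m * k)" using k by (simp add: mult_ac)
    then show ?thesis by blast
  qed (auto intro: exI[of _ 0])
  define \<Phi> where "\<Phi> = (\<lambda>b x. of_rat (?r x b) :: real) ` ?B"
  show ?thesis
  proof
    show "finite \<Phi>" unfolding \<Phi>_def using fB by simp
    show "0 < 1 / real_of_int D" using D by simp
    show "\<phi> (x + y) = \<phi> x + \<phi> y" if "\<phi> \<in> \<Phi>" for \<phi> x y
      using that rat_real.representation_add[OF B(1) sp sp, of x y] by (auto simp: \<Phi>_def of_rat_add)
    fix k :: "real \<Rightarrow> int"
    let ?y = "\<Sum>s\<in>S. of_int (k s) * s"
    assume y0: "?y \<noteq> 0"
    have ry: "?r ?y b = (\<Sum>s\<in>S. of_int (k s) * ?r s b)" for b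
    proof -
      have "?y = (\<Sum>s\<in>S. of_rat (of_int (k s)) * s)" by simp
      then show ?thesis
        using rat_real.representation_sum[OF B(1), of S "\<lambda>s. of_rat (of_int (k s)) * s"] sp
        by (simp add: rat_real.representation_scale[OF B(1) sp] del: of_rat_of_int_eq)
    qed
    have "\<exists>b. ?r ?y b \<noteq> 0"
    proof (rule ccontr)
      assume "\<not> (\<exists>b. ?r ?y b \<noteq> 0)"
      then have "{b. ?r ?y b \<noteq> 0} = {}" by simp
      then have "?y = 0" using rat_real.sum_nonzero_representation_eq[OF B(1) sp, of ?y] by simp
      then show False using y0 by simp
    qed
    then obtain b where b: "?r ?y b \<noteq> 0" by blast
    have bB: "b \<in> ?B"
    proof (rule ccontr)
      assume "b \<notin> ?B"
      then have "?r s b = 0" if "s \<in> S" for s using that by auto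
      then have "?r ?y b = 0" unfolding ry by simp
      with b show False by simp
    qed
    have "\<forall>s\<in>S. \<exists>k::int. of_int D * ?r s b = of_int k" using Dint by simp
    from bchoice[OF this] obtain c :: "real \<Rightarrow> int" where "\<forall>s\<in>S. of_int D * ?r s b = of_int (c s)" ..
    then have c: "\<And>s. s \<in> S \<Longrightarrow> of_int D * ?r s b = of_int (c s)" by simp
    have "of_int D * ?r ?y b = (\<Sum>s\<in>S. of_int (k s) * (of_int D * ?r s b))"
      unfolding ry by (simp only: sum_distrib_left mult.left_commute[of "rat_of_int D"])
    also have "\<dots> = of_int (\<Sum>s\<in>S. k s * c s)" by (simp add: c)
    finally have e: "of_int D * ?r ?y b = of_int (\<Sum>s\<in>S. k s * c s)" .
    then have "(\<Sum>s\<in>S. k s * c s) \<noteq> 0" using b D by (metis mult_eq_0_iff of_int_0 of_int_eq_0_iff less_irrefl)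
    then have "1 \<le> \<bar>\<Sum>s\<in>S. k s * c s\<bar>" by linarith
    then have "1 \<le> \<bar>real_of_int (\<Sum>s\<in>S. k s * c s)\<bar>" by (metis of_int_abs of_int_le_iff of_int_1)
    also have "real_of_int (\<Sum>s\<in>S. k s * c s) = of_rat (of_int D * ?r ?y b)" unfolding e by (rule of_rat_of_int_eq[symmetric])
    also have "\<dots> = real_of_int D * of_rat (?r ?y b)" by (simp add: of_rat_mult)
    finally have "1 / real_of_int D \<le> \<bar>of_rat (?r ?y b)\<bar>"
      using D by (simp add: abs_mult field_simps)
    moreover have "(\<lambda>x. of_rat (?r x b) :: real) \<in> \<Phi>"
      unfolding \<Phi>_def using bB by (rule imageI)
    ultimately show "\<exists>\<phi>\<in>\<Phi>. 1 / real_of_int D \<le> \<bar>\<phi> ?y\<bar>" by (rule bexI)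
  qed
qed

lemma has_vector_derivative_exp_complex:
  fixes f :: "real \<Rightarrow> complex"
  assumes "(f has_vector_derivative f') (at z)"
  shows "((\<lambda>z. exp (f z)) has_vector_derivative exp (f z) * f') (at z)"
  using field_vector_diff_chain_at[OF assms, of exp "exp (f z)"] by (simp add: comp_def mult.commute)

text \<open>The product of u with exp (- L) has derivative 0. This identifies u without any choice
  of a branch of the logarithm.\<close>

lemma log_derivative_unique:
  fixes u L :: "real \<Rightarrow> complex"
  assumes u: "\<And>z. (u has_vector_derivative u' z) (at z)" and L: "\<And>z. (L has_vector_derivative L' z) (at z)"
    and eq: "\<And>z. u' z = u z * L' z"
  obtains c where "\<And>z. u z = c * exp (L z)"
proof -
  have "((\<lambda>z. u z * exp (- L z)) has_vector_derivative 0) (at z)" for z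
  proof -
    have "((\<lambda>z. exp (- L z)) has_vector_derivative exp (- L z) * - L' z) (at z)"
      by (intro has_vector_derivative_exp_complex has_vector_derivative_minus L)
    from has_vector_derivative_mult[OF u[of z] this] show ?thesis
      by (rule has_vector_derivative_eq_rhs) (simp add: eq mult_ac)
  qed
  then obtain c where c: "\<And>z. u z * exp (- L z) = c"
    using has_vector_derivative_zero_constant[of UNIV "\<lambda>z. u z * exp (- L z)"] by auto
  have "u z = c * exp (L z)" for z
    using c[of z] by (simp add: exp_minus field_simps)
  then show ?thesis by (rule that)
qed

text \<open>Let \<open>\<alpha> \<phi>\<close> be the coefficients of the quotient of
  \<open>tpd \<phi> p\<close> by p; they are summable since 1 / p is q times a geometric series in
  v. The logarithm has the coefficients \<open>\<alpha> ?id y / y\<close>. Commuting derivations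
  give \<open>y * \<alpha> \<phi> y = \<phi> y * \<alpha> ?id y\<close>, so this is
  \<open>\<alpha> \<phi> y / \<phi> y\<close> whenever \<phi> y is nonzero. A coordinate with
  |\<phi> y| >= \<kappa> bounds it by |\<open>\<alpha> \<phi> y\<close>| / \<kappa>, and finitely
  many summable families suffice.\<close>

theorem trigpoly_log:
  assumes \<delta>: "0 < \<delta>" "\<And>z. \<delta> \<le> cmod (tpev p z)"
  obtains A w c \<gamma> where "wtr A w" "\<And>z. tpev p z = c * exp (\<i> * \<gamma> * of_real z + w z)"
proof -
  let ?id = "\<lambda>y::real. y"
  define M where "M = tpn p"
  have M: "0 < M" using \<delta>(1) \<delta>(2)[of 0] norm_tpev_le[of p 0] unfolding M_def by linarith
  \<comment> \<open>Pointwise p q = |p|^2 / M^2 = 1 - v with 0 <= v < 1, so 1 / p is q times the sum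
    of the powers of v.\<close>
  define q where "q = Poly_Mapping.single 0 (of_real (1 / M\<^sup>2)) * tpcnj p"
  define v where "v = 1 - p * q"
  have tv: "tpev v z = of_real (1 - (cmod (tpev p z))\<^sup>2 / M\<^sup>2)" for z
  proof -
    have "tpev v z = 1 - of_real (1 / M\<^sup>2) * (tpev p z * cnj (tpev p z))" by (simp add: v_def q_def)
    also have "\<dots> = of_real (1 - (cmod (tpev p z))\<^sup>2 / M\<^sup>2)"
      unfolding complex_norm_square[symmetric] by simp
    finally show ?thesis .
  qed
  \<comment> \<open>The midpoint between the supremum bound 1 - \<delta>^2 / M^2 of v and 1,
    positive even when \<delta> = M.\<close>
  define \<rho> where "\<rho> = (1 - \<delta>\<^sup>2 / M\<^sup>2 + 1) / 2"
  have \<delta>M: "\<delta> \<le> M" using \<delta>(2)[of 0] norm_tpev_le[of p 0] unfolding M_def by linarith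
  obtain t where t: "t = \<delta>\<^sup>2 / M\<^sup>2" by blast
  have "t \<le> 1" "0 < t" unfolding t using \<delta>(1) \<delta>M M by (auto simp: power_mono)
  then have \<rho>: "0 < \<rho>" "\<rho> < 1" "1 - \<delta>\<^sup>2 / M\<^sup>2 \<le> \<rho>"
    unfolding \<rho>_def t[symmetric] by auto
  have vb: "cmod (tpev v z) \<le> \<rho>" for z
  proof -
    have "\<delta>\<^sup>2 \<le> (cmod (tpev p z))\<^sup>2" "(cmod (tpev p z))\<^sup>2 \<le> M\<^sup>2"
      using \<delta> norm_tpev_le[of p z] by (auto simp: M_def intro: power_mono)
    then have "0 \<le> 1 - (cmod (tpev p z))\<^sup>2 / M\<^sup>2" "1 - (cmod (tpev p z))\<^sup>2 / M\<^sup>2 \<le> 1 - \<delta>\<^sup>2 / M\<^sup>2"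
      using M by (auto simp: divide_right_mono)
    then show ?thesis unfolding tv norm_of_real using \<rho>(3) by simp
  qed
  have pnz: "tpev p z \<noteq> 0" for z using \<delta>(1) \<delta>(2)[of z] by auto
  obtain \<Phi> :: "(real \<Rightarrow> real) set" and \<kappa> where \<Phi>: "finite \<Phi>" "0 < \<kappa>"
    "\<And>\<phi> x y. \<phi> \<in> \<Phi> \<Longrightarrow> \<phi> (x + y) = \<phi> x + \<phi> y"
    "\<And>k :: real \<Rightarrow> int. (\<Sum>s\<in>keys p. of_int (k s) * s) \<noteq> 0 \<Longrightarrow> \<exists>\<phi>\<in>\<Phi>. \<kappa> \<le> \<bar>\<phi> (\<Sum>s\<in>keys p. of_int (k s) * s)\<bar>"
    by (rule finitely_generated_coordinates[OF finite_keys[of p]]) blast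
  \<comment> \<open>The group generated by the frequencies of p. Conjugation only changes signs of
    frequencies, so q, v and all terms of the series stay in it.\<close>
  define G where "G = {y. \<exists>k :: real \<Rightarrow> int. y = (\<Sum>s\<in>keys p. of_int (k s) * s)}"
  have G0: "0 \<in> G" unfolding G_def by (auto intro!: exI[of _ "\<lambda>_. 0"])
  have Gadd: "x + y \<in> G" if "x \<in> G" "y \<in> G" for x y
  proof -
    obtain k l :: "real \<Rightarrow> int" where "x = (\<Sum>s\<in>keys p. of_int (k s) * s)" "y = (\<Sum>s\<in>keys p. of_int (l s) * s)"
      using \<open>x \<in> G\<close> \<open>y \<in> G\<close> unfolding G_def by blast
    then have "x + y = (\<Sum>s\<in>keys p. of_int (k s + l s) * s)" by (simp add: sum.distrib algebra_simps)
    then show ?thesis unfolding G_def by (intro CollectI exI)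
  qed
  have Gp: "x \<in> G" "- x \<in> G" if "x \<in> keys p" for x
  proof -
    have e: "x = (\<Sum>s\<in>keys p. of_int (if s = x then 1 else 0) * s)" "- x = (\<Sum>s\<in>keys p. of_int (if s = x then -1 else 0) * s)"
      using that by (simp_all add: if_distrib[of of_int] if_distrib[of "\<lambda>c. c * _"] sum.delta cong: if_cong)
    show "x \<in> G" unfolding G_def by (intro CollectI exI) (rule e(1))
    show "- x \<in> G" unfolding G_def by (intro CollectI exI) (rule e(2))
  qed
  have Gmult: "keys (a * b) \<subseteq> G" if "keys a \<subseteq> G" "keys b \<subseteq> G" for a b :: trigpoly
  proof
    fix x assume "x \<in> keys (a * b)"
    then obtain s t where "s \<in> keys a" "t \<in> keys b" "x = s + t" using keys_mult[of a b] by auto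
    then show "x \<in> G" using that Gadd by auto
  qed
  have Gq: "keys q \<subseteq> G"
    unfolding q_def using G0 Gp(2) keys_tpcnj[of p] by (intro Gmult) (auto split: if_splits)
  have Gv: "keys v \<subseteq> G"
  proof -
    have "keys (p * q) \<subseteq> G" using Gp(1) Gq by (intro Gmult) auto
    moreover have "keys v \<subseteq> keys (1::trigpoly) \<union> keys (p * q)"
      unfolding v_def using keys_add[of 1 "- (p * q)"] by simp
    ultimately show ?thesis using G0 by auto
  qed
  have Gvn: "keys (v ^ n) \<subseteq> G" for n
  proof (induction n)
    case 0
    show ?case using G0 by simp
  next
    case (Suc n)
    show ?case unfolding power_Suc by (rule Gmult[OF Gv Suc])
  qed
  \<comment> \<open>The n-th term of the series for the quotient of \<open>tpd \<phi> p\<close> by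
    p.\<close>
  define f where "f = (\<lambda>\<phi> n. tpd \<phi> p * q * v ^ n)"
  have Gf: "keys (f \<phi> n) \<subseteq> G" for \<phi> n
    unfolding f_def using keys_tpd[of \<phi> p] Gp(1) by (intro Gmult Gq Gvn) auto
  define S where "S = (\<Union>\<phi>\<in>insert ?id \<Phi>. \<Union>n. keys (f \<phi> n))"
  have S: "countable S" unfolding S_def by (intro countable_UN) (use \<Phi>(1) in \<open>auto intro: countable_finite\<close>)
  have SG: "S \<subseteq> G" unfolding S_def using Gf by blast
  have kS: "keys (f \<phi> n) \<subseteq> S" if "\<phi> \<in> insert ?id \<Phi>" for \<phi> n unfolding S_def using that by blast
  have sm: "summable (\<lambda>n. tpn (f \<phi> n))" for \<phi>
  proof -
    \<comment> \<open>Half of the decay of \<rho>^n pays for the number of frequencies of v^n, the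
      other half for the summation.\<close>
    define s where "s = sqrt \<rho>"
    have s: "0 < s" "s < 1" "\<rho> = s * s" using \<rho> by (auto simp: s_def)
    obtain C where C: "\<And>n. real (n + 1) ^ card (keys v) * s ^ n \<le> C"
      using poly_times_power_bounded[OF s(1,2)] by blast
    have le: "tpn (f \<phi> n) \<le> tpn (tpd \<phi> p * q) * (C * s ^ n)" for n
    proof -
      have "tpn (v ^ n) \<le> real (n + 1) ^ card (keys v) * \<rho> ^ n" by (rule tpn_power_le[OF vb])
      also have "\<dots> = (real (n + 1) ^ card (keys v) * s ^ n) * s ^ n" by (simp add: s(3) power_mult_distrib)
      also have "\<dots> \<le> C * s ^ n" using C[of n] s by (intro mult_right_mono) auto
      finally have "tpn (tpd \<phi> p * q) * tpn (v ^ n) \<le> tpn (tpd \<phi> p * q) * (C * s ^ n)"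
        by (intro mult_left_mono tpn_nonneg)
      then show ?thesis unfolding f_def using tpn_mult[of "tpd \<phi> p * q" "v ^ n"] by linarith
    qed
    have sg: "summable (\<lambda>n. tpn (tpd \<phi> p * q) * (C * s ^ n))"
      using s by (intro summable_mult summable_geometric) auto
    show ?thesis
      by (rule summable_comparison_test'[OF sg, of 0]) (simp add: tpn_nonneg le)
  qed
  define \<alpha> where "\<alpha> = (\<lambda>\<phi> y. suminf (\<lambda>n. lookup (f \<phi> n) y))"
  have ser: "summable (\<lambda>n. lookup (f \<phi> n) y)" "integrable (count_space S) (\<alpha> \<phi>)"
     "ft (count_space S) (\<lambda>y. y) (\<alpha> \<phi>) z = suminf (\<lambda>n. tpev (f \<phi> n) z)" if "\<phi> \<in> insert ?id \<Phi>" for \<phi> y z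
    using trigpoly_series[OF sm S kS[OF that]] unfolding \<alpha>_def by auto
  have T: "ft (count_space S) (\<lambda>y. y) (\<alpha> ?id) z = tpev (tpd ?id p) z / tpev p z" for z
  proof -
    have lt: "cmod (tpev v z) < 1" using vb[of z] \<rho>(2) by linarith
    have pq: "1 - tpev v z = tpev p z * tpev q z" by (simp add: v_def)
    have "tpev q z \<noteq> 0" using pnz[of z] M by (simp add: q_def)
    have "suminf (\<lambda>n. tpev (f ?id n) z) = tpev (tpd ?id p) z * tpev q z * suminf (\<lambda>n. tpev v z ^ n)"
      unfolding f_def tpev_mult tpev_power by (rule suminf_mult[OF summable_geometric[OF lt]])
    also have "\<dots> = tpev (tpd ?id p) z / tpev p z"
      unfolding suminf_geometric[OF lt] pq using pnz[of z] \<open>tpev q z \<noteq> 0\<close> by simp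
    finally show ?thesis using ser(3)[of ?id] by simp
  qed
  \<comment> \<open>An approximate inverse of p with error v^N. It is again a trigonometric
    polynomial, so derivations apply to it.\<close>
  define r where "r = (\<lambda>N. q * (\<Sum>n<N. v ^ n))"
  have pr: "p * r N = 1 - v ^ N" for N
  proof -
    have "p * r N = (1 - v) * (\<Sum>n<N. v ^ n)" by (simp add: r_def v_def mult.assoc)
    then show ?thesis by (simp add: one_diff_power_eq)
  qed
  have fr: "tpd \<phi> p * r N = (\<Sum>n<N. f \<phi> n)" for \<phi> N
    by (simp add: r_def f_def sum_distrib_left mult_ac)
  have lim: "(\<lambda>N. lookup (tpd \<phi> p * r N) y) \<longlonglongrightarrow> \<alpha> \<phi> y" if "\<phi> \<in> insert ?id \<Phi>" for \<phi> y
    unfolding fr lookup_sum \<alpha>_def using ser(1)[OF that] by (rule summable_LIMSEQ)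
  \<comment> \<open>For an exact inverse r of p and derivations D, E the expressions D (E p r) and E
    (D p r) agree, both being the mixed derivative of log p. For \<open>r N\<close> their difference
    \<open>Cv N\<close> has supremum of order N \<rho>^N, and comparing coefficients at y gives the
    identity in the limit.\<close>
  have compat: "of_real y * \<alpha> \<phi> y = of_real (\<phi> y) * \<alpha> ?id y" if \<phi>: "\<phi> \<in> \<Phi>" for \<phi> y
  proof -
    note add = \<Phi>(3)[OF \<phi>]
    define K1 where "K1 = (tpn (tpd \<phi> p) * tpn (tpd ?id v) + tpn (tpd ?id p) * tpn (tpd \<phi> v)) / \<delta>"
    define Cv where "Cv = (\<lambda>N. tpd ?id (tpd \<phi> p * r N) - tpd \<phi> (tpd ?id p * r N))"
    have bound: "cmod (tpev (Cv (Suc n)) z) \<le> real (n + 1) * \<rho> ^ n * K1" for n z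
    proof -
      let ?P = "tpev p z" and ?R = "tpev (r (Suc n)) z" and ?V = "tpev v z"
      let ?D = "\<lambda>p. tpev (tpd ?id p) z" and ?E = "\<lambda>p. tpev (tpd \<phi> p) z"
      have "tpd \<phi> 1 = (0::trigpoly)" using add[of 0 0] by simp
      then have "?E p * ?R + ?P * ?E (r (Suc n)) = - ?E (v ^ Suc n)"
        using arg_cong[OF pr[of "Suc n"], of "\<lambda>p. tpev (tpd \<phi> p) z"] by (simp add: tpd_mult[of \<phi>] add del: power_Suc)
      moreover have "?D p * ?R + ?P * ?D (r (Suc n)) = - ?D (v ^ Suc n)"
        using arg_cong[OF pr[of "Suc n"], of "\<lambda>p. tpev (tpd ?id p) z"] by (simp add: tpd_mult[of ?id] del: power_Suc)
      moreover have "tpev (Cv (Suc n)) z = ?E p * ?D (r (Suc n)) - ?D p * ?E (r (Suc n))"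
        unfolding Cv_def by (simp add: tpd_mult[of \<phi>] tpd_mult[of ?id] add tpd_commute[of \<phi> ?id])
      \<comment> \<open>Multiplying by p allows elimination of \<open>r (Suc n)\<close> and its two
        derivatives by means of the derivatives of p r = 1 - v^(n + 1).\<close>
      ultimately have "?P * tpev (Cv (Suc n)) z = ?D p * ?E (v ^ Suc n) - ?E p * ?D (v ^ Suc n)"
        by algebra
      also have "?E (v ^ Suc n) = of_nat (Suc n) * ?V ^ n * ?E v"
        by (subst tpd_power) (simp_all add: add)
      also have "?D (v ^ Suc n) = of_nat (Suc n) * ?V ^ n * ?D v"
        by (subst tpd_power) simp_all
      finally have "?P * tpev (Cv (Suc n)) z = of_nat (Suc n) * ?V ^ n * (?D p * ?E v - ?E p * ?D v)"
        by (simp add: algebra_simps)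
      then have "cmod ?P * cmod (tpev (Cv (Suc n)) z) = cmod (of_nat (Suc n)) * cmod ?V ^ n * cmod (?D p * ?E v - ?E p * ?D v)"
        by (metis norm_mult norm_power)
      also have "\<dots> \<le> real (Suc n) * \<rho> ^ n * (tpn (tpd \<phi> p) * tpn (tpd ?id v) + tpn (tpd ?id p) * tpn (tpd \<phi> v))"
      proof (intro mult_mono power_mono vb)
        have "cmod (?D p * ?E v - ?E p * ?D v) \<le> cmod (?D p) * cmod (?E v) + cmod (?E p) * cmod (?D v)"
          unfolding norm_mult[symmetric] by (rule norm_triangle_ineq4)
        also have "\<dots> \<le> tpn (tpd ?id p) * tpn (tpd \<phi> v) + tpn (tpd \<phi> p) * tpn (tpd ?id v)"
          by (intro add_mono mult_mono norm_tpev_le tpn_nonneg norm_ge_zero)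
        finally show "cmod (?D p * ?E v - ?E p * ?D v) \<le> tpn (tpd \<phi> p) * tpn (tpd ?id v) + tpn (tpd ?id p) * tpn (tpd \<phi> v)"
          by simp
        show "cmod (of_nat (Suc n)) \<le> real (Suc n)" by (simp only: norm_of_nat order_refl)
      qed (use \<rho> in auto)
      finally have "\<delta> * cmod (tpev (Cv (Suc n)) z) \<le> real (Suc n) * \<rho> ^ n * (\<delta> * K1)"
        using mult_right_mono[OF \<delta>(2)[of z], of "cmod (tpev (Cv (Suc n)) z)"] \<delta>(1) by (simp add: K1_def)
      then have "\<delta> * cmod (tpev (Cv (Suc n)) z) \<le> \<delta> * (real (n + 1) * \<rho> ^ n * K1)" by (simp add: mult_ac)
      then show ?thesis using \<delta>(1) by simp
    qed
    have "(\<lambda>n. lookup (Cv (Suc n)) y) \<longlonglongrightarrow> 0"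
    proof (rule Lim_null_comparison)
      show "\<forall>\<^sub>F n in sequentially. norm (lookup (Cv (Suc n)) y) \<le> real (n + 1) * \<rho> ^ n * K1"
        by (intro always_eventually allI norm_lookup_le bound)
      have "(\<lambda>n. (real n * \<rho> ^ n + \<rho> ^ n) * K1) \<longlonglongrightarrow> (0 + 0) * K1"
        using \<rho> by (intro tendsto_intros powser_times_n_limit_0 LIMSEQ_realpow_zero) auto
      then show "(\<lambda>n. real (n + 1) * \<rho> ^ n * K1) \<longlonglongrightarrow> 0" by (simp add: algebra_simps)
    qed
    moreover have "lookup (Cv N) y = of_real y * lookup (tpd \<phi> p * r N) y - of_real (\<phi> y) * lookup (tpd ?id p * r N) y" for N
      unfolding Cv_def by (simp add: lookup_minus)
    moreover have "(\<lambda>n. of_real y * lookup (tpd \<phi> p * r (Suc n)) y - of_real (\<phi> y) * lookup (tpd ?id p * r (Suc n)) y)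
        \<longlonglongrightarrow> of_real y * \<alpha> \<phi> y - of_real (\<phi> y) * \<alpha> ?id y"
      using \<phi> by (intro tendsto_intros LIMSEQ_Suc[OF lim]) auto
    ultimately have "of_real y * \<alpha> \<phi> y - of_real (\<phi> y) * \<alpha> ?id y = 0"
      using LIMSEQ_unique by fastforce
    then show ?thesis by simp
  qed
  \<comment> \<open>The coefficient at y = 0 cannot be divided; it becomes the linear term
    \<gamma>.\<close>
  define b where "b = (\<lambda>y. if y = 0 then 0 else \<alpha> ?id y / of_real y)"
  have bb: "cmod (b y) \<le> (\<Sum>\<phi>\<in>\<Phi>. cmod (\<alpha> \<phi> y) / \<kappa>)" if "y \<in> S" for y
  proof (cases "y = 0")
    case True
    then show ?thesis using \<Phi>(2) by (auto simp: b_def intro!: sum_nonneg)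
  next
    case False
    then obtain \<phi> where \<phi>: "\<phi> \<in> \<Phi>" "\<kappa> \<le> \<bar>\<phi> y\<bar>"
      using \<Phi>(4) SG \<open>y \<in> S\<close> unfolding G_def by blast
    have "b y = \<alpha> \<phi> y / of_real (\<phi> y)"
      using compat[OF \<phi>(1), of y] False \<phi>(2) \<Phi>(2) by (simp add: b_def field_simps)
    then have "cmod (b y) = cmod (\<alpha> \<phi> y) / \<bar>\<phi> y\<bar>" by (simp add: norm_divide)
    also have "\<dots> \<le> cmod (\<alpha> \<phi> y) / \<kappa>" using \<phi>(2) \<Phi>(2) by (intro divide_left_mono mult_pos_pos) auto
    also have "\<dots> \<le> (\<Sum>\<phi>\<in>\<Phi>. cmod (\<alpha> \<phi> y) / \<kappa>)"
      using \<phi>(1) \<Phi> by (intro member_le_sum[of \<phi> \<Phi> "\<lambda>\<phi>. cmod (\<alpha> \<phi> y) / \<kappa>"]) auto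
    finally show ?thesis .
  qed
  have bi: "integrable (count_space S) b"
  proof (rule Bochner_Integration.integrable_bound)
    show "integrable (count_space S) (\<lambda>y. \<Sum>\<phi>\<in>\<Phi>. cmod (\<alpha> \<phi> y) / \<kappa>)"
      by (intro Bochner_Integration.integrable_sum integrable_divide integrable_norm ser(2)) auto
    show "AE y in count_space S. norm (b y) \<le> norm (\<Sum>\<phi>\<in>\<Phi>. cmod (\<alpha> \<phi> y) / \<kappa>)"
      using order_trans[OF bb abs_ge_self] by (intro AE_I2) simp
  qed simp
  define \<gamma> where "\<gamma> = (LINT y|count_space S. indicator {0} y *\<^sub>R \<alpha> ?id y)"
  define w where "w = (\<lambda>z. LINT y|count_space S. b y * (iexp (z * y) - 1))"
  have yb: "of_real y * b y = \<alpha> ?id y - indicator {0} y *\<^sub>R \<alpha> ?id y" for y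
    by (auto simp: b_def)
  have ai: "integrable (count_space S) (\<alpha> ?id)" by (rule ser(2)) simp
  have ii: "integrable (count_space S) (\<lambda>y. indicator {0} y *\<^sub>R \<alpha> ?id y)"
    by (rule integrable_count_space_finite_support[of "{0}"]) auto
  have ybi: "integrable (count_space S) (\<lambda>y. of_real y * b y)"
    unfolding yb using ai ii by simp
  have fyb: "ft (count_space S) (\<lambda>y. y) (\<lambda>y. of_real y * b y) z = tpev (tpd ?id p) z / tpev p z - \<gamma>" for z
  proof -
    have "ft (count_space S) (\<lambda>y. y) (\<lambda>y. of_real y * b y) z =
        (LINT y|count_space S. \<alpha> ?id y * iexp (z * y) - indicator {0} y *\<^sub>R \<alpha> ?id y)"
      unfolding ft_def yb by (intro Bochner_Integration.integral_cong refl) (auto simp: indicator_def algebra_simps)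
    also have "\<dots> = (LINT y|count_space S. \<alpha> ?id y * iexp (z * y)) - \<gamma>"
      unfolding \<gamma>_def using ii integrable_times_iexp[OF ai, of "\<lambda>y. y" z] by (intro Bochner_Integration.integral_diff) auto
    also have "\<dots> = tpev (tpd ?id p) z / tpev p z - \<gamma>" using T[of z] by (simp add: ft_def)
    finally show ?thesis .
  qed
  have wd: "(w has_vector_derivative \<i> * (tpev (tpd ?id p) z / tpev p z - \<gamma>)) (at z)" for z
    unfolding w_def fyb[symmetric] by (rule has_vector_derivative_ft) (use ybi in auto)
  have Ld: "((\<lambda>z. \<i> * \<gamma> * of_real z + w z) has_vector_derivative \<i> * \<gamma> + \<i> * (tpev (tpd ?id p) z / tpev p z - \<gamma>)) (at z)" for z
    by (rule has_vector_derivative_add[OF _ wd]) (auto intro!: derivative_eq_intros has_vector_derivative_real_field)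
  obtain c where c: "\<And>z. tpev p z = c * exp (\<i> * \<gamma> * of_real z + w z)"
  proof (rule log_derivative_unique[OF has_vector_derivative_tpev[of p] Ld])
    show "\<i> * tpev (tpd ?id p) z = tpev p z * (\<i> * \<gamma> + \<i> * (tpev (tpd ?id p) z / tpev p z - \<gamma>))" for z
      using pnz[of z] by (simp add: algebra_simps)
  qed blast
  have "w z = ft (count_space S) (\<lambda>y. y) b z + - (LINT y|count_space S. b y)" for z
  proof -
    have "w z = (LINT y|count_space S. b y * iexp (z * y) - b y)"
      unfolding w_def by (simp add: right_diff_distrib)
    also have "\<dots> = ft (count_space S) (\<lambda>y. y) b z - (LINT y|count_space S. b y)"
      unfolding ft_def using bi integrable_times_iexp[OF bi, of "\<lambda>y. y" z] by (intro Bochner_Integration.integral_diff) auto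
    finally show ?thesis by simp
  qed
  then have "w = (\<lambda>z. ft (count_space S) (\<lambda>y. y) b z + - (LINT y|count_space S. b y))" by auto
  then have "wtr ((LINT y|count_space S. cmod (b y)) + cmod (- (LINT y|count_space S. b y))) w"
    by (simp only:) (intro wtr_add wtr_dtr dtr_countable S bi dtr_const)
  then show ?thesis using c by (rule that)
qed

subsection \<open>Logarithms\<close>

text \<open>The gamma density without the factor 1 / Gamma a; at a = 1 it is the exponential
  density.\<close>

definition gammaf :: "real \<Rightarrow> real \<Rightarrow> real" where
  "gammaf a x = indicator {0<..} x * (x powr (a - 1) * exp (- x))"

lemma gammaf_nonneg: "0 \<le> gammaf a x" by (auto simp: gammaf_def)

lemma gammaf_measurable [measurable]: "gammaf a \<in> borel_measurable borel"
  unfolding gammaf_def by measurable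

lemma has_bochner_integral_gammaf:
  assumes "0 < a"
  shows "has_bochner_integral lborel (gammaf a) (Gamma a)"
proof (rule has_bochner_integral_nn_integral)
  have "((\<lambda>t. t powr (a - 1) / exp t) has_integral Gamma a) {0..}"
    by (rule Gamma_integral_real[OF assms])
  then have "((\<lambda>t. if t \<in> {0..} then t powr (a - 1) / exp t else 0) has_integral Gamma a) UNIV"
    by (simp only: has_integral_restrict_UNIV)
  also have "(\<lambda>t. if t \<in> {0..} then t powr (a - 1) / exp t else 0) = gammaf a"
    by (auto simp: gammaf_def fun_eq_iff exp_minus divide_inverse indicator_def)
  finally have "(gammaf a has_integral Gamma a) UNIV" .
  then show "(\<integral>\<^sup>+x. ennreal (gammaf a x) \<partial>lborel) = ennreal (Gamma a)"
    by (intro nn_integral_has_integral_lborel) (auto simp: gammaf_nonneg)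
qed (use assms Gamma_real_pos[of a] in \<open>auto simp: gammaf_nonneg\<close>)

lemma integrable_gammaf: "0 < a \<Longrightarrow> integrable lborel (gammaf a)"
  using has_bochner_integral_gammaf by (rule integrable.intros)

lemma integrable_gammaf_complex: "0 < a \<Longrightarrow> integrable lborel (\<lambda>x. of_real (gammaf a x) :: complex)"
  using integrable_gammaf by (simp only: complex_of_real_integrable_eq)

lemma one_minus_ii_ne_0: "1 - \<i> * of_real z \<noteq> 0" "1 + \<i> * of_real z \<noteq> 0"
  by (auto simp: complex_eq_iff)

lemma tendsto_powr_mult_exp:
  "((\<lambda>x. of_real (x powr a) * exp ((\<i> * of_real z - 1) * of_real x)) \<longlongrightarrow> 0) at_top"
proof (rule tendsto_norm_zero_cancel)
  obtain n where n: "a \<le> real n" using real_arch_simple by blast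
  have "((\<lambda>x::real. x ^ n / exp x) \<longlongrightarrow> 0) at_top" by (rule tendsto_power_div_exp_0)
  then show "((\<lambda>x. cmod (of_real (x powr a) * exp ((\<i> * of_real z - 1) * of_real x))) \<longlongrightarrow> 0) at_top"
  proof (rule Lim_null_comparison[rotated])
    show "\<forall>\<^sub>F x in at_top. norm (cmod (of_real (x powr a) * exp ((\<i> * of_real z - 1) * of_real x))) \<le> x ^ n / exp x"
      using eventually_ge_at_top[of 1]
    proof eventually_elim
      case (elim x)
      then have "x powr a \<le> x ^ n" using n powr_mono[of a "real n" x] by (simp add: powr_realpow)
      then show ?case by (simp add: norm_mult exp_minus divide_inverse)
    qed
  qed
qed

lemma has_vector_derivative_powr_mult_exp:
  assumes "0 < x"
  shows "((\<lambda>x. of_real (x powr a) * exp ((\<i> * of_real z - 1) * of_real x)) has_vector_derivative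
     of_real (a * x powr (a - 1)) * exp ((\<i> * of_real z - 1) * of_real x)
     - (1 - \<i> * of_real z) * (of_real (x powr a) * exp ((\<i> * of_real z - 1) * of_real x))) (at x)"
proof -
  have 1: "((\<lambda>x. of_real (x powr a) :: complex) has_vector_derivative of_real (a * x powr (a - 1))) (at x)"
    using assms by (intro has_vector_derivative_of_real) (auto simp flip: has_real_derivative_iff_has_vector_derivative intro!: derivative_eq_intros)
  have 2: "((\<lambda>x. exp ((\<i> * of_real z - 1) * of_real x)) has_vector_derivative exp ((\<i> * of_real z - 1) * of_real x) * (\<i> * of_real z - 1)) (at x)"
    by (intro has_vector_derivative_exp_complex) (auto intro!: derivative_eq_intros has_vector_derivative_real_field)
  show ?thesis
    by (rule has_vector_derivative_eq_rhs[OF has_vector_derivative_mult[OF 1 2]]) (simp add: algebra_simps)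
qed

lemma gammaf_times_iexp:
  "of_real (gammaf a x) * iexp (z * x) = indicator {0<..} x *\<^sub>R (of_real (x powr (a - 1)) * exp ((\<i> * of_real z - 1) * of_real x))"
proof -
  have "exp ((\<i> * of_real z - 1) * of_real x) = iexp (z * x) * of_real (exp (- x))"
    by (simp add: algebra_simps exp_diff exp_minus divide_inverse flip: exp_of_real)
  then show ?thesis by (auto simp: gammaf_def indicator_def)
qed

text \<open>The derivative of x^a exp((i z - 1) x) is integrated over the positive half-line. The
  boundary value at 0 is 1 when a = 0 and 0 when a > 0: the former case gives the transform of the
  exponential density, the latter the differential equation of the gamma transforms.\<close>

lemma lft_gammaf_FTC:
  assumes a: "0 < a \<or> a = 0"
  shows "(1 - \<i> * of_real z) * lft (\<lambda>x. of_real (gammaf (a + 1) x)) z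
     = (if a = 0 then 1 else of_real a * lft (\<lambda>x. of_real (gammaf a x)) z)"
proof -
  let ?F = "\<lambda>x. of_real (x powr a) * exp ((\<i> * of_real z - 1) * of_real x)"
  let ?f = "\<lambda>x. of_real (a * x powr (a - 1)) * exp ((\<i> * of_real z - 1) * of_real x)
     - (1 - \<i> * of_real z) * (of_real (x powr a) * exp ((\<i> * of_real z - 1) * of_real x))"
  have eqf: "indicator {0<..} x *\<^sub>R ?f x = of_real a * (of_real (gammaf a x) * iexp (z * x)) - (1 - \<i> * of_real z) * (of_real (gammaf (a + 1) x) * iexp (z * x))" for x
    unfolding gammaf_times_iexp by (auto simp: indicator_def algebra_simps)
  \<comment> \<open>At a = 0 the function \<open>gammaf 0\<close> is not integrable, but it enters
    with the factor 0.\<close>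
  have i1: "integrable lborel (\<lambda>x. of_real a * (of_real (gammaf a x) * iexp (z * x)))"
    using a integrable_times_iexp[OF integrable_gammaf_complex, of a "\<lambda>x. x" z] by auto
  have i2: "integrable lborel (\<lambda>x. of_real (gammaf (a + 1) x) * iexp (z * x))"
    using a by (intro integrable_times_iexp integrable_gammaf_complex) auto
  have ei: "einterval 0 \<infinity> = {0<..}" by (auto simp: einterval_def)
  have int: "set_integrable lborel (einterval 0 \<infinity>) ?f"
    unfolding set_integrable_def ei eqf by (intro Bochner_Integration.integrable_diff i1 integrable_mult_right i2)
  have cont: "isCont ?f x" if "0 < x" for x
    using that by (intro continuous_intros) auto
  have I1: "(LBINT x=0..\<infinity>. ?f x) = 0 - (if a = 0 then 1 else 0)"
  proof (rule interval_integral_FTC_integrable)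
    show "((?F \<circ> real_of_ereal) \<longlongrightarrow> 0) (at_left \<infinity>)"
      unfolding ereal_tendsto_simps by (rule tendsto_powr_mult_exp)
    have "((\<lambda>x. x powr a) \<longlongrightarrow> (if a = 0 then 1 else 0)) (at_right (0::real))"
    proof (cases "a = 0")
      case True
      have "((\<lambda>x::real. x powr 0) \<longlongrightarrow> 1) (at_right 0)"
        by (rule tendsto_eventually) (auto simp: eventually_at_right_less intro: eventually_mono[OF eventually_at_right_less])
      then show ?thesis using True by simp
    next
      case False
      have ev: "\<forall>\<^sub>F x in at_right (0::real). 0 \<le> x"
        using eventually_at_right_less[of 0] by eventually_elim simp
      have "((\<lambda>x::real. x powr a) \<longlongrightarrow> 0 powr a) (at_right 0)"
        by (rule tendsto_powr'[OF tendsto_ident_at tendsto_const]) (use ev a False in auto)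
      then show ?thesis using False by simp
    qed
    then have "((\<lambda>x. of_real (x powr a) * exp ((\<i> * of_real z - 1) * of_real x)) \<longlongrightarrow> of_real (if a = 0 then 1 else 0) * exp ((\<i> * of_real z - 1) * of_real 0)) (at_right 0)"
      by (intro tendsto_intros)
    then show "((?F \<circ> real_of_ereal) \<longlongrightarrow> (if a = 0 then 1 else 0)) (at_right 0)"
      unfolding zero_ereal_def ereal_tendsto_simps by (simp split: if_splits)
    fix x assume "0 < ereal x" "ereal x < \<infinity>"
    then have x: "0 < x" by simp
    show "(?F has_vector_derivative ?f x) (at x)" by (rule has_vector_derivative_powr_mult_exp[OF x])
    show "isCont ?f x" by (rule cont[OF x])
  qed (use int in auto)
  have I2: "(LBINT x=0..\<infinity>. ?f x) = (LINT x|lborel. indicator {0<..} x *\<^sub>R ?f x)"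
    unfolding interval_lebesgue_integral_def set_lebesgue_integral_def ei by simp
  have I3: "(LINT x|lborel. indicator {0<..} x *\<^sub>R ?f x) = of_real a * lft (\<lambda>x. of_real (gammaf a x)) z - (1 - \<i> * of_real z) * lft (\<lambda>x. of_real (gammaf (a + 1) x)) z"
    unfolding eqf ft_def
    by (subst Bochner_Integration.integral_diff[OF i1 integrable_mult_right[OF i2]]) (simp only: integral_mult_right_zero)
  have "of_real a * lft (\<lambda>x. of_real (gammaf a x)) z - (1 - \<i> * of_real z) * lft (\<lambda>x. of_real (gammaf (a + 1) x)) z
      = 0 - (if a = 0 then 1 else 0)"
    using I1 unfolding I2 I3 .
  then show ?thesis by (cases "a = 0") (simp_all add: eq_diff_eq)
qed

lemma lft_gammaf_1: "lft (\<lambda>x. of_real (gammaf 1 x)) z = 1 / (1 - \<i> * of_real z)"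
  using lft_gammaf_FTC[of 0 z] one_minus_ii_ne_0[of z] by (simp add: field_simps)

text \<open>Away from the point 0 the function is the sum of the exponential density and its
  reflection.\<close>

lemma integrable_exp_minus_abs: "integrable lborel (\<lambda>x::real. exp (- \<bar>x\<bar>))"
  and lft_exp_minus_abs: "lft (\<lambda>x. of_real (exp (- \<bar>x\<bar>))) z = 2 / (1 + (of_real z)\<^sup>2)"
proof -
  have ae: "AE x in lborel. exp (- \<bar>x\<bar>) = gammaf 1 x + gammaf 1 (- x)"
  proof (rule AE_I'[of "{0}"])
    show "{x \<in> space lborel. exp (- \<bar>x\<bar>) \<noteq> gammaf 1 x + gammaf 1 (- x)} \<subseteq> {0::real}"
      by (auto simp: gammaf_def indicator_def abs_if split: if_splits)
  qed (auto intro: finite_imp_null_set_lborel)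
  have i: "integrable lborel (gammaf 1)" by (rule integrable_gammaf) simp
  then have im: "integrable lborel (\<lambda>x. gammaf 1 (- x))"
    using lborel_integrable_real_affine[of "gammaf 1" "-1" 0] by simp
  show "integrable lborel (\<lambda>x::real. exp (- \<bar>x\<bar>))"
  proof (subst integrable_cong_AE[OF _ _ ae])
    show "integrable lborel (\<lambda>x. gammaf 1 x + gammaf 1 (- x))" using i im by simp
  qed measurable
  have ic: "integrable lborel (\<lambda>x. of_real (gammaf 1 x) :: complex)" "integrable lborel (\<lambda>x. of_real (gammaf 1 (- x)) :: complex)"
    using i im by (simp_all only: complex_of_real_integrable_eq)
  have "lft (\<lambda>x. of_real (exp (- \<bar>x\<bar>))) z = lft (\<lambda>x. of_real (gammaf 1 x) + of_real (gammaf 1 (- x))) z"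
    unfolding ft_def
  proof (rule integral_cong_AE)
    show "AE x in lborel. of_real (exp (- \<bar>x\<bar>)) * iexp (z * x) = (of_real (gammaf 1 x) + of_real (gammaf 1 (- x))) * iexp (z * x)"
      using ae by eventually_elim (simp only: of_real_add)
  qed measurable
  also have "\<dots> = lft (\<lambda>x. of_real (gammaf 1 x)) z + lft (\<lambda>x. of_real (gammaf 1 (- x))) z"
    by (rule lft_add[OF ic])
  also have "lft (\<lambda>x. of_real (gammaf 1 (- x))) z = lft (\<lambda>x. of_real (gammaf 1 x)) (- z)"
    unfolding ft_def using lborel_integral_real_affine[of "-1" "\<lambda>x. of_real (gammaf 1 x) * iexp (- z * x)" 0] by simp
  also have "lft (\<lambda>x. of_real (gammaf 1 x)) z + lft (\<lambda>x. of_real (gammaf 1 x)) (- z) = 2 / (1 + (of_real z)\<^sup>2)"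
  proof -
    have "(1 - \<i> * of_real z) * (1 + \<i> * of_real z) = 1 + (of_real z)\<^sup>2"
      by (simp add: algebra_simps power2_eq_square)
    then show ?thesis
      unfolding lft_gammaf_1 using one_minus_ii_ne_0[of z]
      by (simp add: add_frac_eq)
  qed
  finally show "lft (\<lambda>x. of_real (exp (- \<bar>x\<bar>))) z = 2 / (1 + (of_real z)\<^sup>2)" .
qed

section \<open>The winding number\<close>

text \<open>Convolution with a finite measure preserves Lipschitz bounds. The product therefore has
  a continuous density, whose value at 0 makes sense.\<close>

lemma lipbd_mult_wtr:
  assumes f: "integrable lborel f" "lipbd f" and u: "wtr B u"
  obtains k where "integrable lborel k" "lipbd k" "\<And>z. lft k z = lft f z * u z"
proof -
  obtain A C v w where vw: "dtr A v" "ltr C w" "u = (\<lambda>z. v z + w z)"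
    using u by (rule wtrE) blast
  obtain b :: "nat \<Rightarrow> complex" and y where b: "integrable (count_space UNIV) b" "v = ft (count_space UNIV) y b"
    using vw(1) unfolding dtr_def by blast
  obtain s where s: "integrable lborel s" "w = lft s"
    using vw(2) unfolding ltr_def by blast
  have sf: "sigma_finite_measure (count_space (UNIV::nat set))"
    by (simp add: sigma_finite_measure_count_space_countable)
  have ym: "y \<in> borel_measurable (count_space UNIV)" "(\<lambda>x::real. x) \<in> borel_measurable lborel" by simp_all
  note c1 = ft_convolution[OF sf b(1) ym(1) f(1)] and c2 = ft_convolution[OF lborel.sigma_finite_measure_axioms s(1) ym(2) f(1)]
  note l1 = lipbd_convolution[OF f(2) b(1) ym(1)] and l2 = lipbd_convolution[OF f(2) s(1) ym(2)]
  show ?thesis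
  proof (rule that[OF Bochner_Integration.integrable_add[OF c1(1) c2(1)] lipbd_add[OF l1 l2]])
    fix z
    show "lft (\<lambda>x. (LINT v|count_space UNIV. b v * f (x - y v)) + (LINT v|lborel. s v * f (x - v))) z = lft f z * u z"
      unfolding lft_add[OF c1(1) c2(1)] c1(3) c2(3) by (simp add: vw(3) b(2) s(2) algebra_simps)
  qed
qed


text \<open>The factor x is bounded on the support. A pair of points with at least one in
  [-|T|, |T|] is handled by the product rule at that point; elsewhere the function vanishes.\<close>

lemma lipbd_times_id:
  assumes L: "\<And>x y. cmod (h x - h y) \<le> L * \<bar>x - y\<bar>" and T: "\<And>x. T < \<bar>x\<bar> \<Longrightarrow> h x = 0"
  shows "lipbd (\<lambda>x. of_real x * h x)"
proof -
  have lb: "lipbd h" by (rule lipbd_if_vanishing[OF L T])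
  then obtain L' M where L': "0 \<le> L'" "\<And>x y. cmod (h x - h y) \<le> L' * \<bar>x - y\<bar>" and M: "0 \<le> M" "\<And>x. cmod (h x) \<le> M"
    by (rule lipbdE) blast
  have one: "cmod (of_real x * h x - of_real y * h y) \<le> (\<bar>T\<bar> * L' + M) * \<bar>x - y\<bar>" if "\<bar>x\<bar> \<le> \<bar>T\<bar>" for x y
  proof -
    have "of_real x * h x - of_real y * h y = of_real x * (h x - h y) + of_real (x - y) * h y" by (simp add: algebra_simps)
    also have "cmod \<dots> \<le> \<bar>x\<bar> * cmod (h x - h y) + \<bar>x - y\<bar> * cmod (h y)"
      by (rule order_trans[OF norm_triangle_ineq]) (simp only: norm_mult norm_of_real order_refl)
    also have "\<dots> \<le> \<bar>T\<bar> * (L' * \<bar>x - y\<bar>) + \<bar>x - y\<bar> * M"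
      using that by (intro add_mono mult_mono L' M) auto
    finally show ?thesis by (simp add: algebra_simps)
  qed
  have two: "cmod (of_real x * h x - of_real y * h y) \<le> (\<bar>T\<bar> * L' + M) * \<bar>x - y\<bar>" for x y
  proof -
    consider "\<bar>x\<bar> \<le> \<bar>T\<bar>" | "\<bar>y\<bar> \<le> \<bar>T\<bar>" | "\<bar>T\<bar> < \<bar>x\<bar>" "\<bar>T\<bar> < \<bar>y\<bar>" by linarith
    then show ?thesis
    proof cases
      case 2
      then show ?thesis using one[of y x] by (simp add: norm_minus_commute abs_minus_commute)
    next
      case 3
      then show ?thesis using T[of x] T[of y] L' M by simp
    qed (rule one)
  qed
  show ?thesis
  proof (rule lipbd_if_vanishing[OF two])
    show "of_real x * h x = 0" if "T < \<bar>x\<bar>" for x using T[OF that] by simp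
  qed
qed

lemma tendsto_arctan:
  "((\<lambda>z. of_real (arctan z) :: complex) \<longlongrightarrow> of_real (pi / 2)) at_top"
  "((\<lambda>z. of_real (arctan z) :: complex) \<longlongrightarrow> of_real (- (pi / 2))) at_bot"
  by (rule tendsto_of_real[OF tendsto_arctan_at_top], rule tendsto_of_real[OF tendsto_arctan_at_bot])

text \<open>The logarithmic derivative is the transform of a Lipschitz function \<open>k\<close>,
  and a primitive needs the density k x / (i x). The value \<kappa> = k 0 obstructs this. It is
  removed by subtracting \<kappa> exp(-|x|), whose transform 2 \<kappa> / (1 + z^2) has the
  primitive 2 \<kappa> arctan z. Since \<open>1 + lft g\<close> tends to 1 at both ends, \<kappa> is
  i times an integer.\<close>

lemma one_plus_lft_nice_log:
  assumes g: "nice g" and \<delta>: "0 < \<delta>" "\<And>z. \<delta> \<le> cmod (1 + lft g z)"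
  obtains m :: int and A w c where "wtr A w" "\<And>z. 1 + lft g z = c * exp (2 * \<i> * of_int m * of_real (arctan z) + w z)"
proof -
  note gi = nice_integrable[OF g]
  obtain L T where L: "\<And>x y. cmod (g x - g y) \<le> L * \<bar>x - y\<bar>" and T: "\<And>x. T < \<bar>x\<bar> \<Longrightarrow> g x = 0"
    using g unfolding nice_def by blast
  \<comment> \<open>The density of the derivative of \<open>lft g\<close>.\<close>
  define f where "f = (\<lambda>x. \<i> * (of_real x * g x))"
  have xgi: "integrable lborel (\<lambda>x. of_real x * g x)"
  proof (rule Bochner_Integration.integrable_bound[OF integrable_mult_right[OF gi, of "of_real \<bar>T\<bar>"]])
    show "(\<lambda>x. of_real x * g x) \<in> borel_measurable lborel" using borel_measurable_integrable[OF gi] by measurable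
    have "cmod (of_real x * g x) \<le> cmod (of_real \<bar>T\<bar> * g x)" for x
    proof (cases "T < \<bar>x\<bar>")
      case False
      then have "\<bar>x\<bar> * cmod (g x) \<le> \<bar>T\<bar> * cmod (g x)" by (intro mult_right_mono) auto
      then show ?thesis by (simp add: norm_mult)
    qed (simp add: T)
    then show "AE x in lborel. norm (of_real x * g x) \<le> norm (of_real \<bar>T\<bar> * g x)" by (intro AE_I2)
  qed
  have fi: "integrable lborel f" unfolding f_def using xgi by simp
  have flb: "lipbd f"
  proof -
    obtain L' M where "\<And>x y. cmod (of_real x * g x - of_real y * g y) \<le> L' * \<bar>x - y\<bar>" "\<And>x. cmod (of_real x * g x) \<le> M"
      using lipbd_times_id[OF L T] unfolding lipbd_def by blast
    then show ?thesis unfolding lipbd_def f_def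
      by (intro conjI exI[of _ L'] exI[of _ M]) (auto simp: norm_mult simp flip: right_diff_distrib)
  qed
  have "wtr (cmod 1 + (LINT x|lborel. cmod (g x))) (\<lambda>z. 1 + lft g z)"
    by (intro wtr_sum2 dtr_const ltr_lft gi)
  then have gw: "wtr (cmod 1 + (LINT x|lborel. cmod (g x))) (\<lambda>z. 1 + lft g z)" .
  obtain R where R: "wtr R (\<lambda>z. inverse (1 + lft g z))" using wtr_inverse[OF gw \<delta>] by blast
  obtain k where k: "integrable lborel k" "lipbd k" "\<And>z. lft k z = lft f z * inverse (1 + lft g z)"
    using lipbd_mult_wtr[OF fi flb R] by blast
  define \<kappa> where "\<kappa> = k 0"
  let ?E = "\<lambda>x::real. of_real (exp (- \<bar>x\<bar>)) :: complex"
  have Ei: "integrable lborel ?E" using integrable_exp_minus_abs by (simp only: complex_of_real_integrable_eq)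
  define h where "h = (\<lambda>x. (k x - \<kappa> * ?E x) / (\<i> * of_real x))"
  obtain K M where K: "0 \<le> K" "\<And>x y. cmod (k x - k y) \<le> K * \<bar>x - y\<bar>" and M: "0 \<le> M" "\<And>x. cmod (k x) \<le> M"
    using k(2) by (rule lipbdE) blast
  have [measurable]: "k \<in> borel_measurable borel" by (rule lipbd_measurable[OF k(2)])
  have hm [measurable]: "h \<in> borel_measurable borel" unfolding h_def by measurable
  have hi: "integrable lborel h"
  proof (rule Bochner_Integration.integrable_bound)
    \<comment> \<open>Near 0 the numerator is at most (K + |\<kappa>|) |x|, by the Lipschitz bound
      and 1 - exp(-|x|) <= |x|; for |x| > 1 the division by x only decreases the modulus.\<close>
    show "integrable lborel (\<lambda>x. indicator {-1..1} x * (K + cmod \<kappa>) + cmod (k x) + cmod (\<kappa> * ?E x))"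
      by (intro Bochner_Integration.integrable_add integrable_norm k(1) integrable_mult_right Ei integrable_mult_left)
         (simp add: emeasure_lborel_Icc_eq)
    have "cmod (h x) \<le> indicator {-1..1} x * (K + cmod \<kappa>) + cmod (k x) + cmod (\<kappa> * ?E x)" for x
    proof (cases "\<bar>x\<bar> \<le> 1")
      case True
      have "k x - \<kappa> * ?E x = (k x - k 0) + \<kappa> * (1 - ?E x)" by (simp add: \<kappa>_def algebra_simps)
      also have "cmod \<dots> \<le> K * \<bar>x - 0\<bar> + cmod \<kappa> * \<bar>x\<bar>"
      proof (intro order_trans[OF norm_triangle_ineq] add_mono K)
        have "\<bar>1 - exp (- \<bar>x\<bar>)\<bar> \<le> \<bar>x\<bar>" using exp_ge_add_one_self[of "- \<bar>x\<bar>"] by simp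
        then have "cmod (1 - ?E x) \<le> \<bar>x\<bar>" by (metis norm_of_real of_real_1 of_real_diff)
        then show "cmod (\<kappa> * (1 - ?E x)) \<le> cmod \<kappa> * \<bar>x\<bar>" unfolding norm_mult by (intro mult_left_mono) auto
      qed
      finally have "cmod (k x - \<kappa> * ?E x) \<le> (K + cmod \<kappa>) * \<bar>x\<bar>" by (simp add: algebra_simps)
      then have hb: "cmod (h x) \<le> K + cmod \<kappa>" unfolding h_def norm_divide norm_mult
        using K(1) by (cases "x = 0") (auto simp: divide_le_eq)
      have i1: "indicator {-1..1} x = (1::real)" using True by (auto simp: indicator_def)
      show ?thesis
        unfolding i1 mult_1 add.assoc[of "K + cmod \<kappa>"]
        by (rule add_increasing2[OF add_nonneg_nonneg[OF norm_ge_zero norm_ge_zero] hb])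
    next
      case False
      have "cmod (h x) \<le> cmod (k x - \<kappa> * ?E x)"
        unfolding h_def norm_divide norm_mult using False mult_left_mono[of 1 "\<bar>x\<bar>" "cmod (k x - \<kappa> * ?E x)"] by (simp add: divide_le_eq)
      also have "\<dots> \<le> cmod (k x) + cmod (\<kappa> * ?E x)" by (rule norm_triangle_ineq4)
      finally have hb: "cmod (h x) \<le> cmod (k x) + cmod (\<kappa> * ?E x)" .
      have i0: "indicator {-1..1} x = (0::real)" using False by (auto simp: indicator_def)
      show ?thesis unfolding i0 mult_zero_left add_0_left by (rule hb)
    qed
    then show "AE x in lborel. norm (h x) \<le> norm (indicator {-1..1} x * (K + cmod \<kappa>) + cmod (k x) + cmod (\<kappa> * ?E x))"
      by (intro AE_I2) (simp only: real_norm_def, rule order_trans[OF _ abs_ge_self])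
  qed measurable
  \<comment> \<open>At x = 0 both sides vanish because k 0 = \<kappa>.\<close>
  have xh: "of_real x * h x = - \<i> * (k x - \<kappa> * ?E x)" for x
    by (cases "x = 0") (simp_all add: h_def \<kappa>_def field_simps)
  have kEi: "integrable lborel (\<lambda>x. k x - \<kappa> * ?E x)" using k(1) Ei by simp
  have xhi: "integrable lborel (\<lambda>x. of_real x * h x)" unfolding xh using kEi by simp
  have ixh: "\<i> * lft (\<lambda>x. of_real x * h x) z = lft k z - \<kappa> * (2 / (1 + (of_real z)\<^sup>2))" for z
    unfolding xh lft_cmult lft_diff[OF k(1) integrable_mult_right[OF Ei]] lft_exp_minus_abs by (simp add: mult.assoc[symmetric])
  have hd: "((\<lambda>z. LINT x|lborel. h x * (iexp (z * x) - 1)) has_vector_derivative lft k z - \<kappa> * (2 / (1 + (of_real z)\<^sup>2))) (at z)" for z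
    unfolding ixh[symmetric] by (rule has_vector_derivative_ft) (use xhi in auto)
  have ad: "((\<lambda>z. 2 * \<kappa> * of_real (arctan z)) has_vector_derivative 2 * \<kappa> * of_real (1 / (1 + z\<^sup>2))) (at z)" for z
    by (intro has_vector_derivative_mult_right has_vector_derivative_of_real)
       (auto simp flip: has_real_derivative_iff_has_vector_derivative intro!: derivative_eq_intros simp: divide_inverse)
  have Ld: "((\<lambda>z. (LINT x|lborel. h x * (iexp (z * x) - 1)) + 2 * \<kappa> * of_real (arctan z)) has_vector_derivative lft k z) (at z)" for z
    by (rule has_vector_derivative_eq_rhs[OF has_vector_derivative_add[OF hd ad]]) simp
  have hft: "(LINT x|lborel. h x * (iexp (z * x) - 1)) = lft h z - lft h 0" for z
    unfolding ft_def using hi integrable_times_iexp[OF hi, of "\<lambda>x. x" z]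
    by (simp add: right_diff_distrib)
  have ud: "((\<lambda>z. 1 + lft g z) has_vector_derivative lft f z) (at z)" for z
  proof -
    define g1 where "g1 = 1 + lft g 0"
    have e: "1 + lft g z = (LINT x|lborel. g x * (iexp (z * x) - 1)) + g1" for z
      unfolding g1_def ft_def using gi integrable_times_iexp[OF gi, of "\<lambda>x. x" z]
      by (simp add: right_diff_distrib)
    have "((\<lambda>z. LINT x|lborel. g x * (iexp (z * x) - 1)) has_vector_derivative \<i> * lft (\<lambda>x. of_real x * g x) z) (at z)"
      by (rule has_vector_derivative_ft) (use xgi gi in auto)
    then have "((\<lambda>z. LINT x|lborel. g x * (iexp (z * x) - 1)) has_vector_derivative lft f z) (at z)"
      unfolding f_def lft_cmult .
    then show ?thesis unfolding e has_vector_derivative_add_const .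
  qed
  have une: "1 + lft g z \<noteq> 0" for z using \<delta>(1) \<delta>(2)[of z] by auto
  obtain c where c: "\<And>z. 1 + lft g z = c * exp ((LINT x|lborel. h x * (iexp (z * x) - 1)) + 2 * \<kappa> * of_real (arctan z))"
  proof (rule log_derivative_unique[OF ud Ld])
    show "lft f z = (1 + lft g z) * lft k z" for z using une[of z] by (simp add: k(3))
  qed blast
  have u: "1 + lft g z = c * exp (lft h z - lft h 0 + 2 * \<kappa> * of_real (arctan z))" for z
    unfolding c hft ..
  have l1: "((\<lambda>z. 1 + lft g z) \<longlongrightarrow> 1 + 0) F" if "F = at_top \<or> F = at_bot" for F
    by (intro tendsto_add tendsto_const ltr_tendsto_0[OF ltr_lft[OF gi] that])
  have l2: "(lft h \<longlongrightarrow> 0) F" if "F = at_top \<or> F = at_bot" for F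
    by (rule ltr_tendsto_0[OF ltr_lft[OF hi] that])
  have lim: "1 = c * exp (0 - lft h 0 + 2 * \<kappa> * a)" if F: "F = at_top \<or> F = at_bot" and a: "((\<lambda>z. of_real (arctan z)) \<longlongrightarrow> a) F" for F a
  proof (rule tendsto_unique)
    show "F \<noteq> bot"
      using F by (elim disjE) (simp_all only: trivial_limit_at_top_linorder trivial_limit_at_bot_linorder not_False_eq_True)
    show "((\<lambda>z. 1 + lft g z) \<longlongrightarrow> 1) F" using l1[OF F] by simp
    show "((\<lambda>z. 1 + lft g z) \<longlongrightarrow> c * exp (0 - lft h 0 + 2 * \<kappa> * a)) F"
      unfolding u by (intro tendsto_intros l2[OF F] a)
  qed
  have e1: "1 = c * exp (0 - lft h 0 + 2 * \<kappa> * of_real (pi / 2))" by (rule lim[OF _ tendsto_arctan(1)]) simp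
  have e2: "1 = c * exp (0 - lft h 0 + 2 * \<kappa> * of_real (- (pi / 2)))" by (rule lim[OF _ tendsto_arctan(2)]) simp
  have cn: "c \<noteq> 0" using e1 by auto
  have "exp (0 - lft h 0 + 2 * \<kappa> * of_real (pi / 2)) = exp (0 - lft h 0 + 2 * \<kappa> * of_real (- (pi / 2)))"
    using e1 e2 cn by (metis mult_left_cancel)
  \<comment> \<open>The limits at the two ends differ by the factor exp(2 pi \<kappa>), which is
    therefore 1.\<close>
  then obtain m :: int where m: "0 - lft h 0 + 2 * \<kappa> * of_real (pi / 2) = 0 - lft h 0 + 2 * \<kappa> * of_real (- (pi / 2)) + of_int (2 * m) * (of_real pi * \<i>)"
    unfolding exp_eq by (auto simp: mult.assoc)
  have "of_real pi * (2 * \<kappa>) = of_real pi * (2 * (\<i> * of_int m))" using m by (simp add: algebra_simps)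
  then have \<kappa>: "\<kappa> = \<i> * of_int m" by simp
  have wh: "wtr ((LINT x|lborel. cmod (h x)) + cmod (- lft h 0)) (\<lambda>z. lft h z + - lft h 0)"
    by (intro wtr_add wtr_ltr ltr_lft hi wtr_const)
  show ?thesis
    by (rule that[OF wh, of c m]) (simp only: u \<kappa>, simp add: algebra_simps)
qed

section \<open>Logarithms of functions bounded away from zero\<close>

text \<open>Up to an exponential, F is p Q with Q = 1 + h / p. As densities form an ideal, h / p is
  the transform of a density, but not of a nice one; a second approximation replaces it by
  \<open>g0\<close>, to which the winding number argument applies.\<close>

theorem wtr_log:
  assumes F: "wtr B F" and \<delta>: "0 < \<delta>" "\<And>z. \<delta> \<le> cmod (F z)"
  obtains m :: int and \<gamma> :: real and A w where "wtr A w" "\<And>z. F z = exp (\<i> * of_real (\<gamma> * z) + 2 * \<i> * of_int m * of_real (arctan z) + w z)"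
proof -
  obtain A1 C1 v w where vw: "dtr A1 v" "ltr C1 w" "F = (\<lambda>z. v z + w z)"
    using F by (rule wtrE) blast
  \<comment> \<open>Two errors of \<delta> / 8 put G within \<delta> / 4 of F, while |G| >= 3
    \<delta> / 4, so F / G has a logarithm. The same proportions recur for Q with d.\<close>
  obtain p where p: "dtr (\<delta> / 8) (\<lambda>z. v z - tpev p z)" using dtr_approx[OF vw(1), of "\<delta> / 8"] \<delta>(1) by auto
  obtain h where h: "nice h" "ltr (\<delta> / 8) (\<lambda>z. w z - lft h z)" using ltr_approx[OF vw(2), of "\<delta> / 8"] \<delta>(1) by auto
  note hi = nice_integrable[OF h(1)]
  let ?G = "\<lambda>z. tpev p z + lft h z"
  have Gw: "wtr (tpn p + (LINT x|lborel. cmod (h x))) ?G"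
    by (intro wtr_sum2 dtr_tpev ltr_lft hi)
  have FG: "cmod (F z - ?G z) \<le> \<delta> / 4" for z
  proof -
    have e: "F z - ?G z = (v z - tpev p z) + (w z - lft h z)" by (simp add: vw(3))
    show ?thesis unfolding e using norm_triangle_ineq[of "v z - tpev p z" "w z - lft h z"] norm_dtr_le[OF p, of z] norm_ltr_le[OF h(2), of z]
      by linarith
  qed
  have Gb: "3 * \<delta> / 4 \<le> cmod (?G z)" for z
    using norm_triangle_ineq2[of "F z" "F z - ?G z"] FG[of z] \<delta>(2)[of z] by simp
  obtain A2 w2 where w2: "wtr A2 w2" "\<And>z. F z = ?G z * exp (w2 z)"
    using wtr_exp_quotient[OF F Gw _ Gb FG] \<delta>(1) by auto
  have Pb: "3 * \<delta> / 4 \<le> cmod (tpev p z)" for z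
    by (rule dtr_add_vanishing_ge[OF dtr_tpev ltr_tendsto_0[OF ltr_lft[OF hi]] Gb]) simp
  have d4: "0 < 3 * \<delta> / 4" using \<delta>(1) by simp
  have Pn: "tpev p z \<noteq> 0" for z using Pb[of z] d4 by auto
  obtain A3 w3 c3 \<gamma>3 where w3: "wtr A3 w3" "\<And>z. tpev p z = c3 * exp (\<i> * \<gamma>3 * of_real z + w3 z)"
    using trigpoly_log[OF d4 Pb] by blast
  obtain D where D: "wtr D (\<lambda>z. inverse (tpev p z))"
    using wtr_inverse[OF wtr_dtr[OF dtr_tpev] d4 Pb] by blast
  have g: "ltr ((LINT x|lborel. cmod (h x)) * D) (\<lambda>z. lft h z * inverse (tpev p z))"
    by (rule ltr_mult_wtr[OF ltr_lft[OF hi] D])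
  let ?Q = "\<lambda>z. 1 + lft h z * inverse (tpev p z)"
  have GQ: "?G z = tpev p z * ?Q z" for z using Pn[of z] by (simp add: field_simps)
  define M where "M = tpn p"
  have M: "0 < M" using d4 Pb[of 0] norm_tpev_le[of p 0] unfolding M_def by linarith
  define d where "d = 3 * \<delta> / 4 / M"
  have d: "0 < d" unfolding d_def using d4 M by simp
  have Qb: "d \<le> cmod (?Q z)" for z
  proof -
    have "3 * \<delta> / 4 \<le> cmod (tpev p z) * cmod (?Q z)" using Gb[of z] unfolding GQ norm_mult .
    also have "\<dots> \<le> M * cmod (?Q z)" unfolding M_def by (intro mult_right_mono norm_tpev_le) auto
    finally show ?thesis unfolding d_def using M by (simp add: pos_divide_le_eq mult.commute)
  qed
  obtain g0 where g0: "nice g0" "ltr (d / 4) (\<lambda>z. lft h z * inverse (tpev p z) - lft g0 z)"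
    using ltr_approx[OF g, of "d / 4"] d by auto
  have QG: "cmod (?Q z - (1 + lft g0 z)) \<le> d / 4" for z
    using norm_ltr_le[OF g0(2), of z] by simp
  have G0b: "3 * d / 4 \<le> cmod (1 + lft g0 z)" for z
    using norm_triangle_ineq2[of "?Q z" "?Q z - (1 + lft g0 z)"] QG[of z] Qb[of z] by simp
  have d34: "0 < 3 * d / 4" using d by simp
  have Qw: "wtr (cmod 1 + (LINT x|lborel. cmod (h x)) * D) ?Q"
    by (intro wtr_sum2 dtr_const g)
  have G0w: "wtr (cmod 1 + (LINT x|lborel. cmod (g0 x))) (\<lambda>z. 1 + lft g0 z)"
    by (intro wtr_sum2 dtr_const ltr_lft nice_integrable g0)
  obtain A4 w4 where w4: "wtr A4 w4" "\<And>z. ?Q z = (1 + lft g0 z) * exp (w4 z)"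
    using wtr_exp_quotient[OF Qw G0w d34 G0b QG] d by auto
  obtain m :: int and A5 w5 c5 where w5: "wtr A5 w5" "\<And>z. 1 + lft g0 z = c5 * exp (2 * \<i> * of_int m * of_real (arctan z) + w5 z)"
    by (rule one_plus_lft_nice_log[OF g0(1) d34 G0b]) (rule that)
  define c where "c = c3 * c5"
  let ?w = "\<lambda>z. Ln c + (w2 z + (w3 z + (w4 z + w5 z)))"
  have W: "wtr (cmod (Ln c) + (A2 + (A3 + (A4 + A5)))) ?w"
    by (intro wtr_add wtr_const w2 w3 w4 w5)
  have Fc: "F z = c * exp (\<i> * \<gamma>3 * of_real z + 2 * \<i> * of_int m * of_real (arctan z) + (w2 z + (w3 z + (w4 z + w5 z))))" for z
  proof -
    have "F z = tpev p z * ?Q z * exp (w2 z)" using w2(2)[of z] unfolding GQ .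
    also have "?Q z = (1 + lft g0 z) * exp (w4 z)" by (rule w4(2))
    also have "1 + lft g0 z = c5 * exp (2 * \<i> * of_int m * of_real (arctan z) + w5 z)" by (rule w5(2))
    also have "tpev p z = c3 * exp (\<i> * \<gamma>3 * of_real z + w3 z)" by (rule w3(2))
    finally have "F z = (c3 * exp (\<i> * \<gamma>3 * of_real z + w3 z)) * (((c5 * exp (2 * \<i> * of_int m * of_real (arctan z) + w5 z))) * exp (w4 z)) * exp (w2 z)"
      .
    then show ?thesis by (simp only: c_def exp_add mult_ac)
  qed
  have "c \<noteq> 0" using Fc[of 0] \<delta>(1) \<delta>(2)[of 0] by auto
  then have Fe: "F z = exp (\<i> * \<gamma>3 * of_real z + 2 * \<i> * of_int m * of_real (arctan z) + ?w z)" for z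
    unfolding Fc by (simp add: exp_add mult_ac)
  \<comment> \<open>Otherwise |F| would decay exponentially in one direction, against the lower
    bound \<delta>: the arctangent term is imaginary and \<open>?w\<close> is bounded.\<close>
  have "Im \<gamma>3 = 0"
  proof (rule ccontr)
    assume ne: "Im \<gamma>3 \<noteq> 0"
    let ?N = "cmod (Ln c) + (A2 + (A3 + (A4 + A5)))"
    have nF: "cmod (F z) = exp (- (Im \<gamma>3 * z) + Re (?w z))" for z
      unfolding Fe norm_exp_eq_Re by simp
    have "Im \<gamma>3 * z \<le> ?N - ln \<delta>" for z
    proof -
      have "exp (ln \<delta>) \<le> exp (- (Im \<gamma>3 * z) + Re (?w z))" using \<delta>(1) \<delta>(2)[of z] unfolding nF by simp
      then have "ln \<delta> \<le> - (Im \<gamma>3 * z) + Re (?w z)" by (simp only: exp_le_cancel_iff)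
      moreover have "Re (?w z) \<le> ?N" using complex_Re_le_cmod[of "?w z"] norm_wtr_le[OF W, of z] by linarith
      ultimately show ?thesis by linarith
    qed
    from this[of "(?N - ln \<delta> + 1) / Im \<gamma>3"] ne show False by simp
  qed
  then have "\<gamma>3 = of_real (Re \<gamma>3)" by (simp add: complex_eq_iff)
  then have "F z = exp (\<i> * of_real (Re \<gamma>3 * z) + 2 * \<i> * of_int m * of_real (arctan z) + ?w z)" for z
    unfolding Fe by (metis mult.assoc of_real_mult)
  then show ?thesis by (rule that[OF W])
qed

subsection \<open>Infinitely divisible distributions\<close>

lemma char_eq_ft: "char M = ft M (\<lambda>x. x) (\<lambda>_. 1)"
  by (auto simp: char_def ft_def fun_eq_iff)

lemma real_distribution_integrable_iexp:
  assumes "real_distribution M" shows "integrable M (\<lambda>x. iexp (z * x))"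
proof -
  interpret real_distribution M by fact
  show ?thesis by (rule integrable_const_bound[of _ 1]) auto
qed

lemma real_distribution_convolution:
  assumes M: "real_distribution M" and N: "real_distribution N"
  shows "real_distribution (convolution M N)" "char (convolution M N) z = char M z * char N z"
proof -
  interpret M: real_distribution M by fact
  interpret N: real_distribution N by fact
  interpret P: pair_prob_space M N ..
  have sm: "sigma_finite_measure M" "sigma_finite_measure N" by unfold_locales
  have m: "(\<lambda>(x, y). x + y) \<in> borel_measurable (M \<Otimes>\<^sub>M N)" by measurable
  show "real_distribution (convolution M N)"
    unfolding convolution_def real_distribution_def real_distribution_axioms_def
    using P.prob_space_distr[OF m] by simp
  have "char (convolution M N) z = ft (M \<Otimes>\<^sub>M N) (\<lambda>(x, y). x + y) (\<lambda>(x, y). 1 * 1) z"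
    unfolding convolution_def char_def ft_def
    by (subst integral_distr[OF m]) (auto intro!: Bochner_Integration.integral_cong)
  also have "\<dots> = ft M (\<lambda>x. x) (\<lambda>_. 1) z * ft N (\<lambda>x. x) (\<lambda>_. 1) z"
    by (rule ft_pair(3)[OF sm]) simp_all
  finally show "char (convolution M N) z = char M z * char N z" unfolding char_eq_ft .
qed

lemma real_distribution_return: "real_distribution (return borel (t::real))" "char (return borel t) z = iexp (z * t)"
proof -
  show "real_distribution (return borel t)"
    unfolding real_distribution_def real_distribution_axioms_def by (simp add: prob_space_return)
  show "char (return borel t) z = iexp (z * t)"
    unfolding char_def by (subst integral_return) auto
qed

lemma real_distribution_uminus:
  assumes M: "real_distribution M"
  shows "real_distribution (distr M borel uminus)" "char (distr M borel uminus) z = char M (- z)"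
proof -
  interpret M: real_distribution M by fact
  have m: "uminus \<in> borel_measurable M" by simp
  show "real_distribution (distr M borel uminus)" by (rule M.real_distribution_distr) simp
  show "char (distr M borel uminus) z = char M (- z)"
    unfolding char_def by (subst integral_distr[OF m]) auto
qed

lemma real_distribution_conv_power:
  assumes "real_distribution R"
  shows "real_distribution (conv_power R n) \<and> char (conv_power R n) = (\<lambda>z. char R z ^ n)"
proof (induction n)
  case 0
  show ?case using real_distribution_return[of 0] by auto
next
  case (Suc n)
  then show ?case using real_distribution_convolution[OF assms, of "conv_power R n"] by auto
qed

section \<open>Convolution semigroups\<close>

text \<open>Requiring a distribution for every t > 0 makes sums, reflections and nonnegative
  multiples immediate; t = 1 / n supplies the convolution roots.\<close>

definition conv_semigroup_exponent :: "(real \<Rightarrow> complex) \<Rightarrow> bool" where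
  "conv_semigroup_exponent \<psi> \<longleftrightarrow> (\<forall>t>0. \<exists>R. real_distribution R \<and> (\<forall>z. char R z = exp (of_real t * \<psi> z)))"

text \<open>Levy's uniqueness theorem identifies the distribution at time 1 with the n-fold
  convolution power of the one at time 1 / n.\<close>

lemma conv_semigroup_exponent_imp_infinitely_divisible:
  assumes "conv_semigroup_exponent \<psi>"
  obtains M where "infinitely_divisible M" "\<And>z. char M z = exp (\<psi> z)"
proof -
  obtain M where M: "real_distribution M" "\<And>z. char M z = exp (of_real 1 * \<psi> z)"
    using assms unfolding conv_semigroup_exponent_def by (meson zero_less_one)
  have "\<exists>R. real_distribution R \<and> M = conv_power R n" if n: "1 \<le> n" for n :: nat
  proof -
    have "0 < 1 / real n" using n by simp
    then obtain R where R: "real_distribution R" "\<And>z. char R z = exp (of_real (1 / real n) * \<psi> z)"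
      using assms unfolding conv_semigroup_exponent_def by meson
    note c = real_distribution_conv_power[OF R(1), of n]
    have "M = conv_power R n"
    proof (rule Levy_uniqueness[OF M(1) conjunct1[OF c]])
      show "char M = char (conv_power R n)"
      proof
        fix z
        have "char (conv_power R n) z = exp (of_nat n * (of_real (1 / real n) * \<psi> z))"
          unfolding conjunct2[OF c] R(2) exp_of_nat_mult ..
        also have "of_nat n * (of_real (1 / real n) * \<psi> z) = of_real 1 * \<psi> z" using n by simp
        finally show "char M z = char (conv_power R n) z" by (simp add: M(2))
      qed
    qed
    then show ?thesis using R(1) by blast
  qed
  then have "infinitely_divisible M" unfolding infinitely_divisible_def using M(1) by blast
  then show ?thesis using M(2) by (intro that[of M]) simp_all
qed

lemma conv_semigroup_exponent_add:
  assumes "conv_semigroup_exponent \<psi>" "conv_semigroup_exponent \<phi>"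
  shows "conv_semigroup_exponent (\<lambda>z. \<psi> z + \<phi> z)"
  unfolding conv_semigroup_exponent_def
proof (intro allI impI)
  fix t :: real assume t: "0 < t"
  obtain R where R: "real_distribution R" "\<And>z. char R z = exp (of_real t * \<psi> z)"
    using assms(1) t unfolding conv_semigroup_exponent_def by meson
  obtain S where S: "real_distribution S" "\<And>z. char S z = exp (of_real t * \<phi> z)"
    using assms(2) t unfolding conv_semigroup_exponent_def by meson
  show "\<exists>R. real_distribution R \<and> (\<forall>z. char R z = exp (of_real t * (\<psi> z + \<phi> z)))"
    using real_distribution_convolution[OF R(1) S(1)]
    by (intro exI[of _ "convolution R S"]) (simp add: R(2) S(2) distrib_left exp_add)
qed

lemma conv_semigroup_exponent_drift: "conv_semigroup_exponent (\<lambda>z. \<i> * of_real (\<gamma> * z))"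
  unfolding conv_semigroup_exponent_def
proof (intro allI impI)
  fix t :: real
  show "\<exists>R. real_distribution R \<and> (\<forall>z. char R z = exp (of_real t * (\<i> * of_real (\<gamma> * z))))"
    using real_distribution_return[of "t * \<gamma>"]
    by (intro exI[of _ "return borel (t * \<gamma>)"]) (simp add: mult_ac)
qed

lemma conv_semigroup_exponent_zero: "conv_semigroup_exponent (\<lambda>_. 0)"
  using conv_semigroup_exponent_drift[of 0] by simp

lemma conv_semigroup_exponent_uminus:
  assumes "conv_semigroup_exponent \<psi>"
  shows "conv_semigroup_exponent (\<lambda>z. \<psi> (- z))"
  unfolding conv_semigroup_exponent_def
proof (intro allI impI)
  fix t :: real assume t: "0 < t"
  obtain R where R: "real_distribution R" "\<And>z. char R z = exp (of_real t * \<psi> z)"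
    using assms(1) t unfolding conv_semigroup_exponent_def by meson
  show "\<exists>R. real_distribution R \<and> (\<forall>z. char R z = exp (of_real t * \<psi> (- z)))"
    using real_distribution_uminus[OF R(1)] by (intro exI[of _ "distr R borel uminus"]) (simp add: R(2))
qed

lemma conv_semigroup_exponent_scale:
  assumes "conv_semigroup_exponent \<psi>" "0 \<le> a"
  shows "conv_semigroup_exponent (\<lambda>z. of_real a * \<psi> z)"
proof (cases "a = 0")
  case True
  then show ?thesis using conv_semigroup_exponent_zero by simp
next
  case False
  show ?thesis unfolding conv_semigroup_exponent_def
  proof (intro allI impI)
    fix t :: real assume "0 < t"
    then have "0 < t * a" using False assms(2) by simp
    then obtain R where "real_distribution R" "\<And>z. char R z = exp (of_real (t * a) * \<psi> z)"
      using assms(1) unfolding conv_semigroup_exponent_def by meson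
    then show "\<exists>R. real_distribution R \<and> (\<forall>z. char R z = exp (of_real t * (of_real a * \<psi> z)))"
      by (intro exI[of _ R]) (simp add: mult.assoc)
  qed
qed

text \<open>The argument stays on the line of real part 1, off the branch cut.\<close>

lemma has_vector_derivative_Ln_affine:
  "((\<lambda>z. Ln (1 + \<i> * of_real (c * z))) has_vector_derivative (\<i> * of_real c) / (1 + \<i> * of_real (c * z))) (at z)"
proof -
  have "1 + \<i> * of_real (c * z) \<notin> \<real>\<^sub>\<le>\<^sub>0" by (auto simp: complex_nonpos_Reals_iff)
  then have 1: "(Ln has_field_derivative inverse (1 + \<i> * of_real (c * z))) (at (1 + \<i> * of_real (c * z)))"
    by (rule has_field_derivative_Ln)
  have 2: "((\<lambda>z. 1 + \<i> * of_real (c * z)) has_vector_derivative (\<i> * of_real c)) (at z)"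
    by (auto intro!: derivative_eq_intros has_vector_derivative_real_field simp: of_real_mult)
  show ?thesis
    using field_vector_diff_chain_at[OF 2 1] by (simp add: comp_def divide_inverse)
qed

text \<open>The recursion from \<open>gammaf t\<close> to \<open>gammaf (t + 1)\<close> says that
  the gamma transform has logarithmic derivative i t / (1 - i z), the same as the power -t of 1 - i
  z; the constant is read off at z = 0.\<close>

lemma conv_semigroup_exponent_gamma: "conv_semigroup_exponent (\<lambda>z. - Ln (1 - \<i> * of_real z))"
  unfolding conv_semigroup_exponent_def
proof (intro allI impI)
  fix t :: real assume t: "0 < t"
  have G: "0 < Gamma t" using t by (rule Gamma_real_pos)
  let ?g = "\<lambda>x. gammaf t x / Gamma t"
  have gi: "integrable lborel (\<lambda>x. of_real (gammaf t x) :: complex)" by (rule integrable_gammaf_complex[OF t])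
  have xg: "of_real x * of_real (gammaf t x) = (of_real (gammaf (t + 1) x) :: complex)" for x
  proof (cases "0 < x")
    case True
    then have "x * x powr (t - 1) = x powr t" by (simp add: powr_mult_base)
    then have "x * gammaf t x = gammaf (t + 1) x" using True by (simp add: gammaf_def mult.assoc[symmetric])
    then show ?thesis by (metis of_real_mult)
  qed (simp add: gammaf_def)
  have xgi: "integrable lborel (\<lambda>x. of_real x * (of_real (gammaf t x) :: complex))"
    unfolding xg using t by (intro integrable_gammaf_complex) simp
  define g1 where "g1 = lft (\<lambda>x. of_real (gammaf t x)) 0"
  have e: "lft (\<lambda>x. of_real (gammaf t x)) = (\<lambda>z. (LINT x|lborel. of_real (gammaf t x) * (iexp (z * x) - 1)) + g1)"
  proof
    fix z
    show "lft (\<lambda>x. of_real (gammaf t x)) z = (LINT x|lborel. of_real (gammaf t x) * (iexp (z * x) - 1)) + g1"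
      unfolding g1_def ft_def using gi integrable_times_iexp[OF gi, of "\<lambda>x. x" z] by (simp add: right_diff_distrib)
  qed
  have "((\<lambda>z. LINT x|lborel. of_real (gammaf t x) * (iexp (z * x) - 1)) has_vector_derivative \<i> * lft (\<lambda>x. of_real x * of_real (gammaf t x)) z) (at z)" for z
    by (rule has_vector_derivative_ft) (use xgi in auto)
  then have ud: "(lft (\<lambda>x. of_real (gammaf t x)) has_vector_derivative \<i> * lft (\<lambda>x. of_real (gammaf (t + 1) x)) z) (at z)" for z
    unfolding e xg has_vector_derivative_add_const .
  have Ld: "((\<lambda>z. of_real t * - Ln (1 + \<i> * of_real (- 1 * z))) has_vector_derivative of_real t * - ((\<i> * of_real (- 1)) / (1 + \<i> * of_real (- 1 * z)))) (at z)" for z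
    by (intro has_vector_derivative_mult_right has_vector_derivative_minus has_vector_derivative_Ln_affine)
  obtain c where c: "\<And>z. lft (\<lambda>x. of_real (gammaf t x)) z = c * exp (of_real t * - Ln (1 + \<i> * of_real (- 1 * z)))"
  proof (rule log_derivative_unique[OF ud Ld])
    fix z
    show "\<i> * lft (\<lambda>x. of_real (gammaf (t + 1) x)) z = lft (\<lambda>x. of_real (gammaf t x)) z * (of_real t * - ((\<i> * of_real (- 1)) / (1 + \<i> * of_real (- 1 * z))))"
    proof -
      have "(1 - \<i> * of_real z) * lft (\<lambda>x. of_real (gammaf (t + 1) x)) z = of_real t * lft (\<lambda>x. of_real (gammaf t x)) z"
        using lft_gammaf_FTC[of t z] t by simp
      then have "lft (\<lambda>x. of_real (gammaf (t + 1) x)) z = of_real t * lft (\<lambda>x. of_real (gammaf t x)) z / (1 - \<i> * of_real z)"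
        using one_minus_ii_ne_0[of z] by (simp add: nonzero_eq_divide_eq mult.commute)
      then show ?thesis by simp
    qed
  qed blast
  have "c = of_real (Gamma t)"
  proof -
    have "lft (\<lambda>x. of_real (gammaf t x)) 0 = of_real (LINT x|lborel. gammaf t x)"
      unfolding ft_def by simp
    also have "(LINT x|lborel. gammaf t x) = Gamma t"
      using has_bochner_integral_gammaf[OF t] by (rule has_bochner_integral_integral_eq)
    finally show ?thesis using c[of 0] by simp
  qed
  define R where "R = density lborel (\<lambda>x. ennreal (?g x))"
  have gn: "0 \<le> ?g x" for x using G by (simp add: gammaf_nonneg)
  have "prob_space R"
  proof
    have "emeasure R (space R) = (\<integral>\<^sup>+x. ennreal (?g x) \<partial>lborel)" unfolding R_def by (simp add: emeasure_density)
    also have "\<dots> = ennreal (LINT x|lborel. ?g x)"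
      using integrable_gammaf[OF t] gn by (intro nn_integral_eq_integral) auto
    also have "(LINT x|lborel. ?g x) = 1"
      using has_bochner_integral_integral_eq[OF has_bochner_integral_gammaf[OF t]] G by simp
    finally show "emeasure R (space R) = 1" by simp
  qed
  then have "real_distribution R" unfolding real_distribution_def real_distribution_axioms_def by (simp add: R_def)
  moreover have "char R z = exp (of_real t * - Ln (1 - \<i> * of_real z))" for z
  proof -
    have "char R z = (LINT x|lborel. ?g x *\<^sub>R iexp (z * x))"
      unfolding char_def R_def using gn by (intro integral_density) auto
    also have "\<dots> = (LINT x|lborel. of_real (gammaf t x) * iexp (z * x) / of_real (Gamma t))"
      by (intro Bochner_Integration.integral_cong) (auto simp: scaleR_conv_of_real)
    also have "\<dots> = lft (\<lambda>x. of_real (gammaf t x)) z / of_real (Gamma t)"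
      unfolding ft_def by (rule integral_divide_zero)
    finally show ?thesis using c[of z] G \<open>c = of_real (Gamma t)\<close> by simp
  qed
  ultimately show "\<exists>R. real_distribution R \<and> (\<forall>z. char R z = exp (of_real t * - Ln (1 - \<i> * of_real z)))" by blast
qed

text \<open>The generating function of the Poisson distribution at a complex point, summed as an
  exponential series.\<close>

lemma integral_poisson_power:
  assumes r: "0 < r"
  shows "(LINT k|measure_pmf (poisson_pmf r). (c::complex) ^ k) = exp (of_real r * (c - 1))"
proof -
  let ?f = "\<lambda>k. (r ^ k / fact k * exp (- r)) *\<^sub>R c ^ k"
  have f: "?f k = of_real (exp (- r)) * ((of_real r * c) ^ k /\<^sub>R fact k)" for k
    by (simp add: scaleR_conv_of_real power_mult_distrib field_simps)
  have "(LINT k|measure_pmf (poisson_pmf r). c ^ k) = (LINT k|count_space UNIV. ?f k)"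
    unfolding measure_pmf_eq_density pmf_poisson[OF r, symmetric]
    by (intro integral_density AE_I2) (simp_all add: less_imp_le[OF r] r)
  moreover have "integrable (count_space UNIV) ?f"
    unfolding integrable_count_space_nat_iff f norm_mult
    using summable_norm_exp[of "of_real r * c"] by (intro summable_mult) simp
  then have "?f sums (LINT k|count_space UNIV. ?f k)" by (rule sums_integral_count_space_nat)
  moreover have "?f sums (of_real (exp (- r)) * exp (of_real r * c))"
    unfolding f by (intro sums_mult exp_converges)
  ultimately have "(LINT k|measure_pmf (poisson_pmf r). c ^ k) = of_real (exp (- r)) * exp (of_real r * c)"
    using sums_unique2 by metis
  also have "\<dots> = exp (of_real r * (c - 1))" by (simp add: exp_of_real exp_diff exp_minus right_diff_distrib divide_inverse mult.commute)
  finally show ?thesis .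
qed

text \<open>At time t the distribution is a Poisson mixture of convolution powers: the number of
  jumps has parameter t times the mass of N, and each jump follows the normalised law Q.\<close>

lemma conv_semigroup_exponent_compound_poisson:
  fixes N :: "real measure"
  assumes N: "finite_measure N" "sets N = sets borel"
  shows "conv_semigroup_exponent (\<lambda>z. LINT x|N. iexp (z * x) - 1)"
proof -
  interpret N: finite_measure N by fact
  have mN: "(\<lambda>x. f x) \<in> borel_measurable N" if "f \<in> borel_measurable borel" for f :: "real \<Rightarrow> complex"
    using that measurable_cong_sets[OF N(2) refl] by blast
  show ?thesis
  proof (cases "measure N (space N) = 0")
    \<comment> \<open>The zero measure cannot be normalised.\<close>
    case True
    then have "emeasure N (space N) = 0" by (simp add: N.emeasure_eq_measure)
    then have "AE x in N. False" by (simp add: AE_iff_measurable[OF sets.top])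
    then have "(LINT x|N. iexp (z * x) - 1) = (LINT x|N. 0)" for z
      by (intro integral_cong_AE) (auto intro: mN)
    then show ?thesis using conv_semigroup_exponent_zero by simp
  next
    case False
    define l where "l = measure N (space N)"
    have l: "0 < l" using False unfolding l_def by (simp add: zero_less_measure_iff)
    define Q where "Q = density N (\<lambda>_. ennreal (1 / l))"
    have "prob_space Q"
    proof
      show "emeasure Q (space Q) = 1" unfolding Q_def
        using l by (simp add: emeasure_density_const N.emeasure_eq_measure l_def[symmetric] flip: ennreal_mult')
    qed
    then have Q: "real_distribution Q" unfolding real_distribution_def real_distribution_axioms_def by (simp add: Q_def N)
    have chQ: "of_real l * (char Q z - 1) = (LINT x|N. iexp (z * x) - 1)" for z
    proof -
      have "char Q z = (LINT x|N. (1 / l) *\<^sub>R iexp (z * x))"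
        unfolding char_def Q_def using l by (intro integral_density) (auto intro: mN)
      then have "of_real l * char Q z = (LINT x|N. iexp (z * x))" using l by (simp add: scaleR_conv_of_real)
      moreover have "integrable N (\<lambda>x. iexp (z * x))"
        by (rule N.integrable_const_bound[of _ 1]) (auto intro: mN)
      ultimately show ?thesis by (simp add: right_diff_distrib l_def scaleR_conv_of_real)
    qed
    show ?thesis unfolding conv_semigroup_exponent_def
    proof (intro allI impI)
      fix t :: real assume t: "0 < t"
      let ?P = "measure_pmf (poisson_pmf (t * l))"
      note cp = real_distribution_conv_power[OF Q]
      interpret C: real_distribution "conv_power Q k" for k using cp by blast
      have ps: "prob_space (conv_power Q k)" "subprob_space (conv_power Q k)" for k by unfold_locales
      have km: "conv_power Q \<in> measurable ?P (subprob_algebra borel)"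
        using ps by (auto simp: space_subprob_algebra)
      define R where "R = ?P \<bind> conv_power Q"
      have Rs: "sets R = sets borel" unfolding R_def by (rule sets_bind) auto
      have "prob_space R" unfolding R_def
        by (rule measure_pmf.prob_space_bind[OF _ km]) (use ps in auto)
      then have R: "real_distribution R" unfolding real_distribution_def real_distribution_axioms_def by (simp add: Rs)
      interpret R: real_distribution R by fact
      \<comment> \<open>The mixture formula concerns real integrands, so real and imaginary parts
        are compared separately below.\<close>
      have ib: "(LINT x|R. f x) = (LINT k|?P. LINT x|conv_power Q k. f x)"
        if "f \<in> borel_measurable borel" "\<And>x. \<bar>f x\<bar> \<le> 1" for f :: "real \<Rightarrow> real"
        unfolding R_def
        by (rule integral_bind[where K=borel and B=1 and B'=1])
           (use that km ps in \<open>auto intro!: AE_I2 subprob_space.subprob_emeasure_le_1 measure_pmf.finite_measure_axioms\<close>)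
      have pin: "integrable ?P (\<lambda>k. char Q z ^ k)" for z
        by (rule measure_pmf.integrable_const_bound[of _ 1])
           (auto simp: norm_power intro!: AE_I2 power_le_one real_distribution.cmod_char_le_1[OF Q])
      have "char R z = exp (of_real t * (LINT x|N. iexp (z * x) - 1))" for z
      proof -
        have "Re (char R z) = Re (LINT k|?P. char Q z ^ k)"
        proof -
          have "Re (char R z) = (LINT x|R. Re (iexp (z * x)))"
            unfolding char_def by (rule integral_Re[symmetric]) (rule real_distribution_integrable_iexp[OF R])
          also have "\<dots> = (LINT k|?P. LINT x|conv_power Q k. Re (iexp (z * x)))"
            by (rule ib) (auto simp: abs_Re_le_cmod intro: order_trans[OF abs_Re_le_cmod])
          also have "\<dots> = (LINT k|?P. Re (char (conv_power Q k) z))"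
            unfolding char_def by (intro Bochner_Integration.integral_cong refl integral_Re) (rule real_distribution_integrable_iexp, simp add: cp)
          also have "\<dots> = (LINT k|?P. Re (char Q z ^ k))" using cp by simp
          also have "\<dots> = Re (LINT k|?P. char Q z ^ k)" by (rule integral_Re[OF pin])
          finally show ?thesis .
        qed
        moreover have "Im (char R z) = Im (LINT k|?P. char Q z ^ k)"
        proof -
          have "Im (char R z) = (LINT x|R. Im (iexp (z * x)))"
            unfolding char_def by (rule integral_Im[symmetric]) (rule real_distribution_integrable_iexp[OF R])
          also have "\<dots> = (LINT k|?P. LINT x|conv_power Q k. Im (iexp (z * x)))"
            by (rule ib) (auto simp: abs_Im_le_cmod intro: order_trans[OF abs_Im_le_cmod])
          also have "\<dots> = (LINT k|?P. Im (char (conv_power Q k) z))"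
            unfolding char_def by (intro Bochner_Integration.integral_cong refl integral_Im) (rule real_distribution_integrable_iexp, simp add: cp)
          also have "\<dots> = (LINT k|?P. Im (char Q z ^ k))" using cp by simp
          also have "\<dots> = Im (LINT k|?P. char Q z ^ k)" by (rule integral_Im[OF pin])
          finally show ?thesis .
        qed
        ultimately have "char R z = (LINT k|?P. char Q z ^ k)" by (rule complex_eqI)
        also have "\<dots> = exp (of_real (t * l) * (char Q z - 1))"
          using t l by (intro integral_poisson_power) simp
        also have "of_real (t * l) * (char Q z - 1) = of_real t * (LINT x|N. iexp (z * x) - 1)"
          using chQ[of z] by (simp add: mult.assoc)
        finally show ?thesis .
      qed
      then show "\<exists>R. real_distribution R \<and> (\<forall>z. char R z = exp (of_real t * (LINT x|N. iexp (z * x) - 1)))"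
        using R by blast
    qed
  qed
qed

section \<open>Lower bounds for characteristic functions\<close>

lemma INF_cmod_pos_iff:
  fixes F :: "real \<Rightarrow> complex"
  shows "(INF z. cmod (F z)) > 0 \<longleftrightarrow> (\<exists>\<delta>>0. \<forall>z. \<delta> \<le> cmod (F z))"
proof
  assume p: "(INF z. cmod (F z)) > 0"
  have "bdd_below (range (\<lambda>z. cmod (F z)))" by (rule bdd_belowI[of _ 0]) auto
  then have "(INF z. cmod (F z)) \<le> cmod (F z)" for z by (rule cINF_lower) simp
  with p show "\<exists>\<delta>>0. \<forall>z. \<delta> \<le> cmod (F z)" by (intro exI[of _ "INF z. cmod (F z)"]) simp
next
  assume "\<exists>\<delta>>0. \<forall>z. \<delta> \<le> cmod (F z)"
  then obtain \<delta> where \<delta>: "0 < \<delta>" "\<And>z. \<delta> \<le> cmod (F z)" by blast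
  have "\<delta> \<le> (INF z. cmod (F z))" by (rule cINF_greatest) (auto simp: \<delta>)
  with \<delta>(1) show "(INF z. cmod (F z)) > 0" by linarith
qed

lemma continuous_nonzero_bounded_below:
  fixes F :: "real \<Rightarrow> complex"
  assumes cont: "\<And>z. isCont F z" and nz: "\<And>z. F z \<noteq> 0" and c: "0 < c" "\<And>z. R \<le> \<bar>z\<bar> \<Longrightarrow> c \<le> cmod (F z)"
  shows "\<exists>\<delta>>0. \<forall>z. \<delta> \<le> cmod (F z)"
proof -
  define K where "K = {- \<bar>R\<bar>..\<bar>R\<bar>}"
  have "continuous_on K (\<lambda>z. cmod (F z))"
    by (intro continuous_on_norm continuous_at_imp_continuous_on ballI cont)
  moreover have "compact K" "K \<noteq> {}" by (auto simp: K_def)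
  ultimately obtain x where x: "\<And>z. z \<in> K \<Longrightarrow> cmod (F x) \<le> cmod (F z)"
    using continuous_attains_inf[of K "\<lambda>z. cmod (F z)"] by blast
  show ?thesis
  proof (intro exI[of _ "min c (cmod (F x))"] conjI allI)
    show "0 < min c (cmod (F x))" using c(1) nz by simp
    show "min c (cmod (F x)) \<le> cmod (F z)" for z
    proof (cases "z \<in> K")
      case True
      then show ?thesis using x by (simp add: min.coboundedI2)
    next
      case False
      then have "R \<le> \<bar>z\<bar>" by (auto simp: K_def)
      then show ?thesis using c(2) by (simp add: min.coboundedI1)
    qed
  qed
qed

text \<open>The second difference of exp(i z x) in z is exp(i z x) (2 cos(h x) - 2), whose modulus 2
  - 2 cos(h x) integrates to 2 (1 - \<theta> h).\<close>

lemma char_second_difference: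
  assumes Q: "real_distribution Q" and ch: "\<And>z. char Q z = of_real (\<theta> z)"
  shows "\<bar>\<theta> (z + h) + \<theta> (z - h) - 2 * \<theta> z\<bar> \<le> 2 * (1 - \<theta> h)"
proof -
  note i = real_distribution_integrable_iexp[OF Q]
  interpret Q: real_distribution Q by fact
  have ci: "integrable Q (\<lambda>x. cos (h * x))" by (rule Q.integrable_const_bound[of _ 1]) auto
  have f: "iexp ((z + h) * x) + iexp ((z - h) * x) - 2 * iexp (z * x) = iexp (z * x) * of_real (2 * cos (h * x) - 2)" for x
  proof -
    have e1: "iexp (h * x) + iexp (- (h * x)) = of_real (2 * cos (h * x))"
      by (simp add: complex_eq_iff Re_exp Im_exp)
    have e2: "iexp ((z + h) * x) = iexp (z * x) * iexp (h * x)" "iexp ((z - h) * x) = iexp (z * x) * iexp (- (h * x))"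
      by (simp_all add: algebra_simps flip: exp_add)
    have "iexp ((z + h) * x) + iexp ((z - h) * x) - 2 * iexp (z * x) = iexp (z * x) * ((iexp (h * x) + iexp (- (h * x))) - 2)"
      unfolding e2 by (simp only: right_diff_distrib distrib_left mult.commute[of _ 2])
    then show ?thesis unfolding e1 by simp
  qed
  have "of_real (\<theta> (z + h) + \<theta> (z - h) - 2 * \<theta> z) = (LINT x|Q. iexp ((z + h) * x) + iexp ((z - h) * x) - 2 * iexp (z * x))"
    using i[of "z + h"] i[of "z - h"] i[of z] ch[of "z + h"] ch[of "z - h"] ch[of z] unfolding char_def
    by (simp only: Bochner_Integration.integral_diff Bochner_Integration.integral_add Bochner_Integration.integrable_add integrable_mult_right integral_mult_right_zero of_real_add of_real_diff of_real_mult of_real_numeral)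
  also have "\<dots> = (LINT x|Q. iexp (z * x) * of_real (2 * cos (h * x) - 2))" by (simp only: f)
  finally have "cmod (of_real (\<theta> (z + h) + \<theta> (z - h) - 2 * \<theta> z)) \<le> (LINT x|Q. cmod (iexp (z * x) * of_real (2 * cos (h * x) - 2)))"
    using integral_norm_bound[of Q "\<lambda>x. iexp (z * x) * of_real (2 * cos (h * x) - 2)"] by (simp only:)
  also have "\<dots> = (LINT x|Q. 2 - 2 * cos (h * x))"
  proof (intro Bochner_Integration.integral_cong refl)
    fix x
    have "\<bar>2 * cos (h * x) - 2\<bar> = 2 - 2 * cos (h * x)" using cos_le_one[of "h * x"] by linarith
    then show "cmod (iexp (z * x) * of_real (2 * cos (h * x) - 2)) = 2 - 2 * cos (h * x)"
      by (simp only: norm_mult norm_exp_i_times norm_of_real mult_1)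
  qed
  also have "\<dots> = 2 - 2 * (LINT x|Q. cos (h * x))" using ci Q.prob_space by simp
  also have "(LINT x|Q. cos (h * x)) = \<theta> h"
  proof -
    have "(LINT x|Q. cos (h * x)) = (LINT x|Q. Re (iexp (h * x)))"
      by (intro Bochner_Integration.integral_cong refl) (simp add: Re_exp)
    also have "\<dots> = Re (char Q h)" unfolding char_def by (rule integral_Re[OF i])
    finally show ?thesis by (simp add: ch)
  qed
  finally show ?thesis by (simp only: norm_of_real) simp
qed

text \<open>The derivative of exp at 0, taken along a / (n + 1) with a = 2 ln x.\<close>

lemma tendsto_n_mult_powr_minus_one:
  fixes x :: real
  assumes "0 < x"
  shows "(\<lambda>n. real (Suc n) * (x powr (2 / real (Suc n)) - 1)) \<longlonglongrightarrow> 2 * ln x"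
proof (cases "x = 1")
  case False
  define a where "a = 2 * ln x"
  have a: "a \<noteq> 0" using False assms by (simp add: a_def)
  have 1: "((\<lambda>h. (exp (0 + h) - exp 0) / h) \<longlongrightarrow> exp (0::real)) (at 0)"
    using DERIV_exp[of "0::real"] unfolding DERIV_def .
  have 2: "filterlim (\<lambda>n. a / real (Suc n)) (at 0) sequentially"
  proof (rule filterlim_atI)
    show "(\<lambda>n. a / real (Suc n)) \<longlonglongrightarrow> 0"
      using tendsto_mult[OF tendsto_const LIMSEQ_inverse_real_of_nat, of a] by (simp add: divide_inverse)
    show "\<forall>\<^sub>F n in sequentially. a / real (Suc n) \<noteq> 0" using a by simp
  qed
  have "(\<lambda>n. a * ((exp (0 + a / real (Suc n)) - exp 0) / (a / real (Suc n)))) \<longlonglongrightarrow> a * exp 0"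
    by (intro tendsto_mult tendsto_const filterlim_compose[OF 1 2])
  moreover have "a * ((exp (0 + a / real (Suc n)) - exp 0) / (a / real (Suc n))) = real (Suc n) * (x powr (2 / real (Suc n)) - 1)" for n
    using a assms by (simp add: powr_def a_def mult.commute)
  ultimately show ?thesis by (simp add: a_def)
qed simp

context
  fixes M :: "real measure"
  assumes ID: "infinitely_divisible M"
begin

text \<open>If R is a convolution root of order n + 1, its symmetrisation has the real
  characteristic function |char R|^2, which is |char M| to the power 2 / (n + 1).\<close>

lemma infinitely_divisible_root_second_difference:
  defines "\<theta> \<equiv> \<lambda>n z. (cmod (char M z)) powr (2 / real (Suc n))"
  shows "\<bar>\<theta> n (z + h) + \<theta> n (z - h) - 2 * \<theta> n z\<bar> \<le> 2 * (1 - \<theta> n h)"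
proof -
  obtain R where R: "real_distribution R" "M = conv_power R (Suc n)"
    using ID unfolding infinitely_divisible_def by (metis le_add1 plus_1_eq_Suc)
  have ch: "char M z = char R z ^ Suc n" for z
    using real_distribution_conv_power[OF R(1), of "Suc n"] R(2) by simp
  have th: "\<theta> n z = (cmod (char R z))\<^sup>2" for z
  proof (cases "char R z = 0")
    case False
    then have c: "0 < cmod (char R z)" by simp
    have "\<theta> n z = (cmod (char R z) ^ Suc n) powr (2 / real (Suc n))" by (simp only: \<theta>_def ch norm_power)
    also have "\<dots> = cmod (char R z) powr (real (Suc n) * (2 / real (Suc n)))"
      using c by (simp only: powr_realpow[symmetric] powr_powr)
    also have "real (Suc n) * (2 / real (Suc n)) = real 2" by (simp del: of_nat_Suc)
    also have "cmod (char R z) powr real 2 = (cmod (char R z))\<^sup>2" using c by (rule powr_realpow)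
    finally show ?thesis .
  qed (simp add: \<theta>_def ch)
  note u = real_distribution_uminus[OF R(1)]
  note c = real_distribution_convolution[OF R(1) u(1)]
  have "char R (- z) = cnj (char R z)" for z
  proof -
    have "cnj (char R z) = ft R (\<lambda>x. - x) (\<lambda>x. cnj 1) z" unfolding char_eq_ft by (rule cnj_ft)
    then show ?thesis by (simp add: ft_def char_def)
  qed
  then have cj: "char R (- z) = cnj (char R z)" for z .
  have "char (convolution R (distr R borel uminus)) z = of_real (\<theta> n z)" for z
    unfolding c(2) u(2) th cj by (rule complex_norm_square[symmetric])
  then show ?thesis by (rule char_second_difference[OF c(1)])
qed

text \<open>If char M vanished at 2 z but not at z, the second difference with step z, where
  \<theta> n is 1 at 0 and 0 at 2 z, would keep \<theta> n z below 3 / 4, although it tends to 1. So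
  nonvanishing is inherited under doubling, and it holds near 0 by continuity.\<close>

lemma infinitely_divisible_char_nonzero: "char M z \<noteq> 0"
proof -
  interpret real_distribution M using ID unfolding infinitely_divisible_def by blast
  let ?\<theta> = "\<lambda>n z. (cmod (char M z)) powr (2 / real (Suc n))"
  have dbl: "char M (2 * z) \<noteq> 0" if nz: "char M z \<noteq> 0" for z
  proof
    assume z0: "char M (2 * z) = 0"
    have "\<bar>?\<theta> n (z + z) + ?\<theta> n (z - z) - 2 * ?\<theta> n z\<bar> \<le> 2 * (1 - ?\<theta> n z)" for n
      by (rule infinitely_divisible_root_second_difference)
    then have le: "1 \<le> 4 * (1 - ?\<theta> n z)" for n
      using z0 char_zero by (smt (verit) mult_2 diff_self norm_one norm_zero powr_one_eq_one powr_zero_eq_one powr_eq_0_iff)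
    have "(\<lambda>n. cmod (char M z) powr (2 * inverse (real (Suc n)))) \<longlonglongrightarrow> cmod (char M z) powr (2 * 0)"
      using nz by (intro tendsto_powr tendsto_mult tendsto_const LIMSEQ_inverse_real_of_nat) auto
    then have "(\<lambda>n. ?\<theta> n z) \<longlonglongrightarrow> 1" using nz by (simp add: divide_inverse)
    then have "(\<lambda>n. 4 * (1 - ?\<theta> n z)) \<longlonglongrightarrow> 4 * (1 - 1)" by (intro tendsto_intros)
    from LIMSEQ_le_const[OF this, of 1] le show False by auto
  qed
  have "(\<lambda>k. z * (1 / 2) ^ k) \<longlonglongrightarrow> z * 0"
    by (intro tendsto_mult tendsto_const LIMSEQ_realpow_zero) auto
  then have "(\<lambda>k. char M (z * (1 / 2) ^ k)) \<longlonglongrightarrow> char M 0"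
    using isCont_tendsto_compose[OF isCont_char[of 0]] by simp
  then have "(\<lambda>k. cmod (char M (z * (1 / 2) ^ k))) \<longlonglongrightarrow> 1"
    using tendsto_norm[of "\<lambda>k. char M (z * (1 / 2) ^ k)" "char M 0"] char_zero by simp
  then have "\<forall>\<^sub>F k in sequentially. 0 < cmod (char M (z * (1 / 2) ^ k))"
    by (rule order_tendstoD) simp
  then obtain k where "char M (z * (1 / 2) ^ k) \<noteq> 0"
    using eventually_happens'[OF sequentially_bot] by fastforce
  then show "char M z \<noteq> 0"
  proof (induction k)
    case (Suc k)
    have "2 * (z * (1 / 2) ^ Suc k) = z * (1 / 2) ^ k" by simp
    then show ?case using dbl[OF Suc.prems] Suc.IH by simp
  qed simp
qed

text \<open>The inequality for the roots, multiplied by n + 1, in the limit: each \<theta> n z - 1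
  becomes 2 ln |char M z|, and the subtracted ones cancel in the second difference.\<close>

lemma infinitely_divisible_log_second_difference:
  defines "l \<equiv> \<lambda>z. ln (cmod (char M z))"
  shows "\<bar>l (z + h) + l (z - h) - 2 * l z\<bar> \<le> - 2 * l h"
proof -
  let ?\<theta> = "\<lambda>n z. (cmod (char M z)) powr (2 / real (Suc n))"
  have lim: "(\<lambda>n. real (Suc n) * (?\<theta> n z - 1)) \<longlonglongrightarrow> 2 * l z" for z
    unfolding l_def using infinitely_divisible_char_nonzero by (intro tendsto_n_mult_powr_minus_one) simp
  have le: "\<bar>real (Suc n) * (?\<theta> n (z + h) - 1) + real (Suc n) * (?\<theta> n (z - h) - 1) - 2 * (real (Suc n) * (?\<theta> n z - 1))\<bar>
      \<le> - 2 * (real (Suc n) * (?\<theta> n h - 1))" for n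
  proof -
    have "real (Suc n) * (?\<theta> n (z + h) - 1) + real (Suc n) * (?\<theta> n (z - h) - 1) - 2 * (real (Suc n) * (?\<theta> n z - 1))
      = real (Suc n) * (?\<theta> n (z + h) + ?\<theta> n (z - h) - 2 * ?\<theta> n z)" by (simp only: algebra_simps)
    also have "\<bar>\<dots>\<bar> = real (Suc n) * \<bar>?\<theta> n (z + h) + ?\<theta> n (z - h) - 2 * ?\<theta> n z\<bar>"
      by (simp only: abs_mult abs_of_nat)
    also have "\<dots> \<le> real (Suc n) * (2 * (1 - ?\<theta> n h))"
      by (intro mult_left_mono infinitely_divisible_root_second_difference of_nat_0_le_iff)
    also have "\<dots> = - 2 * (real (Suc n) * (?\<theta> n h - 1))" by (simp only: algebra_simps)
    finally show ?thesis .
  qed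
  have "\<bar>2 * l (z + h) + 2 * l (z - h) - 2 * (2 * l z)\<bar> \<le> - 2 * (2 * l h)"
  proof (rule LIMSEQ_le)
    show "(\<lambda>n. \<bar>real (Suc n) * (?\<theta> n (z + h) - 1) + real (Suc n) * (?\<theta> n (z - h) - 1) - 2 * (real (Suc n) * (?\<theta> n z - 1))\<bar>)
        \<longlonglongrightarrow> \<bar>2 * l (z + h) + 2 * l (z - h) - 2 * (2 * l z)\<bar>"
      by (intro tendsto_rabs tendsto_diff tendsto_add lim tendsto_mult[OF tendsto_const lim])
    show "(\<lambda>n. - 2 * (real (Suc n) * (?\<theta> n h - 1))) \<longlonglongrightarrow> - 2 * (2 * l h)"
      by (rule tendsto_mult[OF tendsto_const lim])
  qed (use le in blast)
  then show ?thesis by linarith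
qed

end

text \<open>The second difference is centred at z + h, where a step h in [0, L] brings u near u 0.
  It reads l z >= 2 l (z + h) - l (z + 2 h) - K h, the term - l (z + 2 h) is nonnegative since
  |char| <= 1, and K is bounded on [0, L].\<close>

theorem quasi_infinitely_divisible_imp_bounded_below:
  assumes qid: "quasi_infinitely_divisible \<mu>" and F: "\<And>z. char \<mu> z = u z + v z"
    and u: "dtr A u" "u 0 \<noteq> 0" and v: "ltr B v"
  shows "\<exists>\<delta>>0. \<forall>z. \<delta> \<le> cmod (char \<mu> z)"
proof -
  obtain M1 M2 where M: "infinitely_divisible M1" "infinitely_divisible M2" "\<And>z. char \<mu> z = char M1 z / char M2 z"
    using qid unfolding quasi_infinitely_divisible_def by blast
  interpret mu: real_distribution \<mu> using qid unfolding quasi_infinitely_divisible_def by blast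
  interpret M1: real_distribution M1 using M(1) unfolding infinitely_divisible_def by blast
  interpret M2: real_distribution M2 using M(2) unfolding infinitely_divisible_def by blast
  note nz1 = infinitely_divisible_char_nonzero[OF M(1)] and nz2 = infinitely_divisible_char_nonzero[OF M(2)]
  have nz: "char \<mu> z \<noteq> 0" for z using nz1 nz2 by (simp add: M(3))
  define l where "l = (\<lambda>z. ln (cmod (char \<mu> z)))"
  let ?l1 = "\<lambda>z. ln (cmod (char M1 z))" and ?l2 = "\<lambda>z. ln (cmod (char M2 z))"
  have l: "l z = ?l1 z - ?l2 z" for z
    unfolding l_def M(3) norm_divide using nz1 nz2 by (simp add: ln_div)
  \<comment> \<open>The two logarithms are subtracted, but the bounds of their second differences
    add.\<close>
  define K where "K = (\<lambda>h. - 2 * ?l1 h - 2 * ?l2 h)"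
  have lK: "\<bar>l (z + h) + l (z - h) - 2 * l z\<bar> \<le> K h" for z h
  proof -
    have gen: "\<bar>a - a' + (b - b') - 2 * (c - c')\<bar> \<le> - 2 * d - 2 * d'"
      if "\<bar>a + b - 2 * c\<bar> \<le> - 2 * d" "\<bar>a' + b' - 2 * c'\<bar> \<le> - 2 * d'" for a b c d a' b' c' d' :: real
      using that by (intro abs_leI) (simp_all add: abs_le_iff)
    show ?thesis unfolding l K_def
      by (intro gen infinitely_divisible_log_second_difference M)
  qed
  \<comment> \<open>A quarter of |u 0|, so that |u| >= 3 e at z + h, and |u + v| >= 2 e once |v| <
    e.\<close>
  define e where "e = cmod (u 0) / 4"
  have e: "0 < e" using u(2) by (simp add: e_def)
  obtain L where L: "0 \<le> L" "\<And>\<tau>. \<exists>h\<in>{0..L}. \<forall>z. cmod (u (z + \<tau> + h) - u z) \<le> e"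
    by (rule dtr_almost_periodic[OF u(1) e]) blast
  have "continuous_on {0..L} K"
    unfolding K_def using nz1 nz2
    by (intro continuous_intros continuous_at_imp_continuous_on ballI M1.isCont_char M2.isCont_char) auto
  then have "\<exists>x\<in>{0..L}. \<forall>y\<in>{0..L}. K y \<le> K x"
    using L(1) by (intro continuous_attains_sup) auto
  then obtain x where "\<forall>y\<in>{0..L}. K y \<le> K x" by blast
  then have x: "\<And>h. h \<in> {0..L} \<Longrightarrow> K h \<le> K x" by simp
  have "\<forall>\<^sub>F z in at_top. cmod (v z) < e" "\<forall>\<^sub>F z in at_bot. cmod (v z) < e"
    using tendstoD[OF ltr_tendsto_0[OF v, of at_top] e] tendstoD[OF ltr_tendsto_0[OF v, of at_bot] e] by auto
  then obtain R1 R2 where R1: "\<And>z. R1 \<le> z \<Longrightarrow> cmod (v z) < e" and R2: "\<And>z. z \<le> R2 \<Longrightarrow> cmod (v z) < e"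
    unfolding eventually_at_top_linorder eventually_at_bot_linorder by blast
  \<comment> \<open>Adding L keeps z + h beyond R1 or below R2, whichever end z lies at.\<close>
  define R where "R = \<bar>R1\<bar> + \<bar>R2\<bar> + L"
  have l0: "l z \<le> 0" for z
    unfolding l_def using mu.cmod_char_le_1[of z] nz[of z] by (simp add: ln_le_zero_iff)
  have big: "exp (2 * ln (2 * e) - K x) \<le> cmod (char \<mu> z)" if z: "R \<le> \<bar>z\<bar>" for z
  proof -
    obtain h where h: "h \<in> {0..L}" "\<And>y. cmod (u (y + z + h) - u y) \<le> e" using L(2)[of z] by blast
    have vz: "cmod (v (z + h)) < e"
    proof (cases "0 \<le> z")
      case True
      then show ?thesis using z h(1) by (intro R1) (auto simp: R_def)
    next
      case False
      then show ?thesis using z h(1) L(1) by (intro R2) (auto simp: R_def)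
    qed
    have "cmod (u 0) \<le> cmod (u (0 + z + h)) + cmod (u (0 + z + h) - u 0)"
      using norm_triangle_ineq4[of "u (0 + z + h)" "u (0 + z + h) - u 0"] by simp
    then have "4 * e \<le> cmod (u (z + h)) + e" using h(2)[of 0] by (simp add: e_def)
    moreover have "cmod (u (z + h)) \<le> cmod (char \<mu> (z + h)) + cmod (v (z + h))"
      using norm_triangle_ineq4[of "char \<mu> (z + h)" "v (z + h)"] by (simp add: F)
    ultimately have "2 * e \<le> cmod (char \<mu> (z + h))" using vz by linarith
    then have "ln (2 * e) \<le> l (z + h)" unfolding l_def using e nz by (subst ln_le_cancel_iff) auto
    moreover have "2 * l (z + h) \<le> l z + K x"
      using lK[of "z + h" h] l0[of "z + h + h"] x[OF h(1)] by (simp add: abs_le_iff)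
    ultimately have "2 * ln (2 * e) - K x \<le> l z" by linarith
    then have "exp (2 * ln (2 * e) - K x) \<le> exp (l z)" by (simp only: exp_le_cancel_iff)
    also have "\<dots> = cmod (char \<mu> z)" unfolding l_def using nz by simp
    finally show ?thesis .
  qed
  show ?thesis
    by (rule continuous_nonzero_bounded_below[OF mu.isCont_char nz _ big]) simp
qed

section \<open>Sums of measures and the two parts of the distribution\<close>

text \<open>The sum is given only through its values, so that the same fact serves the mixture of
  two distributions and the Levy measures assembled from an atomic part and a density.\<close>

lemma nn_integral_measure_add:
  fixes M M1 M2 :: "real measure"
  assumes sets: "sets M = sets borel" "sets M1 = sets borel" "sets M2 = sets borel"
    and em: "\<And>B. B \<in> sets borel \<Longrightarrow> emeasure M B = emeasure M1 B + emeasure M2 B"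
    and f: "f \<in> borel_measurable borel"
  shows "(\<integral>\<^sup>+x. f x \<partial>M) = (\<integral>\<^sup>+x. f x \<partial>M1) + (\<integral>\<^sup>+x. f x \<partial>M2)"
proof -
  note [measurable_cong] = sets
  show ?thesis using f
  proof (induct f rule: borel_measurable_induct)
    case (cong f g)
    then show ?case by (simp cong: nn_integral_cong_simp)
  next
    case (set A)
    then show ?case using em by (simp add: sets)
  next
    case (mult u c)
    then show ?case by (simp add: nn_integral_cmult distrib_left)
  next
    case (add u v)
    then show ?case by (simp add: nn_integral_add add_ac)
  next
    case (seq U)
    have inc: "incseq U" by fact
    have m: "U i \<in> borel_measurable borel" for i by fact
    have e: "(\<integral>\<^sup>+x. (SUP i. U i) x \<partial>N) = (SUP i. \<integral>\<^sup>+x. U i x \<partial>N)" if "sets N = sets borel" for N :: "real measure"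
      unfolding SUP_apply
      by (rule nn_integral_monotone_convergence_SUP[OF inc]) (use m measurable_cong_sets[OF that refl] in blast)
    have i: "incseq (\<lambda>i. \<integral>\<^sup>+x. U i x \<partial>N)" for N :: "real measure"
      using inc by (auto simp: incseq_def le_fun_def intro!: nn_integral_mono)
    show ?case unfolding e[OF sets(1)] e[OF sets(2)] e[OF sets(3)] seq(3)
      by (rule ennreal_SUP_add[OF i i])
  qed
qed

lemma
  fixes M M1 M2 :: "real measure" and f :: "real \<Rightarrow> complex"
  assumes sets: "sets M = sets borel" "sets M1 = sets borel" "sets M2 = sets borel"
    and em: "\<And>B. B \<in> sets borel \<Longrightarrow> emeasure M B = emeasure M1 B + emeasure M2 B"
    and i: "integrable M1 f" "integrable M2 f"
  shows integrable_measure_add: "integrable M f"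
    and integral_measure_add: "(LINT x|M. f x) = (LINT x|M1. f x) + (LINT x|M2. f x)"
proof -
  note add = nn_integral_measure_add[OF sets em]
  have ms: "borel_measurable M = (borel_measurable borel :: (real \<Rightarrow> 'x::topological_space) set)"
    "borel_measurable M1 = (borel_measurable borel :: (real \<Rightarrow> 'x) set)"
    by (auto simp: measurable_cong_sets[OF sets(1) refl] measurable_cong_sets[OF sets(2) refl])
  have fm: "f \<in> borel_measurable borel" using borel_measurable_integrable[OF i(1)] by (simp only: measurable_cong_sets[OF sets(2) refl])
  show iM: "integrable M f"
  proof (rule integrableI_bounded)
    show "f \<in> borel_measurable M" using fm by (simp only: measurable_cong_sets[OF sets(1) refl])
    have "(\<integral>\<^sup>+x. ennreal (norm (f x)) \<partial>M) = (\<integral>\<^sup>+x. ennreal (norm (f x)) \<partial>M1) + (\<integral>\<^sup>+x. ennreal (norm (f x)) \<partial>M2)"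
      using fm by (intro add) auto
    also have "\<dots> < \<infinity>" using i by (simp add: integrable_iff_bounded)
    finally show "(\<integral>\<^sup>+x. ennreal (norm (f x)) \<partial>M) < \<infinity>" .
  qed
  have real: "(LINT x|M. g x) = (LINT x|M1. g x) + (LINT x|M2. g x)"
    if g: "integrable M g" "integrable M1 g" "integrable M2 g" for g :: "real \<Rightarrow> real"
  proof -
    have gm: "g \<in> borel_measurable borel" using borel_measurable_integrable[OF g(1)] by (simp only: measurable_cong_sets[OF sets(1) refl])
    have fin: "(\<integral>\<^sup>+x. ennreal (g x) \<partial>N) < top" "(\<integral>\<^sup>+x. ennreal (- g x) \<partial>N) < top" if "integrable N g" for N
    proof -
      have nf: "(\<integral>\<^sup>+x. ennreal (norm (g x)) \<partial>N) < top" using that by (simp add: integrable_iff_bounded)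
      show "(\<integral>\<^sup>+x. ennreal (g x) \<partial>N) < top"
        by (rule order.strict_trans1[OF nn_integral_mono nf]) (auto intro: ennreal_leI)
      show "(\<integral>\<^sup>+x. ennreal (- g x) \<partial>N) < top"
        by (rule order.strict_trans1[OF nn_integral_mono nf]) (auto intro: ennreal_leI)
    qed
    have "(\<integral>\<^sup>+x. ennreal (g x) \<partial>M) = (\<integral>\<^sup>+x. ennreal (g x) \<partial>M1) + (\<integral>\<^sup>+x. ennreal (g x) \<partial>M2)"
      "(\<integral>\<^sup>+x. ennreal (- g x) \<partial>M) = (\<integral>\<^sup>+x. ennreal (- g x) \<partial>M1) + (\<integral>\<^sup>+x. ennreal (- g x) \<partial>M2)"
      using gm by (intro add; simp)+
    then show ?thesis
      unfolding real_lebesgue_integral_def[OF g(1)] real_lebesgue_integral_def[OF g(2)] real_lebesgue_integral_def[OF g(3)]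
      by (simp add: enn2real_plus fin g)
  qed
  show "(LINT x|M. f x) = (LINT x|M1. f x) + (LINT x|M2. f x)"
    using real[of "\<lambda>x. Re (f x)"] real[of "\<lambda>x. Im (f x)"] iM i
    by (auto intro!: complex_eqI simp flip: integral_Re integral_Im)
qed

lemma ex_measure_add:
  fixes M1 M2 :: "real measure"
  assumes sets: "sets M1 = sets borel" "sets M2 = sets borel"
  obtains M :: "real measure" where "sets M = sets borel" "\<And>B. B \<in> sets borel \<Longrightarrow> emeasure M B = emeasure M1 B + emeasure M2 B"
proof -
  let ?M = "measure_of UNIV (sets borel) (\<lambda>B. emeasure M1 B + emeasure M2 B) :: real measure"
  have sg: "sigma_algebra UNIV (sets (borel::real measure))"
    using sets.sigma_algebra_axioms[of "borel::real measure"] by simp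
  have "emeasure ?M B = emeasure M1 B + emeasure M2 B" if "B \<in> sets borel" for B
  proof (rule emeasure_measure_of_sigma[OF sg _ _ that])
    show "positive (sets borel) (\<lambda>B. emeasure M1 B + emeasure M2 B)" by (simp add: positive_def)
    show "countably_additive (sets borel) (\<lambda>B. emeasure M1 B + emeasure M2 B)"
    proof (rule countably_additiveI)
      fix A :: "nat \<Rightarrow> real set" assume A: "range A \<subseteq> sets borel" "disjoint_family A"
      have "suminf (\<lambda>i. emeasure M1 (A i) + emeasure M2 (A i)) = suminf (\<lambda>i. emeasure M1 (A i)) + suminf (\<lambda>i. emeasure M2 (A i))"
        by (rule suminf_add[symmetric]) auto
      also have "\<dots> = emeasure M1 (\<Union>i. A i) + emeasure M2 (\<Union>i. A i)"
        using A sets by (simp add: suminf_emeasure)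
      finally show "suminf (\<lambda>i. emeasure M1 (A i) + emeasure M2 (A i)) = emeasure M1 (\<Union>i. A i) + emeasure M2 (\<Union>i. A i)" .
    qed
  qed
  moreover have "sets ?M = sets borel" using sigma_algebra.sets_measure_of_eq[OF sg] by simp
  ultimately show ?thesis by (rule that[rotated])
qed

lemma integral_density_const_complex:
  fixes f :: "real \<Rightarrow> complex"
  assumes "0 \<le> c" "f \<in> borel_measurable M"
  shows "(LINT x|density M (\<lambda>_. ennreal c). f x) = of_real c * (LINT x|M. f x)"
  using assms by (subst integral_density) (auto simp: scaleR_conv_of_real)

lemma char_mixture:
  assumes \<mu>: "real_distribution \<mu>" and d: "real_distribution \<mu>1" and a: "real_distribution \<mu>2"
    and p: "0 \<le> p" "p \<le> 1" and mix: "\<forall>B\<in>sets borel. measure \<mu> B = p * measure \<mu>1 B + (1 - p) * measure \<mu>2 B"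
  shows "char \<mu> z = of_real p * char \<mu>1 z + of_real (1 - p) * char \<mu>2 z"
proof -
  interpret M: real_distribution \<mu> by fact
  interpret M1: real_distribution \<mu>1 by fact
  interpret M2: real_distribution \<mu>2 by fact
  let ?D1 = "density \<mu>1 (\<lambda>_. ennreal p)" and ?D2 = "density \<mu>2 (\<lambda>_. ennreal (1 - p))"
  have i1: "integrable ?D1 (\<lambda>x. iexp (z * x))" and i2: "integrable ?D2 (\<lambda>x. iexp (z * x))"
    using p M1.integrable_const_bound[of "\<lambda>x. iexp (z * x)" 1] M2.integrable_const_bound[of "\<lambda>x. iexp (z * x)" 1]
    by (subst integrable_density; simp)+
  have "char \<mu> z = (LINT x|?D1. iexp (z * x)) + (LINT x|?D2. iexp (z * x))"
    unfolding char_def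
  proof (rule integral_measure_add[OF _ _ _ _ i1 i2])
    fix B :: "real set" assume B: "B \<in> sets borel"
    then show "emeasure \<mu> B = emeasure ?D1 B + emeasure ?D2 B"
      using mix p by (simp add: emeasure_density_const M.emeasure_eq_measure M1.emeasure_eq_measure M2.emeasure_eq_measure
         ennreal_mult' ennreal_plus flip: ennreal_mult')
  qed simp_all
  then show ?thesis unfolding char_def using p by (simp add: integral_density_const_complex)
qed

text \<open>A distribution carried by a countable set is the image of a weighted counting measure,
  the weights being the masses of points.\<close>

lemma dtr_char_discrete:
  assumes "discrete_distribution M"
  obtains A where "dtr A (char M)"
proof -
  obtain C where C: "countable C" "measure M C = 1" and M: "real_distribution M"
    using assms unfolding discrete_distribution_def by blast
  interpret real_distribution M by fact
  have sC: "A \<in> sets borel" if "A \<subseteq> C" for A :: "real set"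
    using countable_subset[OF that C(1)] by (rule sets.countable[rotated]) simp
  let ?D = "distr (density (count_space C) (\<lambda>y. ennreal (measure M {y}))) borel (\<lambda>y. y)"
  have "AE x in M. x \<in> C" using C(2) sC[of C] by (subst AE_in_set_eq_1) auto
  then have eC: "emeasure M B = emeasure M (B \<inter> C)" if "B \<in> sets borel" for B
    using that sC[of C] by (intro emeasure_eq_AE) auto
  have eq: "M = ?D"
  proof (rule measure_eqI)
    fix B assume "B \<in> sets M"
    then have B: "B \<in> sets borel" by simp
    have "emeasure M (B \<inter> C) = (\<integral>\<^sup>+y. emeasure M {y} \<partial>count_space (B \<inter> C))"
      using C(1) by (intro emeasure_countable_singleton) (auto intro: countable_subset)
    also have "\<dots> = (\<integral>\<^sup>+y. ennreal (measure M {y}) * indicator B y \<partial>count_space C)"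
      by (simp add: emeasure_eq_measure nn_integral_count_space_indicator)
         (auto intro!: nn_integral_cong simp: indicator_def)
    also have "\<dots> = emeasure ?D B"
      using B by (simp add: emeasure_distr emeasure_density) (auto intro!: nn_integral_cong simp: indicator_def)
    finally show "emeasure M B = emeasure ?D B" using eC[OF B] by simp
  qed simp
  have eqc: "(LINT y|?D. f y) = (LINT y|count_space C. measure M {y} *\<^sub>R f y)" if "f \<in> borel_measurable borel" for f :: "real \<Rightarrow> complex"
    using that by (subst integral_distr) (simp_all add: integral_density)
  have "integrable ?D (\<lambda>_. 1 :: real)" using eq integrable_const[of "1::real"] by simp
  then have "integrable (count_space C) (\<lambda>y. measure M {y})"
    by (subst (asm) integrable_distr_eq) (simp_all add: integrable_density)
  then have ic: "integrable (count_space C) (\<lambda>y. of_real (measure M {y}) :: complex)"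
    by (simp only: complex_of_real_integrable_eq)
  have "char M z = ft (count_space C) (\<lambda>y. y) (\<lambda>y. of_real (measure M {y})) z" for z
  proof -
    have "char M z = (LINT y|?D. iexp (z * y))" unfolding char_def using eq by simp
    also have "\<dots> = (LINT y|count_space C. measure M {y} *\<^sub>R iexp (z * y))" by (rule eqc) simp
    finally show ?thesis by (simp add: ft_def scaleR_conv_of_real)
  qed
  then have "char M = ft (count_space C) (\<lambda>y. y) (\<lambda>y. of_real (measure M {y}))" by auto
  then show ?thesis using dtr_countable[OF C(1) ic, of "\<lambda>y. y"] that by simp
qed

lemma ltr_char_ac:
  assumes "ac_distribution M"
  obtains B where "ltr B (char M)"
proof -
  have M: "real_distribution M" and ac: "absolutely_continuous lborel M"
    using assms unfolding ac_distribution_def by auto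
  interpret real_distribution M by fact
  have s: "sets M = sets lborel" by simp
  obtain D where D: "D \<in> borel_measurable lborel" "AE x in lborel. RN_deriv lborel M x = ennreal (D x)"
      "AE x in M. 0 < D x" "\<And>x. 0 \<le> D x"
    by (rule sigma_finite_measure.real_RN_deriv[OF lborel.sigma_finite_measure_axioms finite_measure_axioms ac s]) blast
  have Dm [measurable]: "D \<in> borel_measurable borel" using D(1) by simp
  have "M = density lborel (RN_deriv lborel M)" using sigma_finite_measure.density_RN_deriv[OF lborel.sigma_finite_measure_axioms ac s] by simp
  also have "\<dots> = density lborel (\<lambda>x. ennreal (D x))" using D(2) by (intro density_cong) auto
  finally have eq: "M = density lborel (\<lambda>x. ennreal (D x))" .
  have "integrable (density lborel (\<lambda>x. ennreal (D x))) (\<lambda>_. 1 :: real)" using eq integrable_const[of "1::real"] by metis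
  then have "integrable lborel D" using D(4) by (subst (asm) integrable_density) auto
  then have Di: "integrable lborel (\<lambda>x. of_real (D x) :: complex)" by (simp only: complex_of_real_integrable_eq)
  have "char M z = lft (\<lambda>x. of_real (D x)) z" for z
  proof -
    have "char M z = (LINT x|density lborel (\<lambda>x. ennreal (D x)). iexp (z * x))" unfolding char_def using eq by metis
    also have "\<dots> = (LINT x|lborel. D x *\<^sub>R iexp (z * x))" using D(4) by (intro integral_density) auto
    finally show ?thesis by (simp add: ft_def scaleR_conv_of_real)
  qed
  then have "char M = lft (\<lambda>x. of_real (D x))" by auto
  then show ?thesis using ltr_lft[OF Di] that by simp
qed

subsection \<open>Quasi-Levy measures\<close>

text \<open>\<open>ennreal\<close> cuts negative weights to 0, so \<open>w\<close> and
  \<open>- w\<close> give the images of the positive and of the negative part of the weight.\<close>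

definition weighted_push :: "'a measure \<Rightarrow> ('a \<Rightarrow> real) \<Rightarrow> ('a \<Rightarrow> real) \<Rightarrow> real measure" where
  "weighted_push K \<pi> w = distr (density K (\<lambda>k. ennreal (w k))) borel \<pi>"

lemma sets_weighted_push [simp, measurable_cong]: "sets (weighted_push K \<pi> w) = sets borel"
  by (simp add: weighted_push_def)

lemma nn_integral_weighted_push:
  assumes [measurable]: "w \<in> borel_measurable K" "\<pi> \<in> borel_measurable K" "f \<in> borel_measurable borel"
  shows "(\<integral>\<^sup>+x. f x \<partial>weighted_push K \<pi> w) = (\<integral>\<^sup>+k. ennreal (w k) * f (\<pi> k) \<partial>K)"
  unfolding weighted_push_def by (subst nn_integral_distr) (simp_all add: nn_integral_density)

lemma emeasure_weighted_push:
  assumes "w \<in> borel_measurable K" "\<pi> \<in> borel_measurable K" "B \<in> sets borel"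
  shows "emeasure (weighted_push K \<pi> w) B = (\<integral>\<^sup>+k. ennreal (w k) * indicator B (\<pi> k) \<partial>K)"
  using nn_integral_weighted_push[OF assms(1,2), of "indicator B"] assms(3) by simp

lemma finite_measure_weighted_push:
  assumes w: "integrable K w" and \<pi>: "\<pi> \<in> borel_measurable K"
  shows "finite_measure (weighted_push K \<pi> w)"
proof
  have "space (weighted_push K \<pi> w) = UNIV" by (simp add: weighted_push_def)
  then have "emeasure (weighted_push K \<pi> w) (space (weighted_push K \<pi> w)) = (\<integral>\<^sup>+k. ennreal (w k) \<partial>K)"
    using emeasure_weighted_push[OF borel_measurable_integrable[OF w] \<pi>, of UNIV] by simp
  also have "\<dots> \<le> (\<integral>\<^sup>+k. ennreal (norm (w k)) \<partial>K)" by (intro nn_integral_mono ennreal_leI) simp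
  also have "\<dots> < \<infinity>" using w by (simp add: integrable_iff_bounded)
  finally show "emeasure (weighted_push K \<pi> w) (space (weighted_push K \<pi> w)) \<noteq> \<infinity>" by simp
qed

lemma
  fixes f :: "real \<Rightarrow> complex"
  assumes m [measurable]: "w \<in> borel_measurable K" "\<pi> \<in> borel_measurable K" "f \<in> borel_measurable borel"
    and i: "integrable K (\<lambda>k. w k *\<^sub>R f (\<pi> k))"
  shows integrable_weighted_push: "integrable (weighted_push K \<pi> w) f"
    and integral_weighted_push: "(LINT x|weighted_push K \<pi> w. f x) = (LINT k|K. max 0 (w k) *\<^sub>R f (\<pi> k))"
    and integrable_max_weight: "integrable K (\<lambda>k. max 0 (w k) *\<^sub>R f (\<pi> k))"
proof -
  have e: "ennreal (w k) = ennreal (max 0 (w k))" for k by (simp add: max_def ennreal_neg)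
  show im: "integrable K (\<lambda>k. max 0 (w k) *\<^sub>R f (\<pi> k))"
    by (rule Bochner_Integration.integrable_bound[OF i]) (auto simp: max_def intro!: AE_I2 mult_right_mono mult_nonpos_nonneg)
  have d: "integrable (density K (\<lambda>k. ennreal (max 0 (w k)))) (\<lambda>k. f (\<pi> k))"
    "(LINT k|density K (\<lambda>k. ennreal (max 0 (w k))). f (\<pi> k)) = (LINT k|K. max 0 (w k) *\<^sub>R f (\<pi> k))"
    using im by (subst integrable_density; simp) (subst integral_density; simp)
  note d = d[folded e]
  show "integrable (weighted_push K \<pi> w) f"
    unfolding weighted_push_def using d(1) by (subst integrable_distr_eq) simp_all
  show "(LINT x|weighted_push K \<pi> w. f x) = (LINT k|K. max 0 (w k) *\<^sub>R f (\<pi> k))"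
    unfolding weighted_push_def using d(2) by (subst integral_distr) simp_all
qed

lemma weighted_push_difference:
  fixes f :: "real \<Rightarrow> complex"
  assumes m [measurable]: "w \<in> borel_measurable K" "\<pi> \<in> borel_measurable K" "f \<in> borel_measurable borel"
    and i: "integrable K (\<lambda>k. w k *\<^sub>R f (\<pi> k))"
  shows "integrable (weighted_push K \<pi> (\<lambda>k. - w k)) f"
    and "(LINT x|weighted_push K \<pi> w. f x) - (LINT x|weighted_push K \<pi> (\<lambda>k. - w k). f x) = (LINT k|K. w k *\<^sub>R f (\<pi> k))"
proof -
  have m': "(\<lambda>k. - w k) \<in> borel_measurable K" by measurable
  have i': "integrable K (\<lambda>k. - w k *\<^sub>R f (\<pi> k))" using i by simp
  show "integrable (weighted_push K \<pi> (\<lambda>k. - w k)) f" by (rule integrable_weighted_push[OF m' m(2,3) i'])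
  have "(LINT x|weighted_push K \<pi> w. f x) - (LINT x|weighted_push K \<pi> (\<lambda>k. - w k). f x)
      = (LINT k|K. max 0 (w k) *\<^sub>R f (\<pi> k) - max 0 (- w k) *\<^sub>R f (\<pi> k))"
    unfolding integral_weighted_push[OF m i] integral_weighted_push[OF m' m(2,3) i']
    by (rule Bochner_Integration.integral_diff[OF integrable_max_weight[OF m i] integrable_max_weight[OF m' m(2,3) i'], symmetric])
  also have "\<dots> = (LINT k|K. w k *\<^sub>R f (\<pi> k))"
    by (intro Bochner_Integration.integral_cong refl) (auto simp: max_def scaleR_left_diff_distrib[symmetric])
  finally show "(LINT x|weighted_push K \<pi> w. f x) - (LINT x|weighted_push K \<pi> (\<lambda>k. - w k). f x) = (LINT k|K. w k *\<^sub>R f (\<pi> k))" .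
qed

lemma integrable_scaleR_iexp_minus_one:
  assumes w: "integrable K w" and \<pi> [measurable]: "\<pi> \<in> borel_measurable K"
  shows "integrable K (\<lambda>k. w k *\<^sub>R (iexp (z * \<pi> k) - 1))"
proof (rule Bochner_Integration.integrable_bound[OF integrable_mult_right[OF w, of 2]])
  note [measurable] = borel_measurable_integrable[OF w]
  show "(\<lambda>k. w k *\<^sub>R (iexp (z * \<pi> k) - 1)) \<in> borel_measurable K" by measurable
  have b: "cmod (iexp t - 1) \<le> 2" for t using norm_triangle_ineq4[of "iexp t" 1] by simp
  show "AE k in K. norm (w k *\<^sub>R (iexp (z * \<pi> k) - 1)) \<le> norm (2 * w k)"
  proof (rule AE_I2)
    fix k
    show "norm (w k *\<^sub>R (iexp (z * \<pi> k) - 1)) \<le> norm (2 * w k)"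
      using mult_left_mono[OF b[of "z * \<pi> k"] abs_ge_zero[of "w k"]]
      by (simp only: norm_scaleR real_norm_def abs_mult abs_numeral mult.commute[of 2])
  qed
qed

text \<open>An integrable real weight is the difference of two finite measures, each the jump
  measure of a compound Poisson exponent.\<close>

lemma conv_semigroup_exponent_difference:
  assumes w: "integrable K w" and \<pi>: "\<pi> \<in> borel_measurable K"
  obtains \<psi>1 \<psi>2 where "conv_semigroup_exponent \<psi>1" "conv_semigroup_exponent \<psi>2"
    "\<And>z. \<psi>1 z - \<psi>2 z = (LINT k|K. w k *\<^sub>R (iexp (z * \<pi> k) - 1))"
proof (rule that)
  show "conv_semigroup_exponent (\<lambda>z. LINT x|weighted_push K \<pi> w. iexp (z * x) - 1)"
    by (rule conv_semigroup_exponent_compound_poisson[OF finite_measure_weighted_push[OF w \<pi>]]) simp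
  show "conv_semigroup_exponent (\<lambda>z. LINT x|weighted_push K \<pi> (\<lambda>k. - w k). iexp (z * x) - 1)"
    by (rule conv_semigroup_exponent_compound_poisson[OF finite_measure_weighted_push[OF Bochner_Integration.integrable_minus[OF w] \<pi>]]) simp
  show "(LINT x|weighted_push K \<pi> w. iexp (z * x) - 1) - (LINT x|weighted_push K \<pi> (\<lambda>k. - w k). iexp (z * x) - 1)
     = (LINT k|K. w k *\<^sub>R (iexp (z * \<pi> k) - 1))" for z
    by (rule weighted_push_difference(2)[OF borel_measurable_integrable[OF w] \<pi> _ integrable_scaleR_iexp_minus_one[OF w \<pi>]]) measurable
qed

section \<open>The arctangent term\<close>

lemma has_vector_derivative_two_arctan:
  "((\<lambda>z. 2 * \<i> * of_real (arctan z)) has_vector_derivative 2 * \<i> / (1 + (of_real z)\<^sup>2)) (at z)"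
proof -
  have "((\<lambda>z. of_real (arctan z) :: complex) has_vector_derivative of_real (inverse (1 + z\<^sup>2))) (at z)"
    using DERIV_arctan[of z] by (intro has_vector_derivative_of_real) (simp add: has_real_derivative_iff_has_vector_derivative)
  then have "((\<lambda>z. (2 * \<i>) * of_real (arctan z)) has_vector_derivative (2 * \<i>) * of_real (inverse (1 + z\<^sup>2))) (at z)"
    by (rule has_vector_derivative_mult_right)
  then show ?thesis by (simp add: divide_inverse)
qed

lemma eq_if_same_vector_derivative:
  fixes f g :: "real \<Rightarrow> complex"
  assumes "\<And>z. (f has_vector_derivative d z) (at z)" "\<And>z. (g has_vector_derivative d z) (at z)" "f 0 = g 0"
  shows "f z = g z"
proof -
  have "((\<lambda>z. f z - g z) has_vector_derivative 0) (at z)" for z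
    using has_vector_derivative_diff[OF assms(1,2)] by simp
  then have "((\<lambda>z. f z - g z) has_derivative (\<lambda>_. 0)) (at z within UNIV)" for z
    by (simp add: has_vector_derivative_def)
  then obtain c where "\<And>z. f z - g z = c"
    using has_derivative_zero_constant[of UNIV "\<lambda>z. f z - g z"] by auto
  from this[of 0] this[of z] assms(3) show ?thesis by simp
qed

text \<open>Both sides vanish at 0 and have derivative 2 i / (1 + z^2). Up to sign the logarithms
  are the gamma exponent and its reflection.\<close>

lemma two_arctan_eq_Ln_diff:
  "2 * \<i> * of_real (arctan z) = Ln (1 + \<i> * of_real z) - Ln (1 - \<i> * of_real z)"
proof -
  have "2 * \<i> * of_real (arctan z) = Ln (1 + \<i> * of_real (1 * z)) - Ln (1 + \<i> * of_real (- 1 * z))"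
  proof (rule eq_if_same_vector_derivative[where f="\<lambda>z. 2 * \<i> * of_real (arctan z)" and g="\<lambda>z. Ln (1 + \<i> * of_real (1 * z)) - Ln (1 + \<i> * of_real (- 1 * z))",
        OF has_vector_derivative_two_arctan])
    fix z :: real
    have nz: "1 + \<i> * of_real z \<noteq> 0" "1 - \<i> * of_real z \<noteq> 0" by (simp_all add: complex_eq_iff)
    have "(1 + \<i> * of_real z) * (1 - \<i> * of_real z) = 1 + (of_real z)\<^sup>2"
      by (simp add: algebra_simps power2_eq_square)
    then have e: "2 * \<i> / (1 + (of_real z)\<^sup>2) = (\<i> * of_real 1) / (1 + \<i> * of_real (1 * z)) - (\<i> * of_real (- 1)) / (1 + \<i> * of_real (- 1 * z))"
      using nz by (simp add: field_simps)
    show "((\<lambda>z. Ln (1 + \<i> * of_real (1 * z)) - Ln (1 + \<i> * of_real (- 1 * z))) has_vector_derivative 2 * \<i> / (1 + (of_real z)\<^sup>2)) (at z)"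
      unfolding e by (intro has_vector_derivative_diff has_vector_derivative_Ln_affine)
  qed simp
  then show ?thesis by simp
qed

text \<open>The weight has a singularity of order 1 / |x| at 0, but x times it is exp(-|x|) off 0.
  Differentiation in z therefore gives i times the transform of exp(-|x|), that is 2 i / (1 +
  z^2).\<close>

lemma
  defines "w \<equiv> \<lambda>x::real. exp (- \<bar>x\<bar>) / \<bar>x\<bar> * sgn x"
  shows integral_laplace_levy: "(LINT x|lborel. w x *\<^sub>R (iexp (z * x) - 1)) = 2 * \<i> * of_real (arctan z)"
proof -
  have [measurable]: "w \<in> borel_measurable borel" unfolding w_def by measurable
  have ae: "AE x in lborel. of_real x * of_real (w x) = (of_real (exp (- \<bar>x\<bar>)) :: complex)"
  proof -
    have "AE x in lborel. x \<noteq> (0::real)" by (rule AE_lborel_singleton)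
    then show ?thesis
    proof eventually_elim
      fix x :: real assume "x \<noteq> 0"
      then have "x * w x = exp (- \<bar>x\<bar>)" by (simp add: w_def sgn_if abs_if)
      then show "of_real x * of_real (w x) = (of_real (exp (- \<bar>x\<bar>)) :: complex)" by (simp flip: of_real_mult)
    qed
  qed
  have Ei: "integrable lborel (\<lambda>x. of_real (exp (- \<bar>x\<bar>)) :: complex)"
    using integrable_exp_minus_abs by (simp only: complex_of_real_integrable_eq)
  have xi: "integrable lborel (\<lambda>x. of_real x * of_real (w x) :: complex)"
    using ae by (intro integrable_cong_AE_imp[OF Ei]) auto
  have E: "ft lborel (\<lambda>x. x) (\<lambda>x. of_real x * of_real (w x)) z = 2 / (1 + (of_real z)\<^sup>2)" for z
    unfolding lft_exp_minus_abs[symmetric] ft_def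
    by (rule integral_cong_AE) (use ae in auto)
  have "(LINT x|lborel. of_real (w x) * (iexp (z * x) - 1)) = 2 * \<i> * of_real (arctan z)"
  proof (rule eq_if_same_vector_derivative[where f="\<lambda>z. LINT x|lborel. of_real (w x) * (iexp (z * x) - 1)" and g="\<lambda>z. 2 * \<i> * of_real (arctan z)",
        OF _ has_vector_derivative_two_arctan])
    fix z
    have "((\<lambda>z. LINT x|lborel. of_real (w x) * (iexp (z * x) - 1)) has_vector_derivative \<i> * ft lborel (\<lambda>x. x) (\<lambda>x. of_real x * of_real (w x)) z) (at z)"
      by (rule has_vector_derivative_ft) (use xi in auto)
    then show "((\<lambda>z. LINT x|lborel. of_real (w x) * (iexp (z * x) - 1)) has_vector_derivative 2 * \<i> / (1 + (of_real z)\<^sup>2)) (at z)"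
      unfolding E by (simp add: mult.commute)
  qed simp
  then show ?thesis by (simp add: scaleR_conv_of_real)
qed

section \<open>Real weights from Hermitian symmetry\<close>

text \<open>Adding the Hermitian reflection replaces a weight by twice its real part; the
  subtraction of the value at 0 produces exp(i z x) - 1.\<close>

lemma ft_symmetrize:
  fixes a :: "'a \<Rightarrow> complex"
  assumes a: "integrable N a" and \<pi> [measurable]: "\<pi> \<in> borel_measurable N"
  shows "(ft N \<pi> a z + cnj (ft N \<pi> a (- z))) - (ft N \<pi> a 0 + cnj (ft N \<pi> a (- 0)))
    = 2 * (LINT x|N. Re (a x) *\<^sub>R (iexp (z * \<pi> x) - 1))"
proof -
  have ca: "integrable N (\<lambda>x. cnj (a x))" using a by simp
  have c: "ft N \<pi> a t + cnj (ft N \<pi> a (- t)) = (LINT x|N. of_real (2 * Re (a x)) * iexp (t * \<pi> x))" for t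
  proof -
    have "cnj (ft N \<pi> a (- t)) = (LINT x|N. cnj (a x) * iexp (t * \<pi> x))"
      unfolding cnj_ft by (simp add: ft_def)
    then have "ft N \<pi> a t + cnj (ft N \<pi> a (- t)) = (LINT x|N. a x * iexp (t * \<pi> x) + cnj (a x) * iexp (t * \<pi> x))"
      using integrable_times_iexp[OF a \<pi>, of t] integrable_times_iexp[OF ca \<pi>, of t] by (simp add: ft_def)
    also have "\<dots> = (LINT x|N. of_real (2 * Re (a x)) * iexp (t * \<pi> x))"
      by (intro Bochner_Integration.integral_cong refl) (simp only: distrib_right[symmetric] complex_add_cnj)
    finally show ?thesis .
  qed
  have r: "integrable N (\<lambda>x. of_real (2 * Re (a x)) :: complex)" using a by (simp only: complex_of_real_integrable_eq) simp
  have "(ft N \<pi> a z + cnj (ft N \<pi> a (- z))) - (ft N \<pi> a 0 + cnj (ft N \<pi> a (- 0)))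
     = (LINT x|N. of_real (2 * Re (a x)) * iexp (z * \<pi> x) - of_real (2 * Re (a x)) * iexp (0 * \<pi> x))"
    unfolding c by (rule Bochner_Integration.integral_diff[symmetric]) (rule integrable_times_iexp[OF r \<pi>])+
  also have "\<dots> = (LINT x|N. 2 * (Re (a x) *\<^sub>R (iexp (z * \<pi> x) - 1)))"
    by (intro Bochner_Integration.integral_cong refl) (simp add: scaleR_conv_of_real right_diff_distrib)
  finally show ?thesis by (simp only: integral_mult_right_zero)
qed

text \<open>The values of D lie in the discrete set 2 pi i Z.\<close>

lemma continuous_exp_eq_1_imp_constant:
  fixes D :: "real \<Rightarrow> complex"
  assumes cont: "\<And>z. isCont D z" and e: "\<And>z. exp (D z) = 1"
  shows "D z = D 0"
proof -
  have "\<exists>e>0. \<forall>y. y \<in> UNIV \<and> D y \<noteq> D x \<longrightarrow> e \<le> norm (D y - D x)" for x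
  proof (intro exI[of _ pi] conjI allI impI)
    fix y assume y: "y \<in> UNIV \<and> D y \<noteq> D x"
    obtain i j :: int where ij: "Im (D y) = of_int (2 * i) * pi" "Im (D x) = of_int (2 * j) * pi" and re: "Re (D y) = 0" "Re (D x) = 0"
      using e[of x] e[of y] unfolding exp_eq_1 by blast
    have "i \<noteq> j" using y ij re by (auto simp: complex_eq_iff)
    then have "1 \<le> \<bar>real_of_int (i - j)\<bar>" by linarith
    then have "1 * pi \<le> (2 * \<bar>real_of_int (i - j)\<bar>) * pi" by (intro mult_right_mono) auto
    also have "\<dots> = \<bar>2 * real_of_int (i - j) * pi\<bar>" by (simp only: abs_mult abs_numeral abs_of_pos[OF pi_gt_zero])
    also have "2 * real_of_int (i - j) * pi = Im (D y - D x)" using ij by (simp add: algebra_simps)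
    also have "\<bar>Im (D y - D x)\<bar> \<le> cmod (D y - D x)" by (rule abs_Im_le_cmod)
    finally show "pi \<le> norm (D y - D x)" by simp
  qed simp
  then have "D constant_on UNIV"
    using cont by (intro continuous_discrete_range_constant) (auto intro: continuous_at_imp_continuous_on)
  then show ?thesis unfolding constant_on_def by auto
qed

text \<open>The linear and the arctangent term are Hermitian, so w z and cnj (w (-z)) are logarithms
  of the same function; their difference is continuous with values in 2 pi i Z, hence constant.
  Therefore w z - w 0 equals its own symmetrisation, whose weights are real. From F 0 = 1 follows
  exp (w 0) = 1, though w 0 may be a nonzero multiple of 2 pi i.\<close>

lemma hermitian_wtr_log:
  assumes F: "wtr B F" and \<delta>: "0 < \<delta>" "\<And>z. \<delta> \<le> cmod (F z)"
    and herm: "\<And>z. F (- z) = cnj (F z)" and F0: "F 0 = 1"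
  obtains m :: int and \<gamma> :: real and \<alpha> :: "nat \<Rightarrow> real" and y :: "nat \<Rightarrow> real" and H :: "real \<Rightarrow> real"
  where "integrable (count_space UNIV) \<alpha>" "integrable lborel H"
    "\<And>z. F z = exp (\<i> * of_real (\<gamma> * z) + of_int m * (2 * \<i> * of_real (arctan z))
       + (LINT n|count_space UNIV. \<alpha> n *\<^sub>R (iexp (z * y n) - 1)) + (LINT x|lborel. H x *\<^sub>R (iexp (z * x) - 1)))"
proof -
  obtain m :: int and \<gamma> :: real and A w where w: "wtr A w"
    and Fw: "\<And>z. F z = exp (\<i> * of_real (\<gamma> * z) + 2 * \<i> * of_int m * of_real (arctan z) + w z)"
    by (rule wtr_log[OF F \<delta>]) (rule that)
  obtain A1 A2 v1 v2 where v: "dtr A1 v1" "ltr A2 v2" and wv: "w = (\<lambda>z. v1 z + v2 z)"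
    by (rule wtrE[OF w]) (rule that)
  obtain a :: "nat \<Rightarrow> complex" and y where a: "integrable (count_space UNIV) a" and v1: "v1 = ft (count_space UNIV) y a"
    using v(1) unfolding dtr_def by blast
  obtain h where h: "integrable lborel h" and v2: "v2 = lft h"
    using v(2) unfolding ltr_def by blast
  define D where "D = (\<lambda>z. cnj (w (- z)) - w z)"
  have D1: "exp (D z) = 1" for z
  proof -
    have "exp (\<i> * of_real (\<gamma> * z) + 2 * \<i> * of_int m * of_real (arctan z) + w z) = cnj (F (- z))"
      using herm[of z] Fw[of z] by simp
    also have "\<dots> = exp (\<i> * of_real (\<gamma> * z) + 2 * \<i> * of_int m * of_real (arctan z) + cnj (w (- z)))"
      unfolding Fw exp_cnj by (simp add: arctan_minus)
    also have "\<dots> = exp (\<i> * of_real (\<gamma> * z) + 2 * \<i> * of_int m * of_real (arctan z) + w z) * exp (D z)"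
      unfolding D_def exp_add[symmetric] by (simp add: add.assoc)
    finally show ?thesis by simp
  qed
  have Dc: "isCont D z" for z
    unfolding D_def
    by (intro continuous_intros isCont_o2[where g=w and f=uminus] isCont_wtr[OF w])
  have "D z = D 0" for z by (rule continuous_exp_eq_1_imp_constant[OF Dc D1])
  then have w1: "w z - w 0 = ((w z + cnj (w (- z))) - (w 0 + cnj (w (- 0)))) / 2" for z
    unfolding D_def by (simp add: field_simps)
  have w2: "(w z + cnj (w (- z))) - (w 0 + cnj (w (- 0)))
     = 2 * (LINT n|count_space UNIV. Re (a n) *\<^sub>R (iexp (z * y n) - 1)) + 2 * (LINT x|lborel. Re (h x) *\<^sub>R (iexp (z * x) - 1))" for z
  proof -
    have alg: "((a1 + a2) + (b1 + b2)) - ((c1 + c2) + (d1 + d2)) = s + t"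
      if "(a1 + b1) - (c1 + d1) = s" "(a2 + b2) - (c2 + d2) = t" for a1 a2 b1 b2 c1 c2 d1 d2 s t :: complex
      using that by (simp add: algebra_simps)
    show ?thesis
      unfolding wv v1 v2 complex_cnj_add by (rule alg[OF ft_symmetrize[OF a] ft_symmetrize[OF h]]) simp_all
  qed
  have wz: "w z - w 0 = (LINT n|count_space UNIV. Re (a n) *\<^sub>R (iexp (z * y n) - 1)) + (LINT x|lborel. Re (h x) *\<^sub>R (iexp (z * x) - 1))" for z
    unfolding w1 w2 by (simp only: distrib_left[symmetric] nonzero_mult_div_cancel_left[OF zero_neq_numeral[symmetric]])
  have w0: "exp (w 0) = 1" using Fw[of 0] F0 by simp
  show ?thesis
  proof (rule that)
    show "integrable (count_space UNIV) (\<lambda>n. Re (a n))" "integrable lborel (\<lambda>x. Re (h x))" using a h by simp_all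
    fix z
    have "F z = exp (\<i> * of_real (\<gamma> * z) + of_int m * (2 * \<i> * of_real (arctan z)) + (w z - w 0)) * exp (w 0)"
      unfolding Fw exp_add[symmetric] by (simp add: algebra_simps)
    then show "F z = exp (\<i> * of_real (\<gamma> * z) + of_int m * (2 * \<i> * of_real (arctan z))
       + (LINT n|count_space UNIV. Re (a n) *\<^sub>R (iexp (z * y n) - 1)) + (LINT x|lborel. Re (h x) *\<^sub>R (iexp (z * x) - 1)))"
      unfolding w0 wz by (simp add: add.assoc)
  qed
qed

section \<open>The pair of Levy measures\<close>

text \<open>Near 0 the singularity 1 / |x| is compensated by f = O(|x|); far out the exponential
  decay and the boundedness of f suffice.\<close>

lemma integrable_laplace_levy_density:
  fixes f :: "real \<Rightarrow> complex"
  assumes H: "integrable lborel H" and f [measurable]: "f \<in> borel_measurable borel"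
    and C: "\<And>x. cmod (f x) \<le> C * min \<bar>x\<bar> 1"
  shows "integrable lborel (\<lambda>x. (H x + of_int m * exp (- \<bar>x\<bar>) / \<bar>x\<bar> * sgn x) *\<^sub>R f x)"
    and "integrable lborel (\<lambda>x. H x *\<^sub>R f x)"
    and "integrable lborel (\<lambda>x. (exp (- \<bar>x\<bar>) / \<bar>x\<bar> * sgn x) *\<^sub>R f x)"
proof -
  have [measurable]: "H \<in> borel_measurable borel" using borel_measurable_integrable[OF H] by simp
  have C0: "0 \<le> C" using order_trans[OF norm_ge_zero C[of 1]] by simp
  have C1: "cmod (f x) \<le> C" "cmod (f x) \<le> C * \<bar>x\<bar>" for x
    using order_trans[OF C[of x] mult_left_mono[OF min.cobounded2 C0]] order_trans[OF C[of x] mult_left_mono[OF min.cobounded1 C0]] by simp_all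
  show 1: "integrable lborel (\<lambda>x. H x *\<^sub>R f x)"
  proof (rule Bochner_Integration.integrable_bound[OF integrable_mult_left[OF H, of C]])
    show "AE x in lborel. norm (H x *\<^sub>R f x) \<le> norm (H x * C)"
      using C1(1) C0 by (intro AE_I2) (simp add: abs_mult mult_left_mono)
  qed measurable
  show 2: "integrable lborel (\<lambda>x. (exp (- \<bar>x\<bar>) / \<bar>x\<bar> * sgn x) *\<^sub>R f x)"
  proof (rule Bochner_Integration.integrable_bound[OF integrable_mult_left[OF integrable_exp_minus_abs, of C]])
    have "norm ((exp (- \<bar>x\<bar>) / \<bar>x\<bar> * sgn x) *\<^sub>R f x) \<le> norm (exp (- \<bar>x\<bar>) * C)" for x
    proof (cases "x = 0")
      case False
      have "norm ((exp (- \<bar>x\<bar>) / \<bar>x\<bar> * sgn x) *\<^sub>R f x) = exp (- \<bar>x\<bar>) * (cmod (f x) / \<bar>x\<bar>)"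
        using False by (simp add: abs_mult abs_sgn_eq)
      also have "\<dots> \<le> exp (- \<bar>x\<bar>) * C"
        using False C1(2)[of x] by (intro mult_left_mono) (simp_all add: divide_le_eq)
      finally show ?thesis using C0 by (simp add: abs_mult)
    qed simp
    then show "AE x in lborel. norm ((exp (- \<bar>x\<bar>) / \<bar>x\<bar> * sgn x) *\<^sub>R f x) \<le> norm (exp (- \<bar>x\<bar>) * C)" by (rule AE_I2)
  qed measurable
  have e: "(H x + of_int m * exp (- \<bar>x\<bar>) / \<bar>x\<bar> * sgn x) *\<^sub>R f x = H x *\<^sub>R f x + of_int m *\<^sub>R ((exp (- \<bar>x\<bar>) / \<bar>x\<bar> * sgn x) *\<^sub>R f x)" for x
    by (simp add: scaleR_left_distrib)
  show "integrable lborel (\<lambda>x. (H x + of_int m * exp (- \<bar>x\<bar>) / \<bar>x\<bar> * sgn x) *\<^sub>R f x)"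
    unfolding e by (intro Bochner_Integration.integrable_add 1 integrable_scaleR_right 2)
qed

lemma levy_measureI:
  assumes "sets N = sets borel" "emeasure N {0} = 0"
    and i: "integrable N (\<lambda>x. complex_of_real (min (x\<^sup>2) 1))"
  shows "levy_measure N"
proof -
  have "norm (complex_of_real (min (x\<^sup>2) 1)) = min (x\<^sup>2) 1" for x :: real by (simp add: min_def)
  then show ?thesis using assms unfolding levy_measure_def by (simp add: integrable_iff_bounded)
qed

text \<open>Positive parts go to N1, negative parts to N2. The bound by a multiple of min |x| 1
  admits all test functions that follow: exp(i z x) - 1, the truncated identity, indicators of sets
  away from 0, and min (x^2) 1 for the Levy condition.\<close>

lemma ex_levy_difference:
  fixes \<alpha> y :: "nat \<Rightarrow> real" and H :: "real \<Rightarrow> real" and m :: int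
  assumes \<alpha>: "integrable (count_space UNIV) \<alpha>" and H: "integrable lborel H"
  obtains N1 N2 where "levy_measure N1" "levy_measure N2"
    "\<And>(f::real \<Rightarrow> complex) C. f \<in> borel_measurable borel \<Longrightarrow> (\<And>x. cmod (f x) \<le> C * min \<bar>x\<bar> 1) \<Longrightarrow>
       integrable N1 f \<and> integrable N2 f \<and> (LINT x|N1. f x) - (LINT x|N2. f x) =
         (LINT n|count_space UNIV. \<alpha> n *\<^sub>R f (y n)) + (LINT x|lborel. (H x + of_int m * exp (- \<bar>x\<bar>) / \<bar>x\<bar> * sgn x) *\<^sub>R f x)"
proof -
  define g where "g = (\<lambda>x. H x + of_int m * exp (- \<bar>x\<bar>) / \<bar>x\<bar> * sgn x)"
  \<comment> \<open>A Levy measure has no atom at 0. Dropping the atom changes no integral, since f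
    0 = 0.\<close>
  define \<alpha>' where "\<alpha>' = (\<lambda>n. if y n = 0 then 0 else \<alpha> n)"
  have Hm: "H \<in> borel_measurable borel" using borel_measurable_integrable[OF H] by simp
  have gm [measurable]: "g \<in> borel_measurable borel" unfolding g_def using Hm by measurable
  have m1: "\<alpha>' \<in> borel_measurable (count_space UNIV)" "y \<in> borel_measurable (count_space UNIV)"
    "(\<lambda>n. - \<alpha>' n) \<in> borel_measurable (count_space UNIV)" by simp_all
  have m2: "g \<in> borel_measurable lborel" "(\<lambda>x::real. x) \<in> borel_measurable lborel" "(\<lambda>x. - g x) \<in> borel_measurable lborel"
    by simp_all
  obtain N1 where N1: "sets N1 = sets borel" "\<And>B. B \<in> sets borel \<Longrightarrow>
      emeasure N1 B = emeasure (weighted_push (count_space UNIV) y \<alpha>') B + emeasure (weighted_push lborel (\<lambda>x. x) g) B"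
    by (rule ex_measure_add[OF sets_weighted_push sets_weighted_push]) blast
  obtain N2 where N2: "sets N2 = sets borel" "\<And>B. B \<in> sets borel \<Longrightarrow>
      emeasure N2 B = emeasure (weighted_push (count_space UNIV) y (\<lambda>n. - \<alpha>' n)) B + emeasure (weighted_push lborel (\<lambda>x. x) (\<lambda>x. - g x)) B"
    by (rule ex_measure_add[OF sets_weighted_push sets_weighted_push]) blast
  have main: "integrable N1 f \<and> integrable N2 f \<and> (LINT x|N1. f x) - (LINT x|N2. f x) =
         (LINT n|count_space UNIV. \<alpha> n *\<^sub>R f (y n)) + (LINT x|lborel. g x *\<^sub>R f x)"
    if f: "f \<in> borel_measurable borel" and C: "\<And>x. cmod (f x) \<le> C * min \<bar>x\<bar> 1" for f :: "real \<Rightarrow> complex" and C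
  proof -
    have C0: "0 \<le> C" using order_trans[OF norm_ge_zero C[of 1]] by simp
    have f0: "f 0 = 0" using C[of 0] by simp
    have fC: "cmod (f x) \<le> C" for x using order_trans[OF C[of x] mult_left_mono[OF min.cobounded2 C0]] by simp
    have e: "\<alpha>' n *\<^sub>R f (y n) = \<alpha> n *\<^sub>R f (y n)" for n using f0 by (simp add: \<alpha>'_def)
    have i1: "integrable (count_space UNIV) (\<lambda>n. \<alpha>' n *\<^sub>R f (y n))"
    proof (rule Bochner_Integration.integrable_bound[OF integrable_mult_left[OF \<alpha>, of C]])
      show "AE n in count_space UNIV. norm (\<alpha>' n *\<^sub>R f (y n)) \<le> norm (\<alpha> n * C)"
        unfolding e using fC C0 by (intro AE_I2) (simp add: abs_mult mult_left_mono)
    qed simp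
    have i2: "integrable lborel (\<lambda>x. g x *\<^sub>R f x)"
      unfolding g_def by (rule integrable_laplace_levy_density(1)[OF H f C])
    note P1 = integrable_weighted_push[OF m1(1,2) f i1] integrable_weighted_push[OF m2(1,2) f i2]
    note P2 = weighted_push_difference(1)[OF m1(1,2) f i1] weighted_push_difference(1)[OF m2(1,2) f i2]
    have A1: "integrable N1 f" "(LINT x|N1. f x) = (LINT x|weighted_push (count_space UNIV) y \<alpha>'. f x) + (LINT x|weighted_push lborel (\<lambda>x. x) g. f x)"
      by (rule integrable_measure_add[OF N1(1) sets_weighted_push sets_weighted_push N1(2) P1]
        integral_measure_add[OF N1(1) sets_weighted_push sets_weighted_push N1(2) P1], assumption)+
    have A2: "integrable N2 f" "(LINT x|N2. f x) = (LINT x|weighted_push (count_space UNIV) y (\<lambda>n. - \<alpha>' n). f x) + (LINT x|weighted_push lborel (\<lambda>x. x) (\<lambda>x. - g x). f x)"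
      by (rule integrable_measure_add[OF N2(1) sets_weighted_push sets_weighted_push N2(2) P2]
        integral_measure_add[OF N2(1) sets_weighted_push sets_weighted_push N2(2) P2], assumption)+
    have alg: "(a1 + a2) - (b1 + b2) = s + t" if "a1 - b1 = s" "a2 - b2 = t" for a1 a2 b1 b2 s t :: complex
      using that by (simp add: algebra_simps)
    have "(LINT x|N1. f x) - (LINT x|N2. f x) = (LINT n|count_space UNIV. \<alpha> n *\<^sub>R f (y n)) + (LINT x|lborel. g x *\<^sub>R f x)"
      by (subst A1(2), subst A2(2), rule alg)
         (rule weighted_push_difference(2)[OF m1(1,2) f i1, unfolded e] weighted_push_difference(2)[OF m2(1,2) f i2])+
    then show ?thesis using A1(1) A2(1) by blast
  qed
  have q: "cmod (of_real (min (x\<^sup>2) 1)) \<le> 1 * min \<bar>x\<bar> 1" for x :: real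
  proof (cases "\<bar>x\<bar> \<le> 1")
    case True
    then have "x\<^sup>2 \<le> \<bar>x\<bar>" using mult_left_le[of "\<bar>x\<bar>" "\<bar>x\<bar>"] by (simp add: power2_eq_square)
    then show ?thesis by (simp add: min_def)
  qed (simp add: min_def)
  have qm: "(\<lambda>x::real. complex_of_real (min (x\<^sup>2) 1)) \<in> borel_measurable borel" by measurable
  have z1: "(\<integral>\<^sup>+n. ennreal (s * \<alpha>' n) * indicator {0} (y n) \<partial>count_space UNIV) = 0" for s
  proof -
    have "ennreal (s * \<alpha>' n) * indicator {0} (y n) = 0" for n by (simp add: \<alpha>'_def)
    then show ?thesis by (simp only: nn_integral_const mult_zero_left)
  qed
  have z2: "(\<integral>\<^sup>+x. ennreal (k x) * indicator {0} x \<partial>lborel) = 0" for k :: "real \<Rightarrow> real"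
  proof -
    have "AE x in lborel. x \<noteq> (0::real)" by (rule AE_lborel_singleton)
    then have "AE x in lborel. ennreal (k x) * indicator {0} x = 0" by eventually_elim simp
    from nn_integral_cong_AE[OF this] show ?thesis by (simp only: nn_integral_const mult_zero_left)
  qed
  have "emeasure N1 {0} = 0"
    using N1(2)[of "{0}"] emeasure_weighted_push[OF m1(1,2), of "{0}"] emeasure_weighted_push[OF m2(1,2), of "{0}"]
      z1[of 1] z2[of g] by simp
  then have L1: "levy_measure N1" using main[OF qm q] by (intro levy_measureI[OF N1(1)]) auto
  have "emeasure N2 {0} = 0"
    using N2(2)[of "{0}"] emeasure_weighted_push[OF m1(3,2), of "{0}"] emeasure_weighted_push[OF m2(3,2), of "{0}"]
      z1[of "-1"] z2[of "\<lambda>x. - g x"] by simp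
  then have L2: "levy_measure N2" using main[OF qm q] by (intro levy_measureI[OF N2(1)]) auto
  show ?thesis
    by (rule that[OF L1 L2]) (rule main[unfolded g_def])
qed

text \<open>All indices n with the same y n contribute to one atom, whose mass is the sum over the
  fibre. Absolute summability allows the regrouping.\<close>

lemma
  fixes \<alpha> y :: "nat \<Rightarrow> real"
  assumes \<alpha>: "integrable (count_space UNIV) \<alpha>"
  defines "c \<equiv> \<lambda>t. \<Sum>\<^sub>\<infinity>n\<in>{n. y n = t}. \<alpha> n"
  shows abs_summable_on_fibre_sums: "(\<lambda>t. \<bar>c t\<bar>) summable_on C"
    and infsum_fibre_sums: "range y \<inter> B \<subseteq> C \<Longrightarrow> (\<Sum>\<^sub>\<infinity>t\<in>C \<inter> B. c t) = (LINT n|count_space UNIV. \<alpha> n * indicator B (y n))"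
proof -
  have s: "summable (\<lambda>n. norm (\<alpha> n))" using \<alpha> by (simp add: integrable_count_space_nat_iff)
  have bij: "bij_betw snd (Sigma T (\<lambda>t. {n. y n = t})) {n. y n \<in> T}" for T
    by (rule bij_betw_byWitness[where f'="\<lambda>n. (y n, n)"]) auto
  have sub: "b summable_on UNIV \<Longrightarrow> (\<lambda>(t, n). b n) summable_on (Sigma T (\<lambda>t. {n. y n = t}))" for b :: "nat \<Rightarrow> real" and T
    using summable_on_reindex_bij_betw[OF bij[of T], of b] summable_on_subset_banach[of b UNIV "{n. y n \<in> T}"]
    by (simp add: case_prod_beta')
  have a1: "\<alpha> summable_on UNIV" using s by (rule norm_summable_imp_summable_on)
  have a2: "(\<lambda>n. norm (\<alpha> n)) summable_on UNIV" using s by (intro norm_summable_imp_summable_on) simp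
  have "(\<lambda>t. \<Sum>\<^sub>\<infinity>n\<in>{n. y n = t}. norm (\<alpha> n)) summable_on C"
    by (rule summable_on_Sigma_banach[OF sub[OF a2]])
  then show "(\<lambda>t. \<bar>c t\<bar>) summable_on C"
  proof (rule summable_on_comparison_test)
    show "\<bar>c t\<bar> \<le> (\<Sum>\<^sub>\<infinity>n\<in>{n. y n = t}. norm (\<alpha> n))" for t
      unfolding c_def real_norm_def[symmetric]
      by (rule norm_infsum_bound) (rule summable_on_subset_banach[OF a2], simp)
  qed simp
  assume CB: "range y \<inter> B \<subseteq> C"
  have "(\<Sum>\<^sub>\<infinity>t\<in>C \<inter> B. c t) = (\<Sum>\<^sub>\<infinity>(t, n)\<in>Sigma (C \<inter> B) (\<lambda>t. {n. y n = t}). \<alpha> n)"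
    unfolding c_def by (rule infsum_Sigma'_banach[OF sub[OF a1]])
  also have "\<dots> = (\<Sum>\<^sub>\<infinity>n\<in>{n. y n \<in> C \<inter> B}. \<alpha> n)"
    using infsum_reindex_bij_betw[OF bij[of "C \<inter> B"], of \<alpha>] by (simp add: case_prod_beta')
  also have "\<dots> = (\<Sum>\<^sub>\<infinity>n. \<alpha> n * indicator B (y n))"
    using CB by (intro infsum_cong_neutral) (auto simp: indicator_def)
  also have "\<dots> = (LINT n|count_space UNIV. \<alpha> n * indicator B (y n))"
  proof -
    have i: "integrable (count_space UNIV) (\<lambda>n. \<alpha> n * indicator B (y n))"
      by (rule Bochner_Integration.integrable_bound[OF \<alpha>]) (auto simp: indicator_def)
    then have "summable (\<lambda>n. norm (\<alpha> n * indicator B (y n)))" by (simp only: integrable_count_space_nat_iff)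
    from norm_summable_imp_has_sum[OF this sums_integral_count_space_nat[OF i]] show ?thesis by (rule infsumI)
  qed
  finally show "(\<Sum>\<^sub>\<infinity>t\<in>C \<inter> B. c t) = (LINT n|count_space UNIV. \<alpha> n * indicator B (y n))" .
qed

section \<open>Conclusions from the exponential form\<close>

text \<open>Every term of the exponent is a difference of convolution semigroup exponents: compound
  Poisson for the finite weights, gamma and reflected gamma for the arctangent. Minuends and
  subtrahends are collected separately.\<close>

lemma exp_levy_form_imp_quasi_infinitely_divisible:
  fixes \<alpha> y :: "nat \<Rightarrow> real" and H :: "real \<Rightarrow> real" and m :: int
  assumes \<mu>: "real_distribution \<mu>" and \<alpha>: "integrable (count_space UNIV) \<alpha>" and H: "integrable lborel H"
    and F: "\<And>z. char \<mu> z = exp (\<i> * of_real (\<gamma> * z) + of_int m * (2 * \<i> * of_real (arctan z))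
       + (LINT n|count_space UNIV. \<alpha> n *\<^sub>R (iexp (z * y n) - 1)) + (LINT x|lborel. H x *\<^sub>R (iexp (z * x) - 1)))"
  shows "quasi_infinitely_divisible \<mu>"
proof -
  obtain \<psi>1 \<psi>2 where \<psi>: "conv_semigroup_exponent \<psi>1" "conv_semigroup_exponent \<psi>2"
    "\<And>z. \<psi>1 z - \<psi>2 z = (LINT n|count_space UNIV. \<alpha> n *\<^sub>R (iexp (z * y n) - 1))"
    by (rule conv_semigroup_exponent_difference[OF \<alpha>, of y]) (simp, rule that)
  obtain \<phi>1 \<phi>2 where \<phi>: "conv_semigroup_exponent \<phi>1" "conv_semigroup_exponent \<phi>2"
    "\<And>z. \<phi>1 z - \<phi>2 z = (LINT x|lborel. H x *\<^sub>R (iexp (z * x) - 1))"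
    by (rule conv_semigroup_exponent_difference[OF H, of "\<lambda>x. x"]) (simp, rule that)
  define G1 G2 where "G1 = (\<lambda>z::real. - Ln (1 - \<i> * of_real z))" and "G2 = (\<lambda>z::real. - Ln (1 - \<i> * of_real (- z)))"
  have G1: "conv_semigroup_exponent G1" unfolding G1_def by (rule conv_semigroup_exponent_gamma)
  have G2: "conv_semigroup_exponent G2" unfolding G2_def by (rule conv_semigroup_exponent_uminus[OF conv_semigroup_exponent_gamma])
  have G: "2 * \<i> * of_real (arctan z) = G1 z - G2 z" for z
    unfolding G1_def G2_def two_arctan_eq_Ln_diff by simp
  \<comment> \<open>Multiples of exponents must be nonnegative, so for negative m the two gamma
    exponents change sides.\<close>
  define a b where "a = max 0 (real_of_int m)" and "b = max 0 (- real_of_int m)"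
  have ab: "0 \<le> a" "0 \<le> b" "real_of_int m = a - b" by (auto simp: a_def b_def)
  have mab: "of_int m = (of_real a - of_real b :: complex)"
    unfolding of_real_diff[symmetric] ab(3)[symmetric] by simp
  define \<Psi>1 where "\<Psi>1 = (\<lambda>z. \<i> * of_real (\<gamma> * z) + (\<psi>1 z + (\<phi>1 z + (of_real a * G1 z + of_real b * G2 z))))"
  define \<Psi>2 where "\<Psi>2 = (\<lambda>z. \<psi>2 z + (\<phi>2 z + (of_real a * G2 z + of_real b * G1 z)))"
  have "conv_semigroup_exponent \<Psi>1" "conv_semigroup_exponent \<Psi>2"
    unfolding \<Psi>1_def \<Psi>2_def
    by (rule conv_semigroup_exponent_add conv_semigroup_exponent_drift \<psi> \<phi> conv_semigroup_exponent_scale G1 G2 ab)+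
  note \<Psi> = this
  obtain M1 where M1: "infinitely_divisible M1" "\<And>z. char M1 z = exp (\<Psi>1 z)"
    by (rule conv_semigroup_exponent_imp_infinitely_divisible[OF \<Psi>(1)]) (rule that)
  obtain M2 where M2: "infinitely_divisible M2" "\<And>z. char M2 z = exp (\<Psi>2 z)"
    by (rule conv_semigroup_exponent_imp_infinitely_divisible[OF \<Psi>(2)]) (rule that)
  have "char \<mu> z = char M1 z / char M2 z" for z
  proof -
    have "\<Psi>1 z - \<Psi>2 z = \<i> * of_real (\<gamma> * z) + of_int m * (2 * \<i> * of_real (arctan z)) + (\<psi>1 z - \<psi>2 z) + (\<phi>1 z - \<phi>2 z)"
      unfolding \<Psi>1_def \<Psi>2_def G mab by (simp add: algebra_simps)
    then show ?thesis unfolding F M1(2) M2(2) exp_diff[symmetric] \<psi>(3) \<phi>(3) by simp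
  qed
  then show ?thesis using \<mu> M1(1) M2(1) unfolding quasi_infinitely_divisible_def by blast
qed

text \<open>Everything is read off from \<open>int\<close> by a choice of test function. The triplet
  has \<gamma> + b0 in place of the drift \<gamma>, where b0 is the integral of x over (-1, 1)
  against \<nu>.\<close>

lemma exp_levy_form_imp_triplet:
  fixes \<alpha> y :: "nat \<Rightarrow> real" and H :: "real \<Rightarrow> real" and m :: int
  assumes \<alpha>: "integrable (count_space UNIV) \<alpha>" and H: "integrable lborel H"
    and F: "\<And>z. char \<mu> z = exp (\<i> * of_real (\<gamma> * z) + of_int m * (2 * \<i> * of_real (arctan z))
       + (LINT n|count_space UNIV. \<alpha> n *\<^sub>R (iexp (z * y n) - 1)) + (LINT x|lborel. H x *\<^sub>R (iexp (z * x) - 1)))"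
  obtains b \<nu> c where "characteristic_triplet \<mu> 0 b \<nu>" "finite_drift \<mu> 0 \<gamma> \<nu>"
    "(\<lambda>t. \<bar>c t\<bar>) summable_on (range y - {0})"
    "\<And>B. away_from_0 B \<Longrightarrow> \<nu> B = (\<Sum>\<^sub>\<infinity>t\<in>(range y - {0}) \<inter> B. c t) +
       (LINT x:B|lborel. H x + of_int m * exp (- \<bar>x\<bar>) / \<bar>x\<bar> * sgn x)"
proof -
  define g where "g = (\<lambda>x. H x + of_int m * exp (- \<bar>x\<bar>) / \<bar>x\<bar> * sgn x)"
  obtain N1 N2 where N: "levy_measure N1" "levy_measure N2"
    and int: "\<And>(f::real \<Rightarrow> complex) C. f \<in> borel_measurable borel \<Longrightarrow> (\<And>x. cmod (f x) \<le> C * min \<bar>x\<bar> 1) \<Longrightarrow>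
       integrable N1 f \<and> integrable N2 f \<and> (LINT x|N1. f x) - (LINT x|N2. f x) =
         (LINT n|count_space UNIV. \<alpha> n *\<^sub>R f (y n)) + (LINT x|lborel. g x *\<^sub>R f x)"
  proof (rule ex_levy_difference[OF \<alpha> H, where m=m and y=y], goal_cases)
    case (1 N1 N2)
    show ?case by (rule 1(1)[OF 1(2,3)]) (unfold g_def, rule 1(4))
  qed
  define \<nu> where "\<nu> = (\<lambda>B. measure N1 B - measure N2 B)"
  have \<nu>: "levy_difference \<nu> N1 N2" using N unfolding levy_difference_def \<nu>_def by simp
  define f0 where "f0 = (\<lambda>z x::real. iexp (z * x) - 1)"
  have f0m: "f0 z \<in> borel_measurable borel" for z unfolding f0_def by measurable
  have f0b: "cmod (f0 z x) \<le> (\<bar>z\<bar> + 2) * min \<bar>x\<bar> 1" for z x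
  proof (cases "\<bar>x\<bar> \<le> 1")
    case True
    have "cmod (f0 z x) \<le> \<bar>z\<bar> * \<bar>x\<bar>" using norm_iexp_minus_one_le[of "z * x"] by (simp add: f0_def abs_mult)
    also have "\<dots> \<le> (\<bar>z\<bar> + 2) * \<bar>x\<bar>" by (intro mult_right_mono) auto
    finally show ?thesis using True by simp
  next
    case False
    have "cmod (f0 z x) \<le> 2" using norm_triangle_ineq4[of "iexp (z * x)" 1] by (simp add: f0_def)
    then show ?thesis using False by simp
  qed
  note int0 = int[OF f0m f0b]
  define I0 where "I0 = (\<lambda>z. (LINT x|N1. f0 z x) - (LINT x|N2. f0 z x))"
  have I0: "I0 z = of_int m * (2 * \<i> * of_real (arctan z)) + (LINT n|count_space UNIV. \<alpha> n *\<^sub>R f0 z (y n)) + (LINT x|lborel. H x *\<^sub>R f0 z x)" for z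
  proof -
    note L = integrable_laplace_levy_density(2,3)[OF H f0m f0b, of z]
    have K: "(LINT x|lborel. (exp (- \<bar>x\<bar>) / \<bar>x\<bar> * sgn x) *\<^sub>R f0 z x) = 2 * \<i> * of_real (arctan z)"
      unfolding f0_def by (rule integral_laplace_levy)
    have "(LINT x|lborel. g x *\<^sub>R f0 z x) = (LINT x|lborel. H x *\<^sub>R f0 z x + of_int m * ((exp (- \<bar>x\<bar>) / \<bar>x\<bar> * sgn x) *\<^sub>R f0 z x))"
      unfolding g_def by (intro Bochner_Integration.integral_cong refl) (simp add: scaleR_conv_of_real distrib_right mult.assoc)
    also have "\<dots> = (LINT x|lborel. H x *\<^sub>R f0 z x) + of_int m * (2 * \<i> * of_real (arctan z))"
      by (subst Bochner_Integration.integral_add[OF L(1) integrable_mult_right[OF L(2)]])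
         (simp only: integral_mult_right_zero K)
    finally show ?thesis using int0[of z] unfolding I0_def by simp
  qed
  have ch: "char \<mu> z = exp (\<i> * of_real (\<gamma> * z) + I0 z)" for z
    unfolding F I0 by (simp add: f0_def add.assoc)
  have drift: "\<exists>I. has_quasi_levy_integral (\<lambda>x. iexp (z * x) - 1) I \<nu> \<and>
      char \<mu> z = exp (\<i> * of_real (\<gamma> * z) - of_real (0 * z\<^sup>2 / 2) + I)" for z
  proof (intro exI conjI)
    show "has_quasi_levy_integral (\<lambda>x. iexp (z * x) - 1) (I0 z) \<nu>"
      unfolding has_quasi_levy_integral_def I0_def using \<nu> int0[of z]
      by (intro exI[of _ N1] exI[of _ N2]) (simp only: f0_def simp_thms)
    show "char \<mu> z = exp (\<i> * of_real (\<gamma> * z) - of_real (0 * z\<^sup>2 / 2) + I0 z)" unfolding ch by simp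
  qed
  \<comment> \<open>The truncated identity is bounded by min |x| 1, so it is integrable for both
    measures and the compensator can be split off.\<close>
  define t where "t = (\<lambda>x::real. x * indicator {-1<..<1} x)"
  define t' where "t' = (\<lambda>x. complex_of_real (t x))"
  have t'm: "t' \<in> borel_measurable borel" unfolding t'_def t_def by measurable
  have "cmod (t' x) \<le> 1 * min \<bar>x\<bar> 1" for x unfolding t'_def t_def by (auto simp: indicator_def)
  note intt = int[OF t'm this]
  define b0 where "b0 = (LINT x|N1. t x) - (LINT x|N2. t x)"
  have b0: "(LINT x|N1. t' x) - (LINT x|N2. t' x) = of_real b0" unfolding t'_def b0_def by simp
  have trip: "\<exists>I. has_quasi_levy_integral (\<lambda>x. iexp (z * x) - 1 - \<i> * of_real (z * x * indicator {-1<..<1} x)) I \<nu> \<and>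
      char \<mu> z = exp (\<i> * of_real ((\<gamma> + b0) * z) - of_real (0 * z\<^sup>2 / 2) + I)" for z
  proof (intro exI conjI)
    have e: "iexp (z * x) - 1 - \<i> * of_real (z * x * indicator {-1<..<1} x) = f0 z x - (\<i> * of_real z) * t' x" for x
      unfolding f0_def t'_def t_def by (simp add: mult.assoc)
    have i: "integrable N1 (\<lambda>x. (\<i> * of_real z) * t' x)" "integrable N2 (\<lambda>x. (\<i> * of_real z) * t' x)"
      using intt by (intro integrable_mult_right; blast)+
    have i0: "integrable N1 (f0 z)" "integrable N2 (f0 z)" using int0[of z] by blast+
    have d1: "(LINT x|N1. f0 z x - (\<i> * of_real z) * t' x) = (LINT x|N1. f0 z x) - (\<i> * of_real z) * (LINT x|N1. t' x)"
      by (subst Bochner_Integration.integral_diff[OF i0(1) i(1)]) (simp only: integral_mult_right_zero)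
    have d2: "(LINT x|N2. f0 z x - (\<i> * of_real z) * t' x) = (LINT x|N2. f0 z x) - (\<i> * of_real z) * (LINT x|N2. t' x)"
      by (subst Bochner_Integration.integral_diff[OF i0(2) i(2)]) (simp only: integral_mult_right_zero)
    have "I0 z - \<i> * of_real z * of_real b0 = (LINT x|N1. f0 z x - (\<i> * of_real z) * t' x) - (LINT x|N2. f0 z x - (\<i> * of_real z) * t' x)"
      unfolding d1 d2 b0[symmetric] I0_def by (simp add: algebra_simps)
    moreover have "integrable N1 (\<lambda>x. f0 z x - (\<i> * of_real z) * t' x)" "integrable N2 (\<lambda>x. f0 z x - (\<i> * of_real z) * t' x)"
      by (rule Bochner_Integration.integrable_diff[OF i0(1) i(1)] Bochner_Integration.integrable_diff[OF i0(2) i(2)])+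
    ultimately show "has_quasi_levy_integral (\<lambda>x. iexp (z * x) - 1 - \<i> * of_real (z * x * indicator {-1<..<1} x))
        (I0 z - \<i> * of_real z * of_real b0) \<nu>"
      unfolding has_quasi_levy_integral_def e using \<nu> by (intro exI[of _ N1] exI[of _ N2] conjI)
    show "char \<mu> z = exp (\<i> * of_real ((\<gamma> + b0) * z) - of_real (0 * z\<^sup>2 / 2) + (I0 z - \<i> * of_real z * of_real b0))"
      unfolding ch by (simp add: algebra_simps)
  qed
  have ct: "characteristic_triplet \<mu> 0 (\<gamma> + b0) \<nu>"
    unfolding characteristic_triplet_def quasi_levy_type_def using \<nu> trip by blast
  have fd: "finite_drift \<mu> 0 \<gamma> \<nu>"
    unfolding finite_drift_def using ct drift by blast
  define c where "c = (\<lambda>s. \<Sum>\<^sub>\<infinity>n\<in>{n. y n = s}. \<alpha> n)"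
  have form: "\<nu> B = (\<Sum>\<^sub>\<infinity>s\<in>(range y - {0}) \<inter> B. c s) + (LINT x:B|lborel. g x)" if B: "away_from_0 B" for B
  proof -
    obtain r where r: "0 < r" "B \<inter> {-r<..<r} = {}" and Bm [measurable]: "B \<in> sets borel" using B unfolding away_from_0_def by blast
    have rB: "r \<le> \<bar>x\<bar>" if "x \<in> B" for x using r that by (cases "\<bar>x\<bar> < r") (auto simp: abs_less_iff)
    define k where "k = (\<lambda>x. complex_of_real (indicator B x))"
    have km: "k \<in> borel_measurable borel" unfolding k_def by measurable
    \<comment> \<open>Points of B satisfy |x| >= r, which gives the constant 1 / min r 1.\<close>
    have kb: "cmod (k x) \<le> 1 / min r 1 * min \<bar>x\<bar> 1" for x
    proof (cases "x \<in> B")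
      case True
      then have "min r 1 \<le> min \<bar>x\<bar> 1" using rB by (intro min.mono) auto
      then show ?thesis using True r(1) by (simp add: k_def le_divide_eq)
    qed (use r(1) in \<open>simp add: k_def\<close>)
    have sp: "space N1 = UNIV" "space N2 = UNIV"
      using N sets_eq_imp_space_eq[of N1 borel] sets_eq_imp_space_eq[of N2 borel] unfolding levy_measure_def by auto
    have "of_real (\<nu> B) = (LINT x|N1. k x) - (LINT x|N2. k x)"
      unfolding \<nu>_def k_def integral_complex_of_real integral_indicator by (simp add: sp)
    also have "\<dots> = (LINT n|count_space UNIV. \<alpha> n *\<^sub>R k (y n)) + (LINT x|lborel. g x *\<^sub>R k x)" using int[OF km kb] by blast
    also have "(LINT n|count_space UNIV. \<alpha> n *\<^sub>R k (y n)) = of_real (LINT n|count_space UNIV. \<alpha> n * indicator B (y n))"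
      unfolding k_def scaleR_conv_of_real of_real_mult[symmetric] by (rule integral_complex_of_real)
    also have "(LINT x|lborel. g x *\<^sub>R k x) = of_real (LINT x|lborel. g x * indicator B x)"
      unfolding k_def scaleR_conv_of_real of_real_mult[symmetric] by (rule integral_complex_of_real)
    finally have "\<nu> B = (LINT n|count_space UNIV. \<alpha> n * indicator B (y n)) + (LINT x|lborel. g x * indicator B x)"
      unfolding of_real_add[symmetric] of_real_eq_iff .
    \<comment> \<open>Removing 0 from the set of atoms loses nothing on B.\<close>
    moreover have "0 \<notin> B" using r by auto
    then have "(\<Sum>\<^sub>\<infinity>s\<in>(range y - {0}) \<inter> B. c s) = (LINT n|count_space UNIV. \<alpha> n * indicator B (y n))"
      unfolding c_def by (intro infsum_fibre_sums[OF \<alpha>]) auto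
    ultimately show ?thesis unfolding set_lebesgue_integral_def by (simp add: mult.commute)
  qed
  have sum: "(\<lambda>s. \<bar>c s\<bar>) summable_on (range y - {0})"
    unfolding c_def by (rule abs_summable_on_fibre_sums[OF \<alpha>])
  show ?thesis by (rule that[OF ct fd sum]) (rule form[unfolded g_def])
qed

text \<open>The formula for \<nu> is tested on Borel sets bounded away from the origin, where the
  density is integrable; an atom at 0 would be invisible there, hence \<open>0 \<notin> C\<close>.
  The implications proved are (i) to (ii), the equivalence of (ii) and (iii), and from (ii) jointly
  (i) and the representation.\<close>

theorem theorem2p2:
  fixes \<mu> \<mu>\<^sub>d \<mu>\<^sub>a\<^sub>c :: "real measure" and p :: real
  assumes "real_distribution \<mu>"
    and "discrete_distribution \<mu>\<^sub>d"
    and "ac_distribution \<mu>\<^sub>a\<^sub>c"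
    and "0 < p" and "p \<le> 1"
    and "\<forall>B\<in>sets borel. measure \<mu> B = p * measure \<mu>\<^sub>d B + (1 - p) * measure \<mu>\<^sub>a\<^sub>c B"
  shows "(quasi_infinitely_divisible \<mu> \<longleftrightarrow> (INF z. cmod (char \<mu> z)) > 0) \<and>
    ((INF z. cmod (char \<mu> z)) > 0 \<longleftrightarrow>
       (\<forall>z. char \<mu> z \<noteq> 0) \<and> (INF z. cmod (char \<mu>\<^sub>d z)) > 0) \<and>
    (quasi_infinitely_divisible \<mu> \<longrightarrow>
       (\<exists>(b::real) (\<gamma>::real) \<nu> (C::real set) (c::real \<Rightarrow> real) (m::int) (h::real \<Rightarrow> real).
          characteristic_triplet \<mu> 0 b \<nu> \<and> finite_drift \<mu> 0 \<gamma> \<nu> \<and>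
          countable C \<and> 0 \<notin> C \<and> (\<lambda>y. \<bar>c y\<bar>) summable_on C \<and> integrable lborel h \<and>
          (\<forall>B. away_from_0 B \<longrightarrow>
             \<nu> B = (\<Sum>\<^sub>\<infinity>y\<in>C \<inter> B. c y) +
               (LINT x:B|lborel. h x + of_int m * exp (- \<bar>x\<bar>) / \<bar>x\<bar> * sgn x))))"
proof -
  interpret M: real_distribution \<mu> by fact
  have d: "real_distribution \<mu>\<^sub>d" and a: "real_distribution \<mu>\<^sub>a\<^sub>c"
    using assms(2,3) unfolding discrete_distribution_def ac_distribution_def by auto
  interpret Md: real_distribution \<mu>\<^sub>d by fact
  \<comment> \<open>The mixture weights are put into u and v, so that p = 1, where v = 0, is no
    special case.\<close>
  define u v where "u = (\<lambda>z. of_real p * char \<mu>\<^sub>d z)" and "v = (\<lambda>z. char \<mu>\<^sub>a\<^sub>c z * of_real (1 - p))"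
  have F: "char \<mu> z = u z + v z" for z
    using char_mixture[OF assms(1) d a less_imp_le[OF assms(4)] assms(5,6), of z] by (simp add: u_def v_def mult.commute)
  obtain A where "dtr A (char \<mu>\<^sub>d)" by (rule dtr_char_discrete[OF assms(2)])
  then have u: "dtr (cmod (of_real p) * A) u" unfolding u_def by (rule dtr_mult[OF dtr_const])
  obtain B where "ltr B (char \<mu>\<^sub>a\<^sub>c)" by (rule ltr_char_ac[OF assms(3)])
  then have v: "ltr (B * cmod (of_real (1 - p))) v" unfolding v_def by (rule ltr_mult_dtr[OF _ dtr_const])
  have wF: "wtr (cmod (of_real p) * A + B * cmod (of_real (1 - p))) (char \<mu>)"
    using wtr_sum2[OF u v] unfolding F[symmetric] .
  have cu: "cmod (u z) = p * cmod (char \<mu>\<^sub>d z)" for z using assms(4) by (simp add: u_def norm_mult)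
  have u0: "u 0 \<noteq> 0" using assms(4) Md.char_zero by (simp add: u_def)
  let ?ii = "\<exists>\<delta>>0. \<forall>z. \<delta> \<le> cmod (char \<mu> z)"
  have i_ii: ?ii if "quasi_infinitely_divisible \<mu>"
    by (rule quasi_infinitely_divisible_imp_bounded_below[OF that _ u u0 v]) (rule F)
  have ii_iii: "(\<forall>z. char \<mu> z \<noteq> 0) \<and> (\<exists>\<delta>>0. \<forall>z. \<delta> \<le> cmod (char \<mu>\<^sub>d z))" if ii: ?ii
  proof -
    obtain \<delta> where \<delta>: "0 < \<delta>" "\<And>z. \<delta> \<le> cmod (char \<mu> z)" using ii by blast
    have "char \<mu> z \<noteq> 0" for z using \<delta>(1) \<delta>(2)[of z] by auto
    moreover have "(v \<longlongrightarrow> 0) at_top" by (rule ltr_tendsto_0[OF v]) simp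
    then have "\<delta> \<le> cmod (u z)" for z
      by (rule dtr_add_vanishing_ge[OF u]) (unfold F[symmetric], rule \<delta>(2))
    then have "\<delta> / p \<le> cmod (char \<mu>\<^sub>d z)" for z using assms(4) unfolding cu by (simp add: divide_le_eq mult.commute)
    moreover have "0 < \<delta> / p" using \<delta>(1) assms(4) by simp
    ultimately show ?thesis by blast
  qed
  have iii_ii: ?ii if nz: "\<And>z. char \<mu> z \<noteq> 0" and ex: "\<exists>\<delta>>0. \<forall>z. \<delta> \<le> cmod (char \<mu>\<^sub>d z)"
  proof -
    obtain \<delta> where \<delta>: "0 < \<delta>" "\<And>z. \<delta> \<le> cmod (char \<mu>\<^sub>d z)" using ex by blast
    \<comment> \<open>Far out |v| is below half of the lower bound p \<delta> of |u|, so the sum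
      stays above the other half; on the remaining compact interval nonvanishing and continuity
      suffice.\<close>
    have p\<delta>: "0 < p * \<delta> / 2" using \<delta>(1) assms(4) by simp
    have ev: "eventually (\<lambda>z. cmod (v z) < p * \<delta> / 2) G" if "G = at_top \<or> G = at_bot" for G
      using tendstoD[OF ltr_tendsto_0[OF v that] p\<delta>] by (simp add: dist_norm)
    obtain R1 where R1: "\<And>z. R1 \<le> z \<Longrightarrow> cmod (v z) < p * \<delta> / 2"
      using ev[of at_top] unfolding eventually_at_top_linorder by blast
    obtain R2 where R2: "\<And>z. z \<le> R2 \<Longrightarrow> cmod (v z) < p * \<delta> / 2"
      using ev[of at_bot] unfolding eventually_at_bot_linorder by blast
    have "p * \<delta> / 2 \<le> cmod (char \<mu> z)" if "max R1 (- R2) \<le> \<bar>z\<bar>" for z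
    proof -
      have "R1 \<le> z \<or> z \<le> R2" using that by (auto simp: abs_if split: if_splits)
      then have "cmod (v z) < p * \<delta> / 2" using R1 R2 by blast
      moreover have "p * \<delta> \<le> cmod (u z)" unfolding cu using \<delta>(2) assms(4) by simp
      moreover have "cmod (u z) - cmod (v z) \<le> cmod (char \<mu> z)" unfolding F by (rule norm_diff_ineq)
      ultimately show ?thesis by argo
    qed
    then show ?thesis by (rule continuous_nonzero_bounded_below[OF M.isCont_char nz p\<delta>])
  qed
  have herm: "char \<mu> (- z) = cnj (char \<mu> z)" for z
    unfolding char_eq_ft cnj_ft by (simp add: ft_def)
  have ii_i_triplet: "quasi_infinitely_divisible \<mu> \<and>
       (\<exists>(b::real) (\<gamma>::real) \<nu> (C::real set) (c::real \<Rightarrow> real) (m::int) (h::real \<Rightarrow> real).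
          characteristic_triplet \<mu> 0 b \<nu> \<and> finite_drift \<mu> 0 \<gamma> \<nu> \<and>
          countable C \<and> 0 \<notin> C \<and> (\<lambda>y. \<bar>c y\<bar>) summable_on C \<and> integrable lborel h \<and>
          (\<forall>B. away_from_0 B \<longrightarrow>
             \<nu> B = (\<Sum>\<^sub>\<infinity>y\<in>C \<inter> B. c y) +
               (LINT x:B|lborel. h x + of_int m * exp (- \<bar>x\<bar>) / \<bar>x\<bar> * sgn x)))" if ii: ?ii
  proof -
    obtain \<delta> where \<delta>: "0 < \<delta>" "\<And>z. \<delta> \<le> cmod (char \<mu> z)" using ii by blast
    obtain m :: int and \<gamma> :: real and \<alpha> y :: "nat \<Rightarrow> real" and H :: "real \<Rightarrow> real"
      where rep: "integrable (count_space UNIV) \<alpha>" "integrable lborel H"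
      "\<And>z. char \<mu> z = exp (\<i> * of_real (\<gamma> * z) + of_int m * (2 * \<i> * of_real (arctan z))
         + (LINT n|count_space UNIV. \<alpha> n *\<^sub>R (iexp (z * y n) - 1)) + (LINT x|lborel. H x *\<^sub>R (iexp (z * x) - 1)))"
      by (rule hermitian_wtr_log[OF wF \<delta> herm M.char_zero]) (rule that)
    have q: "quasi_infinitely_divisible \<mu>"
      by (rule exp_levy_form_imp_quasi_infinitely_divisible[OF assms(1) rep])
    obtain b \<nu> c where t: "characteristic_triplet \<mu> 0 b \<nu>" "finite_drift \<mu> 0 \<gamma> \<nu>"
      "(\<lambda>t. \<bar>c t\<bar>) summable_on (range y - {0})"
      "\<And>B. away_from_0 B \<Longrightarrow> \<nu> B = (\<Sum>\<^sub>\<infinity>t\<in>(range y - {0}) \<inter> B. c t) +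
         (LINT x:B|lborel. H x + of_int m * exp (- \<bar>x\<bar>) / \<bar>x\<bar> * sgn x)"
      by (rule exp_levy_form_imp_triplet[OF rep]) (rule that)
    have C: "countable (range y - {0})" "0 \<notin> range y - {0}" by simp_all
    show ?thesis
      by (intro conjI q exI allI impI) (rule t C rep(2) | assumption)+
  qed
  show ?thesis
    unfolding INF_cmod_pos_iff using i_ii ii_iii iii_ii ii_i_triplet by blast
qed

end
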